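(* Let $k$ be a commutative ring, $H$ a Hopf algebra over $k$, $\alpha,\beta:H\to k$ characters and $\pi\in H$ a grouplike element satisfying condition (CM). Let ${}_\beta k_\alpha$ denote $k$ viewed as an $H$-bimodule via $a\cdot\lambda\cdot b=\beta(a)\lambda\alpha(b)$ for $a,b\in H$, $\lambda\in k$. Then there is a long exact sequence $$\cdots\to H_n(H,{}_\beta k_\alpha)\to HC_n^{\pi,\alpha,\beta}(H)\to HC_{n-2}^{\pi,\alpha,\beta}(H)\to H_{n-1}(H,{}_\beta k_\alpha)\to\cdots,$$ where $H_*(H,{}_\beta k_\alpha)$ is the Hochschild homology of the underlying algebra of $H$ with coefficients in ${}_\beta k_\alpha$.
   Context: Sweedler notation: $a^{(1)}\otimes a^{(2)}\otimes\cdots$ is the iterated comultiplication of $a$. A character is a unital algebra map $H\to k$. $S$ is the antipode, $\varepsilon$ the counit, $\eta$ the unit; $S_\pi(a)=\pi S(a)$. Condition (CM): (i) $\alpha(\pi)=1=\beta(\pi)$; (ii) $(\alpha*S_\pi*\beta)^2=\mathrm{id}_H$ ($*$ convolution product, square for composition), i.e. $\alpha(a^{(1)})\alpha(S(a^{(4)}))\pi S^2(a^{(3)})\pi^{-1}\beta(S(a^{(2)}))\beta(a^{(5)})=a$ for all $a\in H$. Under (CM), $C_n^{(\pi,\alpha,\beta)}(H)=H^{\otimes n}$ ($n\ge0$) is a cyclic module with, on $a_1\otimes\cdots\otimes a_n$ ($n\ge 1$): $d_0=\alpha(a_1)a_2\otimes\cdots\otimes a_n$; $d_i=a_1\otimes\cdots\otimes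 a_ia_{i+1}\otimes\cdots\otimes a_n$ for $1\le i\le n-1$; $d_n=a_1\otimes\cdots\otimes a_{n-1}\beta(a_n)$ (so for $n=1$, $d_0=\alpha$ and $d_1=\beta$); degeneracies $s_i$ ($0\le i\le n$) inserting $1$ after $a_i$ (at the front if $i=0$; $s_0=\eta$ if $n=0$); and cyclic operator $t_n(a_1\otimes\cdots\otimes a_n)=\alpha(a_1^{(1)}\cdots a_n^{(1)})S_\pi(a_1^{(2)}\cdots a_n^{(2)})\otimes a_1^{(3)}\otimes\cdots\otimes a_{n-1}^{(3)}\beta(a_n^{(3)})$, $t_0=\mathrm{id}_k$. $HC_*^{\pi,\alpha,\beta}(H)$ is the cyclic homology of this cyclic module: the homology of the total complex of the first-quadrant bicomplex whose columns are alternately $(C_*,b)$ and $(C_*,-b')$, $b=\sum_{i=0}^n(-1)^id_i$, $b'=\sum_{i=0}^{n-1}(-1)^id_i$, with horizontal maps alternately $1-\tau_n$ and $\sum_{i=0}^n\tau_n^i$, where $\tau_n=(-1)^nt_n$. It is zero in negative degrees. $H_*(H,M)$ is the homology of the Hochschild complex $M\otimes H^{\otimes *}$. *)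

theory Defs
  imports Complex_Main "HOL-Algebra.Module" "HOL-Algebra.AbelCoset" "HOL-Library.Poly_Mapping" "HOL-Library.FuncSet"
begin

text \<open>
  The ground ring is a type of class \<open>comm_ring_1\<close> and a \<open>k\<close>-algebra is a type of class
  \<open>ring_1\<close> with a scalar multiplication in the sense of \<open>Modules.module\<close>. Tensor
  products, complexes and homology are module records (theory \<open>HOL-Algebra.Module\<close>) whose
  scalars are the elements of the type of the ground ring; their \<open>mult\<close> and \<open>one\<close> fields
  play no role.
\<close>


section \<open>Modules, quotients and linear maps\<close>

definition linear_maps ::
  "('k, 'a) module \<Rightarrow> ('k, 'b) module \<Rightarrow> ('a \<Rightarrow> 'b) set" where
  "linear_maps M N = {f \<in> carrier M \<rightarrow> carrier N.
     (\<forall>x\<in>carrier M. \<forall>y\<in>carrier M. f (x \<oplus>\<^bsub>M\<^esub> y) = f x \<oplus>\<^bsub>N\<^esub> f y) \<and>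
     (\<forall>c. \<forall>x\<in>carrier M. f (c \<odot>\<^bsub>M\<^esub> x) = c \<odot>\<^bsub>N\<^esub> f x)}"

definition exact_at ::
  "('k, 'a) module \<Rightarrow> ('a \<Rightarrow> 'b) \<Rightarrow> ('k, 'b) module \<Rightarrow> ('b \<Rightarrow> 'c) \<Rightarrow> ('k, 'c) module \<Rightarrow> bool" where
  "exact_at L f M g N \<longleftrightarrow> f ` carrier L = a_kernel M N g"

definition quot_module :: "('k, 'a) module \<Rightarrow> 'a set \<Rightarrow> ('k, 'a set) module" where
  "quot_module M W =
     \<lparr>carrier = a_rcosets\<^bsub>M\<^esub> W, mult = undefined, one = undefined,
      zero = W, add = (<+>\<^bsub>M\<^esub>),
      smult = (\<lambda>c X. \<Union>x\<in>X. W +>\<^bsub>M\<^esub> (c \<odot>\<^bsub>M\<^esub> x))\<rparr>"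


section \<open>Free modules and tensor products\<close>

definition fscale :: "'k::comm_ring_1 \<Rightarrow> ('x \<Rightarrow>\<^sub>0 'k) \<Rightarrow> ('x \<Rightarrow>\<^sub>0 'k)" where
  "fscale c p = Poly_Mapping.map ((*) c) p"

lemma lookup_fscale: "Poly_Mapping.lookup (fscale c p) x = c * Poly_Mapping.lookup p x"
  by (simp add: fscale_def Poly_Mapping.map.rep_eq when_def)

lemma module_fscale: "Modules.module (fscale :: 'k::comm_ring_1 \<Rightarrow> ('x \<Rightarrow>\<^sub>0 'k) \<Rightarrow> _)"
  by (standard; rule poly_mapping_eqI) (simp_all add: lookup_fscale lookup_add algebra_simps)

definition free_module :: "'x set \<Rightarrow> ('k::comm_ring_1, 'x \<Rightarrow>\<^sub>0 'k) module" where
  "free_module X =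
     \<lparr>carrier = {p. Poly_Mapping.keys p \<subseteq> X}, mult = undefined, one = undefined,
      zero = 0, add = (+), smult = fscale\<rparr>"

text \<open>The linear extension of a function on basis elements to a free module, with values
  in a module with scalar multiplication \<open>s\<close>.\<close>

definition lin_ext ::
  "('k::comm_ring_1 \<Rightarrow> 'v::ab_group_add \<Rightarrow> 'v) \<Rightarrow> ('x \<Rightarrow> 'v) \<Rightarrow> ('x \<Rightarrow>\<^sub>0 'k) \<Rightarrow> 'v" where
  "lin_ext s f p = (\<Sum>x\<in>Poly_Mapping.keys p. s (Poly_Mapping.lookup p x) (f x))"

text \<open>A tensor product is the free module on tuples modulo multilinearity. Every \<open>g \<in> G\<close>
  sends an element of the module with scalar multiplication \<open>s\<close> to the tuple having that
  element in one slot, the other entries being fixed.\<close>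

definition slot_relations ::
  "('k::comm_ring_1 \<Rightarrow> 'v::ab_group_add \<Rightarrow> 'v) \<Rightarrow> ('v \<Rightarrow> 'x) set \<Rightarrow> ('x \<Rightarrow>\<^sub>0 'k) set" where
  "slot_relations s G =
     {Poly_Mapping.single (g (u + v)) 1 - Poly_Mapping.single (g u) 1
        - Poly_Mapping.single (g v) 1 | g u v. g \<in> G} \<union>
     {Poly_Mapping.single (g (s c u)) 1 - Poly_Mapping.single (g u) c | g c u. g \<in> G}"

text \<open>The tensor power \<open>H\<^sup>\<otimes>\<^sup>n\<close>; the pure tensor \<open>a\<^sub>1 \<otimes> \<dots> \<otimes> a\<^sub>n\<close> is
  the class of the basis element \<open>[a\<^sub>1, \<dots>, a\<^sub>n]\<close>.\<close>

definition tensor_rel ::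
  "('k::comm_ring_1 \<Rightarrow> 'h::ring_1 \<Rightarrow> 'h) \<Rightarrow> nat \<Rightarrow> ('h list \<Rightarrow>\<^sub>0 'k) set" where
  "tensor_rel s n = Modules.module.span fscale
     (slot_relations s {\<lambda>u. xs @ u # ys | xs ys. length xs + 1 + length ys = n})"

definition tensor_power ::
  "('k::comm_ring_1 \<Rightarrow> 'h::ring_1 \<Rightarrow> 'h) \<Rightarrow> nat \<Rightarrow> ('k, ('h list \<Rightarrow>\<^sub>0 'k) set) module" where
  "tensor_power s n = quot_module (free_module {as. length as = n}) (tensor_rel s n)"

definition tensor_class ::
  "('k::comm_ring_1 \<Rightarrow> 'h::ring_1 \<Rightarrow> 'h) \<Rightarrow> nat \<Rightarrow> ('h list \<Rightarrow>\<^sub>0 'k) \<Rightarrow> ('h list \<Rightarrow>\<^sub>0 'k) set" where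
  "tensor_class s n p = tensor_rel s n +>\<^bsub>free_module {as. length as = n}\<^esub> p"

text \<open>\<open>M \<otimes> H\<^sup>\<otimes>\<^sup>n\<close> for a module \<open>M\<close> with scalar multiplication \<open>sM\<close>; the class of
  \<open>(m, [a\<^sub>1, \<dots>, a\<^sub>n])\<close> is \<open>m \<otimes> a\<^sub>1 \<otimes> \<dots> \<otimes> a\<^sub>n\<close>.\<close>

definition coeff_tensor_rel ::
  "('k::comm_ring_1 \<Rightarrow> 'm::ab_group_add \<Rightarrow> 'm) \<Rightarrow> ('k \<Rightarrow> 'h::ring_1 \<Rightarrow> 'h) \<Rightarrow> nat
     \<Rightarrow> ('m \<times> 'h list \<Rightarrow>\<^sub>0 'k) set" where
  "coeff_tensor_rel sM s n = Modules.module.span fscale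
     (slot_relations sM {\<lambda>m. (m, as) | as. length as = n} \<union>
      slot_relations s {\<lambda>u. (m, xs @ u # ys) | m xs ys. length xs + 1 + length ys = n})"

definition coeff_tensor ::
  "('k::comm_ring_1 \<Rightarrow> 'm::ab_group_add \<Rightarrow> 'm) \<Rightarrow> ('k \<Rightarrow> 'h::ring_1 \<Rightarrow> 'h) \<Rightarrow> nat
     \<Rightarrow> ('k, ('m \<times> 'h list \<Rightarrow>\<^sub>0 'k) set) module" where
  "coeff_tensor sM s n =
     quot_module (free_module {(m, as). length as = n}) (coeff_tensor_rel sM s n)"

text \<open>The map into the quotient by \<open>W\<close> of the free module on \<open>X\<close> that is induced by a
  function \<open>f\<close> on basis elements of the source, when the linear extension of \<open>f\<close> respects the
  relations.\<close>

definition induced_map ::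
  "'y set \<Rightarrow> ('y \<Rightarrow>\<^sub>0 'k::comm_ring_1) set \<Rightarrow> ('x \<Rightarrow> 'y \<Rightarrow>\<^sub>0 'k)
     \<Rightarrow> ('x \<Rightarrow>\<^sub>0 'k) set \<Rightarrow> ('y \<Rightarrow>\<^sub>0 'k) set" where
  "induced_map X W f T = (\<Union>p\<in>T. W +>\<^bsub>free_module X\<^esub> lin_ext fscale f p)"


section \<open>Hopf algebras\<close>

locale k_algebra = Modules.module scale
  for scale :: "'k::comm_ring_1 \<Rightarrow> 'h::ring_1 \<Rightarrow> 'h" +
  assumes scale_mult_left: "scale c x * y = scale c (x * y)"
    and scale_mult_right: "x * scale c y = scale c (x * y)"

definition character ::
  "('k::comm_ring_1 \<Rightarrow> 'h::ring_1 \<Rightarrow> 'h) \<Rightarrow> ('h \<Rightarrow> 'k) \<Rightarrow> bool" where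
  "character s \<chi> \<longleftrightarrow> Modules.module_hom s (*) \<chi> \<and> \<chi> 1 = 1 \<and> (\<forall>a b. \<chi> (a * b) = \<chi> a * \<chi> b)"

text \<open>
  Sweedler notation. A comultiplication \<open>\<Delta>\<close> has values in the tensor power \<open>H \<otimes> H\<close>, whose
  elements are classes. \<open>sweedler \<Delta> n a\<close> is a formal sum of lists
  \<open>[a\<^sup>(\<^sup>1\<^sup>), \<dots>, a\<^sup>(\<^sup>n\<^sup>+\<^sup>1\<^sup>)]\<close> representing the \<open>n\<close>-fold iterated comultiplication of \<open>a\<close>, so
  that \<open>lin_ext s f (sweedler \<Delta> n a)\<close> is the sum of the \<open>f [a\<^sup>(\<^sup>1\<^sup>), \<dots>, a\<^sup>(\<^sup>n\<^sup>+\<^sup>1\<^sup>)]\<close>. For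
  multilinear \<open>f\<close> it does not depend on the choice of representatives.
\<close>

definition representative :: "'a set \<Rightarrow> 'a" where
  "representative X = (SOME p. p \<in> X)"

primrec sweedler ::
  "('h \<Rightarrow> ('h list \<Rightarrow>\<^sub>0 'k::comm_ring_1) set) \<Rightarrow> nat \<Rightarrow> 'h \<Rightarrow> ('h list \<Rightarrow>\<^sub>0 'k)" where
  "sweedler \<Delta> 0 a = Poly_Mapping.single [a] 1"
| "sweedler \<Delta> (Suc n) a =
     lin_ext fscale (\<lambda>as. lin_ext fscale (\<lambda>bs. Poly_Mapping.single (bs @ tl as) 1)
       (representative (\<Delta> (hd as)))) (sweedler \<Delta> n a)"

locale hopf_algebra = k_algebra scale
  for scale :: "'k::comm_ring_1 \<Rightarrow> 'h::ring_1 \<Rightarrow> 'h"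
    and \<Delta> :: "'h \<Rightarrow> ('h list \<Rightarrow>\<^sub>0 'k) set"
    and \<epsilon> :: "'h \<Rightarrow> 'k"
    and S :: "'h \<Rightarrow> 'h" +
  assumes comult_closed: "\<Delta> a \<in> carrier (tensor_power scale 2)"
    and comult_add: "\<Delta> (a + b) = \<Delta> a \<oplus>\<^bsub>tensor_power scale 2\<^esub> \<Delta> b"
    and comult_scale: "\<Delta> (scale c a) = c \<odot>\<^bsub>tensor_power scale 2\<^esub> \<Delta> a"
    and comult_one: "\<Delta> 1 = tensor_class scale 2 (Poly_Mapping.single [1, 1] 1)"
    and comult_mult: "\<Delta> (a * b) = tensor_class scale 2
      (lin_ext fscale (\<lambda>as. lin_ext fscale (\<lambda>bs.
         Poly_Mapping.single [as ! 0 * bs ! 0, as ! 1 * bs ! 1] 1)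
         (sweedler \<Delta> 1 b)) (sweedler \<Delta> 1 a))"
    and coassoc: "tensor_class scale 3
        (lin_ext fscale (\<lambda>as. lin_ext fscale (\<lambda>bs. Poly_Mapping.single [bs ! 0, bs ! 1, as ! 1] 1)
          (sweedler \<Delta> 1 (as ! 0))) (sweedler \<Delta> 1 a))
      = tensor_class scale 3
        (lin_ext fscale (\<lambda>as. lin_ext fscale (\<lambda>bs. Poly_Mapping.single [as ! 0, bs ! 0, bs ! 1] 1)
          (sweedler \<Delta> 1 (as ! 1))) (sweedler \<Delta> 1 a))"
    and counit_character: "character scale \<epsilon>"
    and counit_left: "lin_ext scale (\<lambda>as. scale (\<epsilon> (as ! 0)) (as ! 1)) (sweedler \<Delta> 1 a) = a"
    and counit_right: "lin_ext scale (\<lambda>as. scale (\<epsilon> (as ! 1)) (as ! 0)) (sweedler \<Delta> 1 a) = a"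
    and antipode_linear: "Modules.module_hom scale scale S"
    and antipode_left: "lin_ext scale (\<lambda>as. S (as ! 0) * as ! 1) (sweedler \<Delta> 1 a) = scale (\<epsilon> a) 1"
    and antipode_right: "lin_ext scale (\<lambda>as. as ! 0 * S (as ! 1)) (sweedler \<Delta> 1 a) = scale (\<epsilon> a) 1"

definition grouplike ::
  "('k::comm_ring_1 \<Rightarrow> 'h::ring_1 \<Rightarrow> 'h) \<Rightarrow> ('h \<Rightarrow> ('h list \<Rightarrow>\<^sub>0 'k) set) \<Rightarrow> ('h \<Rightarrow> 'k) \<Rightarrow> 'h \<Rightarrow> bool"
  where
  "grouplike s \<Delta> \<epsilon> \<pi> \<longleftrightarrow>
     \<Delta> \<pi> = tensor_class s 2 (Poly_Mapping.single [\<pi>, \<pi>] 1) \<and> \<epsilon> \<pi> = 1"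

definition convolution ::
  "('k::comm_ring_1 \<Rightarrow> 'h::ring_1 \<Rightarrow> 'h) \<Rightarrow> ('h \<Rightarrow> ('h list \<Rightarrow>\<^sub>0 'k) set)
     \<Rightarrow> ('h \<Rightarrow> 'h) \<Rightarrow> ('h \<Rightarrow> 'h) \<Rightarrow> 'h \<Rightarrow> 'h" where
  "convolution s \<Delta> f g a = lin_ext s (\<lambda>as. f (as ! 0) * g (as ! 1)) (sweedler \<Delta> 1 a)"

text \<open>In the convolution algebra \<open>Hom(H, H)\<close> a character \<open>\<chi>\<close> stands for \<open>\<eta> \<circ> \<chi>\<close>, with \<open>\<eta>\<close> the
  unit of \<open>H\<close>.\<close>

definition condition_CM ::
  "('k::comm_ring_1 \<Rightarrow> 'h::ring_1 \<Rightarrow> 'h) \<Rightarrow> ('h \<Rightarrow> ('h list \<Rightarrow>\<^sub>0 'k) set) \<Rightarrow> ('h \<Rightarrow> 'h)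
     \<Rightarrow> 'h \<Rightarrow> ('h \<Rightarrow> 'k) \<Rightarrow> ('h \<Rightarrow> 'k) \<Rightarrow> bool" where
  "condition_CM s \<Delta> S \<pi> \<alpha> \<beta> \<longleftrightarrow>
     \<alpha> \<pi> = 1 \<and> \<beta> \<pi> = 1 \<and>
     (let \<sigma> = convolution s \<Delta>
                (convolution s \<Delta> (\<lambda>a. s (\<alpha> a) 1) (\<lambda>a. \<pi> * S a)) (\<lambda>a. s (\<beta> a) 1)
      in \<sigma> \<circ> \<sigma> = id)"


section \<open>Homology of complexes\<close>

text \<open>A complex in non-negative degrees is a sequence of modules \<open>C n\<close> with differentials
  \<open>d n\<close> from \<open>C n\<close> to \<open>C (n - 1)\<close> for \<open>n \<ge> 1\<close> (\<open>d 0\<close> is ignored). It is extended by zero to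
  all integer degrees.\<close>

definition complex_module :: "(nat \<Rightarrow> ('k, 'c) module) \<Rightarrow> int \<Rightarrow> ('k, 'c) module" where
  "complex_module C n = (if n < 0 then (C 0)\<lparr>carrier := {\<zero>\<^bsub>C 0\<^esub>}\<rparr> else C (nat n))"

definition complex_diff ::
  "(nat \<Rightarrow> ('k, 'c) module) \<Rightarrow> (nat \<Rightarrow> 'c \<Rightarrow> 'c) \<Rightarrow> int \<Rightarrow> 'c \<Rightarrow> 'c" where
  "complex_diff C d n = (if n \<le> 0 then (\<lambda>_. \<zero>\<^bsub>C 0\<^esub>) else d (nat n))"

definition homology ::
  "(nat \<Rightarrow> ('k, 'c) module) \<Rightarrow> (nat \<Rightarrow> 'c \<Rightarrow> 'c) \<Rightarrow> int \<Rightarrow> ('k, 'c set) module" where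
  "homology C d n =
     quot_module
       ((complex_module C n)\<lparr>carrier :=
          a_kernel (complex_module C n) (complex_module C (n - 1)) (complex_diff C d n)\<rparr>)
       (complex_diff C d (n + 1) ` carrier (complex_module C (n + 1)))"

text \<open>Below, \<open>d n i\<close> is the face map \<open>d\<^sub>i\<close> from \<open>C n\<close> to \<open>C (n - 1)\<close>, for \<open>n \<ge> 1\<close> and
  \<open>i \<le> n\<close>.\<close>

definition b_map ::
  "(nat \<Rightarrow> ('k::comm_ring_1, 'c) module) \<Rightarrow> (nat \<Rightarrow> nat \<Rightarrow> 'c \<Rightarrow> 'c) \<Rightarrow> nat \<Rightarrow> 'c \<Rightarrow> 'c" where
  "b_map C d n x = (\<Oplus>\<^bsub>C (n - 1)\<^esub>i\<in>{..n}. (- 1) ^ i \<odot>\<^bsub>C (n - 1)\<^esub> d n i x)"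

definition b'_map ::
  "(nat \<Rightarrow> ('k::comm_ring_1, 'c) module) \<Rightarrow> (nat \<Rightarrow> nat \<Rightarrow> 'c \<Rightarrow> 'c) \<Rightarrow> nat \<Rightarrow> 'c \<Rightarrow> 'c" where
  "b'_map C d n x = (\<Oplus>\<^bsub>C (n - 1)\<^esub>i\<in>{..<n}. (- 1) ^ i \<odot>\<^bsub>C (n - 1)\<^esub> d n i x)"


section \<open>Hochschild homology\<close>

definition hochschild_face ::
  "('h \<Rightarrow> 'm \<Rightarrow> 'm) \<Rightarrow> ('m \<Rightarrow> 'h \<Rightarrow> 'm) \<Rightarrow> nat \<Rightarrow> nat \<Rightarrow> 'm \<times> 'h::ring_1 list
     \<Rightarrow> ('m \<times> 'h list \<Rightarrow>\<^sub>0 'k::comm_ring_1)" where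
  "hochschild_face l r n i = (\<lambda>(m, as).
     if i = 0 then Poly_Mapping.single (r m (hd as), tl as) 1
     else if i < n then
       Poly_Mapping.single (m, take (i - 1) as @ (as ! (i - 1) * as ! i) # drop (i + 1) as) 1
     else Poly_Mapping.single (l (last as) m, butlast as) 1)"

text \<open>\<open>H\<^sub>n(H, M)\<close> for the bimodule \<open>M\<close> with scalar multiplication \<open>sM\<close>, left action \<open>l\<close> and
  right action \<open>r\<close>.\<close>

definition hochschild_homology ::
  "('k::comm_ring_1 \<Rightarrow> 'h::ring_1 \<Rightarrow> 'h) \<Rightarrow> ('k \<Rightarrow> 'm::ab_group_add \<Rightarrow> 'm) \<Rightarrow> ('h \<Rightarrow> 'm \<Rightarrow> 'm)
     \<Rightarrow> ('m \<Rightarrow> 'h \<Rightarrow> 'm) \<Rightarrow> int \<Rightarrow> ('k, ('m \<times> 'h list \<Rightarrow>\<^sub>0 'k) set set) module" where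
  "hochschild_homology s sM l r =
     homology (coeff_tensor sM s)
       (b_map (coeff_tensor sM s)
          (\<lambda>n i. induced_map {(m, as). length as = n - 1} (coeff_tensor_rel sM s (n - 1))
                   (hochschild_face l r n i)))"


section \<open>Cyclic homology\<close>

text \<open>Cyclic homology of a cyclic module with modules \<open>C n\<close>, faces \<open>d n i\<close> and cyclic operators
  \<open>t n\<close>; the degeneracies do not enter the bicomplex. An element \<open>x\<close> of degree \<open>n\<close> of the total
  complex has component \<open>x p\<close> in column \<open>p\<close>, which contributes \<open>C (n - p)\<close>.\<close>

definition tau_map ::
  "(nat \<Rightarrow> ('k::comm_ring_1, 'c) module) \<Rightarrow> (nat \<Rightarrow> 'c \<Rightarrow> 'c) \<Rightarrow> nat \<Rightarrow> 'c \<Rightarrow> 'c" where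
  "tau_map C t n x = (- 1) ^ n \<odot>\<^bsub>C n\<^esub> t n x"

definition one_minus_tau ::
  "(nat \<Rightarrow> ('k::comm_ring_1, 'c) module) \<Rightarrow> (nat \<Rightarrow> 'c \<Rightarrow> 'c) \<Rightarrow> nat \<Rightarrow> 'c \<Rightarrow> 'c" where
  "one_minus_tau C t n x = x \<ominus>\<^bsub>C n\<^esub> tau_map C t n x"

definition norm_map ::
  "(nat \<Rightarrow> ('k::comm_ring_1, 'c) module) \<Rightarrow> (nat \<Rightarrow> 'c \<Rightarrow> 'c) \<Rightarrow> nat \<Rightarrow> 'c \<Rightarrow> 'c" where
  "norm_map C t n x = (\<Oplus>\<^bsub>C n\<^esub>i\<in>{..n}. (tau_map C t n ^^ i) x)"

definition total_module ::
  "(nat \<Rightarrow> ('k, 'c) module) \<Rightarrow> nat \<Rightarrow> ('k, nat \<Rightarrow> 'c) module" where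
  "total_module C n =
     \<lparr>carrier = (\<Pi>\<^sub>E p\<in>{..n}. carrier (C (n - p))), mult = undefined, one = undefined,
      zero = (\<lambda>p\<in>{..n}. \<zero>\<^bsub>C (n - p)\<^esub>),
      add = (\<lambda>x y. \<lambda>p\<in>{..n}. x p \<oplus>\<^bsub>C (n - p)\<^esub> y p),
      smult = (\<lambda>c x. \<lambda>p\<in>{..n}. c \<odot>\<^bsub>C (n - p)\<^esub> x p)\<rparr>"

definition total_diff ::
  "(nat \<Rightarrow> ('k::comm_ring_1, 'c) module) \<Rightarrow> (nat \<Rightarrow> nat \<Rightarrow> 'c \<Rightarrow> 'c) \<Rightarrow> (nat \<Rightarrow> 'c \<Rightarrow> 'c)
     \<Rightarrow> nat \<Rightarrow> (nat \<Rightarrow> 'c) \<Rightarrow> (nat \<Rightarrow> 'c)" where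
  "total_diff C d t n x = (\<lambda>p\<in>{..n - 1}.
     if even p
     then b_map C d (n - p) (x p) \<oplus>\<^bsub>C (n - 1 - p)\<^esub> one_minus_tau C t (n - 1 - p) (x (p + 1))
     else (\<ominus>\<^bsub>C (n - 1 - p)\<^esub> b'_map C d (n - p) (x p))
            \<oplus>\<^bsub>C (n - 1 - p)\<^esub> norm_map C t (n - 1 - p) (x (p + 1)))"

definition cyclic_homology ::
  "(nat \<Rightarrow> ('k::comm_ring_1, 'c) module) \<Rightarrow> (nat \<Rightarrow> nat \<Rightarrow> 'c \<Rightarrow> 'c) \<Rightarrow> (nat \<Rightarrow> 'c \<Rightarrow> 'c)
     \<Rightarrow> int \<Rightarrow> ('k, (nat \<Rightarrow> 'c) set) module" where
  "cyclic_homology C d t = homology (total_module C) (total_diff C d t)"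


section \<open>The cyclic module of a Hopf algebra\<close>

definition hopf_face ::
  "('h \<Rightarrow> 'k) \<Rightarrow> ('h \<Rightarrow> 'k) \<Rightarrow> nat \<Rightarrow> nat \<Rightarrow> 'h::ring_1 list \<Rightarrow> ('h list \<Rightarrow>\<^sub>0 'k::comm_ring_1)" where
  "hopf_face \<alpha> \<beta> n i as =
     (if i = 0 then Poly_Mapping.single (tl as) (\<alpha> (hd as))
      else if i < n then
        Poly_Mapping.single (take (i - 1) as @ (as ! (i - 1) * as ! i) # drop (i + 1) as) 1
      else Poly_Mapping.single (butlast as) (\<beta> (last as)))"

text \<open>The formal sum of the lists
  \<open>[[a\<^sub>1\<^sup>(\<^sup>1\<^sup>), a\<^sub>1\<^sup>(\<^sup>2\<^sup>), a\<^sub>1\<^sup>(\<^sup>3\<^sup>)], \<dots>, [a\<^sub>n\<^sup>(\<^sup>1\<^sup>), a\<^sub>n\<^sup>(\<^sup>2\<^sup>), a\<^sub>n\<^sup>(\<^sup>3\<^sup>)]]\<close>.\<close>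

primrec sweedler3_list ::
  "('h \<Rightarrow> ('h list \<Rightarrow>\<^sub>0 'k::comm_ring_1) set) \<Rightarrow> 'h list \<Rightarrow> ('h list list \<Rightarrow>\<^sub>0 'k)" where
  "sweedler3_list \<Delta> [] = Poly_Mapping.single [] 1"
| "sweedler3_list \<Delta> (a # as) =
     lin_ext fscale (\<lambda>x. lin_ext fscale (\<lambda>xs. Poly_Mapping.single (x # xs) 1)
       (sweedler3_list \<Delta> as)) (sweedler \<Delta> 2 a)"

definition hopf_cyclic ::
  "('h \<Rightarrow> ('h list \<Rightarrow>\<^sub>0 'k) set) \<Rightarrow> ('h \<Rightarrow> 'h) \<Rightarrow> 'h \<Rightarrow> ('h \<Rightarrow> 'k) \<Rightarrow> ('h \<Rightarrow> 'k) \<Rightarrow> nat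
     \<Rightarrow> 'h::ring_1 list \<Rightarrow> ('h list \<Rightarrow>\<^sub>0 'k::comm_ring_1)" where
  "hopf_cyclic \<Delta> S \<pi> \<alpha> \<beta> n as =
     (if n = 0 then Poly_Mapping.single as 1
      else lin_ext fscale
        (\<lambda>xs. Poly_Mapping.single
           ((\<pi> * S (prod_list (map (\<lambda>x. x ! 1) xs))) # map (\<lambda>x. x ! 2) (butlast xs))
           (\<alpha> (prod_list (map (\<lambda>x. x ! 0) xs)) * \<beta> (last xs ! 2)))
        (sweedler3_list \<Delta> as))"

text \<open>\<open>HC\<^sub>n\<^sup>\<pi>\<^sup>,\<^sup>\<alpha>\<^sup>,\<^sup>\<beta>(H)\<close>\<close>

definition hopf_cyclic_homology ::
  "('k::comm_ring_1 \<Rightarrow> 'h::ring_1 \<Rightarrow> 'h) \<Rightarrow> ('h \<Rightarrow> ('h list \<Rightarrow>\<^sub>0 'k) set) \<Rightarrow> ('h \<Rightarrow> 'h)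
     \<Rightarrow> 'h \<Rightarrow> ('h \<Rightarrow> 'k) \<Rightarrow> ('h \<Rightarrow> 'k) \<Rightarrow> int
     \<Rightarrow> ('k, (nat \<Rightarrow> ('h list \<Rightarrow>\<^sub>0 'k) set) set) module" where
  "hopf_cyclic_homology s \<Delta> S \<pi> \<alpha> \<beta> =
     cyclic_homology (tensor_power s)
       (\<lambda>n i. induced_map {as. length as = n - 1} (tensor_rel s (n - 1)) (hopf_face \<alpha> \<beta> n i))
       (\<lambda>n. induced_map {as. length as = n} (tensor_rel s n) (hopf_cyclic \<Delta> S \<pi> \<alpha> \<beta> n))"

end

theory Submission
  imports Defs
begin

text \<open>
  The first two columns of the cyclic bicomplex form a subcomplex of the total complex whose
  quotient is the total complex again, shifted by two degrees. Column \<open>1\<close>, with differential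
  \<open>- b'\<close>, is contractible, so that the homology of the subcomplex is that of column \<open>0\<close>; and
  column \<open>0\<close> is the Hochschild complex of \<open>H\<close> with coefficients in \<open>\<^sub>\<beta>k\<^sub>\<alpha>\<close>, since \<open>k \<otimes> H\<^sup>\<otimes>\<^sup>n\<close> is
  \<open>H\<^sup>\<otimes>\<^sup>n\<close> and the two outer faces are \<open>\<alpha>\<close> and \<open>\<beta>\<close> in both. The long exact sequence of this
  extension is the claim. Its maps have explicit representatives: the inclusion of column \<open>0\<close>, the
  shift by two columns, and Connes' operator \<open>(1 - \<tau>) s N\<close>, where \<open>s\<close> contracts column \<open>1\<close>.
  With them exactness is checked directly on cycles (\<open>connes_exact_sequence\<close>). The contraction is
  \<open>a\<^sub>1 \<otimes> \<dots> \<otimes> a\<^sub>n \<mapsto> (- 1)\<^sup>n a\<^sub>1 \<otimes> \<dots> \<otimes> a\<^sub>n \<otimes> 1\<close>.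

  The argument needs the bicomplex to be one, which rests on the cyclic identities. In their signed
  form \<open>E\<^sub>i\<^sub>+\<^sub>1 \<tau> = \<tau> E\<^sub>i\<close> and \<open>E\<^sub>0 \<tau> = E\<^sub>n\<close> they show that each face is conjugate to \<open>E\<^sub>0\<close> by a power of
  \<open>\<tau>\<close>, whence \<open>b' N = N E\<^sub>0 N = N b\<close> (\<open>b'V_NV\<close>).

  The one deep identity is \<open>t\<^sub>n\<^sup>n\<^sup>+\<^sup>1 = 1\<close> (\<open>t_gen_power\<close>). Let \<open>x \<otimes> w\<close> denote the diagonal left coaction
  on \<open>H\<^sup>\<otimes>\<^sup>n\<close> and \<open>tw = \<alpha> * S\<close> the twisted antipode. Then \<open>t\<^sub>n\<close> is the map \<open>\<pi> tw(x) \<otimes> w\<close> into \<open>n + 1\<close>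
  factors, followed by \<open>\<beta>\<close> on the last one. This map has a left inverse, \<open>\<alpha>\<close> on the first
  factor, and it intertwines \<open>t\<^sub>n\<close> with the rotation of \<open>n + 1\<close> factors that applies a linear map
  \<open>\<theta>\<close> to the factor moved to the front (\<open>embed_t_gen\<close>). The power of exponent \<open>n + 1\<close> of the
  rotation is \<open>\<theta>\<close> in every factor; carried back to \<open>H\<^sup>\<otimes>\<^sup>n\<close> it is the convolution of the character
  \<open>\<beta> \<circ> tw\<close> with \<open>\<theta>\<close> in every factor, and that convolution is the square of
  \<open>\<alpha> * S\<^sub>\<pi> * \<beta>\<close>, the identity by condition (CM) (\<open>sum_\<theta>\<close>).
\<close>

section \<open>Modules over a commutative ring and their quotients\<close>

locale kmodule = abelian_group M for M :: "('k::comm_ring_1, 'a) module" (structure) +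
  assumes smult_closed [simp, intro]: "x \<in> carrier M \<Longrightarrow> c \<odot> x \<in> carrier M"
    and smult_r_distr: "\<lbrakk>x \<in> carrier M; y \<in> carrier M\<rbrakk> \<Longrightarrow> c \<odot> (x \<oplus> y) = c \<odot> x \<oplus> c \<odot> y"
    and smult_l_distr: "x \<in> carrier M \<Longrightarrow> (c + d) \<odot> x = c \<odot> x \<oplus> d \<odot> x"
    and smult_assoc: "x \<in> carrier M \<Longrightarrow> (c * d) \<odot> x = c \<odot> (d \<odot> x)"
    and smult_one [simp]: "x \<in> carrier M \<Longrightarrow> 1 \<odot> x = x"
begin

lemma smult_zero_left [simp]:
  assumes "x \<in> carrier M" shows "0 \<odot> x = \<zero>"
proof -
  have "0 \<odot> x \<oplus> 0 \<odot> x = 0 \<odot> x"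
    using smult_l_distr[OF assms, of 0 0] by simp
  then show ?thesis
    using assms add.l_cancel_one'[of "0 \<odot> x" "0 \<odot> x"] by simp
qed

lemma smult_zero_right [simp]: "c \<odot> \<zero> = \<zero>"
proof -
  have "c \<odot> \<zero> \<oplus> c \<odot> \<zero> = c \<odot> \<zero>"
    using smult_r_distr[of \<zero> \<zero> c] by simp
  then show ?thesis
    using add.l_cancel_one'[of "c \<odot> \<zero>" "c \<odot> \<zero>"] by simp
qed

lemma minus_zero [simp]: "\<ominus> \<zero> = \<zero>"
  by (simp add: minus_equality)

lemma smult_minus_one:
  assumes "x \<in> carrier M" shows "(- 1) \<odot> x = \<ominus> x"
proof -
  have "(- 1) \<odot> x \<oplus> x = \<zero>"
    using smult_l_distr[OF assms, of "- 1" 1] assms by simp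
  then show ?thesis
    using assms by (simp add: minus_equality)
qed

lemma smult_minus:
  assumes "x \<in> carrier M" shows "c \<odot> (\<ominus> x) = \<ominus> (c \<odot> x)"
  using assms smult_assoc[of x c "- 1"] smult_assoc[of x "- 1" c]
  by (simp add: smult_minus_one)

end

locale ksubmodule = kmodule M for M :: "('k::comm_ring_1, 'a) module" (structure) +
  fixes W :: "'a set"
  assumes sub_carrier: "W \<subseteq> carrier M"
    and sub_zero [simp, intro]: "\<zero> \<in> W"
    and sub_add: "\<lbrakk>x \<in> W; y \<in> W\<rbrakk> \<Longrightarrow> x \<oplus> y \<in> W"
    and sub_smult: "x \<in> W \<Longrightarrow> c \<odot> x \<in> W"
begin

lemma sub_minus: "x \<in> W \<Longrightarrow> \<ominus> x \<in> W"
  using sub_smult[of x "- 1"] sub_carrier by (auto simp: smult_minus_one)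

lemma additive_subgroup: "additive_subgroup W M"
proof
  show "W \<subseteq> carrier (add_monoid M)" using sub_carrier by simp
qed (use sub_add sub_minus in \<open>auto simp: a_inv_def\<close>)

sublocale abelian_subgroup W M
  using additive_subgroup abelian_group_axioms by (rule abelian_subgroupI3)

lemma coset_eq_iff:
  assumes "x \<in> carrier M" "y \<in> carrier M"
  shows "W +> x = W +> y \<longleftrightarrow> x \<ominus> y \<in> W"
proof
  assume "W +> x = W +> y"
  then have "x \<in> W +> y" using a_rcos_self[OF assms(1)] by simp
  then show "x \<ominus> y \<in> W"
    using assms a_rcos_module[of y x] by (simp add: minus_eq)
next
  assume "x \<ominus> y \<in> W"
  then have "x \<in> W +> y"
    using assms a_rcos_module[of y x] by (simp add: minus_eq)
  then show "W +> x = W +> y"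
    using a_repr_independence'[OF _ assms(2)] by simp
qed

lemma quot_carrier: "carrier (quot_module M W) = (\<lambda>x. W +> x) ` carrier M"
  by (auto simp: quot_module_def A_RCOSETS_def')

lemma quot_zero: "\<zero>\<^bsub>quot_module M W\<^esub> = W +> \<zero>"
  using a_rcos_const[OF sub_zero]
  by (simp add: quot_module_def)

lemma quot_add:
  "\<lbrakk>x \<in> carrier M; y \<in> carrier M\<rbrakk> \<Longrightarrow>
    (W +> x) \<oplus>\<^bsub>quot_module M W\<^esub> (W +> y) = W +> (x \<oplus> y)"
  by (simp add: quot_module_def a_rcos_sum)

lemma coset_carrier: "x \<in> carrier M \<Longrightarrow> y \<in> W +> x \<Longrightarrow> y \<in> carrier M \<and> y \<ominus> x \<in> W"
  using a_elemrcos_carrier[of x y] a_rcos_module[of x y] by (simp add: minus_eq)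

text \<open>A map that respects the submodules is constant on cosets, so that the union in the
  definition of an induced map has only one member.\<close>

lemma UN_coset:
  assumes x: "x \<in> carrier M"
    and f: "\<And>y. \<lbrakk>y \<in> carrier M; y \<ominus> x \<in> W\<rbrakk> \<Longrightarrow> F y = F x"
  shows "(\<Union>y\<in>W +> x. F y) = F x"
  proof -
  have "(\<Union>y\<in>W +> x. F y) = (\<Union>y\<in>W +> x. F x)"
    using coset_carrier[OF x] f by (intro SUP_cong refl) blast
  moreover have "W +> x \<noteq> {}"
    using a_rcos_self[OF x] by blast
  ultimately show ?thesis
    by simp
qed

lemma quot_smult:
  assumes "x \<in> carrier M"
  shows "c \<odot>\<^bsub>quot_module M W\<^esub> (W +> x) = W +> (c \<odot> x)"
proof -
  have "W +> c \<odot> y = W +> c \<odot> x" if "y \<in> carrier M" "y \<ominus> x \<in> W" for y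
  proof -
    have "c \<odot> y \<ominus> c \<odot> x = c \<odot> (y \<ominus> x)"
      using assms that by (simp add: minus_eq smult_r_distr smult_minus)
    then show ?thesis
      using assms that sub_smult by (simp add: coset_eq_iff)
  qed
  then show ?thesis
    using assms by (simp add: quot_module_def UN_coset)
qed

lemma kmodule_quot: "kmodule (quot_module M W)"
proof -
  let ?Q = "quot_module M W"
  have rep: "\<exists>x\<in>carrier M. X = W +> x" if "X \<in> carrier ?Q" for X
    using that by (auto simp: quot_carrier)
  have "abelian_group ?Q"
  proof (rule abelian_groupI)
    fix X Y assume "X \<in> carrier ?Q" "Y \<in> carrier ?Q"
    then show "X \<oplus>\<^bsub>?Q\<^esub> Y \<in> carrier ?Q" by (auto simp: quot_carrier quot_add)
  next
    show "\<zero>\<^bsub>?Q\<^esub> \<in> carrier ?Q" by (auto simp: quot_zero quot_carrier)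
  next
    fix X Y Z assume "X \<in> carrier ?Q" "Y \<in> carrier ?Q" "Z \<in> carrier ?Q"
    then show "X \<oplus>\<^bsub>?Q\<^esub> Y \<oplus>\<^bsub>?Q\<^esub> Z = X \<oplus>\<^bsub>?Q\<^esub> (Y \<oplus>\<^bsub>?Q\<^esub> Z)"
      by (auto simp: quot_carrier quot_add a_assoc)
  next
    fix X Y assume "X \<in> carrier ?Q" "Y \<in> carrier ?Q"
    then show "X \<oplus>\<^bsub>?Q\<^esub> Y = Y \<oplus>\<^bsub>?Q\<^esub> X"
      by (auto simp: quot_carrier quot_add a_comm)
  next
    fix X assume "X \<in> carrier ?Q"
    then show "\<zero>\<^bsub>?Q\<^esub> \<oplus>\<^bsub>?Q\<^esub> X = X"
      by (auto simp: quot_carrier quot_add quot_zero)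
  next
    fix X assume "X \<in> carrier ?Q"
    then obtain x where x: "x \<in> carrier M" "X = W +> x" using rep by blast
    then show "\<exists>Y\<in>carrier ?Q. Y \<oplus>\<^bsub>?Q\<^esub> X = \<zero>\<^bsub>?Q\<^esub>"
      by (intro bexI[of _ "W +> (\<ominus> x)"]) (auto simp: quot_carrier quot_add quot_zero l_neg)
  qed
  then interpret Q: abelian_group ?Q .
  show ?thesis
    by unfold_locales
      (auto simp: quot_smult quot_add smult_r_distr smult_l_distr smult_assoc quot_carrier)
qed

end

section \<open>Linear maps\<close>

lemma linear_mapsI:
  assumes "\<And>x. x \<in> carrier M \<Longrightarrow> f x \<in> carrier N"
    and "\<And>x y. \<lbrakk>x \<in> carrier M; y \<in> carrier M\<rbrakk> \<Longrightarrow> f (x \<oplus>\<^bsub>M\<^esub> y) = f x \<oplus>\<^bsub>N\<^esub> f y"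
    and "\<And>c x. x \<in> carrier M \<Longrightarrow> f (c \<odot>\<^bsub>M\<^esub> x) = c \<odot>\<^bsub>N\<^esub> f x"
  shows "f \<in> linear_maps M N"
  using assms by (auto simp: linear_maps_def)

lemma linear_maps_closed: "\<lbrakk>f \<in> linear_maps M N; x \<in> carrier M\<rbrakk> \<Longrightarrow> f x \<in> carrier N"
  by (auto simp: linear_maps_def)

lemma linear_maps_add:
  "\<lbrakk>f \<in> linear_maps M N; x \<in> carrier M; y \<in> carrier M\<rbrakk> \<Longrightarrow> f (x \<oplus>\<^bsub>M\<^esub> y) = f x \<oplus>\<^bsub>N\<^esub> f y"
  by (auto simp: linear_maps_def)

lemma linear_maps_smult:
  "\<lbrakk>f \<in> linear_maps M N; x \<in> carrier M\<rbrakk> \<Longrightarrow> f (c \<odot>\<^bsub>M\<^esub> x) = c \<odot>\<^bsub>N\<^esub> f x"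
  by (auto simp: linear_maps_def)

lemma linear_maps_zero:
  assumes "f \<in> linear_maps M N" "kmodule M" "kmodule N"
  shows "f \<zero>\<^bsub>M\<^esub> = \<zero>\<^bsub>N\<^esub>"
proof -
  interpret M: kmodule M by fact
  interpret N: kmodule N by fact
  show ?thesis
    using linear_maps_smult[OF assms(1), of "\<zero>\<^bsub>M\<^esub>" 0] linear_maps_closed[OF assms(1), of "\<zero>\<^bsub>M\<^esub>"]
    by simp
qed

lemma linear_maps_minus:
  assumes "f \<in> linear_maps M N" "kmodule M" "kmodule N" "x \<in> carrier M"
  shows "f (\<ominus>\<^bsub>M\<^esub> x) = \<ominus>\<^bsub>N\<^esub> f x"
proof -
  interpret M: kmodule M by fact
  interpret N: kmodule N by fact
  show ?thesis
    using linear_maps_smult[OF assms(1,4), of "- 1"] linear_maps_closed[OF assms(1,4)] assms(4)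
    by (simp add: M.smult_minus_one N.smult_minus_one)
qed

lemma linear_maps_comp:
  "\<lbrakk>f \<in> linear_maps L M; g \<in> linear_maps M N\<rbrakk> \<Longrightarrow> (\<lambda>x. g (f x)) \<in> linear_maps L N"
  by (auto simp: linear_maps_def Pi_iff)

text \<open>A map between modules is linear as soon as it becomes linear after composition with an injective
  linear map. It is applied to differentials that are intertwined with linear ones by an
  isomorphism, where a direct check would repeat that of the other side.\<close>

lemma linear_maps_by_iso:
  assumes closed: "\<And>x. x \<in> carrier M \<Longrightarrow> g x \<in> carrier N" and N: "kmodule N"
    and u: "u \<in> linear_maps M M'" and v: "v \<in> linear_maps N N'" and inj: "inj_on v (carrier N)"
    and h: "h \<in> linear_maps M' N'" and comm: "\<And>x. x \<in> carrier M \<Longrightarrow> v (g x) = h (u x)"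
    and M: "kmodule M"
  shows "g \<in> linear_maps M N"
proof -
  interpret M: kmodule M by fact
  interpret N: kmodule N by fact
  show ?thesis
  proof (rule linear_mapsI)
    fix x y assume xy: "x \<in> carrier M" "y \<in> carrier M"
    have "v (g (x \<oplus>\<^bsub>M\<^esub> y)) = v (g x \<oplus>\<^bsub>N\<^esub> g y)"
      using xy linear_maps_closed[OF u] by (simp add: comm closed linear_maps_add[OF u]
          linear_maps_add[OF v] linear_maps_add[OF h])
    then show "g (x \<oplus>\<^bsub>M\<^esub> y) = g x \<oplus>\<^bsub>N\<^esub> g y"
      using inj xy by (auto dest!: inj_onD simp: closed)
  next
    fix c x assume x: "x \<in> carrier M"
    have "v (g (c \<odot>\<^bsub>M\<^esub> x)) = v (c \<odot>\<^bsub>N\<^esub> g x)"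
      using x linear_maps_closed[OF u] by (simp add: comm closed linear_maps_smult[OF u]
          linear_maps_smult[OF v] linear_maps_smult[OF h])
    then show "g (c \<odot>\<^bsub>M\<^esub> x) = c \<odot>\<^bsub>N\<^esub> g x"
      using inj x by (auto dest!: inj_onD simp: closed)
  qed (rule closed)
qed

lemma linear_maps_inv_into:
  assumes f: "f \<in> linear_maps M N" and bij: "bij_betw f (carrier M) (carrier N)" and M: "kmodule M"
  shows "inv_into (carrier M) f \<in> linear_maps N M"
proof -
  interpret M: kmodule M by fact
  let ?g = "inv_into (carrier M) f"
  have gc: "?g y \<in> carrier M" and fg: "f (?g y) = y" if "y \<in> carrier N" for y
    using that bij by (auto simp: bij_betw_def inv_into_into f_inv_into_f)
  have eq: "x = x'" if "f x = f x'" "x \<in> carrier M" "x' \<in> carrier M" for x x'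
    using that bij by (auto simp: bij_betw_def inj_on_def)
  have Nadd: "y \<oplus>\<^bsub>N\<^esub> z \<in> carrier N" if "y \<in> carrier N" "z \<in> carrier N" for y z
    using linear_maps_closed[OF f, of "?g y \<oplus>\<^bsub>M\<^esub> ?g z"] gc fg that
    by (simp add: linear_maps_add[OF f])
  have Nsmult: "c \<odot>\<^bsub>N\<^esub> y \<in> carrier N" if "y \<in> carrier N" for y c
    using linear_maps_closed[OF f, of "c \<odot>\<^bsub>M\<^esub> ?g y"] gc fg that
    by (simp add: linear_maps_smult[OF f])
  show ?thesis
    by (rule linear_mapsI; (rule eq)?)
      (simp_all add: gc fg Nadd Nsmult linear_maps_add[OF f] linear_maps_smult[OF f])
qed

section \<open>Homology of complexes indexed by the integers\<close>

context ksubmodule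
begin

lemma kmodule_sub: "kmodule (M\<lparr>carrier := W\<rparr>)"
proof -
  have c: "x \<in> W \<Longrightarrow> x \<in> carrier M" for x
    using sub_carrier by blast
  have "abelian_group (M\<lparr>carrier := W\<rparr>)"
  proof (rule abelian_groupI; simp add: sub_add c a_assoc)
    fix x y assume "x \<in> W" "y \<in> W"
    then show "x \<oplus> y = y \<oplus> x"
      using a_comm c by blast
  next
    fix x assume "x \<in> W"
    then show "\<exists>y\<in>W. y \<oplus> x = \<zero>"
      by (intro bexI[of _ "\<ominus> x"]) (auto simp: l_neg c sub_minus)
  qed
  then interpret N: abelian_group "M\<lparr>carrier := W\<rparr>" .
  show ?thesis
    by unfold_locales (simp_all add: sub_smult c smult_r_distr smult_l_distr smult_assoc)
qed

lemma minus_sub: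
  assumes "x \<in> W" "y \<in> W"
  shows "x \<ominus>\<^bsub>M\<lparr>carrier := W\<rparr>\<^esub> y = x \<ominus> y"
proof -
  interpret N: kmodule "M\<lparr>carrier := W\<rparr>" by (rule kmodule_sub)
  have "\<ominus>\<^bsub>M\<lparr>carrier := W\<rparr>\<^esub> y = \<ominus> y"
    using N.smult_minus_one[of y] smult_minus_one[of y] assms sub_carrier by auto
  then show ?thesis
    by (simp add: N.minus_eq minus_eq)
qed

end

definition cycles ::
  "(int \<Rightarrow> ('k, 'a) module) \<Rightarrow> (int \<Rightarrow> 'a \<Rightarrow> 'a) \<Rightarrow> int \<Rightarrow> 'a set" where
  "cycles D \<delta> n = a_kernel (D n) (D (n - 1)) (\<delta> n)"

definition boundaries ::
  "(int \<Rightarrow> ('k, 'a) module) \<Rightarrow> (int \<Rightarrow> 'a \<Rightarrow> 'a) \<Rightarrow> int \<Rightarrow> 'a set" where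
  "boundaries D \<delta> n = \<delta> (n + 1) ` carrier (D (n + 1))"

definition int_homology ::
  "(int \<Rightarrow> ('k, 'a) module) \<Rightarrow> (int \<Rightarrow> 'a \<Rightarrow> 'a) \<Rightarrow> int \<Rightarrow> ('k, 'a set) module" where
  "int_homology D \<delta> n = quot_module ((D n)\<lparr>carrier := cycles D \<delta> n\<rparr>) (boundaries D \<delta> n)"

definition homology_class ::
  "(int \<Rightarrow> ('k, 'a) module) \<Rightarrow> (int \<Rightarrow> 'a \<Rightarrow> 'a) \<Rightarrow> int \<Rightarrow> 'a \<Rightarrow> 'a set" where
  "homology_class D \<delta> n z = boundaries D \<delta> n +>\<^bsub>D n\<^esub> z"

lemma homology_eq_int_homology: "homology C d = int_homology (complex_module C) (complex_diff C d)"
  by (rule ext) (simp add: homology_def int_homology_def cycles_def boundaries_def)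

lemma cycles_iff:
  "z \<in> cycles D \<delta> n \<longleftrightarrow> z \<in> carrier (D n) \<and> \<delta> n z = \<zero>\<^bsub>D (n - 1)\<^esub>"
  by (auto simp: cycles_def a_kernel_def')

locale chain_complex =
  fixes D :: "int \<Rightarrow> ('k::comm_ring_1, 'a) module" and \<delta> :: "int \<Rightarrow> 'a \<Rightarrow> 'a"
  assumes kmodule: "kmodule (D n)"
    and diff_linear: "\<delta> n \<in> linear_maps (D n) (D (n - 1))"
    and diff_diff: "x \<in> carrier (D n) \<Longrightarrow> \<delta> (n - 1) (\<delta> n x) = \<zero>\<^bsub>D (n - 2)\<^esub>"
begin

lemma diff_closed: "x \<in> carrier (D n) \<Longrightarrow> \<delta> n x \<in> carrier (D (n - 1))"
  by (rule linear_maps_closed[OF diff_linear])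

lemma diff_zero: "\<delta> n \<zero>\<^bsub>D n\<^esub> = \<zero>\<^bsub>D (n - 1)\<^esub>"
  by (rule linear_maps_zero[OF diff_linear kmodule kmodule])

lemma cycles_submodule: "ksubmodule (D n) (cycles D \<delta> n)"
proof -
  interpret Dn: kmodule "D n" by (rule kmodule)
  interpret Dm: kmodule "D (n - 1)" by (rule kmodule)
  show ?thesis
    by unfold_locales
      (auto simp: cycles_iff diff_zero linear_maps_add[OF diff_linear] linear_maps_smult[OF diff_linear])
qed

lemma boundaries_cycles: "boundaries D \<delta> n \<subseteq> cycles D \<delta> n"
  using diff_closed[of _ "n + 1"] diff_diff[of _ "n + 1"] by (auto simp: boundaries_def cycles_iff)

lemma boundaries_closed: "w \<in> boundaries D \<delta> n \<Longrightarrow> w \<in> carrier (D n)"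
  using boundaries_cycles[of n] by (auto simp: cycles_iff)

lemma zero_boundaries: "\<zero>\<^bsub>D n\<^esub> \<in> boundaries D \<delta> n"
proof -
  interpret Dp: kmodule "D (n + 1)" by (rule kmodule)
  show ?thesis
    using diff_zero[of "n + 1"] by (auto simp: boundaries_def intro!: image_eqI[where x = "\<zero>\<^bsub>D (n + 1)\<^esub>"])
qed

lemma boundaries_submodule: "ksubmodule ((D n)\<lparr>carrier := cycles D \<delta> n\<rparr>) (boundaries D \<delta> n)"
proof -
  interpret Dp: kmodule "D (n + 1)" by (rule kmodule)
  interpret Z: ksubmodule "D n" "cycles D \<delta> n" by (rule cycles_submodule)
  interpret ZM: kmodule "(D n)\<lparr>carrier := cycles D \<delta> n\<rparr>" by (rule Z.kmodule_sub)
  have add: "\<delta> (n + 1) (x \<oplus>\<^bsub>D (n + 1)\<^esub> y) = \<delta> (n + 1) x \<oplus>\<^bsub>D n\<^esub> \<delta> (n + 1) y"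
    if "x \<in> carrier (D (n + 1))" "y \<in> carrier (D (n + 1))" for x y
    using linear_maps_add[OF diff_linear[of "n + 1"] that] by simp
  have smult: "\<delta> (n + 1) (c \<odot>\<^bsub>D (n + 1)\<^esub> x) = c \<odot>\<^bsub>D n\<^esub> \<delta> (n + 1) x"
    if "x \<in> carrier (D (n + 1))" for x c
    using linear_maps_smult[OF diff_linear[of "n + 1"] that] by simp
  show ?thesis
  proof
    fix x y assume "x \<in> boundaries D \<delta> n" "y \<in> boundaries D \<delta> n"
    then show "x \<oplus>\<^bsub>(D n)\<lparr>carrier := cycles D \<delta> n\<rparr>\<^esub> y \<in> boundaries D \<delta> n"
      by (auto simp: boundaries_def add[symmetric])
  next
    fix x c assume "x \<in> boundaries D \<delta> n"
    then show "c \<odot>\<^bsub>(D n)\<lparr>carrier := cycles D \<delta> n\<rparr>\<^esub> x \<in> boundaries D \<delta> n"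
      by (auto simp: boundaries_def smult[symmetric])
  qed (use boundaries_cycles zero_boundaries in auto)
qed

lemma homology_class_alt:
  "boundaries D \<delta> n +>\<^bsub>(D n)\<lparr>carrier := cycles D \<delta> n\<rparr>\<^esub> z = homology_class D \<delta> n z"
  by (simp add: homology_class_def a_r_coset_def')

lemma homology_carrier: "carrier (int_homology D \<delta> n) = homology_class D \<delta> n ` cycles D \<delta> n"
proof -
  interpret B: ksubmodule "(D n)\<lparr>carrier := cycles D \<delta> n\<rparr>" "boundaries D \<delta> n"
    by (rule boundaries_submodule)
  show ?thesis
    using B.quot_carrier by (simp add: int_homology_def homology_class_alt)
qed

lemma homology_zero: "\<zero>\<^bsub>int_homology D \<delta> n\<^esub> = homology_class D \<delta> n \<zero>\<^bsub>D n\<^esub>"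
proof -
  interpret B: ksubmodule "(D n)\<lparr>carrier := cycles D \<delta> n\<rparr>" "boundaries D \<delta> n"
    by (rule boundaries_submodule)
  show ?thesis
    using B.quot_zero by (simp add: int_homology_def homology_class_alt)
qed

lemma homology_add:
  "\<lbrakk>y \<in> cycles D \<delta> n; z \<in> cycles D \<delta> n\<rbrakk> \<Longrightarrow>
    homology_class D \<delta> n y \<oplus>\<^bsub>int_homology D \<delta> n\<^esub> homology_class D \<delta> n z = homology_class D \<delta> n (y \<oplus>\<^bsub>D n\<^esub> z)"
proof -
  interpret B: ksubmodule "(D n)\<lparr>carrier := cycles D \<delta> n\<rparr>" "boundaries D \<delta> n"
    by (rule boundaries_submodule)
  assume "y \<in> cycles D \<delta> n" "z \<in> cycles D \<delta> n"
  then show ?thesis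
    using B.quot_add[of y z] by (simp add: int_homology_def homology_class_alt)
qed

lemma homology_smult:
  "z \<in> cycles D \<delta> n \<Longrightarrow>
    c \<odot>\<^bsub>int_homology D \<delta> n\<^esub> homology_class D \<delta> n z = homology_class D \<delta> n (c \<odot>\<^bsub>D n\<^esub> z)"
proof -
  interpret B: ksubmodule "(D n)\<lparr>carrier := cycles D \<delta> n\<rparr>" "boundaries D \<delta> n"
    by (rule boundaries_submodule)
  assume "z \<in> cycles D \<delta> n"
  then show ?thesis
    using B.quot_smult[of z c] by (simp add: int_homology_def homology_class_alt)
qed

lemma homology_class_eq_iff:
  assumes "y \<in> cycles D \<delta> n" "z \<in> cycles D \<delta> n"
  shows "homology_class D \<delta> n y = homology_class D \<delta> n z \<longleftrightarrow> (\<exists>w\<in>boundaries D \<delta> n. y = z \<oplus>\<^bsub>D n\<^esub> w)"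
proof -
  interpret Z: ksubmodule "D n" "cycles D \<delta> n" by (rule cycles_submodule)
  interpret B: ksubmodule "(D n)\<lparr>carrier := cycles D \<delta> n\<rparr>" "boundaries D \<delta> n"
    by (rule boundaries_submodule)
  have yz: "y \<in> carrier (D n)" "z \<in> carrier (D n)"
    using assms by (auto simp: cycles_iff)
  have "homology_class D \<delta> n y = homology_class D \<delta> n z \<longleftrightarrow> y \<ominus>\<^bsub>D n\<^esub> z \<in> boundaries D \<delta> n"
    using B.coset_eq_iff[of y z] assms by (simp add: homology_class_alt Z.minus_sub)
  also have "\<dots> \<longleftrightarrow> (\<exists>w\<in>boundaries D \<delta> n. y = z \<oplus>\<^bsub>D n\<^esub> w)"
  proof
    assume *: "y \<ominus>\<^bsub>D n\<^esub> z \<in> boundaries D \<delta> n"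
    have "y = z \<oplus>\<^bsub>D n\<^esub> (y \<ominus>\<^bsub>D n\<^esub> z)"
      using yz by (simp add: Z.minus_eq Z.a_ac Z.r_neg)
    with * show "\<exists>w\<in>boundaries D \<delta> n. y = z \<oplus>\<^bsub>D n\<^esub> w" by blast
  next
    assume "\<exists>w\<in>boundaries D \<delta> n. y = z \<oplus>\<^bsub>D n\<^esub> w"
    then obtain w where w: "w \<in> boundaries D \<delta> n" "y = z \<oplus>\<^bsub>D n\<^esub> w" by blast
    then have "w \<in> carrier (D n)"
      using boundaries_closed by blast
    then have "y \<ominus>\<^bsub>D n\<^esub> z = w"
      using w yz by (simp add: Z.minus_eq Z.a_ac Z.r_neg1 Z.r_neg2 Z.r_neg)
    then show "y \<ominus>\<^bsub>D n\<^esub> z \<in> boundaries D \<delta> n" using w by simp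
  qed
  finally show ?thesis .
qed

lemma homology_class_eq_zero_iff:
  assumes "z \<in> cycles D \<delta> n"
  shows "homology_class D \<delta> n z = \<zero>\<^bsub>int_homology D \<delta> n\<^esub> \<longleftrightarrow> z \<in> boundaries D \<delta> n"
proof -
  interpret Z: ksubmodule "D n" "cycles D \<delta> n" by (rule cycles_submodule)
  have "w \<in> carrier (D n)" if "w \<in> boundaries D \<delta> n" for w
    using that by (rule boundaries_closed)
  then show ?thesis
    using homology_class_eq_iff[OF assms, of "\<zero>\<^bsub>D n\<^esub>"] by (auto simp: homology_zero)
qed

lemma kmodule_homology: "kmodule (int_homology D \<delta> n)"
  unfolding int_homology_def by (rule ksubmodule.kmodule_quot) (rule boundaries_submodule)

end

text \<open>Besides linearity only the effect of \<open>f\<close> on cycles and boundaries matters, so that \<open>f\<close> may commute with the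
  differentials up to sign and may shift degrees; both occur for Connes' operator \<open>B\<close>.\<close>

lemma homology_map:
  assumes D: "chain_complex D \<delta>" and E: "chain_complex E \<epsilon>"
    and closed: "\<And>z. z \<in> cycles D \<delta> n \<Longrightarrow> f z \<in> cycles E \<epsilon> m"
    and bnd: "\<And>z. z \<in> boundaries D \<delta> n \<Longrightarrow> f z \<in> boundaries E \<epsilon> m"
    and lin: "f \<in> linear_maps (D n) (E m)"
  obtains F where "F \<in> linear_maps (int_homology D \<delta> n) (int_homology E \<epsilon> m)"
    "\<And>z. z \<in> cycles D \<delta> n \<Longrightarrow> F (homology_class D \<delta> n z) = homology_class E \<epsilon> m (f z)"
proof -
  interpret D: chain_complex D \<delta> by fact
  interpret E: chain_complex E \<epsilon> by fact
  interpret Z: ksubmodule "D n" "cycles D \<delta> n" by (rule D.cycles_submodule)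
  define F where "F = (\<lambda>X. homology_class E \<epsilon> m (f (SOME z. z \<in> cycles D \<delta> n \<and> homology_class D \<delta> n z = X)))"
  have F: "F (homology_class D \<delta> n z) = homology_class E \<epsilon> m (f z)" if z: "z \<in> cycles D \<delta> n" for z
  proof -
    define y where "y = (SOME y. y \<in> cycles D \<delta> n \<and> homology_class D \<delta> n y = homology_class D \<delta> n z)"
    have y: "y \<in> cycles D \<delta> n \<and> homology_class D \<delta> n y = homology_class D \<delta> n z"
      unfolding y_def by (rule someI[of _ z]) (use z in simp)
    then obtain w where w: "w \<in> boundaries D \<delta> n" "y = z \<oplus>\<^bsub>D n\<^esub> w"
      using D.homology_class_eq_iff[of y n z] z by blast
    have wc: "w \<in> carrier (D n)" "z \<in> carrier (D n)"
      using w D.boundaries_closed z by (auto simp: cycles_iff)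
    have "f y = f z \<oplus>\<^bsub>E m\<^esub> f w"
      using w wc linear_maps_add[OF lin] by simp
    then have "homology_class E \<epsilon> m (f y) = homology_class E \<epsilon> m (f z)"
      using E.homology_class_eq_iff[of "f y" m "f z"] closed y z bnd[OF w(1)] by blast
    then show ?thesis
      by (simp add: F_def y_def)
  qed
  moreover have "F \<in> linear_maps (int_homology D \<delta> n) (int_homology E \<epsilon> m)"
  proof (rule linear_mapsI)
    fix X assume "X \<in> carrier (int_homology D \<delta> n)"
    then show "F X \<in> carrier (int_homology E \<epsilon> m)"
      by (auto simp: D.homology_carrier E.homology_carrier F closed)
  next
    fix X Y assume "X \<in> carrier (int_homology D \<delta> n)" "Y \<in> carrier (int_homology D \<delta> n)"
    then obtain x y where xy: "x \<in> cycles D \<delta> n" "y \<in> cycles D \<delta> n"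
      "X = homology_class D \<delta> n x" "Y = homology_class D \<delta> n y"
      by (auto simp: D.homology_carrier)
    then have "x \<in> carrier (D n)" "y \<in> carrier (D n)"
      by (auto simp: cycles_iff)
    then show "F (X \<oplus>\<^bsub>int_homology D \<delta> n\<^esub> Y) = F X \<oplus>\<^bsub>int_homology E \<epsilon> m\<^esub> F Y"
      using xy by (simp add: D.homology_add E.homology_add F closed Z.sub_add linear_maps_add[OF lin])
  next
    fix c X assume "X \<in> carrier (int_homology D \<delta> n)"
    then obtain x where x: "x \<in> cycles D \<delta> n" "X = homology_class D \<delta> n x"
      by (auto simp: D.homology_carrier)
    then have "x \<in> carrier (D n)"
      by (auto simp: cycles_iff)
    then show "F (c \<odot>\<^bsub>int_homology D \<delta> n\<^esub> X) = c \<odot>\<^bsub>int_homology E \<epsilon> m\<^esub> F X"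
      using x by (simp add: D.homology_smult E.homology_smult F closed Z.sub_smult linear_maps_smult[OF lin])
  qed
  ultimately show ?thesis using that by blast
qed

text \<open>Exactness in homology as a statement about chains: a cycle \<open>y\<close> that \<open>g\<close> sends to a boundary is
  the image under \<open>f\<close> of a cycle, up to a boundary.\<close>

lemma exact_at_homology:
  assumes D: "chain_complex D \<delta>" and E: "chain_complex E \<epsilon>" and G: "chain_complex G \<gamma>"
    and f: "\<And>x. x \<in> cycles D \<delta> l \<Longrightarrow> f x \<in> cycles E \<epsilon> m"
    and g: "\<And>y. y \<in> cycles E \<epsilon> m \<Longrightarrow> g y \<in> cycles G \<gamma> n"
    and F: "\<And>x. x \<in> cycles D \<delta> l \<Longrightarrow> F (homology_class D \<delta> l x) = homology_class E \<epsilon> m (f x)"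
    and K: "\<And>y. y \<in> cycles E \<epsilon> m \<Longrightarrow> K (homology_class E \<epsilon> m y) = homology_class G \<gamma> n (g y)"
    and gf: "\<And>x. x \<in> cycles D \<delta> l \<Longrightarrow> g (f x) \<in> boundaries G \<gamma> n"
    and ex: "\<And>y. \<lbrakk>y \<in> cycles E \<epsilon> m; g y \<in> boundaries G \<gamma> n\<rbrakk> \<Longrightarrow>
      \<exists>x\<in>cycles D \<delta> l. \<exists>w\<in>boundaries E \<epsilon> m. y = f x \<oplus>\<^bsub>E m\<^esub> w"
  shows "exact_at (int_homology D \<delta> l) F (int_homology E \<epsilon> m) K (int_homology G \<gamma> n)"
proof -
  interpret D: chain_complex D \<delta> by fact
  interpret E: chain_complex E \<epsilon> by fact
  interpret G: chain_complex G \<gamma> by fact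
  show ?thesis
    unfolding exact_at_def
  proof (intro subset_antisym subsetI)
    fix Y assume "Y \<in> F ` carrier (int_homology D \<delta> l)"
    then obtain x where "x \<in> cycles D \<delta> l" "Y = homology_class E \<epsilon> m (f x)"
      by (auto simp: D.homology_carrier F)
    then show "Y \<in> a_kernel (int_homology E \<epsilon> m) (int_homology G \<gamma> n) K"
      using f g gf by (auto simp: a_kernel_def' E.homology_carrier K G.homology_class_eq_zero_iff)
  next
    fix Y assume "Y \<in> a_kernel (int_homology E \<epsilon> m) (int_homology G \<gamma> n) K"
    then obtain y where y: "y \<in> cycles E \<epsilon> m" "Y = homology_class E \<epsilon> m y" "g y \<in> boundaries G \<gamma> n"
      using g by (auto simp: a_kernel_def' E.homology_carrier K G.homology_class_eq_zero_iff)
    then obtain x w where "x \<in> cycles D \<delta> l" "w \<in> boundaries E \<epsilon> m" "y = f x \<oplus>\<^bsub>E m\<^esub> w"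
      using ex by blast
    then have "x \<in> cycles D \<delta> l" "Y = F (homology_class D \<delta> l x)"
      using y f by (auto simp: F E.homology_class_eq_iff)
    then show "Y \<in> F ` carrier (int_homology D \<delta> l)"
      by (auto simp: D.homology_carrier)
  qed
qed

text \<open>Of \<open>\<epsilon>\<close> only closure and the correspondence with \<open>\<delta>\<close> under \<open>\<phi>\<close> are assumed; linearity
  and \<open>\<epsilon> \<circ> \<epsilon> = 0\<close> are inherited.\<close>

locale complex_iso = chain_complex D \<delta>
  for D :: "int \<Rightarrow> ('k::comm_ring_1, 'a) module" and \<delta> +
  fixes E :: "int \<Rightarrow> ('k, 'b) module" and \<epsilon> and \<phi> :: "int \<Rightarrow> 'b \<Rightarrow> 'a"
  assumes source_kmodule: "kmodule (E n)"
    and source_closed: "y \<in> carrier (E n) \<Longrightarrow> \<epsilon> n y \<in> carrier (E (n - 1))"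
    and iso_linear: "\<phi> n \<in> linear_maps (E n) (D n)"
    and iso_bij: "bij_betw (\<phi> n) (carrier (E n)) (carrier (D n))"
    and iso_diff: "y \<in> carrier (E n) \<Longrightarrow> \<phi> (n - 1) (\<epsilon> n y) = \<delta> n (\<phi> n y)"
begin

lemma iso_closed: "y \<in> carrier (E n) \<Longrightarrow> \<phi> n y \<in> carrier (D n)"
  by (rule linear_maps_closed[OF iso_linear])

lemma source_linear: "\<epsilon> n \<in> linear_maps (E n) (E (n - 1))"
  using iso_bij[of "n - 1"]
  by (intro linear_maps_by_iso[OF source_closed source_kmodule iso_linear iso_linear _ diff_linear
        iso_diff source_kmodule]) (auto simp: bij_betw_def)

lemma iso_zero: "\<phi> n \<zero>\<^bsub>E n\<^esub> = \<zero>\<^bsub>D n\<^esub>"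
  by (rule linear_maps_zero[OF iso_linear source_kmodule kmodule])

lemma iso_eqD: "\<lbrakk>\<phi> n x = \<phi> n y; x \<in> carrier (E n); y \<in> carrier (E n)\<rbrakk> \<Longrightarrow> x = y"
  using iso_bij[of n] by (auto simp: bij_betw_def inj_on_def)

lemma zero_source: "\<zero>\<^bsub>E n\<^esub> \<in> carrier (E n)"
proof -
  interpret E: kmodule "E n" by (rule source_kmodule)
  show ?thesis by simp
qed

lemma source_complex: "chain_complex E \<epsilon>"
proof (rule chain_complex.intro[where D = E and \<delta> = \<epsilon>, OF source_kmodule source_linear])
  fix n y assume y: "y \<in> carrier (E n)"
  have "\<phi> (n - 2) (\<epsilon> (n - 1) (\<epsilon> n y)) = \<phi> (n - 2) \<zero>\<^bsub>E (n - 2)\<^esub>"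
    using iso_diff[OF source_closed[OF y]] diff_diff[OF iso_closed[OF y]]
    by (simp add: iso_diff[OF y] iso_zero)
  moreover have "\<epsilon> (n - 1) (\<epsilon> n y) \<in> carrier (E (n - 2))"
    using source_closed[OF source_closed[OF y]] by simp
  ultimately show "\<epsilon> (n - 1) (\<epsilon> n y) = \<zero>\<^bsub>E (n - 2)\<^esub>"
    using zero_source iso_eqD by blast
qed

lemma iso_cycles: "y \<in> carrier (E n) \<Longrightarrow> \<phi> n y \<in> cycles D \<delta> n \<longleftrightarrow> y \<in> cycles E \<epsilon> n"
  using iso_eqD[of "n - 1" "\<epsilon> n y" "\<zero>\<^bsub>E (n - 1)\<^esub>"] source_closed zero_source
  by (auto simp: cycles_iff iso_closed iso_diff[symmetric] iso_zero)

lemma iso_boundaries: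
  assumes "y \<in> carrier (E n)"
  shows "\<phi> n y \<in> boundaries D \<delta> n \<longleftrightarrow> y \<in> boundaries E \<epsilon> n"
proof
  assume "\<phi> n y \<in> boundaries D \<delta> n"
  then obtain x where x: "x \<in> carrier (D (n + 1))" "\<phi> n y = \<delta> (n + 1) x"
    by (auto simp: boundaries_def)
  then obtain w where w: "w \<in> carrier (E (n + 1))" "x = \<phi> (n + 1) w"
    using iso_bij[of "n + 1"] by (auto simp: bij_betw_def)
  then have "\<phi> n y = \<phi> n (\<epsilon> (n + 1) w)"
    using x iso_diff[OF w(1)] by simp
  then have "y = \<epsilon> (n + 1) w"
    using iso_eqD assms source_closed[OF w(1)] by simp
  then show "y \<in> boundaries E \<epsilon> n"
    using w by (auto simp: boundaries_def)
next
  assume "y \<in> boundaries E \<epsilon> n"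
  then show "\<phi> n y \<in> boundaries D \<delta> n"
    using iso_diff[of _ "n + 1"] iso_closed by (auto simp: boundaries_def)
qed

lemma homology_iso:
  obtains F where "F \<in> linear_maps (int_homology E \<epsilon> n) (int_homology D \<delta> n)"
    "bij_betw F (carrier (int_homology E \<epsilon> n)) (carrier (int_homology D \<delta> n))"
proof -
  interpret E: chain_complex E \<epsilon> by (rule source_complex)
  interpret En: kmodule "E n" by (rule source_kmodule)
  have Ec: "y \<in> cycles E \<epsilon> n \<Longrightarrow> y \<in> carrier (E n)" for y
    by (simp add: cycles_iff)
  have Eb: "y \<in> boundaries E \<epsilon> n \<Longrightarrow> y \<in> carrier (E n)" for y
    by (rule E.boundaries_closed)
  obtain F where lin: "F \<in> linear_maps (int_homology E \<epsilon> n) (int_homology D \<delta> n)"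
    and F: "\<And>z. z \<in> cycles E \<epsilon> n \<Longrightarrow> F (homology_class E \<epsilon> n z) = homology_class D \<delta> n (\<phi> n z)"
    using homology_map[OF source_complex chain_complex_axioms, of n "\<phi> n" n]
    by (metis Ec Eb iso_cycles iso_boundaries iso_linear)
  have "inj_on F (carrier (int_homology E \<epsilon> n))"
  proof (rule inj_onI)
    fix X Y assume XY: "X \<in> carrier (int_homology E \<epsilon> n)" "Y \<in> carrier (int_homology E \<epsilon> n)" "F X = F Y"
    then obtain x y where x: "x \<in> cycles E \<epsilon> n" "X = homology_class E \<epsilon> n x"
      and y: "y \<in> cycles E \<epsilon> n" "Y = homology_class E \<epsilon> n y"
      by (auto simp: E.homology_carrier)
    then obtain w where w: "w \<in> boundaries D \<delta> n" "\<phi> n x = \<phi> n y \<oplus>\<^bsub>D n\<^esub> w"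
      using XY homology_class_eq_iff[of "\<phi> n x" n "\<phi> n y"] by (auto simp: F Ec iso_cycles)
    have "w \<in> carrier (D n)"
      using w boundaries_closed by blast
    then obtain v where v: "v \<in> carrier (E n)" "w = \<phi> n v"
      using iso_bij[of n] by (auto simp: bij_betw_def)
    then have "\<phi> n x = \<phi> n (y \<oplus>\<^bsub>E n\<^esub> v)"
      using w y Ec by (simp add: linear_maps_add[OF iso_linear])
    then have "x = y \<oplus>\<^bsub>E n\<^esub> v"
      using iso_eqD[of n x] x y v Ec by blast
    moreover have "v \<in> boundaries E \<epsilon> n"
      using iso_boundaries v w by blast
    ultimately show "X = Y"
      using x y E.homology_class_eq_iff by blast
  qed
  moreover have "F ` carrier (int_homology E \<epsilon> n) = carrier (int_homology D \<delta> n)"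
  proof (intro subset_antisym subsetI)
    fix X assume "X \<in> carrier (int_homology D \<delta> n)"
    then obtain x where x: "x \<in> cycles D \<delta> n" "X = homology_class D \<delta> n x"
      by (auto simp: homology_carrier)
    then obtain y where "y \<in> carrier (E n)" "x = \<phi> n y"
      using iso_bij[of n] by (auto simp: bij_betw_def cycles_iff)
    then have "y \<in> cycles E \<epsilon> n" "X = F (homology_class E \<epsilon> n y)"
      using x by (auto simp: iso_cycles F)
    then show "X \<in> F ` carrier (int_homology E \<epsilon> n)"
      by (auto simp: E.homology_carrier)
  qed (use linear_maps_closed[OF lin] in auto)
  ultimately show ?thesis
    using that lin by (auto simp: bij_betw_def)
qed

end

text \<open>Isomorphisms \<open>u\<close>, \<open>v\<close>, \<open>w\<close> carry an exact sequence to the conjugate maps between the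
  isomorphic modules.\<close>

lemma exact_at_conj:
  assumes ex: "exact_at L f M g N"
    and L: "bij_betw u (carrier L') (carrier L)"
    and M: "v \<in> linear_maps M' M" "bij_betw v (carrier M') (carrier M)"
    and N: "w \<in> linear_maps N' N" "bij_betw w (carrier N') (carrier N)"
    and kmod: "kmodule M" "kmodule M'" "kmodule N" "kmodule N'"
    and f: "f \<in> linear_maps L M" and g: "g \<in> linear_maps M N"
  shows "exact_at L' (\<lambda>x. inv_into (carrier M') v (f (u x))) M'
    (\<lambda>y. inv_into (carrier N') w (g (v y))) N'"
proof -
  interpret N: kmodule N by fact
  interpret N': kmodule N' by fact
  have kerg: "inv_into (carrier N') w (g (v y)) = \<zero>\<^bsub>N'\<^esub> \<longleftrightarrow> g (v y) = \<zero>\<^bsub>N\<^esub>" if "y \<in> carrier M'" for y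
  proof -
    have gv: "g (v y) \<in> carrier N"
      using linear_maps_closed[OF g] linear_maps_closed[OF M(1)] that by blast
    have "w \<zero>\<^bsub>N'\<^esub> = \<zero>\<^bsub>N\<^esub>"
      by (rule linear_maps_zero[OF N(1) kmod(4,3)])
    then show ?thesis
      using gv bij_betw_inv_into_left[OF N(2)] bij_betw_inv_into_right[OF N(2)] N'.zero_closed
      by metis
  qed
  have "(\<lambda>x. inv_into (carrier M') v (f (u x))) ` carrier L' =
    inv_into (carrier M') v ` f ` u ` carrier L'"
    by (simp add: image_image)
  also have "\<dots> = inv_into (carrier M') v ` {y \<in> carrier M. g y = \<zero>\<^bsub>N\<^esub>}"
    using ex L by (simp add: exact_at_def a_kernel_def' bij_betw_def)
  also have "\<dots> = {y \<in> carrier M'. g (v y) = \<zero>\<^bsub>N\<^esub>}"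
  proof (intro subset_antisym subsetI)
    fix y assume "y \<in> inv_into (carrier M') v ` {y \<in> carrier M. g y = \<zero>\<^bsub>N\<^esub>}"
    then show "y \<in> {y \<in> carrier M'. g (v y) = \<zero>\<^bsub>N\<^esub>}"
      using M(2) by (auto simp: bij_betw_def inv_into_into f_inv_into_f)
  next
    fix y assume y: "y \<in> {y \<in> carrier M'. g (v y) = \<zero>\<^bsub>N\<^esub>}"
    then have "y = inv_into (carrier M') v (v y)" "v y \<in> carrier M"
      using bij_betw_inv_into_left[OF M(2)] linear_maps_closed[OF M(1)] by auto
    then show "y \<in> inv_into (carrier M') v ` {y \<in> carrier M. g y = \<zero>\<^bsub>N\<^esub>}"
      using y by blast
  qed
  also have "\<dots> = a_kernel M' N' (\<lambda>y. inv_into (carrier N') w (g (v y)))"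
    by (simp add: a_kernel_def' kerg cong: conj_cong)
  finally show ?thesis
    by (simp add: exact_at_def)
qed

section \<open>Connes' exact sequence of a periodic bicomplex\<close>

text \<open>In the application \<open>T\<close> is \<open>1 - \<tau>\<close>, \<open>N\<close> is the norm and \<open>s\<close> contracts the columns with
  differential \<open>b'\<close>. Indexing by all integers removes every case distinction at the boundary of
  the bicomplex.\<close>

locale periodic_bicomplex =
  fixes A :: "int \<Rightarrow> ('k::comm_ring_1, 'a) module"
    and b b' T N s :: "int \<Rightarrow> 'a \<Rightarrow> 'a"
  assumes kmodule: "kmodule (A n)"
    and b_linear: "b n \<in> linear_maps (A n) (A (n - 1))"
    and b'_linear: "b' n \<in> linear_maps (A n) (A (n - 1))"
    and T_linear: "T n \<in> linear_maps (A n) (A n)"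
    and N_linear: "N n \<in> linear_maps (A n) (A n)"
    and s_linear: "s n \<in> linear_maps (A n) (A (n + 1))"
    and b_b: "x \<in> carrier (A n) \<Longrightarrow> b (n - 1) (b n x) = \<zero>\<^bsub>A (n - 2)\<^esub>"
    and b'_b': "x \<in> carrier (A n) \<Longrightarrow> b' (n - 1) (b' n x) = \<zero>\<^bsub>A (n - 2)\<^esub>"
    and b_T: "x \<in> carrier (A n) \<Longrightarrow> b n (T n x) = T (n - 1) (b' n x)"
    and b'_N: "x \<in> carrier (A n) \<Longrightarrow> b' n (N n x) = N (n - 1) (b n x)"
    and T_N: "x \<in> carrier (A n) \<Longrightarrow> T n (N n x) = \<zero>\<^bsub>A n\<^esub>"
    and N_T: "x \<in> carrier (A n) \<Longrightarrow> N n (T n x) = \<zero>\<^bsub>A n\<^esub>"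
    and homotopy: "x \<in> carrier (A n) \<Longrightarrow> b' (n + 1) (s n x) \<oplus>\<^bsub>A n\<^esub> s (n - 1) (b' n x) = x"
begin

lemma closed:
  assumes "x \<in> carrier (A n)"
  shows "m = n - 1 \<Longrightarrow> b n x \<in> carrier (A m)" "m = n - 1 \<Longrightarrow> b' n x \<in> carrier (A m)"
    "T n x \<in> carrier (A n)" "N n x \<in> carrier (A n)" "m = n + 1 \<Longrightarrow> s n x \<in> carrier (A m)"
  using assms linear_maps_closed[OF b_linear] linear_maps_closed[OF b'_linear]
    linear_maps_closed[OF T_linear] linear_maps_closed[OF N_linear] linear_maps_closed[OF s_linear]
  by blast+

lemmas map_add =
  linear_maps_add[OF b_linear] linear_maps_add[OF b'_linear] linear_maps_add[OF T_linear]
  linear_maps_add[OF N_linear] linear_maps_add[OF s_linear]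

lemmas map_smult =
  linear_maps_smult[OF b_linear] linear_maps_smult[OF b'_linear] linear_maps_smult[OF T_linear]
  linear_maps_smult[OF N_linear] linear_maps_smult[OF s_linear]

lemmas map_zero =
  linear_maps_zero[OF b_linear kmodule kmodule] linear_maps_zero[OF b'_linear kmodule kmodule]
  linear_maps_zero[OF T_linear kmodule kmodule] linear_maps_zero[OF N_linear kmodule kmodule]
  linear_maps_zero[OF s_linear kmodule kmodule]

lemmas map_minus =
  linear_maps_minus[OF b_linear kmodule kmodule] linear_maps_minus[OF b'_linear kmodule kmodule]
  linear_maps_minus[OF T_linear kmodule kmodule] linear_maps_minus[OF N_linear kmodule kmodule]
  linear_maps_minus[OF s_linear kmodule kmodule]

definition total :: "int \<Rightarrow> ('k, nat \<Rightarrow> 'a) module" where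
  "total n =
     \<lparr>carrier = {f. \<forall>p. f p \<in> carrier (A (n - int p))}, mult = undefined, one = undefined,
      zero = (\<lambda>p. \<zero>\<^bsub>A (n - int p)\<^esub>),
      add = (\<lambda>f g p. f p \<oplus>\<^bsub>A (n - int p)\<^esub> g p),
      smult = (\<lambda>c f p. c \<odot>\<^bsub>A (n - int p)\<^esub> f p)\<rparr>"

definition total_d :: "int \<Rightarrow> (nat \<Rightarrow> 'a) \<Rightarrow> nat \<Rightarrow> 'a" where
  "total_d n f p =
     (if even p
      then b (n - int p) (f p) \<oplus>\<^bsub>A (n - int p - 1)\<^esub> T (n - int p - 1) (f (p + 1))
      else (\<ominus>\<^bsub>A (n - int p - 1)\<^esub> b' (n - int p) (f p))
        \<oplus>\<^bsub>A (n - int p - 1)\<^esub> N (n - int p - 1) (f (p + 1)))"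

lemma total_simps:
  "f \<in> carrier (total n) \<longleftrightarrow> (\<forall>p. f p \<in> carrier (A (n - int p)))"
  "\<zero>\<^bsub>total n\<^esub> = (\<lambda>p. \<zero>\<^bsub>A (n - int p)\<^esub>)"
  "f \<oplus>\<^bsub>total n\<^esub> g = (\<lambda>p. f p \<oplus>\<^bsub>A (n - int p)\<^esub> g p)"
  "c \<odot>\<^bsub>total n\<^esub> f = (\<lambda>p. c \<odot>\<^bsub>A (n - int p)\<^esub> f p)"
  by (simp_all add: total_def)

lemma kmodule_total: "kmodule (total n)"
proof -
  have km: "kmodule (A m)" for m by (rule kmodule)
  have ag: "abelian_group (A m)" for m using km by (simp add: kmodule_def)
  have "abelian_group (total n)"
  proof (rule abelian_groupI; (simp only: total_simps)?)
    fix f assume f: "\<forall>p. f p \<in> carrier (A (n - int p))"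
    show "\<exists>y\<in>carrier (total n). (\<lambda>p. y p \<oplus>\<^bsub>A (n - int p)\<^esub> f p) = (\<lambda>p. \<zero>\<^bsub>A (n - int p)\<^esub>)"
      by (rule bexI[of _ "\<lambda>p. \<ominus>\<^bsub>A (n - int p)\<^esub> f p"])
        (use f in \<open>simp_all add: total_simps abelian_group.l_neg[OF ag] abelian_group.a_inv_closed[OF ag]\<close>)
  qed (simp_all add: abelian_monoid.a_closed[OF abelian_group.axioms(1)[OF ag]]
      abelian_monoid.zero_closed[OF abelian_group.axioms(1)[OF ag]]
      abelian_monoid.a_assoc[OF abelian_group.axioms(1)[OF ag]]
      abelian_monoid.a_comm[OF abelian_group.axioms(1)[OF ag]]
      abelian_monoid.a_lcomm[OF abelian_group.axioms(1)[OF ag]]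
      abelian_monoid.l_zero[OF abelian_group.axioms(1)[OF ag]]
      abelian_monoid.r_zero[OF abelian_group.axioms(1)[OF ag]])
  then interpret abelian_group "total n" .
  show ?thesis
    by unfold_locales
      (simp_all add: total_simps kmodule.smult_closed[OF km] kmodule.smult_r_distr[OF km]
        kmodule.smult_l_distr[OF km] kmodule.smult_assoc[OF km] kmodule.smult_one[OF km])
qed

text \<open>An element of the total complex in degree \<open>n\<close> consists of its components in the columns \<open>0\<close>
  and \<open>1\<close> and, by periodicity, of an element in degree \<open>n - 2\<close>.\<close>

definition push :: "'a \<Rightarrow> 'a \<Rightarrow> (nat \<Rightarrow> 'a) \<Rightarrow> nat \<Rightarrow> 'a" where
  "push x y w = case_nat x (case_nat y w)"

lemma push_simps [simp]:
  "push x y w 0 = x" "push x y w (Suc 0) = y" "push x y w (Suc (Suc p)) = w p"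
  by (simp_all add: push_def)

lemma push_collapse: "push (f 0) (f 1) (\<lambda>p. f (p + 2)) = f"
  by (rule ext) (auto simp: push_def split: nat.split)

lemma push_cases:
  assumes "f \<in> carrier (total n)"
  obtains x y w where "f = push x y w" "x \<in> carrier (A n)" "y \<in> carrier (A (n - 1))"
    "w \<in> carrier (total (n - 2))"
proof
  show "f = push (f 0) (f 1) (\<lambda>p. f (p + 2))"
    by (rule push_collapse[symmetric])
  have c: "f p \<in> carrier (A (n - int p))" for p
    using assms by (simp add: total_simps)
  show "f 0 \<in> carrier (A n)" "f 1 \<in> carrier (A (n - 1))"
    using c[of 0] c[of 1] by simp_all
  show "(\<lambda>p. f (p + 2)) \<in> carrier (total (n - 2))"
    using c[of "_ + 2"] by (simp add: total_simps algebra_simps)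
qed

lemma all_push: "(\<forall>p. P p) \<longleftrightarrow> P 0 \<and> P (Suc 0) \<and> (\<forall>p. P (Suc (Suc p)))"
  by (metis not0_implies_Suc)

lemma shift_index: "n - int (Suc (Suc p)) = n - 2 - int p"
  by simp

lemma push_carrier [simp]:
  "push x y w \<in> carrier (total n) \<longleftrightarrow>
    x \<in> carrier (A n) \<and> y \<in> carrier (A (n - 1)) \<and> w \<in> carrier (total (n - 2))"
  unfolding total_simps by (subst all_push) (simp del: of_nat_Suc add: shift_index, simp)

lemma push_eq_iff [simp]: "push x y w = push x' y' w' \<longleftrightarrow> x = x' \<and> y = y' \<and> w = w'"
  unfolding fun_eq_iff by (subst all_push) simp

lemma push_add:
  "push x y w \<oplus>\<^bsub>total n\<^esub> push x' y' w' =
    push (x \<oplus>\<^bsub>A n\<^esub> x') (y \<oplus>\<^bsub>A (n - 1)\<^esub> y') (w \<oplus>\<^bsub>total (n - 2)\<^esub> w')"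
  unfolding fun_eq_iff by (subst all_push) (simp del: of_nat_Suc add: total_simps shift_index, simp)

lemma push_zero: "\<zero>\<^bsub>total n\<^esub> = push \<zero>\<^bsub>A n\<^esub> \<zero>\<^bsub>A (n - 1)\<^esub> \<zero>\<^bsub>total (n - 2)\<^esub>"
  unfolding fun_eq_iff by (subst all_push) (simp del: of_nat_Suc add: total_simps shift_index, simp)

lemma push_smult:
  "c \<odot>\<^bsub>total n\<^esub> push x y w = push (c \<odot>\<^bsub>A n\<^esub> x) (c \<odot>\<^bsub>A (n - 1)\<^esub> y) (c \<odot>\<^bsub>total (n - 2)\<^esub> w)"
  unfolding fun_eq_iff by (subst all_push) (simp del: of_nat_Suc add: total_simps shift_index, simp)

lemma total_d_push:
  "total_d n (push x y w) =
    push (b n x \<oplus>\<^bsub>A (n - 1)\<^esub> T (n - 1) y)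
      ((\<ominus>\<^bsub>A (n - 2)\<^esub> b' (n - 1) y) \<oplus>\<^bsub>A (n - 2)\<^esub> N (n - 2) (w 0)) (total_d (n - 2) w)"
  unfolding fun_eq_iff
  by (subst all_push) (simp del: of_nat_Suc add: total_d_def shift_index, simp)

lemma head_closed: "w \<in> carrier (total n) \<Longrightarrow> w 0 \<in> carrier (A n)"
  using total_simps(1)[of w n] by (metis diff_zero of_nat_0)

lemma head_simps: "\<zero>\<^bsub>total n\<^esub> 0 = \<zero>\<^bsub>A n\<^esub>" "(f \<oplus>\<^bsub>total n\<^esub> g) 0 = f 0 \<oplus>\<^bsub>A n\<^esub> g 0"
  "(c \<odot>\<^bsub>total n\<^esub> f) 0 = c \<odot>\<^bsub>A n\<^esub> f 0"
  by (simp_all add: total_simps)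

lemma even_row:
  assumes "x \<in> carrier (A m)" "y \<in> carrier (A (m - 1))" "z \<in> carrier (A (m - 2))"
  shows "b (m - 1) (b m x \<oplus>\<^bsub>A (m - 1)\<^esub> T (m - 1) y) \<oplus>\<^bsub>A (m - 2)\<^esub>
      T (m - 2) ((\<ominus>\<^bsub>A (m - 2)\<^esub> b' (m - 1) y) \<oplus>\<^bsub>A (m - 2)\<^esub> N (m - 2) z) = \<zero>\<^bsub>A (m - 2)\<^esub>"
proof -
  interpret A: kmodule "A (m - 2)" by (rule kmodule)
  have [simp]: "b (m - 1) (T (m - 1) y) = T (m - 2) (b' (m - 1) y)"
    using b_T[OF assms(2)] by simp
  have [simp]: "b (m - 1) (b m x \<oplus>\<^bsub>A (m - 1)\<^esub> T (m - 1) y) =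
      b (m - 1) (b m x) \<oplus>\<^bsub>A (m - 2)\<^esub> b (m - 1) (T (m - 1) y)"
    using map_add(1)[of "b m x" "m - 1" "T (m - 1) y"] assms by (simp add: closed)
  show ?thesis
    using assms by (simp add: closed b_b T_N map_add(3) map_minus(3) A.r_neg)
qed

lemma odd_row:
  assumes "x \<in> carrier (A m)" "y \<in> carrier (A (m - 1))" "z \<in> carrier (A (m - 2))"
  shows "(\<ominus>\<^bsub>A (m - 2)\<^esub> b' (m - 1) ((\<ominus>\<^bsub>A (m - 1)\<^esub> b' m x) \<oplus>\<^bsub>A (m - 1)\<^esub> N (m - 1) y)) \<oplus>\<^bsub>A (m - 2)\<^esub>
      N (m - 2) (b (m - 1) y \<oplus>\<^bsub>A (m - 2)\<^esub> T (m - 2) z) = \<zero>\<^bsub>A (m - 2)\<^esub>"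
proof -
  interpret A: kmodule "A (m - 2)" by (rule kmodule)
  interpret A1: kmodule "A (m - 1)" by (rule kmodule)
  have [simp]: "b' (m - 1) (N (m - 1) y) = N (m - 2) (b (m - 1) y)"
    using b'_N[OF assms(2)] by simp
  have [simp]: "b' (m - 1) ((\<ominus>\<^bsub>A (m - 1)\<^esub> b' m x) \<oplus>\<^bsub>A (m - 1)\<^esub> N (m - 1) y) =
      (\<ominus>\<^bsub>A (m - 2)\<^esub> b' (m - 1) (b' m x)) \<oplus>\<^bsub>A (m - 2)\<^esub> b' (m - 1) (N (m - 1) y)"
    using map_add(2)[of "\<ominus>\<^bsub>A (m - 1)\<^esub> b' m x" "m - 1" "N (m - 1) y"]
      map_minus(2)[of "b' m x" "m - 1"] assms by (simp add: closed)
  show ?thesis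
    using assms by (simp add: closed b'_b' N_T map_add(4) A.l_neg)
qed

lemma total_complex: "chain_complex total total_d"
proof (rule chain_complex.intro)
  show "kmodule (total n)" for n by (rule kmodule_total)
next
  fix n
  show "total_d n \<in> linear_maps (total n) (total (n - 1))"
  proof (rule linear_mapsI)
    fix f assume f: "f \<in> carrier (total n)"
    have c: "f p \<in> carrier (A (n - int p))" "f (p + 1) \<in> carrier (A (n - int p - 1))" for p
      using f[unfolded total_simps, rule_format, of p] f[unfolded total_simps, rule_format, of "p + 1"]
      by (simp_all add: algebra_simps)
    show "total_d n f \<in> carrier (total (n - 1))"
      unfolding total_simps
    proof
      fix p
      interpret A: kmodule "A (n - int p - 1)" by (rule kmodule)
      have "total_d n f p \<in> carrier (A (n - int p - 1))"
        using c[of p] by (simp add: total_d_def closed)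
      then show "total_d n f p \<in> carrier (A (n - 1 - int p))"
        by (simp add: algebra_simps)
    qed
    fix k
    show "total_d n (k \<odot>\<^bsub>total n\<^esub> f) = k \<odot>\<^bsub>total (n - 1)\<^esub> total_d n f"
    proof
      fix p
      interpret A: kmodule "A (n - int p - 1)" by (rule kmodule)
      have i: "n - 1 - int p = n - int p - 1" "n - int (p + 1) = n - int p - 1" by simp_all
      show "total_d n (k \<odot>\<^bsub>total n\<^esub> f) p = (k \<odot>\<^bsub>total (n - 1)\<^esub> total_d n f) p"
        unfolding total_d_def total_simps i
        using c[of p] by (simp add: closed map_smult A.smult_r_distr A.smult_minus)
    qed
    fix g assume g: "g \<in> carrier (total n)"
    have d: "g p \<in> carrier (A (n - int p))" "g (p + 1) \<in> carrier (A (n - int p - 1))" for p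
      using g[unfolded total_simps, rule_format, of p] g[unfolded total_simps, rule_format, of "p + 1"]
      by (simp_all add: algebra_simps)
    show "total_d n (f \<oplus>\<^bsub>total n\<^esub> g) = total_d n f \<oplus>\<^bsub>total (n - 1)\<^esub> total_d n g"
    proof
      fix p
      interpret A: kmodule "A (n - int p - 1)" by (rule kmodule)
      have i: "n - 1 - int p = n - int p - 1" "n - int (p + 1) = n - int p - 1" by simp_all
      show "total_d n (f \<oplus>\<^bsub>total n\<^esub> g) p = (total_d n f \<oplus>\<^bsub>total (n - 1)\<^esub> total_d n g) p"
        unfolding total_d_def total_simps i
        using c[of p] d[of p] by (simp add: closed map_add A.minus_add A.a_ac)
    qed
  qed
next
  fix n f assume f: "f \<in> carrier (total n)"
  show "total_d (n - 1) (total_d n f) = \<zero>\<^bsub>total (n - 2)\<^esub>"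
  proof
    fix p
    define m where "m = n - int p"
    have i: "n - int p = m" "n - 1 - int p = m - 1" "n - 2 - int p = m - 2" "m - 1 - 1 = m - 2"
      "n - int (p + 1) = m - 1" "n - 1 - int (p + 1) = m - 2" "n - int (p + 1 + 1) = m - 2"
      by (simp_all add: m_def)
    have c: "f p \<in> carrier (A m)" "f (p + 1) \<in> carrier (A (m - 1))" "f (p + 1 + 1) \<in> carrier (A (m - 2))"
      using f[unfolded total_simps, rule_format, of p] f[unfolded total_simps, rule_format, of "p + 1"]
        f[unfolded total_simps, rule_format, of "p + 1 + 1"] by (simp_all only: i)
    show "total_d (n - 1) (total_d n f) p = \<zero>\<^bsub>total (n - 2)\<^esub> p"
      using even_row[OF c] odd_row[OF c]
      by (cases "even p") (simp_all only: total_d_def total_simps i even_plus_one_iff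
          not_True_eq_False not_False_eq_True if_True if_False)
  qed
qed

lemma column_complex: "chain_complex A b"
  by (rule chain_complex.intro[where D = A and \<delta> = b, OF kmodule b_linear b_b])

lemma total_cycleD:
  assumes "push x y w \<in> cycles total total_d n"
  shows "x \<in> carrier (A n)" "y \<in> carrier (A (n - 1))"
    "w \<in> cycles total total_d (n - 2)"
    "T (n - 1) y = \<ominus>\<^bsub>A (n - 1)\<^esub> b n x" "N (n - 2) (w 0) = b' (n - 1) y"
proof -
  interpret A1: kmodule "A (n - 1)" by (rule kmodule)
  interpret A2: kmodule "A (n - 2)" by (rule kmodule)
  have c: "x \<in> carrier (A n)" "y \<in> carrier (A (n - 1))" "w \<in> carrier (total (n - 2))"
    using assms by (simp_all add: cycles_iff)
  then show "x \<in> carrier (A n)" "y \<in> carrier (A (n - 1))" by blast+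
  have eq: "b n x \<oplus>\<^bsub>A (n - 1)\<^esub> T (n - 1) y = \<zero>\<^bsub>A (n - 1)\<^esub>"
    "(\<ominus>\<^bsub>A (n - 2)\<^esub> b' (n - 1) y) \<oplus>\<^bsub>A (n - 2)\<^esub> N (n - 2) (w 0) = \<zero>\<^bsub>A (n - 2)\<^esub>"
    "total_d (n - 2) w = \<zero>\<^bsub>total (n - 3)\<^esub>"
    using assms push_zero[of "n - 1"] by (simp_all add: cycles_iff total_d_push)
  show "w \<in> cycles total total_d (n - 2)"
    using c eq by (simp add: cycles_iff)
  show "T (n - 1) y = \<ominus>\<^bsub>A (n - 1)\<^esub> b n x"
    using eq(1) c by (metis A1.a_comm A1.minus_equality A1.a_inv_closed closed(1,3))
  show "N (n - 2) (w 0) = b' (n - 1) y"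
  proof -
    have N: "N (n - 2) (w 0) \<in> carrier (A (n - 2))"
      using head_closed[OF c(3)] by (rule closed)
    have b': "b' (n - 1) y \<in> carrier (A (n - 2))"
      using c(2) by (rule closed) simp
    have "\<ominus>\<^bsub>A (n - 2)\<^esub> N (n - 2) (w 0) = \<ominus>\<^bsub>A (n - 2)\<^esub> b' (n - 1) y"
      using A2.minus_equality[OF eq(2) N] b' by simp
    then have "\<ominus>\<^bsub>A (n - 2)\<^esub> (\<ominus>\<^bsub>A (n - 2)\<^esub> N (n - 2) (w 0)) =
        \<ominus>\<^bsub>A (n - 2)\<^esub> (\<ominus>\<^bsub>A (n - 2)\<^esub> b' (n - 1) y)"
      by (rule arg_cong)
    then show ?thesis
      by (simp only: A2.minus_minus N b')
  qed
qed

lemma total_cycleI: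
  assumes "x \<in> carrier (A n)" "y \<in> carrier (A (n - 1))" "w \<in> cycles total total_d (n - 2)"
    "T (n - 1) y = \<ominus>\<^bsub>A (n - 1)\<^esub> b n x" "N (n - 2) (w 0) = b' (n - 1) y"
  shows "push x y w \<in> cycles total total_d n"
proof -
  interpret A1: kmodule "A (n - 1)" by (rule kmodule)
  interpret A2: kmodule "A (n - 2)" by (rule kmodule)
  show ?thesis
    using assms push_zero[of "n - 1"] by (simp add: cycles_iff total_d_push closed A1.r_neg A2.l_neg)
qed

text \<open>Since \<open>T b' = b T\<close>, applying \<open>T\<close> to the contraction \<open>y = b' s y + s b' y\<close> shows that \<open>T y\<close>
  and \<open>T s b' y\<close> differ by a boundary for \<open>b\<close>. Every passage from column \<open>1\<close> to column \<open>0\<close>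
  below is an instance of this.\<close>

lemma T_homotopy:
  assumes "y \<in> carrier (A m)"
  shows "T m y = T m (s (m - 1) (b' m y)) \<oplus>\<^bsub>A m\<^esub> b (m + 1) (T (m + 1) (s m y))"
proof -
  interpret A: kmodule "A m" by (rule kmodule)
  have "T m y = T m (b' (m + 1) (s m y) \<oplus>\<^bsub>A m\<^esub> s (m - 1) (b' m y))"
    using homotopy[OF assms] by simp
  also have "\<dots> = T m (b' (m + 1) (s m y)) \<oplus>\<^bsub>A m\<^esub> T m (s (m - 1) (b' m y))"
    using assms by (simp add: map_add closed)
  also have "T m (b' (m + 1) (s m y)) = b (m + 1) (T (m + 1) (s m y))"
    using b_T[of "s m y" "m + 1"] assms by (simp add: closed)
  finally show ?thesis
    using assms by (simp add: A.a_comm closed)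
qed

lemma contract_cycle:
  assumes "y \<in> carrier (A m)" "b' m y = \<zero>\<^bsub>A (m - 1)\<^esub>"
  shows "b' (m + 1) (s m y) = y"
proof -
  interpret A: kmodule "A m" by (rule kmodule)
  show ?thesis
    using homotopy[OF assms(1)] assms map_zero(5)[of "m - 1"] by (simp add: closed)
qed

text \<open>The first component of a cycle satisfies \<open>b z\<^sub>0 = - T z\<^sub>1\<close>, hence \<open>b' N z\<^sub>0 = N b z\<^sub>0 = - N T z\<^sub>1 = 0\<close>.\<close>

lemma norm_of_cycle:
  assumes "z \<in> cycles total total_d n"
  shows "b' n (N n (z 0)) = \<zero>\<^bsub>A (n - 1)\<^esub>"
proof -
  interpret A: kmodule "A (n - 1)" by (rule kmodule)
  have "z \<in> carrier (total n)" using assms by (simp add: cycles_iff)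
  then obtain x y w where z: "z = push x y w" "x \<in> carrier (A n)" "y \<in> carrier (A (n - 1))"
    by (rule push_cases)
  have "b n x = \<ominus>\<^bsub>A (n - 1)\<^esub> T (n - 1) y"
    using total_cycleD(4)[of x y w n] assms z by (simp add: closed)
  then show ?thesis
    using z by (simp add: b'_N map_minus closed N_T)
qed

definition incl :: "int \<Rightarrow> 'a \<Rightarrow> nat \<Rightarrow> 'a" where
  "incl n x = push x \<zero>\<^bsub>A (n - 1)\<^esub> \<zero>\<^bsub>total (n - 2)\<^esub>"

definition shift :: "(nat \<Rightarrow> 'a) \<Rightarrow> nat \<Rightarrow> 'a" where
  "shift f = (\<lambda>p. f (p + 2))"

text \<open>The connecting map of the extension of complexes given by \<open>incl\<close> and \<open>shift\<close>, followed by the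
  identification of the homology of the first two columns with that of the first: the lift
  \<open>push 0 0 z\<close> of a cycle has differential \<open>push 0 (N z\<^sub>0) 0\<close>, and adding the differential of
  \<open>push 0 (s N z\<^sub>0) 0\<close> moves it to column \<open>0\<close>.\<close>

definition connes_B :: "int \<Rightarrow> (nat \<Rightarrow> 'a) \<Rightarrow> 'a" where
  "connes_B n z = T (n - 1) (s (n - 2) (N (n - 2) (z 0)))"

lemma shift_push [simp]: "shift (push x y w) = w"
  by (simp add: shift_def push_def)

lemma zero_cycle: "\<zero>\<^bsub>total n\<^esub> \<in> cycles total total_d n"
  using chain_complex.zero_boundaries[OF total_complex] chain_complex.boundaries_cycles[OF total_complex]
  by blast

lemma incl_linear: "incl n \<in> linear_maps (A n) (total n)"
proof -
  interpret A1: kmodule "A (n - 1)" by (rule kmodule)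
  interpret X: kmodule "total (n - 2)" by (rule kmodule_total)
  show ?thesis
    by (rule linear_mapsI) (simp_all add: incl_def push_add push_smult)
qed

lemma incl_cycle: "x \<in> cycles A b n \<Longrightarrow> incl n x \<in> cycles total total_d n"
proof -
  assume x: "x \<in> cycles A b n"
  interpret A1: kmodule "A (n - 1)" by (rule kmodule)
  show ?thesis
    unfolding incl_def using x zero_cycle map_zero(2)[of "n - 1"]
    by (intro total_cycleI) (simp_all add: cycles_iff map_zero head_simps)
qed

lemma incl_diff: "x \<in> carrier (A n) \<Longrightarrow> total_d n (incl n x) = incl (n - 1) (b n x)"
proof -
  assume x: "x \<in> carrier (A n)"
  interpret A1: kmodule "A (n - 1)" by (rule kmodule)
  interpret A2: kmodule "A (n - 2)" by (rule kmodule)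
  show ?thesis
    using x map_zero(2)[of "n - 1"] chain_complex.diff_zero[OF total_complex, of "n - 2"]
    by (simp add: incl_def total_d_push map_zero head_simps closed)
qed

lemma shift_linear: "shift \<in> linear_maps (total n) (total (n - 2))"
proof (rule linear_mapsI)
  fix f c assume "f \<in> carrier (total n)"
  then obtain x y w where f: "f = push x y w" "w \<in> carrier (total (n - 2))"
    by (rule push_cases)
  then show "shift f \<in> carrier (total (n - 2))"
    "shift (c \<odot>\<^bsub>total n\<^esub> f) = c \<odot>\<^bsub>total (n - 2)\<^esub> shift f"
    by (simp_all add: push_smult)
  fix g assume "g \<in> carrier (total n)"
  then obtain x' y' w' where "g = push x' y' w'"
    by (rule push_cases)
  with f show "shift (f \<oplus>\<^bsub>total n\<^esub> g) = shift f \<oplus>\<^bsub>total (n - 2)\<^esub> shift g"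
    by (simp add: push_add)
qed

lemma shift_cycle: "f \<in> cycles total total_d n \<Longrightarrow> shift f \<in> cycles total total_d (n - 2)"
proof -
  assume f: "f \<in> cycles total total_d n"
  then have "f \<in> carrier (total n)" by (simp add: cycles_iff)
  then obtain x y w where "f = push x y w" by (rule push_cases)
  with f show ?thesis using total_cycleD(3) by simp
qed

lemma bex_total:
  "(\<exists>f\<in>carrier (total n). P f) \<longleftrightarrow>
    (\<exists>x\<in>carrier (A n). \<exists>y\<in>carrier (A (n - 1)). \<exists>w\<in>carrier (total (n - 2)). P (push x y w))"
proof
  assume "\<exists>f\<in>carrier (total n). P f"
  then obtain f where f: "f \<in> carrier (total n)" "P f" by blast
  from f(1) obtain x y w where "f = push x y w" "x \<in> carrier (A n)" "y \<in> carrier (A (n - 1))"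
    "w \<in> carrier (total (n - 2))" by (rule push_cases)
  with f(2) show "\<exists>x\<in>carrier (A n). \<exists>y\<in>carrier (A (n - 1)). \<exists>w\<in>carrier (total (n - 2)). P (push x y w)"
    by blast
qed (use push_carrier in blast)

lemma boundaries_total:
  "f \<in> boundaries total total_d n \<longleftrightarrow> (\<exists>x\<in>carrier (A (n + 1)). \<exists>y\<in>carrier (A n).
    \<exists>w\<in>carrier (total (n - 1)). f = push (b (n + 1) x \<oplus>\<^bsub>A n\<^esub> T n y)
      ((\<ominus>\<^bsub>A (n - 1)\<^esub> b' n y) \<oplus>\<^bsub>A (n - 1)\<^esub> N (n - 1) (w 0)) (total_d (n - 1) w))"
proof -
  have "f \<in> boundaries total total_d n \<longleftrightarrow> (\<exists>v\<in>carrier (total (n + 1)). f = total_d (n + 1) v)"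
    by (auto simp: boundaries_def)
  then show ?thesis
    using bex_total[of "n + 1" "\<lambda>v. f = total_d (n + 1) v"] by (simp add: total_d_push)
qed

lemma shift_boundary:
  assumes "f \<in> boundaries total total_d n"
  shows "shift f \<in> boundaries total total_d (n - 2)"
proof -
  obtain w where "w \<in> carrier (total (n - 1))" "shift f = total_d (n - 1) w"
    using assms unfolding boundaries_total by auto
  then show ?thesis
    by (simp add: boundaries_def)
qed

lemma connes_B_linear: "connes_B n \<in> linear_maps (total (n - 2)) (A (n - 1))"
proof (rule linear_mapsI)
  fix z assume z: "z \<in> carrier (total (n - 2))"
  note zc = head_closed[OF z]
  then have sN: "s (n - 2) (N (n - 2) (z 0)) \<in> carrier (A (n - 1))"
    by (simp add: closed)
  then show "connes_B n z \<in> carrier (A (n - 1))"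
    by (simp add: connes_B_def closed)
  show "connes_B n (c \<odot>\<^bsub>total (n - 2)\<^esub> z) = c \<odot>\<^bsub>A (n - 1)\<^esub> connes_B n z" for c
    using zc sN map_smult(5)[of "N (n - 2) (z 0)" "n - 2" c]
    by (simp add: connes_B_def head_simps map_smult closed)
  fix y assume y: "y \<in> carrier (total (n - 2))"
  note yc = head_closed[OF y]
  then have sN': "s (n - 2) (N (n - 2) (y 0)) \<in> carrier (A (n - 1))"
    by (simp add: closed)
  show "connes_B n (z \<oplus>\<^bsub>total (n - 2)\<^esub> y) = connes_B n z \<oplus>\<^bsub>A (n - 1)\<^esub> connes_B n y"
    using zc sN yc sN' map_add(5)[of "N (n - 2) (z 0)" "n - 2" "N (n - 2) (y 0)"]
    by (simp add: connes_B_def head_simps map_add closed)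
qed

lemma connes_B_cycle:
  assumes "z \<in> cycles total total_d (n - 2)"
  shows "connes_B n z \<in> cycles A b (n - 1)"
proof -
  interpret A2: kmodule "A (n - 2)" by (rule kmodule)
  have zc: "z 0 \<in> carrier (A (n - 2))"
    using assms by (simp add: cycles_iff head_closed)
  have sN: "s (n - 2) (N (n - 2) (z 0)) \<in> carrier (A (n - 1))"
    using zc by (simp add: closed)
  have "b (n - 1) (connes_B n z) = T (n - 2) (b' (n - 1) (s (n - 2) (N (n - 2) (z 0))))"
    using b_T[OF sN] by (simp add: connes_B_def)
  also have "\<dots> = T (n - 2) (N (n - 2) (z 0))"
    using contract_cycle[of "N (n - 2) (z 0)" "n - 2"] norm_of_cycle[OF assms] zc by (simp add: closed)
  also have "\<dots> = \<zero>\<^bsub>A (n - 2)\<^esub>"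
    using zc by (rule T_N)
  finally show ?thesis
    using sN by (simp add: cycles_iff closed connes_B_def)
qed

lemma connes_B_boundary:
  assumes "z \<in> boundaries total total_d (n - 2)"
  shows "connes_B n z \<in> boundaries A b (n - 1)"
proof -
  interpret A1: kmodule "A (n - 1)" by (rule kmodule)
  interpret A0: kmodule "A n" by (rule kmodule)
  interpret A2: kmodule "A (n - 2)" by (rule kmodule)
  obtain x y w where x: "x \<in> carrier (A (n - 1))" and y: "y \<in> carrier (A (n - 2))"
    and z: "z 0 = b (n - 1) x \<oplus>\<^bsub>A (n - 2)\<^esub> T (n - 2) y"
    using assms unfolding boundaries_total by auto
  have "N (n - 2) (z 0) = b' (n - 1) (N (n - 1) x)"
    using x y b'_N[OF x] by (simp add: z map_add closed N_T)
  then have "connes_B n z = T (n - 1) (s (n - 2) (b' (n - 1) (N (n - 1) x)))"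
    by (simp add: connes_B_def)
  moreover have "T (n - 1) (s (n - 2) (b' (n - 1) (N (n - 1) x))) \<oplus>\<^bsub>A (n - 1)\<^esub>
      b n (T n (s (n - 1) (N (n - 1) x))) = \<zero>\<^bsub>A (n - 1)\<^esub>"
    using T_homotopy[of "N (n - 1) x" "n - 1"] x by (simp add: closed T_N)
  ultimately have "connes_B n z = \<ominus>\<^bsub>A (n - 1)\<^esub> b n (T n (s (n - 1) (N (n - 1) x)))"
    using x by (simp add: A1.minus_equality[symmetric] closed)
  also have "\<dots> = b n (\<ominus>\<^bsub>A n\<^esub> T n (s (n - 1) (N (n - 1) x)))"
    using x by (simp add: map_minus closed)
  finally show ?thesis
    using x by (auto simp: boundaries_def closed)
qed

text \<open>The three maps are induced by the inclusion of column \<open>0\<close>, by the shift of the bicomplex by two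
  columns, and by \<open>T s N\<close>. Exactness comes down to removing components in column \<open>1\<close> by
  differentials, which the contraction \<open>s\<close> makes possible.\<close>

theorem connes_exact_sequence:
  "\<exists>I P B. \<forall>n.
    I n \<in> linear_maps (int_homology A b n) (int_homology total total_d n) \<and>
    P n \<in> linear_maps (int_homology total total_d n) (int_homology total total_d (n - 2)) \<and>
    B n \<in> linear_maps (int_homology total total_d (n - 2)) (int_homology A b (n - 1)) \<and>
    exact_at (int_homology A b n) (I n) (int_homology total total_d n) (P n)
      (int_homology total total_d (n - 2)) \<and>
    exact_at (int_homology total total_d n) (P n) (int_homology total total_d (n - 2)) (B n)
      (int_homology A b (n - 1)) \<and>
    exact_at (int_homology total total_d (n - 2)) (B n) (int_homology A b (n - 1)) (I (n - 1))
      (int_homology total total_d (n - 1))"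
proof -
  let ?H = "int_homology A b" and ?X = "int_homology total total_d"
  let ?h = "homology_class A b" and ?x = "homology_class total total_d"
  interpret C: chain_complex A b by (rule column_complex)
  interpret X: chain_complex total total_d by (rule total_complex)
  have incl_bnd: "incl n x \<in> boundaries total total_d n" if x: "x \<in> boundaries A b n" for n x
  proof -
    obtain y where y: "y \<in> carrier (A (n + 1))" "x = b (n + 1) y"
      using x by (auto simp: boundaries_def)
    then have "incl n x = total_d (n + 1) (incl (n + 1) y)"
      using incl_diff[OF y(1)] by simp
    then show ?thesis
      using linear_maps_closed[OF incl_linear y(1)] by (simp add: boundaries_def)
  qed
  have "\<exists>F. F \<in> linear_maps (?H n) (?X n) \<and> (\<forall>z\<in>cycles A b n. F (?h n z) = ?x n (incl n z))" for n
    by (rule homology_map[OF column_complex total_complex incl_cycle incl_bnd incl_linear]) auto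
  then obtain I where I: "I n \<in> linear_maps (?H n) (?X n)"
    "\<And>z. z \<in> cycles A b n \<Longrightarrow> I n (?h n z) = ?x n (incl n z)" for n
    by metis
  have "\<exists>F. F \<in> linear_maps (?X n) (?X (n - 2)) \<and>
    (\<forall>z\<in>cycles total total_d n. F (?x n z) = ?x (n - 2) (shift z))" for n
    by (rule homology_map[OF total_complex total_complex shift_cycle shift_boundary shift_linear]) auto
  then obtain P where P: "P n \<in> linear_maps (?X n) (?X (n - 2))"
    "\<And>z. z \<in> cycles total total_d n \<Longrightarrow> P n (?x n z) = ?x (n - 2) (shift z)" for n
    by metis
  have "\<exists>F. F \<in> linear_maps (?X (n - 2)) (?H (n - 1)) \<and>
    (\<forall>z\<in>cycles total total_d (n - 2). F (?x (n - 2) z) = ?h (n - 1) (connes_B n z))" for n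
    by (rule homology_map[OF total_complex column_complex connes_B_cycle connes_B_boundary connes_B_linear])
      auto
  then obtain B where B: "B n \<in> linear_maps (?X (n - 2)) (?H (n - 1))"
    "\<And>z. z \<in> cycles total total_d (n - 2) \<Longrightarrow> B n (?x (n - 2) z) = ?h (n - 1) (connes_B n z)" for n
    by metis
  have exact1: "exact_at (?H n) (I n) (?X n) (P n) (?X (n - 2))" for n
  proof (rule exact_at_homology[where f = "incl n" and g = shift,
        OF column_complex total_complex total_complex incl_cycle shift_cycle I(2) P(2)];
      assumption?)
    fix x assume "x \<in> cycles A b n"
    then show "shift (incl n x) \<in> boundaries total total_d (n - 2)"
      by (simp add: incl_def X.zero_boundaries)
  next
    fix f assume f: "f \<in> cycles total total_d n" "shift f \<in> boundaries total total_d (n - 2)"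
    interpret A0: kmodule "A n" by (rule kmodule)
    interpret A1: kmodule "A (n - 1)" by (rule kmodule)
    interpret A2: kmodule "A (n - 2)" by (rule kmodule)
    interpret X1: kmodule "total (n - 1)" by (rule kmodule_total)
    interpret X2: kmodule "total (n - 2)" by (rule kmodule_total)
    have "f \<in> carrier (total n)" using f by (simp add: cycles_iff)
    then obtain z0 z1 z where fp: "f = push z0 z1 z" and z0: "z0 \<in> carrier (A n)"
      and z1: "z1 \<in> carrier (A (n - 1))"
      by (rule push_cases)
    obtain w where w: "w \<in> carrier (total (n - 1))" "z = total_d (n - 1) w"
      using f(2) by (auto simp: fp boundaries_def)
    note w0 = head_closed[OF w(1)]
    note cyc = total_cycleD(4,5)[OF f(1)[unfolded fp]]
    \<comment> \<open>Subtracting the differential of \<open>push 0 0 w\<close> removes the columns from \<open>2\<close> on and leaves \<open>y\<close>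
      in column \<open>1\<close>; as a cycle for \<open>b'\<close> it is then removed by the differential of
      \<open>push 0 (s y) 0\<close>.\<close>
    define y where "y = z1 \<oplus>\<^bsub>A (n - 1)\<^esub> (\<ominus>\<^bsub>A (n - 1)\<^esub> N (n - 1) (w 0))"
    have y: "y \<in> carrier (A (n - 1))"
      using z1 w0 by (simp add: y_def closed)
    have Ty: "T (n - 1) y = \<ominus>\<^bsub>A (n - 1)\<^esub> b n z0"
      using z0 z1 w0 cyc by (simp add: y_def map_add map_minus T_N closed)
    obtain u v r where w_push: "w = push u v r" and u: "u \<in> carrier (A (n - 1))"
      and v: "v \<in> carrier (A (n - 2))"
      using w(1) by (rule push_cases) simp
    then have "N (n - 2) (z 0) = N (n - 2) (b (n - 1) u)"
      using w(2) by (simp add: total_d_push map_add closed N_T)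
    then have "b' (n - 1) z1 = b' (n - 1) (N (n - 1) u)"
      using cyc(2) b'_N[OF u] by simp
    then have b'y: "b' (n - 1) y = \<zero>\<^bsub>A (n - 2)\<^esub>"
      using z1 u w_push map_add(2)[of z1 "n - 1" "\<ominus>\<^bsub>A (n - 1)\<^esub> N (n - 1) u"]
        map_minus(2)[of "N (n - 1) u" "n - 1"]
      by (simp add: y_def closed A2.r_neg)
    have sy: "s (n - 1) y \<in> carrier (A n)"
      using y by (simp add: closed)
    have b'sy: "b' n (s (n - 1) y) = y"
      using contract_cycle[OF y] b'y by simp
    define x where "x = z0 \<oplus>\<^bsub>A n\<^esub> T n (s (n - 1) y)"
    have "x \<in> cycles A b n"
      using z0 sy b_T[OF sy] Ty
      by (simp add: x_def cycles_iff map_add closed b'sy A1.r_neg)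
    moreover have "f = incl n x \<oplus>\<^bsub>total n\<^esub> total_d (n + 1) (push \<zero>\<^bsub>A (n + 1)\<^esub> (\<ominus>\<^bsub>A n\<^esub> s (n - 1) y) w)"
    proof -
      have "z0 \<oplus>\<^bsub>A n\<^esub> T n (s (n - 1) y) \<oplus>\<^bsub>A n\<^esub> (\<ominus>\<^bsub>A n\<^esub> T n (s (n - 1) y)) = z0"
        using z0 sy by (simp add: A0.a_assoc A0.r_neg closed)
      moreover have "y \<oplus>\<^bsub>A (n - 1)\<^esub> N (n - 1) (w 0) = z1"
        using z1 w0 by (simp add: y_def A1.a_assoc A1.l_neg closed)
      moreover have "z \<in> carrier (total (n - 2))"
        using w X.diff_closed[OF w(1)] by simp
      ultimately show ?thesis
        using z0 z1 y sy w w0 map_zero(1)[of "n + 1"]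
        by (simp add: fp incl_def x_def total_d_push push_add map_minus closed b'sy)
    qed
    moreover have "push \<zero>\<^bsub>A (n + 1)\<^esub> (\<ominus>\<^bsub>A n\<^esub> s (n - 1) y) w \<in> carrier (total (n + 1))"
      using sy w kmodule[of "n + 1"] abelian_monoid.zero_closed[of "A (n + 1)"]
      by (simp add: kmodule_def abelian_group_def)
    ultimately show "\<exists>x\<in>cycles A b n. \<exists>v\<in>boundaries total total_d n. f = incl n x \<oplus>\<^bsub>total n\<^esub> v"
      unfolding boundaries_def by blast
  qed
  have exact2: "exact_at (?X n) (P n) (?X (n - 2)) (B n) (?H (n - 1))" for n
  proof (rule exact_at_homology[where f = shift and g = "connes_B n",
        OF total_complex total_complex column_complex shift_cycle connes_B_cycle P(2) B(2)]; assumption?)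
    interpret A0: kmodule "A n" by (rule kmodule)
    interpret A1: kmodule "A (n - 1)" by (rule kmodule)
    interpret X2: kmodule "total (n - 2)" by (rule kmodule_total)
    {
      fix f assume f: "f \<in> cycles total total_d n"
      then have "f \<in> carrier (total n)" by (simp add: cycles_iff)
      then obtain z0 z1 z where fp: "f = push z0 z1 z" and z0: "z0 \<in> carrier (A n)"
        and z1: "z1 \<in> carrier (A (n - 1))"
        by (rule push_cases)
      note cyc = total_cycleD(4,5)[OF f[unfolded fp]]
      define u where "u = z0 \<oplus>\<^bsub>A n\<^esub> T n (s (n - 1) z1)"
      have Ts: "T n (s (n - 1) z1) \<in> carrier (A n)"
        using z1 by (intro closed(3,5)) simp_all
      have b'z1: "b' (n - 1) z1 \<in> carrier (A (n - 2))"
        using z1 by (rule closed) simp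
      have Tsb': "T (n - 1) (s (n - 2) (b' (n - 1) z1)) \<in> carrier (A (n - 1))"
        using b'z1 by (intro closed(3,5)) simp_all
      have u: "u \<in> carrier (A n)"
        using z0 Ts by (simp add: u_def)
      note c = Ts Tsb' u closed(1)[OF Ts refl] closed(1)[OF z0 refl] closed(1)[OF u refl]
      have B: "connes_B n z = T (n - 1) (s (n - 2) (b' (n - 1) z1))"
        by (simp add: connes_B_def cyc(2))
      have "connes_B n z \<oplus>\<^bsub>A (n - 1)\<^esub> b n u = T (n - 1) z1 \<oplus>\<^bsub>A (n - 1)\<^esub> b n z0"
        using T_homotopy[OF z1] z0 z1 c by (simp add: B u_def map_add A1.a_ac)
      also have "\<dots> = \<zero>\<^bsub>A (n - 1)\<^esub>"
        using c by (simp add: cyc(1) A1.l_neg)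
      finally have "connes_B n z = b n (\<ominus>\<^bsub>A n\<^esub> u)"
        using c A1.minus_equality[of "connes_B n z" "b n u"] by (simp add: B map_minus)
      then show "connes_B n (shift f) \<in> boundaries A b (n - 1)"
        using c by (auto simp: fp boundaries_def)
    next
      fix z assume z: "z \<in> cycles total total_d (n - 2)" "connes_B n z \<in> boundaries A b (n - 1)"
      then obtain x where x: "x \<in> carrier (A n)" "connes_B n z = b n x"
        by (auto simp: boundaries_def)
      have zc: "z \<in> carrier (total (n - 2))" "z 0 \<in> carrier (A (n - 2))"
        using z by (simp_all add: cycles_iff head_closed)
      define y where "y = s (n - 2) (N (n - 2) (z 0))"
      \<comment> \<open>The component \<open>y\<close> accounts for \<open>N z\<^sub>0 = b' y\<close> in column \<open>1\<close>, and the boundary \<open>b x = T y\<close>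
        is cancelled in column \<open>0\<close>.\<close>
      have "push (\<ominus>\<^bsub>A n\<^esub> x) y z \<in> cycles total total_d n"
      proof (rule total_cycleI)
        show "y \<in> carrier (A (n - 1))" using zc by (simp add: y_def closed)
        show "T (n - 1) y = \<ominus>\<^bsub>A (n - 1)\<^esub> b n (\<ominus>\<^bsub>A n\<^esub> x)"
          using x by (simp add: connes_B_def y_def map_minus closed)
        show "N (n - 2) (z 0) = b' (n - 1) y"
          using contract_cycle[of "N (n - 2) (z 0)" "n - 2"] norm_of_cycle[OF z(1)] zc
          by (simp add: y_def closed)
      qed (use x z in simp_all)
      moreover have "z = shift (push (\<ominus>\<^bsub>A n\<^esub> x) y z) \<oplus>\<^bsub>total (n - 2)\<^esub> \<zero>\<^bsub>total (n - 2)\<^esub>"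
        using zc by simp
      ultimately show "\<exists>x\<in>cycles total total_d n. \<exists>w\<in>boundaries total total_d (n - 2).
          z = shift x \<oplus>\<^bsub>total (n - 2)\<^esub> w"
        using X.zero_boundaries by blast
    }
  qed
  have exact3: "exact_at (?X (n - 2)) (B n) (?H (n - 1)) (I (n - 1)) (?X (n - 1))" for n
  proof (rule exact_at_homology[where f = "connes_B n" and g = "incl (n - 1)",
        OF total_complex column_complex total_complex connes_B_cycle incl_cycle B(2) I(2)]; assumption?)
    interpret A0: kmodule "A n" by (rule kmodule)
    interpret A1: kmodule "A (n - 1)" by (rule kmodule)
    interpret A2: kmodule "A (n - 2)" by (rule kmodule)
    {
      fix z assume z: "z \<in> cycles total total_d (n - 2)"
      have zc: "z \<in> carrier (total (n - 2))" "z 0 \<in> carrier (A (n - 2))"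
        using z by (simp_all add: cycles_iff head_closed)
      define y where "y = s (n - 2) (N (n - 2) (z 0))"
      have y: "y \<in> carrier (A (n - 1))" using zc by (simp add: y_def closed)
      have "b' (n - 1) y = N (n - 2) (z 0)"
        using contract_cycle[of "N (n - 2) (z 0)" "n - 2"] norm_of_cycle[OF z(1)] zc
        by (simp add: y_def closed)
      moreover have "total_d (n - 2) z = \<zero>\<^bsub>total (n - 3)\<^esub>"
        using z by (simp add: cycles_iff)
      ultimately have "incl (n - 1) (connes_B n z) = total_d n (push \<zero>\<^bsub>A n\<^esub> y z)"
        using zc y by (simp add: incl_def connes_B_def total_d_push map_zero y_def[symmetric] closed A2.l_neg)
      then show "incl (n - 1) (connes_B n z) \<in> boundaries total total_d (n - 1)"
        using zc y by (auto simp: boundaries_def)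
    next
      fix x assume x: "x \<in> cycles A b (n - 1)" "incl (n - 1) x \<in> boundaries total total_d (n - 1)"
      then obtain f where f: "f \<in> carrier (total n)" "incl (n - 1) x = total_d n f"
        by (auto simp: boundaries_def)
      from f(1) obtain z0 z1 z where fp: "f = push z0 z1 z" and z0: "z0 \<in> carrier (A n)"
        and z1: "z1 \<in> carrier (A (n - 1))" and z: "z \<in> carrier (total (n - 2))"
        by (rule push_cases)
      have eq: "x = b n z0 \<oplus>\<^bsub>A (n - 1)\<^esub> T (n - 1) z1"
        "\<zero>\<^bsub>A (n - 2)\<^esub> = (\<ominus>\<^bsub>A (n - 2)\<^esub> b' (n - 1) z1) \<oplus>\<^bsub>A (n - 2)\<^esub> N (n - 2) (z 0)"
        "\<zero>\<^bsub>total (n - 3)\<^esub> = total_d (n - 2) z"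
        using f(2) by (simp_all add: fp incl_def total_d_push)
      have zcyc: "z \<in> cycles total total_d (n - 2)"
        using z eq(3) by (simp add: cycles_iff)
      have b'z1: "b' (n - 1) z1 \<in> carrier (A (n - 2))"
        using z1 by (rule closed) simp
      have "\<ominus>\<^bsub>A (n - 2)\<^esub> N (n - 2) (z 0) = \<ominus>\<^bsub>A (n - 2)\<^esub> b' (n - 1) z1"
        using A2.minus_equality[OF eq(2)[symmetric]] b'z1 head_closed[OF z] by (simp add: closed)
      then have "\<ominus>\<^bsub>A (n - 2)\<^esub> (\<ominus>\<^bsub>A (n - 2)\<^esub> N (n - 2) (z 0)) =
          \<ominus>\<^bsub>A (n - 2)\<^esub> (\<ominus>\<^bsub>A (n - 2)\<^esub> b' (n - 1) z1)"
        by (rule arg_cong)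
      then have N: "N (n - 2) (z 0) = b' (n - 1) z1"
        by (simp only: A2.minus_minus b'z1 closed(4)[OF head_closed[OF z]])
      have Ts: "T n (s (n - 1) z1) \<in> carrier (A n)"
        using z1 by (intro closed(3,5)) simp_all
      have Tsb': "T (n - 1) (s (n - 2) (b' (n - 1) z1)) \<in> carrier (A (n - 1))"
        using b'z1 by (intro closed(3,5)) simp_all
      note c = Ts Tsb' closed(1)[OF Ts refl] closed(1)[OF z0 refl]
      have "x = connes_B n z \<oplus>\<^bsub>A (n - 1)\<^esub> b n (z0 \<oplus>\<^bsub>A n\<^esub> T n (s (n - 1) z1))"
        using T_homotopy[OF z1] z0 c
        by (simp add: eq(1) connes_B_def N map_add A1.a_ac)
      then show "\<exists>z\<in>cycles total total_d (n - 2). \<exists>w\<in>boundaries A b (n - 1).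
          x = connes_B n z \<oplus>\<^bsub>A (n - 1)\<^esub> w"
        using zcyc z0 c by (fastforce simp: boundaries_def)
    }
  qed
  show ?thesis
    using I(1) P(1) B(1) exact1 exact2 exact3 by blast
qed

end

section \<open>The cyclic bicomplex as a periodic bicomplex\<close>

lemma complex_module_nat [simp]: "complex_module C (int n) = C n"
  by (simp add: complex_module_def)

lemma complex_module_neg:
  assumes "n < 0"
  shows "carrier (complex_module C n) = {\<zero>\<^bsub>C 0\<^esub>}" "\<zero>\<^bsub>complex_module C n\<^esub> = \<zero>\<^bsub>C 0\<^esub>"
  using assms by (simp_all add: complex_module_def)

lemma kmodule_complex_module:
  assumes C: "\<And>n. kmodule (C n)"
  shows "kmodule (complex_module C n)"
proof (cases "n < 0")
  case True
  interpret kmodule "C 0" by (rule C)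
  interpret ksubmodule "C 0" "{\<zero>\<^bsub>C 0\<^esub>}"
    by unfold_locales auto
  show ?thesis
    using True kmodule_sub by (simp add: complex_module_def)
qed (simp add: complex_module_def C)

lemma complex_module_cases:
  obtains "n < 0" | m where "n = int m"
  by (metis nonneg_int_cases not_less)

definition complex_endo ::
  "(nat \<Rightarrow> ('k, 'c) module) \<Rightarrow> (nat \<Rightarrow> 'c \<Rightarrow> 'c) \<Rightarrow> int \<Rightarrow> 'c \<Rightarrow> 'c" where
  "complex_endo C f n = (if n < 0 then (\<lambda>_. \<zero>\<^bsub>C 0\<^esub>) else f (nat n))"

lemma complex_diff_simps [simp]:
  "complex_diff C d (int (Suc n)) = d (Suc n)" "k \<le> 0 \<Longrightarrow> complex_diff C d k = (\<lambda>_. \<zero>\<^bsub>C 0\<^esub>)"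
  "complex_diff C d (1 + int n) = d (Suc n)"  "complex_diff C d (int n + 1) = d (Suc n)"
  by (simp_all add: complex_diff_def nat_add_distrib)

lemma complex_endo_simps [simp]:
  "complex_endo C f (int n) = f n" "k < 0 \<Longrightarrow> complex_endo C f k = (\<lambda>_. \<zero>\<^bsub>C 0\<^esub>)"
  by (simp_all add: complex_endo_def)

text \<open>The identities among the operators of a cyclic module that make its bicomplex a periodic one
  with contractible odd columns. The extension by zero to negative degrees adds no further
  condition, except in degree \<open>0\<close> of the homotopy.\<close>

locale cyclic_bicomplex =
  fixes C :: "nat \<Rightarrow> ('k::comm_ring_1, 'c) module"
    and d :: "nat \<Rightarrow> nat \<Rightarrow> 'c \<Rightarrow> 'c" and t s :: "nat \<Rightarrow> 'c \<Rightarrow> 'c"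
  assumes kmodule: "kmodule (C n)"
    and b_linear: "b_map C d (Suc n) \<in> linear_maps (C (Suc n)) (C n)"
    and b'_linear: "b'_map C d (Suc n) \<in> linear_maps (C (Suc n)) (C n)"
    and T_linear: "one_minus_tau C t n \<in> linear_maps (C n) (C n)"
    and N_linear: "norm_map C t n \<in> linear_maps (C n) (C n)"
    and s_linear: "s n \<in> linear_maps (C n) (C (Suc n))"
    and b_b: "x \<in> carrier (C (Suc (Suc n))) \<Longrightarrow>
      b_map C d (Suc n) (b_map C d (Suc (Suc n)) x) = \<zero>\<^bsub>C n\<^esub>"
    and b'_b': "x \<in> carrier (C (Suc (Suc n))) \<Longrightarrow>
      b'_map C d (Suc n) (b'_map C d (Suc (Suc n)) x) = \<zero>\<^bsub>C n\<^esub>"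
    and b_T: "x \<in> carrier (C (Suc n)) \<Longrightarrow>
      b_map C d (Suc n) (one_minus_tau C t (Suc n) x) = one_minus_tau C t n (b'_map C d (Suc n) x)"
    and b'_N: "x \<in> carrier (C (Suc n)) \<Longrightarrow>
      b'_map C d (Suc n) (norm_map C t (Suc n) x) = norm_map C t n (b_map C d (Suc n) x)"
    and T_N: "x \<in> carrier (C n) \<Longrightarrow> one_minus_tau C t n (norm_map C t n x) = \<zero>\<^bsub>C n\<^esub>"
    and N_T: "x \<in> carrier (C n) \<Longrightarrow> norm_map C t n (one_minus_tau C t n x) = \<zero>\<^bsub>C n\<^esub>"
    and homotopy_0: "x \<in> carrier (C 0) \<Longrightarrow> b'_map C d (Suc 0) (s 0 x) = x"
    and homotopy: "x \<in> carrier (C (Suc n)) \<Longrightarrow>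
      b'_map C d (Suc (Suc n)) (s (Suc n) x) \<oplus>\<^bsub>C (Suc n)\<^esub> s n (b'_map C d (Suc n) x) = x"
begin

abbreviation "A \<equiv> complex_module C"

lemma zero_nonpos: "m \<le> 0 \<Longrightarrow> \<zero>\<^bsub>A m\<^esub> = \<zero>\<^bsub>C 0\<^esub>"
  by (simp add: complex_module_def)

lemma zero_map_linear:
  assumes "m \<le> 0"
  shows "(\<lambda>_. \<zero>\<^bsub>C 0\<^esub>) \<in> linear_maps (A n) (A m)"
proof -
  interpret M: kmodule "A m" by (rule kmodule_complex_module[OF kmodule])
  have "(\<lambda>_. \<zero>\<^bsub>A m\<^esub>) \<in> linear_maps (A n) (A m)"
    by (rule linear_mapsI) simp_all
  then show ?thesis
    by (simp only: zero_nonpos[OF assms])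
qed

lemma diff_linearI:
  assumes "\<And>n. f (Suc n) \<in> linear_maps (C (Suc n)) (C n)"
  shows "complex_diff C f n \<in> linear_maps (A n) (A (n - 1))"
proof (cases "n \<le> 0")
  case False
  define k where "k = nat (n - 1)"
  have k: "n - 1 = int k" "n = int (Suc k)" using False by (simp_all add: k_def)
  show ?thesis
    unfolding k(1) unfolding k(2) complex_module_nat complex_diff_simps(1) by (rule assms)
qed (simp add: zero_map_linear)

lemma endo_linearI:
  assumes "\<And>n. f n \<in> linear_maps (C n) (C n)"
  shows "complex_endo C f n \<in> linear_maps (A n) (A n)"
  using assms by (cases n rule: complex_module_cases) (simp_all add: zero_map_linear)

lemma int_degree_cases:
  obtains "n < 0" | "n = 0" | "n = 1" | k where "n = int (Suc (Suc k))"
proof -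
  have "n = int (Suc (Suc (nat (n - 2))))" if "n > 1" using that by simp
  then show ?thesis using that by (meson linorder_cases zero_less_imp_eq_int not_less int_one_le_iff_zero_less antisym_conv1)
qed

sublocale P: periodic_bicomplex A "complex_diff C (b_map C d)" "complex_diff C (b'_map C d)"
  "complex_endo C (one_minus_tau C t)" "complex_endo C (norm_map C t)" "complex_endo C s"
proof (rule periodic_bicomplex.intro)
  show "kmodule (A n)" for n by (rule kmodule_complex_module[OF kmodule])
  show "complex_diff C (b_map C d) n \<in> linear_maps (A n) (A (n - 1))" for n
    by (rule diff_linearI[OF b_linear])
  show "complex_diff C (b'_map C d) n \<in> linear_maps (A n) (A (n - 1))" for n
    by (rule diff_linearI[OF b'_linear])
  show "complex_endo C (one_minus_tau C t) n \<in> linear_maps (A n) (A n)" for n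
    by (rule endo_linearI[OF T_linear])
  show "complex_endo C (norm_map C t) n \<in> linear_maps (A n) (A n)" for n
    by (rule endo_linearI[OF N_linear])
  show "complex_endo C s n \<in> linear_maps (A n) (A (n + 1))" for n
  proof (cases n rule: complex_module_cases)
    case (2 m)
    have e: "int m + 1 = int (Suc m)" by simp
    show ?thesis
      unfolding 2 unfolding e complex_module_nat complex_endo_simps(1) by (rule s_linear)
  qed (simp add: zero_map_linear)
next
  fix n x assume x: "x \<in> carrier (A n)"
  have two: "int (Suc (Suc k)) - 1 = int (Suc k)" "int (Suc (Suc k)) - 2 = int k"
    "int (Suc k) - 1 = int k" "int (Suc (Suc k)) + 1 = int (Suc (Suc (Suc k)))" for k
    by simp_all
  have C0: "A 0 = C 0" "A 1 = C (Suc 0)"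
    by (simp_all add: complex_module_def)
  have op1: "complex_diff C f 1 = f (Suc 0)" "complex_endo C f 1 = f (Suc 0)" "complex_endo C f 0 = f 0"
    for f by (simp_all add: complex_diff_def complex_endo_def)
  have hom0: "b'_map C d (Suc 0) (s 0 y) \<oplus>\<^bsub>C 0\<^esub> \<zero>\<^bsub>C 0\<^esub> = y" if "y \<in> carrier (C 0)" for y
  proof -
    interpret kmodule "C 0" by (rule kmodule)
    show ?thesis using that by (simp add: homotopy_0)
  qed
  have zz: "\<zero>\<^bsub>C 0\<^esub> \<oplus>\<^bsub>A n\<^esub> \<zero>\<^bsub>C 0\<^esub> = \<zero>\<^bsub>C 0\<^esub>" if "n < 0"
  proof -
    interpret kmodule "C 0" by (rule kmodule)
    show ?thesis using that by (simp add: complex_module_def)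
  qed
  show "complex_diff C (b_map C d) (n - 1) (complex_diff C (b_map C d) n x) = \<zero>\<^bsub>A (n - 2)\<^esub>"
    using x by (cases n rule: int_degree_cases) (simp_all add: zero_nonpos C0 op1 two b_b del: of_nat_Suc)
  show "complex_diff C (b'_map C d) (n - 1) (complex_diff C (b'_map C d) n x) = \<zero>\<^bsub>A (n - 2)\<^esub>"
    using x by (cases n rule: int_degree_cases) (simp_all add: zero_nonpos C0 op1 two b'_b' del: of_nat_Suc)
  show "complex_diff C (b_map C d) n (complex_endo C (one_minus_tau C t) n x) =
      complex_endo C (one_minus_tau C t) (n - 1) (complex_diff C (b'_map C d) n x)"
    using x by (cases n rule: int_degree_cases) (simp_all add: zero_nonpos C0 op1 two b_T del: of_nat_Suc)
  show "complex_diff C (b'_map C d) n (complex_endo C (norm_map C t) n x) =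
      complex_endo C (norm_map C t) (n - 1) (complex_diff C (b_map C d) n x)"
    using x by (cases n rule: int_degree_cases) (simp_all add: zero_nonpos C0 op1 two b'_N del: of_nat_Suc)
  show "complex_endo C (one_minus_tau C t) n (complex_endo C (norm_map C t) n x) = \<zero>\<^bsub>A n\<^esub>"
    using x by (cases n rule: complex_module_cases) (simp_all add: zero_nonpos T_N)
  show "complex_endo C (norm_map C t) n (complex_endo C (one_minus_tau C t) n x) = \<zero>\<^bsub>A n\<^esub>"
    using x by (cases n rule: complex_module_cases) (simp_all add: zero_nonpos N_T)
  show "complex_diff C (b'_map C d) (n + 1) (complex_endo C s n x) \<oplus>\<^bsub>A n\<^esub>
      complex_endo C s (n - 1) (complex_diff C (b'_map C d) n x) = x"
  proof (cases n rule: int_degree_cases)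
    case 1
    then show ?thesis using x zz by (simp add: complex_module_neg)
  next
    case 2
    then show ?thesis using x hom0 by (simp add: C0 op1)
  next
    case 3
    then show ?thesis using x homotopy[of x 0] complex_diff_simps(1)[of C "b'_map C d" 1]
      by (simp add: C0 op1)
  next
    case (4 k)
    then show ?thesis using x homotopy[of x "Suc k"] by (simp add: two del: of_nat_Suc)
  qed
qed

lemma kmodule_total_module: "kmodule (total_module C n)"
proof -
  have km: "kmodule (C m)" for m by (rule kmodule)
  have ag: "abelian_group (C m)" for m using km by (simp add: kmodule_def)
  note am = abelian_group.axioms(1)[OF ag]
  have ext: "f = g" if "f \<in> carrier (total_module C n)" "g \<in> carrier (total_module C n)"
    "\<And>p. p \<le> n \<Longrightarrow> f p = g p" for f g
    using that by (auto simp: total_module_def intro: PiE_ext)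
  have comp: "f p \<in> carrier (C (n - p))" if "f \<in> carrier (total_module C n)" "p \<le> n" for f p
    using that by (auto simp: total_module_def)
  have ops: "\<zero>\<^bsub>total_module C n\<^esub> \<in> carrier (total_module C n)"
    "p \<le> n \<Longrightarrow> \<zero>\<^bsub>total_module C n\<^esub> p = \<zero>\<^bsub>C (n - p)\<^esub>"
    "p \<le> n \<Longrightarrow> (f \<oplus>\<^bsub>total_module C n\<^esub> g) p = f p \<oplus>\<^bsub>C (n - p)\<^esub> g p"
    "p \<le> n \<Longrightarrow> (c \<odot>\<^bsub>total_module C n\<^esub> f) p = c \<odot>\<^bsub>C (n - p)\<^esub> f p"
    "\<lbrakk>f \<in> carrier (total_module C n); g \<in> carrier (total_module C n)\<rbrakk> \<Longrightarrow>
      f \<oplus>\<^bsub>total_module C n\<^esub> g \<in> carrier (total_module C n)"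
    "f \<in> carrier (total_module C n) \<Longrightarrow> c \<odot>\<^bsub>total_module C n\<^esub> f \<in> carrier (total_module C n)"
    for p f g c
    using abelian_monoid.a_closed[OF am] abelian_monoid.zero_closed[OF am] kmodule.smult_closed[OF km]
    by (auto simp: total_module_def PiE_iff extensional_def)
  have "abelian_group (total_module C n)"
  proof (rule abelian_groupI)
    fix f assume f: "f \<in> carrier (total_module C n)"
    have "(- 1) \<odot>\<^bsub>total_module C n\<^esub> f \<oplus>\<^bsub>total_module C n\<^esub> f = \<zero>\<^bsub>total_module C n\<^esub>"
      using f by (intro ext) (simp_all add: ops comp kmodule.smult_minus_one[OF km] abelian_group.l_neg[OF ag])
    then show "\<exists>g\<in>carrier (total_module C n). g \<oplus>\<^bsub>total_module C n\<^esub> f = \<zero>\<^bsub>total_module C n\<^esub>"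
      using f ops(6) by blast
  qed (auto intro!: ext simp: ops comp abelian_monoid.a_assoc[OF am] abelian_monoid.l_zero[OF am]
      abelian_monoid.a_comm[OF am])
  then interpret abelian_group "total_module C n" .
  show ?thesis
    by unfold_locales (auto intro!: ext simp: ops comp kmodule.smult_r_distr[OF km]
        kmodule.smult_l_distr[OF km] kmodule.smult_assoc[OF km] kmodule.smult_one[OF km])
qed

text \<open>The total complex of \<open>total_module\<close> is truncated to the columns \<open>p \<le> n\<close>; beyond them the
  rows are zero.\<close>

definition total_extend :: "int \<Rightarrow> (nat \<Rightarrow> 'c) \<Rightarrow> nat \<Rightarrow> 'c" where
  "total_extend n f p = (if int p \<le> n then f p else \<zero>\<^bsub>C 0\<^esub>)"

lemma A_row: "p \<le> m \<Longrightarrow> A (int m - int p) = C (m - p)"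
  using complex_module_nat[of C "m - p"] by (simp add: of_nat_diff)

lemma A_beyond: "n < int p \<Longrightarrow> carrier (A (n - int p)) = {\<zero>\<^bsub>C 0\<^esub>}"
  "n < int p \<Longrightarrow> \<zero>\<^bsub>A (n - int p)\<^esub> = \<zero>\<^bsub>C 0\<^esub>"
  by (simp_all add: complex_module_neg)

lemma total_neg: "n < 0 \<Longrightarrow> f \<in> carrier (P.total n) \<longleftrightarrow> f = (\<lambda>_. \<zero>\<^bsub>C 0\<^esub>)"
  by (auto simp: P.total_simps A_beyond)

lemma total_component:
  "\<lbrakk>f \<in> carrier (P.total (int m)); p \<le> m\<rbrakk> \<Longrightarrow> f p \<in> carrier (C (m - p))"
  unfolding P.total_simps by (metis A_row)

lemma total_extend_carrier:
  "f \<in> carrier (total_module C m) \<Longrightarrow> total_extend (int m) f \<in> carrier (P.total (int m))"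
  by (auto simp: P.total_simps total_extend_def A_row A_beyond total_module_def)

lemma total_iso:
  "complex_iso P.total P.total_d (complex_module (total_module C))
    (complex_diff (total_module C) (total_diff C d t)) total_extend"
proof (intro complex_iso.intro complex_iso_axioms.intro P.total_complex)
  show km: "kmodule (complex_module (total_module C) n)" for n
    by (rule kmodule_complex_module[OF kmodule_total_module])
  have z0: "\<zero>\<^bsub>C 0\<^esub> \<oplus>\<^bsub>A (n - int p)\<^esub> \<zero>\<^bsub>C 0\<^esub> = \<zero>\<^bsub>C 0\<^esub>" "c \<odot>\<^bsub>A (n - int p)\<^esub> \<zero>\<^bsub>C 0\<^esub> = \<zero>\<^bsub>C 0\<^esub>"
    if "n < int p" for n p c
  proof -
    interpret kmodule "A (n - int p)" by (rule kmodule_complex_module[OF kmodule])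
    show "\<zero>\<^bsub>C 0\<^esub> \<oplus>\<^bsub>A (n - int p)\<^esub> \<zero>\<^bsub>C 0\<^esub> = \<zero>\<^bsub>C 0\<^esub>" "c \<odot>\<^bsub>A (n - int p)\<^esub> \<zero>\<^bsub>C 0\<^esub> = \<zero>\<^bsub>C 0\<^esub>"
      using A_beyond[OF that] l_zero[of "\<zero>\<^bsub>A (n - int p)\<^esub>"] smult_zero_right[of c] by simp_all
  qed
  show lin: "total_extend n \<in> linear_maps (complex_module (total_module C) n) (P.total n)" for n
  proof (cases n rule: complex_module_cases)
    case 1
    then have "total_extend n = (\<lambda>_ _. \<zero>\<^bsub>C 0\<^esub>)"
      by (auto simp: total_extend_def fun_eq_iff)
    then show ?thesis
      using 1 by (intro linear_mapsI) (simp_all add: total_neg P.total_simps(3,4) z0 fun_eq_iff)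
  next
    case (2 m)
    show ?thesis
      unfolding 2 complex_module_nat
    proof (rule linear_mapsI)
      fix x y c assume "x \<in> carrier (total_module C m)" "y \<in> carrier (total_module C m)"
      show "total_extend (int m) (x \<oplus>\<^bsub>total_module C m\<^esub> y) =
          total_extend (int m) x \<oplus>\<^bsub>P.total (int m)\<^esub> total_extend (int m) y"
        by (auto simp: P.total_simps total_extend_def A_row z0 total_module_def)
    next
      fix x c assume "x \<in> carrier (total_module C m)"
      show "total_extend (int m) (c \<odot>\<^bsub>total_module C m\<^esub> x) =
          c \<odot>\<^bsub>P.total (int m)\<^esub> total_extend (int m) x"
        by (auto simp: P.total_simps total_extend_def A_row z0 total_module_def)
    qed (rule total_extend_carrier)
  qed
  show "bij_betw (total_extend n) (carrier (complex_module (total_module C) n)) (carrier (P.total n))" for n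
  proof (cases n rule: complex_module_cases)
    case 1
    then have "total_extend n f = (\<lambda>_. \<zero>\<^bsub>C 0\<^esub>)" for f
      by (auto simp: total_extend_def fun_eq_iff)
    then show ?thesis
      using 1 by (auto simp: bij_betw_def complex_module_neg total_neg)
  next
    case (2 m)
    show ?thesis
      unfolding 2 complex_module_nat
    proof (rule bij_betw_byWitness[where f' = "\<lambda>f. restrict f {..m}"])
      show "\<forall>f\<in>carrier (total_module C m). restrict (total_extend (int m) f) {..m} = f"
        by (auto simp: total_extend_def total_module_def PiE_iff intro!: extensionalityI[OF restrict_extensional])
      show "\<forall>f\<in>carrier (P.total (int m)). total_extend (int m) (restrict f {..m}) = f"
      proof (intro ballI ext)
        fix f p assume "f \<in> carrier (P.total (int m))"
        then have "f p \<in> carrier (A (int m - int p))" by (simp add: P.total_simps)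
        then show "total_extend (int m) (restrict f {..m}) p = f p"
          using A_beyond(1)[of "int m" p] by (auto simp: total_extend_def)
      qed
      show "total_extend (int m) ` carrier (total_module C m) \<subseteq> carrier (P.total (int m))"
        using total_extend_carrier by blast
      show "(\<lambda>f. restrict f {..m}) ` carrier (P.total (int m)) \<subseteq> carrier (total_module C m)"
      proof (intro image_subsetI)
        fix f assume "f \<in> carrier (P.total (int m))"
        then show "restrict f {..m} \<in> carrier (total_module C m)"
          by (simp add: total_module_def total_component)
      qed
    qed
  qed
  have Suc_diff: "total_diff C d t (Suc m) f \<in> carrier (total_module C m)"
    "total_extend (int m) (total_diff C d t (Suc m) f) = P.total_d (int (Suc m)) (total_extend (int (Suc m)) f)"
    if f: "f \<in> carrier (total_module C (Suc m))" for m f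
  proof -
    have X: "P.total_d (int (Suc m)) (total_extend (int (Suc m)) f) \<in> carrier (P.total (int m))"
      using chain_complex.diff_closed[OF P.total_complex total_extend_carrier[OF f]] by simp
    show eq: "total_extend (int m) (total_diff C d t (Suc m) f) =
        P.total_d (int (Suc m)) (total_extend (int (Suc m)) f)"
    proof
      fix p
      show "total_extend (int m) (total_diff C d t (Suc m) f) p =
        P.total_d (int (Suc m)) (total_extend (int (Suc m)) f) p"
      proof (cases "p \<le> m")
        case True
        have i: "int (Suc m) - int p = int (Suc (m - p))" "int (Suc (m - p)) - 1 = int (m - p)"
          "Suc m - p = Suc (m - p)"
          using True by (simp_all add: of_nat_diff)
        show ?thesis
          using True unfolding P.total_d_def i total_extend_def
          by (simp add: total_diff_def i del: of_nat_Suc of_nat_diff)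
      next
        case False
        then have "P.total_d (int (Suc m)) (total_extend (int (Suc m)) f) p \<in> {\<zero>\<^bsub>C 0\<^esub>}"
          using X A_beyond(1)[of "int m" p] unfolding P.total_simps by auto
        with False show ?thesis by (simp add: total_extend_def)
      qed
    qed
    have "total_diff C d t (Suc m) f = restrict (P.total_d (int (Suc m)) (total_extend (int (Suc m)) f)) {..m}"
      unfolding eq[symmetric] by (rule ext) (simp add: total_extend_def total_diff_def)
    then show "total_diff C d t (Suc m) f \<in> carrier (total_module C m)"
      using X by (simp add: total_module_def total_component)
  qed
  fix n f assume f: "f \<in> carrier (complex_module (total_module C) n)"
  interpret E: kmodule "complex_module (total_module C) (n - 1)" by (rule km)
  show "complex_diff (total_module C) (total_diff C d t) n f \<in> carrier (complex_module (total_module C) (n - 1))"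
  proof (cases "n \<le> 0")
    case True
    then show ?thesis using complex_module_neg[of "n - 1" "total_module C"] by simp
  next
    case False
    define k where "k = nat (n - 1)"
    have k: "n - 1 = int k" "n = int (Suc k)" using False by (simp_all add: k_def)
    show ?thesis
      using f unfolding k(1) unfolding k(2) complex_module_nat complex_diff_simps(1) by (rule Suc_diff)
  qed
  show "total_extend (n - 1) (complex_diff (total_module C) (total_diff C d t) n f) =
      P.total_d n (total_extend n f)"
  proof (cases "n \<le> 0")
    case True
    have "P.total_d n (total_extend n f) \<in> carrier (P.total (n - 1))"
      using chain_complex.diff_closed[OF P.total_complex linear_maps_closed[OF lin f]] .
    then show ?thesis using True by (auto simp: total_neg total_extend_def)
  next
    case False
    define k where "k = nat (n - 1)"
    have k: "n - 1 = int k" "n = int (Suc k)" using False by (simp_all add: k_def)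
    show ?thesis
      using f unfolding k(1) unfolding k(2) complex_module_nat complex_diff_simps(1) by (rule Suc_diff)
  qed
qed

text \<open>Connes' exact sequence for a complex \<open>(E, \<epsilon>)\<close> isomorphic to the Hochschild complex of
  the cyclic module.\<close>

theorem connes_sequence_iso:
  assumes "complex_iso A (complex_diff C (b_map C d)) E \<epsilon> \<phi>"
  shows "let HH = int_homology E \<epsilon>; HC = cyclic_homology C d t
    in \<exists>I P B. \<forall>n::int.
       I n \<in> linear_maps (HH n) (HC n) \<and>
       P n \<in> linear_maps (HC n) (HC (n - 2)) \<and>
       B n \<in> linear_maps (HC (n - 2)) (HH (n - 1)) \<and>
       exact_at (HH n) (I n) (HC n) (P n) (HC (n - 2)) \<and>
       exact_at (HC n) (P n) (HC (n - 2)) (B n) (HH (n - 1)) \<and>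
       exact_at (HC (n - 2)) (B n) (HH (n - 1)) (I (n - 1)) (HC (n - 1))"
proof -
  interpret HH: complex_iso A "complex_diff C (b_map C d)" E \<epsilon> \<phi> by fact
  interpret HC: complex_iso P.total P.total_d "complex_module (total_module C)"
    "complex_diff (total_module C) (total_diff C d t)" total_extend
    by (rule total_iso)
  interpret EH: chain_complex E \<epsilon> by (rule HH.source_complex)
  interpret EC: chain_complex "complex_module (total_module C)"
    "complex_diff (total_module C) (total_diff C d t)" by (rule HC.source_complex)
  let ?H = "int_homology A (complex_diff C (b_map C d))" and ?X = "int_homology P.total P.total_d"
  let ?H' = "int_homology E \<epsilon>" and ?X' = "cyclic_homology C d t"
  have X': "?X' = int_homology (complex_module (total_module C)) (complex_diff (total_module C) (total_diff C d t))"
    by (simp add: cyclic_homology_def homology_eq_int_homology)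
  obtain u where u: "u n \<in> linear_maps (?H' n) (?H n)" "bij_betw (u n) (carrier (?H' n)) (carrier (?H n))" for n
  proof -
    have "\<forall>n. \<exists>F. F \<in> linear_maps (?H' n) (?H n) \<and> bij_betw F (carrier (?H' n)) (carrier (?H n))"
      using HH.homology_iso by blast
    then show ?thesis using that by metis
  qed
  obtain v where v: "v n \<in> linear_maps (?X' n) (?X n)" "bij_betw (v n) (carrier (?X' n)) (carrier (?X n))" for n
  proof -
    have "\<forall>n. \<exists>F. F \<in> linear_maps (?X' n) (?X n) \<and> bij_betw F (carrier (?X' n)) (carrier (?X n))"
      unfolding X' using HC.homology_iso by blast
    then show ?thesis using that by metis
  qed
  have k: "kmodule (?H n)" "kmodule (?H' n)" "kmodule (?X n)" "kmodule (?X' n)" for n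
    unfolding X' by (rule HH.kmodule_homology EH.kmodule_homology HC.kmodule_homology EC.kmodule_homology)+
  let ?u' = "\<lambda>n. inv_into (carrier (?H' n)) (u n)" and ?v' = "\<lambda>n. inv_into (carrier (?X' n)) (v n)"
  have u': "?u' n \<in> linear_maps (?H n) (?H' n)" for n
    by (rule linear_maps_inv_into[OF u k(2)])
  have v': "?v' n \<in> linear_maps (?X n) (?X' n)" for n
    by (rule linear_maps_inv_into[OF v k(4)])
  obtain I P B where seq: "I n \<in> linear_maps (?H n) (?X n)" "P n \<in> linear_maps (?X n) (?X (n - 2))"
    "B n \<in> linear_maps (?X (n - 2)) (?H (n - 1))"
    "exact_at (?H n) (I n) (?X n) (P n) (?X (n - 2))"
    "exact_at (?X n) (P n) (?X (n - 2)) (B n) (?H (n - 1))"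
    "exact_at (?X (n - 2)) (B n) (?H (n - 1)) (I (n - 1)) (?X (n - 1))" for n
    using P.connes_exact_sequence by metis
  show ?thesis
    unfolding Let_def
  proof (intro exI allI conjI)
    fix n
    let ?I = "\<lambda>n x. ?v' n (I n (u n x))" and ?P = "\<lambda>n x. ?v' (n - 2) (P n (v n x))"
      and ?B = "\<lambda>n x. ?u' (n - 1) (B n (v (n - 2) x))"
    show "?I n \<in> linear_maps (?H' n) (?X' n)"
      by (intro linear_maps_comp[OF _ v'] linear_maps_comp[OF u(1)] seq)
    show "?P n \<in> linear_maps (?X' n) (?X' (n - 2))"
      by (intro linear_maps_comp[OF _ v'] linear_maps_comp[OF v(1)] seq)
    show "?B n \<in> linear_maps (?X' (n - 2)) (?H' (n - 1))"
      by (intro linear_maps_comp[OF _ u'] linear_maps_comp[OF v(1)] seq)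
    show "exact_at (?H' n) (?I n) (?X' n) (?P n) (?X' (n - 2))"
      by (rule exact_at_conj[OF seq(4) u(2) v v k(3,4,3,4) seq(1,2)])
    show "exact_at (?X' n) (?P n) (?X' (n - 2)) (?B n) (?H' (n - 1))"
      by (rule exact_at_conj[OF seq(5) v(2) v u k(3,4,1,2) seq(2,3)])
    show "exact_at (?X' (n - 2)) (?B n) (?H' (n - 1)) (?I (n - 1)) (?X' (n - 1))"
      by (rule exact_at_conj[OF seq(6) v(2) u v k(1,2,3,4) seq(3,1)])
  qed
qed

end

section \<open>Linear extension\<close>

interpretation fscale: Modules.module fscale
  by (rule module_fscale)

interpretation fscale_pair: module_pair fscale fscale
  by (rule module_pair.intro) (rule module_fscale)+

lemma lin_ext_superset:
  assumes "Modules.module s" "finite A" "Poly_Mapping.keys p \<subseteq> A"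
  shows "lin_ext s f p = (\<Sum>x\<in>A. s (Poly_Mapping.lookup p x) (f x))"
proof -
  interpret Modules.module s by fact
  show ?thesis
    unfolding lin_ext_def
    by (rule sum.mono_neutral_left) (use assms in \<open>auto simp: in_keys_iff\<close>)
qed

lemma lin_ext_hom:
  fixes s :: "'k::comm_ring_1 \<Rightarrow> 'v::ab_group_add \<Rightarrow> 'v" and f :: "'x \<Rightarrow> 'v"
  assumes "Modules.module s" shows "module_hom fscale s (lin_ext s f)"
proof -
  interpret s: Modules.module s by fact
  show ?thesis
  proof unfold_locales
    fix p q :: "'x \<Rightarrow>\<^sub>0 'k"
    let ?A = "Poly_Mapping.keys p \<union> Poly_Mapping.keys q"
    have "Poly_Mapping.keys (p + q) \<subseteq> ?A"
      by (rule keys_add)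
    then show "lin_ext s f (p + q) = lin_ext s f p + lin_ext s f q"
      by (simp add: lin_ext_superset[OF assms, of ?A] lookup_add s.scale_left_distrib sum.distrib)
  next
    fix c and p :: "'x \<Rightarrow>\<^sub>0 'k"
    have "Poly_Mapping.keys (fscale c p) \<subseteq> Poly_Mapping.keys p"
      by (auto simp: in_keys_iff lookup_fscale)
    then show "lin_ext s f (fscale c p) = s c (lin_ext s f p)"
      by (simp add: lin_ext_superset[OF assms, of "Poly_Mapping.keys p"] lookup_fscale s.scale_sum_right)
  qed
qed

lemma lin_ext_single [simp]:
  assumes "Modules.module s" shows "lin_ext s f (Poly_Mapping.single x c) = s c (f x)"
  using lin_ext_superset[OF assms, of "{x}" "Poly_Mapping.single x c" f] by simp

lemmas lin_ext_fscale_hom = lin_ext_hom[OF module_fscale]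

lemma fscale_single [simp]: "fscale c (Poly_Mapping.single x d) = Poly_Mapping.single x (c * d)"
  by (rule poly_mapping_eqI) (simp add: lookup_fscale lookup_single when_def)

lemma sum_single_lookup:
  "(\<Sum>x\<in>Poly_Mapping.keys p. Poly_Mapping.single x (Poly_Mapping.lookup p x)) = p"
proof (rule poly_mapping_eqI)
  fix y
  show "Poly_Mapping.lookup (\<Sum>x\<in>Poly_Mapping.keys p. Poly_Mapping.single x (Poly_Mapping.lookup p x)) y =
      Poly_Mapping.lookup p y"
    by (simp add: lookup_sum lookup_single when_def in_keys_iff)
qed

lemma hom_eq_lin_ext:
  assumes "module_hom fscale s L"
  shows "L p = lin_ext s (\<lambda>x. L (Poly_Mapping.single x 1)) p"
proof -
  interpret L: module_hom fscale s L by fact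
  have "L p = L (\<Sum>x\<in>Poly_Mapping.keys p. fscale (Poly_Mapping.lookup p x) (Poly_Mapping.single x 1))"
    by (simp add: sum_single_lookup)
  also have "\<dots> = lin_ext s (\<lambda>x. L (Poly_Mapping.single x 1)) p"
    by (simp only: L.sum L.scale lin_ext_def)
  finally show ?thesis .
qed

lemma lin_ext_in_subspace:
  assumes s: "Modules.module s" and W: "Modules.module.subspace s W"
    and "\<And>x. x \<in> Poly_Mapping.keys p \<Longrightarrow> f x \<in> W"
  shows "lin_ext s f p \<in> W"
proof -
  interpret Modules.module s by fact
  show ?thesis
    unfolding lin_ext_def using assms(3) by (intro subspace_sum[OF W] subspace_scale[OF W])
qed

lemma hom_in_subspace:
  assumes L: "module_hom fscale s L" and W: "Modules.module.subspace s W"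
    and "\<And>x. x \<in> Poly_Mapping.keys p \<Longrightarrow> L (Poly_Mapping.single x 1) \<in> W"
  shows "L p \<in> W"
proof -
  have "Modules.module s" using L by (simp add: module_hom_def)
  then have "lin_ext s (\<lambda>x. L (Poly_Mapping.single x 1)) p \<in> W"
    using W assms(3) by (rule lin_ext_in_subspace)
  then show ?thesis by (simp only: hom_eq_lin_ext[OF L, of p])
qed

lemma subspace_keys: "fscale.subspace {p :: 'x \<Rightarrow>\<^sub>0 'k::comm_ring_1. Poly_Mapping.keys p \<subseteq> X}"
proof (rule fscale.subspaceI)
  fix p q :: "'x \<Rightarrow>\<^sub>0 'k" assume "p \<in> {p. Poly_Mapping.keys p \<subseteq> X}" "q \<in> {p. Poly_Mapping.keys p \<subseteq> X}"
  then show "p + q \<in> {p. Poly_Mapping.keys p \<subseteq> X}" using keys_add[of p q] by auto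
next
  fix p :: "'x \<Rightarrow>\<^sub>0 'k" and c assume "p \<in> {p. Poly_Mapping.keys p \<subseteq> X}"
  then show "fscale c p \<in> {p. Poly_Mapping.keys p \<subseteq> X}"
    by (fastforce simp: in_keys_iff lookup_fscale)
qed simp

lemma lin_ext_cong:
  "(\<And>x. x \<in> Poly_Mapping.keys p \<Longrightarrow> f x = g x) \<Longrightarrow> lin_ext s f p = lin_ext s g p"
  by (simp add: lin_ext_def)

lemma hom_comp: "\<lbrakk>module_hom s1 s2 f; module_hom s2 s3 g\<rbrakk> \<Longrightarrow> module_hom s1 s3 (\<lambda>x. g (f x))"
  using module_hom_compose[of s1 s2 f s3 g] by (simp add: o_def)

section \<open>Presented modules\<close>

lemma free_module_simps [simp]:
  "carrier (free_module X) = {p. Poly_Mapping.keys p \<subseteq> X}"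
  "\<zero>\<^bsub>free_module X\<^esub> = 0" "p \<oplus>\<^bsub>free_module X\<^esub> q = p + q" "c \<odot>\<^bsub>free_module X\<^esub> p = fscale c p"
  by (simp_all add: free_module_def)

lemma kmodule_free_module: "kmodule (free_module X :: ('k::comm_ring_1, 'x \<Rightarrow>\<^sub>0 'k) module)"
proof -
  note sub = subspace_keys[of X, where ?'k = 'k]
  have "abelian_group (free_module X :: ('k, 'x \<Rightarrow>\<^sub>0 'k) module)"
  proof (rule abelian_groupI; simp only: free_module_simps)
    fix p :: "'x \<Rightarrow>\<^sub>0 'k" assume "p \<in> {p. Poly_Mapping.keys p \<subseteq> X}"
    then show "\<exists>q\<in>{p. Poly_Mapping.keys p \<subseteq> X}. q + p = 0"
      by (intro bexI[of _ "- p"]) (auto simp: in_keys_iff subset_iff)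
  qed (use fscale.subspace_add[OF sub] fscale.subspace_0[OF sub] in \<open>simp_all add: ac_simps\<close>)
  then interpret abelian_group "free_module X :: ('k, 'x \<Rightarrow>\<^sub>0 'k) module" .
  show ?thesis
    by unfold_locales (use fscale.subspace_scale[OF sub] in
      \<open>simp_all add: fscale.scale_left_distrib fscale.scale_right_distrib\<close>)
qed

lemma free_module_minus:
  assumes "p \<in> carrier (free_module X)" "q \<in> carrier (free_module X)"
  shows "p \<ominus>\<^bsub>free_module X\<^esub> q = p - q"
proof -
  interpret kmodule "free_module X" by (rule kmodule_free_module)
  have "- q \<in> carrier (free_module X)" using assms by (auto simp: in_keys_iff subset_iff)
  then have "\<ominus>\<^bsub>free_module X\<^esub> q = - q"
    using assms minus_equality[of "- q" q] by simp
  then show ?thesis by (simp add: minus_eq)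
qed

text \<open>The module with generators \<open>X\<close> and relations \<open>W\<close>. Identities in it are congruences modulo \<open>W\<close> in
  a type of class \<open>ab_group_add\<close>, so that they can be derived with \<open>sum\<close> and ordinary
  rewriting; \<open>cls\<close> transfers them to the quotient.\<close>

locale presented_module =
  fixes X :: "'x set" and W :: "('x \<Rightarrow>\<^sub>0 'k::comm_ring_1) set"
  assumes subspace: "fscale.subspace W" and keys: "p \<in> W \<Longrightarrow> Poly_Mapping.keys p \<subseteq> X"
begin

abbreviation "Q \<equiv> quot_module (free_module X) W"

definition cls :: "('x \<Rightarrow>\<^sub>0 'k) \<Rightarrow> ('x \<Rightarrow>\<^sub>0 'k) set" where
  "cls p = W +>\<^bsub>free_module X\<^esub> p"

definition V :: "('x \<Rightarrow>\<^sub>0 'k) set" where "V = {p. Poly_Mapping.keys p \<subseteq> X}"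

lemma subspace_V: "fscale.subspace V"
  unfolding V_def by (rule subspace_keys)

sublocale ksubmodule "free_module X" W
proof -
  interpret kmodule "free_module X :: ('k, 'x \<Rightarrow>\<^sub>0 'k) module" by (rule kmodule_free_module)
  show "ksubmodule (free_module X) W"
    by unfold_locales
      (use keys fscale.subspace_0[OF subspace] fscale.subspace_add[OF subspace]
        fscale.subspace_scale[OF subspace] in auto)
qed

lemma Q_carrier: "carrier Q = cls ` V"
  using quot_carrier by (simp add: cls_def V_def)

lemma cls_eq_iff: "\<lbrakk>p \<in> V; q \<in> V\<rbrakk> \<Longrightarrow> cls p = cls q \<longleftrightarrow> p - q \<in> W"
  using coset_eq_iff[of p q] free_module_minus[of p X q] by (simp add: cls_def V_def)

lemma Q_zero: "\<zero>\<^bsub>Q\<^esub> = cls 0"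
  using quot_zero by (simp add: cls_def)

lemma Q_add: "\<lbrakk>p \<in> V; q \<in> V\<rbrakk> \<Longrightarrow> cls p \<oplus>\<^bsub>Q\<^esub> cls q = cls (p + q)"
  using quot_add[of p q] by (simp add: cls_def V_def)

lemma Q_smult: "p \<in> V \<Longrightarrow> c \<odot>\<^bsub>Q\<^esub> cls p = cls (fscale c p)"
  using quot_smult[of p c] by (simp add: cls_def V_def)

lemma kmodule_Q: "kmodule Q"
  by (rule kmodule_quot)

lemma Q_minus: "\<lbrakk>p \<in> V; q \<in> V\<rbrakk> \<Longrightarrow> cls p \<ominus>\<^bsub>Q\<^esub> cls q = cls (p - q)"
proof -
  interpret Q: kmodule Q by (rule kmodule_Q)
  assume pq: "p \<in> V" "q \<in> V"
  have "\<ominus>\<^bsub>Q\<^esub> cls q = cls (- q)"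
    using pq Q.smult_minus_one[of "cls q"] by (simp add: Q_carrier Q_smult)
  then show ?thesis
    using pq fscale.subspace_neg[OF subspace_V] by (simp add: Q.minus_eq Q_add)
qed

lemma Q_finsum:
  assumes "finite I" "\<And>i. i \<in> I \<Longrightarrow> f i \<in> V"
  shows "(\<Oplus>\<^bsub>Q\<^esub>i\<in>I. cls (f i)) = cls (sum f I)"
  using assms
proof (induction I)
  case empty
  interpret Q: kmodule Q by (rule kmodule_Q)
  show ?case by (simp add: Q_zero)
next
  case (insert i I)
  interpret Q: kmodule Q by (rule kmodule_Q)
  have "(\<lambda>i. cls (f i)) \<in> I \<rightarrow> carrier Q" "cls (f i) \<in> carrier Q"
    using insert by (auto simp: Q_carrier)
  then show ?case
    using insert fscale.subspace_sum[OF subspace_V, of I f] by (simp add: Q_add)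
qed

end

lemma induced_map_cls:
  assumes "presented_module X W" "presented_module Y U"
    and L: "module_hom fscale fscale (lin_ext fscale f)"
    and V: "\<And>p. p \<in> presented_module.V X \<Longrightarrow> lin_ext fscale f p \<in> presented_module.V Y"
    and W: "\<And>p. p \<in> W \<Longrightarrow> lin_ext fscale f p \<in> U"
    and p: "p \<in> presented_module.V X"
  shows "induced_map Y U f (presented_module.cls X W p) = presented_module.cls Y U (lin_ext fscale f p)"
proof -
  interpret X: presented_module X W by fact
  interpret Y: presented_module Y U by fact
  interpret L: module_hom fscale fscale "lin_ext fscale f" by fact
  have "U +>\<^bsub>free_module Y\<^esub> lin_ext fscale f q = U +>\<^bsub>free_module Y\<^esub> lin_ext fscale f p"
    if q: "q \<in> carrier (free_module X)" "q \<ominus>\<^bsub>free_module X\<^esub> p \<in> W" for q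
  proof -
    have "q \<in> X.V" "q - p \<in> W"
      using q p free_module_minus[of q X p] by (simp_all add: X.V_def)
    then show ?thesis
      using p V W[of "q - p"] Y.cls_eq_iff[of "lin_ext fscale f q" "lin_ext fscale f p"]
      by (simp add: L.diff Y.cls_def)
  qed
  then show ?thesis
    using p X.UN_coset[of p "\<lambda>q. U +>\<^bsub>free_module Y\<^esub> lin_ext fscale f q"]
    by (simp add: induced_map_def X.cls_def Y.cls_def X.V_def)
qed

section \<open>Cyclic modules given by generators and relations\<close>

text \<open>A double sum over faces, split along the diagonal. The simplicial identities make each summand on
  the right vanish, which gives \<open>b b = 0\<close> and \<open>b' b' = 0\<close> at once.\<close>

lemma face_double_sum:
  fixes h :: "nat \<Rightarrow> nat \<Rightarrow> 'a::ab_group_add"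
  shows "(\<Sum>i\<le>m. \<Sum>j\<le>Suc m. h i j) = (\<Sum>i\<le>m. \<Sum>j\<le>i. h i j + h j (Suc i))"
  by (induction m) (simp_all add: sum.distrib algebra_simps)

locale presented_faces =
  fixes X :: "nat \<Rightarrow> 'x set" and W :: "nat \<Rightarrow> ('x \<Rightarrow>\<^sub>0 'k::comm_ring_1) set"
    and face :: "nat \<Rightarrow> nat \<Rightarrow> 'x \<Rightarrow> 'x \<Rightarrow>\<^sub>0 'k"
  assumes presented: "presented_module (X n) (W n)"
    and face_keys: "\<lbrakk>x \<in> X (Suc n); i \<le> Suc n\<rbrakk> \<Longrightarrow> Poly_Mapping.keys (face (Suc n) i x) \<subseteq> X n"
    and face_W: "\<lbrakk>p \<in> W (Suc n); i \<le> Suc n\<rbrakk> \<Longrightarrow> lin_ext fscale (face (Suc n) i) p \<in> W n"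
begin

sublocale M: presented_module "X n" "W n" for n
  by (rule presented)

definition E :: "nat \<Rightarrow> nat \<Rightarrow> ('x \<Rightarrow>\<^sub>0 'k) \<Rightarrow> ('x \<Rightarrow>\<^sub>0 'k)" where
  "E n i p = fscale ((- 1) ^ i) (lin_ext fscale (face n i) p)"

definition bV :: "nat \<Rightarrow> ('x \<Rightarrow>\<^sub>0 'k) \<Rightarrow> ('x \<Rightarrow>\<^sub>0 'k)" where "bV n p = (\<Sum>i\<le>n. E n i p)"
lemma E_hom: "module_hom fscale fscale (E n i)"
  unfolding E_def by (intro fscale_pair.module_hom_scale lin_ext_fscale_hom)

lemma bV_hom: "module_hom fscale fscale (bV n)"
  unfolding bV_def by (intro fscale_pair.module_hom_sum E_hom) auto

lemma hom_V:
  assumes L: "module_hom fscale fscale L" and "\<And>x. x \<in> X n \<Longrightarrow> L (Poly_Mapping.single x 1) \<in> M.V m"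
    and "p \<in> M.V n"
  shows "L p \<in> M.V m"
  by (rule hom_in_subspace[OF L M.subspace_V]) (use assms(2,3) in \<open>auto simp: M.V_def\<close>)

lemma face_V: "\<lbrakk>p \<in> M.V (Suc n); i \<le> Suc n\<rbrakk> \<Longrightarrow> lin_ext fscale (face (Suc n) i) p \<in> M.V n"
  by (rule hom_V[OF lin_ext_fscale_hom]) (use face_keys in \<open>auto simp: module_fscale M.V_def\<close>)

lemma E_V: "\<lbrakk>p \<in> M.V (Suc n); i \<le> Suc n\<rbrakk> \<Longrightarrow> E (Suc n) i p \<in> M.V n"
  unfolding E_def by (intro fscale.subspace_scale[OF M.subspace_V] face_V)

lemma bV_V: "p \<in> M.V (Suc n) \<Longrightarrow> bV (Suc n) p \<in> M.V n"
  unfolding bV_def by (intro fscale.subspace_sum[OF M.subspace_V] E_V) auto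

definition C :: "nat \<Rightarrow> ('k, ('x \<Rightarrow>\<^sub>0 'k) set) module" where
  "C n = quot_module (free_module (X n)) (W n)"

definition d :: "nat \<Rightarrow> nat \<Rightarrow> ('x \<Rightarrow>\<^sub>0 'k) set \<Rightarrow> ('x \<Rightarrow>\<^sub>0 'k) set" where
  "d n i = induced_map (X (n - 1)) (W (n - 1)) (face n i)"

abbreviation "cls n \<equiv> M.cls n"

lemma d_cls: "\<lbrakk>p \<in> M.V (Suc n); i \<le> Suc n\<rbrakk> \<Longrightarrow> d (Suc n) i (cls (Suc n) p) = cls n (lin_ext fscale (face (Suc n) i) p)"
  unfolding d_def diff_Suc_1
  by (rule induced_map_cls[OF presented presented lin_ext_fscale_hom]) (auto intro: face_V face_W)

lemma C_carrier: "carrier (C n) = cls n ` M.V n"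
  by (simp add: C_def M.Q_carrier)

lemma face_sum_cls:
  assumes p: "p \<in> M.V (Suc n)" and I: "I \<subseteq> {..Suc n}"
  shows "(\<Oplus>\<^bsub>C n\<^esub>i\<in>I. (- 1) ^ i \<odot>\<^bsub>C n\<^esub> d (Suc n) i (cls (Suc n) p)) = cls n (\<Sum>i\<in>I. E (Suc n) i p)"
proof -
  interpret Q: kmodule "C n" unfolding C_def by (rule M.kmodule_Q)
  have "(\<Oplus>\<^bsub>C n\<^esub>i\<in>I. (- 1) ^ i \<odot>\<^bsub>C n\<^esub> d (Suc n) i (cls (Suc n) p)) = (\<Oplus>\<^bsub>C n\<^esub>i\<in>I. cls n (E (Suc n) i p))"
  proof (rule Q.finsum_cong')
    show "(\<lambda>i. cls n (E (Suc n) i p)) \<in> I \<rightarrow> carrier (C n)"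
      using E_V[OF p] I by (auto simp: C_def M.Q_carrier)
    show "(- 1) ^ i \<odot>\<^bsub>C n\<^esub> d (Suc n) i (cls (Suc n) p) = cls n (E (Suc n) i p)" if "i \<in> I" for i
    proof -
      have "i \<le> Suc n" using that I by blast
      then show ?thesis
        using p M.Q_smult[OF face_V[OF p]] by (simp add: d_cls C_def E_def)
    qed
  qed simp
  moreover have "E (Suc n) i p \<in> M.V n" if "i \<in> I" for i
    using that I by (intro E_V[OF p]) blast
  ultimately show ?thesis
    using M.Q_finsum[of I "\<lambda>i. E (Suc n) i p" n] finite_subset[OF I] by (simp add: C_def)
qed

lemma b_cls: "p \<in> M.V (Suc n) \<Longrightarrow> b_map C d (Suc n) (cls (Suc n) p) = cls n (bV (Suc n) p)"
  by (simp add: b_map_def face_sum_cls bV_def)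

end

text \<open>The cyclic identities need to hold only on generators and modulo relations. Of the degeneracies
  only the last one is used: \<open>dgn n\<close> inserts the unit at the end. It commutes with all faces but
  the last two, and so contracts the complex for \<open>b'\<close>, which lacks the last face.\<close>

locale cyclic_presentation = presented_faces X W face
  for X :: "nat \<Rightarrow> 'x set" and W :: "nat \<Rightarrow> ('x \<Rightarrow>\<^sub>0 'k::comm_ring_1) set" and face +
  fixes cyc dgn :: "nat \<Rightarrow> 'x \<Rightarrow> 'x \<Rightarrow>\<^sub>0 'k"
  assumes cyc_keys: "x \<in> X n \<Longrightarrow> Poly_Mapping.keys (cyc n x) \<subseteq> X n"
    and cyc_W: "p \<in> W n \<Longrightarrow> lin_ext fscale (cyc n) p \<in> W n"
    and dgn_keys: "x \<in> X n \<Longrightarrow> Poly_Mapping.keys (dgn n x) \<subseteq> X (Suc n)"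
    and dgn_W: "p \<in> W n \<Longrightarrow> lin_ext fscale (dgn n) p \<in> W (Suc n)"
    and face_face: "\<lbrakk>x \<in> X (Suc (Suc n)); j \<le> i; i \<le> Suc n\<rbrakk> \<Longrightarrow>
      lin_ext fscale (face (Suc n) j) (face (Suc (Suc n)) (Suc i) x) -
      lin_ext fscale (face (Suc n) i) (face (Suc (Suc n)) j x) \<in> W n"
    and face_Suc_cyc: "\<lbrakk>x \<in> X (Suc n); i \<le> n\<rbrakk> \<Longrightarrow>
      lin_ext fscale (face (Suc n) (Suc i)) (cyc (Suc n) x) -
      lin_ext fscale (cyc n) (face (Suc n) i x) \<in> W n"
    and face_0_cyc: "x \<in> X (Suc n) \<Longrightarrow>
      lin_ext fscale (face (Suc n) 0) (cyc (Suc n) x) - face (Suc n) (Suc n) x \<in> W n"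
    and cyc_power: "x \<in> X n \<Longrightarrow>
      (lin_ext fscale (cyc n) ^^ Suc n) (Poly_Mapping.single x 1) - Poly_Mapping.single x 1 \<in> W n"
    and face_dgn: "\<lbrakk>x \<in> X (Suc n); i \<le> n\<rbrakk> \<Longrightarrow>
      lin_ext fscale (face (Suc (Suc n)) i) (dgn (Suc n) x) -
      lin_ext fscale (dgn n) (face (Suc n) i x) \<in> W (Suc n)"
    and last_face_dgn: "x \<in> X n \<Longrightarrow>
      lin_ext fscale (face (Suc n) n) (dgn n x) - Poly_Mapping.single x 1 \<in> W n"
begin

definition eqv :: "nat \<Rightarrow> ('x \<Rightarrow>\<^sub>0 'k) \<Rightarrow> ('x \<Rightarrow>\<^sub>0 'k) \<Rightarrow> bool" where
  "eqv n p q \<longleftrightarrow> p - q \<in> W n"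

lemma eqv_refl [simp]: "eqv n p p"
  using fscale.subspace_0[OF M.subspace] by (simp add: eqv_def)

lemma eqv_sym: "eqv n p q \<Longrightarrow> eqv n q p"
  unfolding eqv_def using fscale.subspace_neg[OF M.subspace, of "p - q"] by simp

lemma eqv_trans [trans]: "eqv n p q \<Longrightarrow> eqv n q r \<Longrightarrow> eqv n p r"
  unfolding eqv_def using fscale.subspace_add[OF M.subspace, of "p - q" n "q - r"] by simp

lemma eq_eqv_trans [trans]: "p = q \<Longrightarrow> eqv n q r \<Longrightarrow> eqv n p r"
  by simp

lemma eqv_eq_trans [trans]: "eqv n p q \<Longrightarrow> q = r \<Longrightarrow> eqv n p r"
  by simp

lemma eqv_add: "eqv n p q \<Longrightarrow> eqv n p' q' \<Longrightarrow> eqv n (p + p') (q + q')"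
  unfolding eqv_def using fscale.subspace_add[OF M.subspace, of "p - q" n "p' - q'"]
  by (simp add: algebra_simps)

lemma eqv_diff: "eqv n p q \<Longrightarrow> eqv n p' q' \<Longrightarrow> eqv n (p - p') (q - q')"
  unfolding eqv_def using fscale.subspace_diff[OF M.subspace, of "p - q" n "p' - q'"]
  by (simp add: algebra_simps)

lemma eqv_scale: "eqv n p q \<Longrightarrow> eqv n (fscale c p) (fscale c q)"
  unfolding eqv_def using fscale.subspace_scale[OF M.subspace, of "p - q" n c]
  by (simp add: fscale.scale_right_diff_distrib)

lemma eqv_sum: "(\<And>i. i \<in> I \<Longrightarrow> eqv n (f i) (g i)) \<Longrightarrow> eqv n (sum f I) (sum g I)"
  unfolding eqv_def using fscale.subspace_sum[OF M.subspace, of I "\<lambda>i. f i - g i" n]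
  by (simp add: sum_subtractf)

lemma eqv_on_generators:
  assumes "module_hom fscale fscale f" "module_hom fscale fscale g"
    and "\<And>x. x \<in> Y \<Longrightarrow> eqv n (f (Poly_Mapping.single x 1)) (g (Poly_Mapping.single x 1))"
    and "Poly_Mapping.keys p \<subseteq> Y"
  shows "eqv n (f p) (g p)"
  unfolding eqv_def
  by (rule hom_in_subspace[OF fscale_pair.module_hom_sub[OF assms(1,2)] M.subspace])
    (use assms(3,4) in \<open>auto simp: eqv_def\<close>)

definition \<tau> :: "nat \<Rightarrow> ('x \<Rightarrow>\<^sub>0 'k) \<Rightarrow> ('x \<Rightarrow>\<^sub>0 'k)" where
  "\<tau> n p = fscale ((- 1) ^ n) (lin_ext fscale (cyc n) p)"

definition \<sigma> :: "nat \<Rightarrow> ('x \<Rightarrow>\<^sub>0 'k) \<Rightarrow> ('x \<Rightarrow>\<^sub>0 'k)" where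
  "\<sigma> n p = fscale ((- 1) ^ n) (lin_ext fscale (dgn n) p)"

definition b'V :: "nat \<Rightarrow> ('x \<Rightarrow>\<^sub>0 'k) \<Rightarrow> ('x \<Rightarrow>\<^sub>0 'k)" where "b'V n p = (\<Sum>i<n. E n i p)"
definition NV :: "nat \<Rightarrow> ('x \<Rightarrow>\<^sub>0 'k) \<Rightarrow> ('x \<Rightarrow>\<^sub>0 'k)" where "NV n p = (\<Sum>j\<le>n. (\<tau> n ^^ j) p)"

lemma \<tau>_hom: "module_hom fscale fscale (\<tau> n)"
  unfolding \<tau>_def by (intro fscale_pair.module_hom_scale lin_ext_fscale_hom)

lemma \<sigma>_hom: "module_hom fscale fscale (\<sigma> n)"
  unfolding \<sigma>_def by (intro fscale_pair.module_hom_scale lin_ext_fscale_hom)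

lemma \<tau>_pow_hom: "module_hom fscale fscale (\<tau> n ^^ j)"
proof (induction j)
  case (Suc j)
  then show ?case using hom_comp[OF Suc \<tau>_hom] by (simp add: o_def)
qed (simp add: fscale.module_hom_id[unfolded id_def] id_def)

lemma b'V_hom: "module_hom fscale fscale (b'V n)"
  unfolding b'V_def by (rule fscale_pair.module_hom_sum) (auto intro: E_hom module_fscale)

lemma NV_hom: "module_hom fscale fscale (NV n)"
  unfolding NV_def by (rule fscale_pair.module_hom_sum) (auto intro: \<tau>_pow_hom)

lemma cyc_V: "p \<in> M.V n \<Longrightarrow> lin_ext fscale (cyc n) p \<in> M.V n"
  by (rule hom_V[OF lin_ext_fscale_hom]) (use cyc_keys in \<open>auto simp: module_fscale M.V_def\<close>)

lemma dgn_V: "p \<in> M.V n \<Longrightarrow> lin_ext fscale (dgn n) p \<in> M.V (Suc n)"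
  by (rule hom_V[OF lin_ext_fscale_hom]) (use dgn_keys in \<open>auto simp: module_fscale M.V_def\<close>)

lemma \<tau>_V: "p \<in> M.V n \<Longrightarrow> \<tau> n p \<in> M.V n"
  unfolding \<tau>_def by (intro fscale.subspace_scale[OF M.subspace_V] cyc_V)

lemma \<sigma>_V: "p \<in> M.V n \<Longrightarrow> \<sigma> n p \<in> M.V (Suc n)"
  unfolding \<sigma>_def by (intro fscale.subspace_scale[OF M.subspace_V] dgn_V)

lemma \<tau>_pow_V: "p \<in> M.V n \<Longrightarrow> (\<tau> n ^^ j) p \<in> M.V n"
  by (induction j) (auto intro: \<tau>_V)

lemma b'V_V: "p \<in> M.V (Suc n) \<Longrightarrow> b'V (Suc n) p \<in> M.V n"
  unfolding b'V_def by (intro fscale.subspace_sum[OF M.subspace_V] E_V) auto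

lemma NV_V: "p \<in> M.V n \<Longrightarrow> NV n p \<in> M.V n"
  unfolding NV_def by (intro fscale.subspace_sum[OF M.subspace_V] \<tau>_pow_V)

lemma eqv_hom: "\<lbrakk>module_hom fscale fscale L; \<And>r. r \<in> W n \<Longrightarrow> L r \<in> W m; eqv n p q\<rbrakk> \<Longrightarrow> eqv m (L p) (L q)"
  unfolding eqv_def by (simp add: module_hom.diff[symmetric])

lemma E_eqv: "\<lbrakk>eqv (Suc n) p q; i \<le> Suc n\<rbrakk> \<Longrightarrow> eqv n (E (Suc n) i p) (E (Suc n) i q)"
  by (rule eqv_hom[OF E_hom]) (auto simp: E_def intro: fscale.subspace_scale[OF M.subspace] face_W)

lemma \<tau>_eqv: "eqv n p q \<Longrightarrow> eqv n (\<tau> n p) (\<tau> n q)"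
  by (rule eqv_hom[OF \<tau>_hom]) (auto simp: \<tau>_def intro: fscale.subspace_scale[OF M.subspace] cyc_W)

lemma \<tau>_pow_eqv: "eqv n p q \<Longrightarrow> eqv n ((\<tau> n ^^ j) p) ((\<tau> n ^^ j) q)"
  by (induction j) (auto intro: \<tau>_eqv)

lemma NV_eqv: "eqv n p q \<Longrightarrow> eqv n (NV n p) (NV n q)"
  unfolding NV_def by (intro eqv_sum \<tau>_pow_eqv)

lemma E_E:
  assumes "p \<in> M.V (Suc (Suc n))" "j \<le> i" "i \<le> Suc n"
  shows "eqv n (E (Suc n) j (E (Suc (Suc n)) (Suc i) p)) (- E (Suc n) i (E (Suc (Suc n)) j p))"
proof (rule eqv_on_generators[where Y = "X (Suc (Suc n))" and p = p and f = "\<lambda>p. E (Suc n) j (E (Suc (Suc n)) (Suc i) p)"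
      and g = "\<lambda>p. - E (Suc n) i (E (Suc (Suc n)) j p)"])
  fix x assume x: "x \<in> X (Suc (Suc n))"
  have 1: "E (Suc n) j (E (Suc (Suc n)) (Suc i) (Poly_Mapping.single x 1)) =
      fscale (- ((- 1) ^ (i + j))) (lin_ext fscale (face (Suc n) j) (face (Suc (Suc n)) (Suc i) x))"
    by (simp add: mult.commute E_def module_fscale module_hom.scale[OF lin_ext_fscale_hom] module_hom.neg[OF lin_ext_fscale_hom] power_add)
  have 2: "- E (Suc n) i (E (Suc (Suc n)) j (Poly_Mapping.single x 1)) =
      fscale (- ((- 1) ^ (i + j))) (lin_ext fscale (face (Suc n) i) (face (Suc (Suc n)) j x))"
    by (simp add: E_def module_fscale module_hom.scale[OF lin_ext_fscale_hom] module_hom.neg[OF lin_ext_fscale_hom] power_add)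
  show "eqv n (E (Suc n) j (E (Suc (Suc n)) (Suc i) (Poly_Mapping.single x 1)))
      (- E (Suc n) i (E (Suc (Suc n)) j (Poly_Mapping.single x 1)))"
    unfolding 1 2 by (rule eqv_scale) (use face_face[OF x assms(2,3)] in \<open>simp add: eqv_def\<close>)
qed (use assms in \<open>auto intro: hom_comp[OF E_hom E_hom] fscale_pair.module_hom_neg simp: M.V_def\<close>)

text \<open>With the signs absorbed in \<open>E\<close> and \<open>\<tau>\<close>, the cyclic identities have no signs.\<close>

lemma E_\<tau>:
  assumes "p \<in> M.V (Suc n)" "i \<le> n"
  shows "eqv n (E (Suc n) (Suc i) (\<tau> (Suc n) p)) (\<tau> n (E (Suc n) i p))"
proof (rule eqv_on_generators[where Y = "X (Suc n)" and p = p and f = "\<lambda>p. E (Suc n) (Suc i) (\<tau> (Suc n) p)"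
      and g = "\<lambda>p. \<tau> n (E (Suc n) i p)"])
  fix x assume x: "x \<in> X (Suc n)"
  have 1: "E (Suc n) (Suc i) (\<tau> (Suc n) (Poly_Mapping.single x 1)) =
      fscale ((- 1) ^ (i + n)) (lin_ext fscale (face (Suc n) (Suc i)) (cyc (Suc n) x))"
    by (simp add: E_def \<tau>_def module_fscale module_hom.scale[OF lin_ext_fscale_hom] module_hom.neg[OF lin_ext_fscale_hom] power_add)
  have 2: "\<tau> n (E (Suc n) i (Poly_Mapping.single x 1)) =
      fscale ((- 1) ^ (i + n)) (lin_ext fscale (cyc n) (face (Suc n) i x))"
    by (simp add: E_def \<tau>_def module_fscale module_hom.scale[OF lin_ext_fscale_hom] module_hom.neg[OF lin_ext_fscale_hom] power_add mult.commute)
  show "eqv n (E (Suc n) (Suc i) (\<tau> (Suc n) (Poly_Mapping.single x 1)))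
      (\<tau> n (E (Suc n) i (Poly_Mapping.single x 1)))"
    unfolding 1 2 by (rule eqv_scale) (use face_Suc_cyc[OF x assms(2)] in \<open>simp add: eqv_def\<close>)
qed (use assms in \<open>auto intro: hom_comp[OF \<tau>_hom E_hom] hom_comp[OF E_hom \<tau>_hom] simp: M.V_def\<close>)

lemma E_0_\<tau>:
  assumes "p \<in> M.V (Suc n)"
  shows "eqv n (E (Suc n) 0 (\<tau> (Suc n) p)) (E (Suc n) (Suc n) p)"
proof (rule eqv_on_generators[where Y = "X (Suc n)" and p = p and f = "\<lambda>p. E (Suc n) 0 (\<tau> (Suc n) p)"
      and g = "\<lambda>p. E (Suc n) (Suc n) p"])
  fix x assume x: "x \<in> X (Suc n)"
  have 1: "E (Suc n) 0 (\<tau> (Suc n) (Poly_Mapping.single x 1)) =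
      fscale ((- 1) ^ Suc n) (lin_ext fscale (face (Suc n) 0) (cyc (Suc n) x))"
    by (simp add: E_def \<tau>_def module_fscale module_hom.scale[OF lin_ext_fscale_hom] module_hom.neg[OF lin_ext_fscale_hom])
  have 2: "E (Suc n) (Suc n) (Poly_Mapping.single x 1) = fscale ((- 1) ^ Suc n) (face (Suc n) (Suc n) x)"
    by (simp add: E_def module_fscale)
  show "eqv n (E (Suc n) 0 (\<tau> (Suc n) (Poly_Mapping.single x 1))) (E (Suc n) (Suc n) (Poly_Mapping.single x 1))"
    unfolding 1 2 by (rule eqv_scale) (use face_0_cyc[OF x] in \<open>simp add: eqv_def\<close>)
qed (use assms in \<open>auto intro: hom_comp[OF \<tau>_hom E_hom] E_hom simp: M.V_def\<close>)

lemma \<tau>_power: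
  assumes "p \<in> M.V n"
  shows "eqv n ((\<tau> n ^^ Suc n) p) p"
proof -
  have pow: "(\<tau> n ^^ j) q = fscale ((- 1) ^ (n * j)) ((lin_ext fscale (cyc n) ^^ j) q)" for j q
    by (induction j) (simp_all add: \<tau>_def module_hom.scale[OF lin_ext_fscale_hom] module_hom.neg[OF lin_ext_fscale_hom] power_add)
  have sign: "(- 1 :: 'k) ^ (n * Suc n) = 1"
    by simp
  show ?thesis
  proof (rule eqv_on_generators[where Y = "X n" and p = p and f = "\<lambda>p. (\<tau> n ^^ Suc n) p"
      and g = "\<lambda>p. p"])
    fix x assume "x \<in> X n"
    then show "eqv n ((\<tau> n ^^ Suc n) (Poly_Mapping.single x 1)) (Poly_Mapping.single x 1)"
      unfolding pow sign using cyc_power by (simp add: eqv_def)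
  qed (use assms in \<open>auto intro: \<tau>_pow_hom fscale.module_hom_ident simp: M.V_def simp del: funpow.simps\<close>)
qed

lemma \<sigma>_E:
  assumes "p \<in> M.V (Suc n)" "i \<le> n"
  shows "eqv (Suc n) (E (Suc (Suc n)) i (\<sigma> (Suc n) p)) (- \<sigma> n (E (Suc n) i p))"
proof (rule eqv_on_generators[where Y = "X (Suc n)" and p = p and f = "\<lambda>p. E (Suc (Suc n)) i (\<sigma> (Suc n) p)"
      and g = "\<lambda>p. - \<sigma> n (E (Suc n) i p)"])
  fix x assume x: "x \<in> X (Suc n)"
  have 1: "E (Suc (Suc n)) i (\<sigma> (Suc n) (Poly_Mapping.single x 1)) =
      fscale (- ((- 1) ^ (i + n))) (lin_ext fscale (face (Suc (Suc n)) i) (dgn (Suc n) x))"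
    by (simp add: E_def \<sigma>_def module_fscale module_hom.scale[OF lin_ext_fscale_hom] module_hom.neg[OF lin_ext_fscale_hom] power_add)
  have 2: "- \<sigma> n (E (Suc n) i (Poly_Mapping.single x 1)) =
      fscale (- ((- 1) ^ (i + n))) (lin_ext fscale (dgn n) (face (Suc n) i x))"
    by (simp add: E_def \<sigma>_def module_fscale module_hom.scale[OF lin_ext_fscale_hom] module_hom.neg[OF lin_ext_fscale_hom] power_add mult.commute)
  show "eqv (Suc n) (E (Suc (Suc n)) i (\<sigma> (Suc n) (Poly_Mapping.single x 1)))
      (- \<sigma> n (E (Suc n) i (Poly_Mapping.single x 1)))"
    unfolding 1 2 by (rule eqv_scale) (use face_dgn[OF x assms(2)] in \<open>simp add: eqv_def\<close>)
qed (use assms in \<open>auto intro: hom_comp[OF \<sigma>_hom E_hom] hom_comp[OF E_hom \<sigma>_hom] fscale_pair.module_hom_neg simp: M.V_def\<close>)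

lemma last_E_\<sigma>:
  assumes "p \<in> M.V n"
  shows "eqv n (E (Suc n) n (\<sigma> n p)) p"
proof (rule eqv_on_generators[where Y = "X n" and p = p and f = "\<lambda>p. E (Suc n) n (\<sigma> n p)"
      and g = "\<lambda>p. p"])
  fix x assume x: "x \<in> X n"
  have sign: "(- 1 :: 'k) ^ n * (- 1) ^ n = 1"
    by (simp add: power_mult_distrib[symmetric])
  have "E (Suc n) n (\<sigma> n (Poly_Mapping.single x 1)) = lin_ext fscale (face (Suc n) n) (dgn n x)"
    by (simp add: E_def \<sigma>_def module_fscale module_hom.scale[OF lin_ext_fscale_hom] module_hom.neg[OF lin_ext_fscale_hom] sign)
  then show "eqv n (E (Suc n) n (\<sigma> n (Poly_Mapping.single x 1))) (Poly_Mapping.single x 1)"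
    using last_face_dgn[OF x] by (simp add: eqv_def)
qed (use assms in \<open>auto intro: hom_comp[OF \<sigma>_hom E_hom] fscale.module_hom_ident simp: M.V_def\<close>)

lemma bV_bV: "p \<in> M.V (Suc (Suc n)) \<Longrightarrow> eqv n (bV (Suc n) (bV (Suc (Suc n)) p)) 0"
proof -
  assume p: "p \<in> M.V (Suc (Suc n))"
  have "bV (Suc n) (bV (Suc (Suc n)) p) = (\<Sum>i\<le>Suc n. \<Sum>j\<le>i.
      E (Suc n) i (E (Suc (Suc n)) j p) + E (Suc n) j (E (Suc (Suc n)) (Suc i) p))"
    unfolding bV_def module_hom.sum[OF E_hom] by (rule face_double_sum)
  also have "eqv n \<dots> (\<Sum>i\<le>Suc n. \<Sum>j\<le>i.
      E (Suc n) i (E (Suc (Suc n)) j p) + (- E (Suc n) i (E (Suc (Suc n)) j p)))"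
    by (intro eqv_sum eqv_add eqv_refl E_E[OF p]) auto
  finally show ?thesis by simp
qed

lemma b'V_b'V: "p \<in> M.V (Suc (Suc n)) \<Longrightarrow> eqv n (b'V (Suc n) (b'V (Suc (Suc n)) p)) 0"
proof -
  assume p: "p \<in> M.V (Suc (Suc n))"
  have "b'V (Suc n) (b'V (Suc (Suc n)) p) = (\<Sum>i\<le>n. \<Sum>j\<le>i.
      E (Suc n) i (E (Suc (Suc n)) j p) + E (Suc n) j (E (Suc (Suc n)) (Suc i) p))"
    unfolding b'V_def module_hom.sum[OF E_hom] lessThan_Suc_atMost by (rule face_double_sum)
  also have "eqv n \<dots> (\<Sum>i\<le>n. \<Sum>j\<le>i.
      E (Suc n) i (E (Suc (Suc n)) j p) + (- E (Suc n) i (E (Suc (Suc n)) j p)))"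
    by (intro eqv_sum eqv_add eqv_refl E_E[OF p]) auto
  finally show ?thesis by simp
qed

lemma bV_T:
  assumes p: "p \<in> M.V (Suc n)"
  shows "eqv n (bV (Suc n) (p - \<tau> (Suc n) p)) (b'V (Suc n) p - \<tau> n (b'V (Suc n) p))"
proof -
  have "bV (Suc n) (\<tau> (Suc n) p) = E (Suc n) 0 (\<tau> (Suc n) p) + (\<Sum>i\<le>n. E (Suc n) (Suc i) (\<tau> (Suc n) p))"
    unfolding bV_def by (simp only: sum.atMost_Suc_shift)
  also have "eqv n \<dots> (E (Suc n) (Suc n) p + (\<Sum>i\<le>n. \<tau> n (E (Suc n) i p)))"
    by (intro eqv_add eqv_sum E_\<tau> E_0_\<tau> p) auto
  also have "\<dots> = E (Suc n) (Suc n) p + \<tau> n (b'V (Suc n) p)"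
    by (simp add: b'V_def lessThan_Suc_atMost module_hom.sum[OF \<tau>_hom])
  finally have "eqv n (bV (Suc n) p - bV (Suc n) (\<tau> (Suc n) p))
      (bV (Suc n) p - (E (Suc n) (Suc n) p + \<tau> n (b'V (Suc n) p)))"
    by (intro eqv_diff eqv_refl)
  moreover have "bV (Suc n) p = b'V (Suc n) p + E (Suc n) (Suc n) p"
    by (simp add: bV_def b'V_def lessThan_Suc_atMost)
  ultimately show ?thesis
    by (simp add: module_hom.diff[OF bV_hom])
qed

lemma \<tau>_NV: "p \<in> M.V n \<Longrightarrow> eqv n (\<tau> n (NV n p)) (NV n p)"
proof -
  assume p: "p \<in> M.V n"
  have "\<tau> n (NV n p) = (\<Sum>j\<le>n. (\<tau> n ^^ Suc j) p)"
    by (simp add: NV_def module_hom.sum[OF \<tau>_hom])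
  also have "\<dots> = (\<Sum>j<n. (\<tau> n ^^ Suc j) p) + (\<tau> n ^^ Suc n) p"
    by (simp add: lessThan_Suc_atMost[symmetric])
  also have "eqv n \<dots> ((\<Sum>j<n. (\<tau> n ^^ Suc j) p) + p)"
    by (intro eqv_add eqv_refl \<tau>_power p)
  also have "\<dots> = NV n p"
    by (simp add: NV_def lessThan_Suc_atMost[symmetric] sum.lessThan_Suc_shift del: sum.lessThan_Suc)
  finally show ?thesis .
qed

lemma NV_\<tau>_commute: "NV n (\<tau> n p) = \<tau> n (NV n p)"
  by (simp add: NV_def module_hom.sum[OF \<tau>_hom] funpow_swap1)

lemma NV_\<tau>_pow: "p \<in> M.V n \<Longrightarrow> eqv n (NV n ((\<tau> n ^^ i) p)) (NV n p)"
proof (induction i)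
  case (Suc i)
  have "eqv n (NV n ((\<tau> n ^^ Suc i) p)) (NV n ((\<tau> n ^^ i) p))"
    using \<tau>_NV[OF \<tau>_pow_V[OF Suc.prems]] by (simp add: NV_\<tau>_commute)
  also have "eqv n \<dots> (NV n p)"
    using Suc by simp
  finally show ?case .
qed simp

lemma E_\<tau>_pow:
  assumes "p \<in> M.V (Suc n)" "i \<le> Suc n"
  shows "eqv n (E (Suc n) i ((\<tau> (Suc n) ^^ i) p)) ((\<tau> n ^^ i) (E (Suc n) 0 p))"
  using assms(2)
proof (induction i)
  case (Suc i)
  have "eqv n (E (Suc n) (Suc i) (\<tau> (Suc n) ((\<tau> (Suc n) ^^ i) p)))
      (\<tau> n (E (Suc n) i ((\<tau> (Suc n) ^^ i) p)))"
    using Suc.prems by (intro E_\<tau> \<tau>_pow_V assms) simp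
  also have "eqv n \<dots> (\<tau> n ((\<tau> n ^^ i) (E (Suc n) 0 p)))"
    using Suc by (intro \<tau>_eqv) simp
  finally show ?case by simp
qed simp

text \<open>Both \<open>b' N\<close> and \<open>N b\<close> equal \<open>N E\<^sub>0 N\<close>: each face is a conjugate of \<open>E\<^sub>0\<close> by a power of
  \<open>\<tau>\<close>, which the norm on either side absorbs.\<close>

lemma b'V_NV:
  assumes p: "p \<in> M.V (Suc n)"
  shows "eqv n (b'V (Suc n) (NV (Suc n) p)) (NV n (bV (Suc n) p))"
proof -
  have E_N: "eqv n (E (Suc n) i (NV (Suc n) p)) ((\<tau> n ^^ i) (E (Suc n) 0 (NV (Suc n) p)))"
    if i: "i \<le> Suc n" for i
  proof -
    have "eqv (Suc n) (NV (Suc n) p) ((\<tau> (Suc n) ^^ i) (NV (Suc n) p))"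
    proof (induction i)
      case (Suc i)
      have "eqv (Suc n) (NV (Suc n) p) (\<tau> (Suc n) (NV (Suc n) p))"
        using \<tau>_NV[OF p] by (rule eqv_sym)
      also have "eqv (Suc n) \<dots> (\<tau> (Suc n) ((\<tau> (Suc n) ^^ i) (NV (Suc n) p)))"
        using Suc by (rule \<tau>_eqv)
      finally show ?case by simp
    qed simp
    then have "eqv n (E (Suc n) i (NV (Suc n) p)) (E (Suc n) i ((\<tau> (Suc n) ^^ i) (NV (Suc n) p)))"
      using i by (rule E_eqv)
    also have "eqv n \<dots> ((\<tau> n ^^ i) (E (Suc n) 0 (NV (Suc n) p)))"
      by (rule E_\<tau>_pow[OF NV_V[OF p] i])
    finally show ?thesis .
  qed
  have N_E: "eqv n (NV n (E (Suc n) i p)) (NV n (E (Suc n) 0 ((\<tau> (Suc n) ^^ (Suc (Suc n) - i)) p)))"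
    if i: "i \<le> Suc n" for i
  proof -
    let ?q = "(\<tau> (Suc n) ^^ (Suc (Suc n) - i)) p"
    have "(\<tau> (Suc n) ^^ i) ?q = (\<tau> (Suc n) ^^ Suc (Suc n)) p"
      using i by (simp add: comp_apply[symmetric, of "\<tau> (Suc n) ^^ _" "\<tau> (Suc n) ^^ _"]
          funpow_add[symmetric] del: funpow.simps comp_apply)
    then have "eqv n (E (Suc n) i p) (E (Suc n) i ((\<tau> (Suc n) ^^ i) ?q))"
      using \<tau>_power[OF p] i by (intro E_eqv) (simp_all add: eqv_sym del: funpow.simps)
    also have "eqv n \<dots> ((\<tau> n ^^ i) (E (Suc n) 0 ?q))"
      by (intro E_\<tau>_pow \<tau>_pow_V p i)
    finally have "eqv n (NV n (E (Suc n) i p)) (NV n ((\<tau> n ^^ i) (E (Suc n) 0 ?q)))"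
      by (rule NV_eqv)
    also have "eqv n \<dots> (NV n (E (Suc n) 0 ?q))"
      by (intro NV_\<tau>_pow E_V \<tau>_pow_V p) simp
    finally show ?thesis .
  qed
  have "eqv n (b'V (Suc n) (NV (Suc n) p)) (\<Sum>i<Suc n. (\<tau> n ^^ i) (E (Suc n) 0 (NV (Suc n) p)))"
    unfolding b'V_def by (intro eqv_sum E_N) simp
  also have "\<dots> = NV n (E (Suc n) 0 (NV (Suc n) p))"
    by (simp only: NV_def lessThan_Suc_atMost)
  also have "eqv n \<dots> (NV n (E (Suc n) 0 (\<tau> (Suc n) (NV (Suc n) p))))"
    by (intro NV_eqv E_eqv eqv_sym[OF \<tau>_NV] p) simp
  also have "\<tau> (Suc n) (NV (Suc n) p) = (\<Sum>i\<le>Suc n. (\<tau> (Suc n) ^^ (Suc (Suc n) - i)) p)"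
  proof -
    have "\<tau> (Suc n) (NV (Suc n) p) = (\<Sum>j<Suc (Suc n). (\<tau> (Suc n) ^^ Suc j) p)"
      by (simp only: NV_def module_hom.sum[OF \<tau>_hom] lessThan_Suc_atMost funpow.simps comp_apply)
    also have "\<dots> = (\<Sum>i<Suc (Suc n). (\<tau> (Suc n) ^^ Suc (Suc (Suc n) - Suc i)) p)"
      by (rule sum.nat_diff_reindex[symmetric])
    also have "\<dots> = (\<Sum>i\<le>Suc n. (\<tau> (Suc n) ^^ (Suc (Suc n) - i)) p)"
      unfolding lessThan_Suc_atMost by (intro sum.cong refl) (simp add: Suc_diff_le del: funpow.simps)
    finally show ?thesis .
  qed
  also have "NV n (E (Suc n) 0 (\<Sum>i\<le>Suc n. (\<tau> (Suc n) ^^ (Suc (Suc n) - i)) p)) =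
      (\<Sum>i\<le>Suc n. NV n (E (Suc n) 0 ((\<tau> (Suc n) ^^ (Suc (Suc n) - i)) p)))"
    by (simp only: module_hom.sum[OF E_hom] module_hom.sum[OF NV_hom])
  also have "eqv n \<dots> (\<Sum>i\<le>Suc n. NV n (E (Suc n) i p))"
    by (intro eqv_sum eqv_sym[OF N_E]) simp
  also have "\<dots> = NV n (bV (Suc n) p)"
    by (simp only: bV_def module_hom.sum[OF NV_hom])
  finally show ?thesis .
qed

text \<open>All faces in \<open>b'\<close> but the last commute with \<open>\<sigma>\<close> up to sign, and the last one undoes it.\<close>

lemma homotopyV:
  assumes p: "p \<in> M.V (Suc n)"
  shows "eqv (Suc n) (b'V (Suc (Suc n)) (\<sigma> (Suc n) p) + \<sigma> n (b'V (Suc n) p)) p"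
proof -
  have "b'V (Suc (Suc n)) (\<sigma> (Suc n) p) =
      (\<Sum>i<Suc n. E (Suc (Suc n)) i (\<sigma> (Suc n) p)) + E (Suc (Suc n)) (Suc n) (\<sigma> (Suc n) p)"
    by (simp add: b'V_def)
  also have "eqv (Suc n) \<dots> ((\<Sum>i<Suc n. - \<sigma> n (E (Suc n) i p)) + p)"
    by (intro eqv_add eqv_sum \<sigma>_E last_E_\<sigma> p) auto
  also have "\<dots> = p - \<sigma> n (b'V (Suc n) p)"
    by (simp add: b'V_def module_hom.sum[OF \<sigma>_hom] sum_negf module_hom.add[OF \<sigma>_hom])
  finally show ?thesis
    using eqv_add[OF _ eqv_refl[of "Suc n" "\<sigma> n (b'V (Suc n) p)"]] by fastforce
qed

lemma homotopyV_0: "p \<in> M.V 0 \<Longrightarrow> eqv 0 (b'V (Suc 0) (\<sigma> 0 p)) p"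
  using last_E_\<sigma>[of p 0] by (simp add: b'V_def)

definition t :: "nat \<Rightarrow> ('x \<Rightarrow>\<^sub>0 'k) set \<Rightarrow> ('x \<Rightarrow>\<^sub>0 'k) set" where
  "t n = induced_map (X n) (W n) (cyc n)"

definition s :: "nat \<Rightarrow> ('x \<Rightarrow>\<^sub>0 'k) set \<Rightarrow> ('x \<Rightarrow>\<^sub>0 'k) set" where
  "s n Z = (- 1) ^ n \<odot>\<^bsub>C (Suc n)\<^esub> induced_map (X (Suc n)) (W (Suc n)) (dgn n) Z"

lemma t_cls: "p \<in> M.V n \<Longrightarrow> t n (cls n p) = cls n (lin_ext fscale (cyc n) p)"
  unfolding t_def
  by (rule induced_map_cls[OF presented presented lin_ext_fscale_hom]) (auto intro: cyc_V cyc_W)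

lemma s_cls: "p \<in> M.V n \<Longrightarrow> s n (cls n p) = cls (Suc n) (\<sigma> n p)"
proof -
  assume p: "p \<in> M.V n"
  have "induced_map (X (Suc n)) (W (Suc n)) (dgn n) (cls n p) = cls (Suc n) (lin_ext fscale (dgn n) p)"
    by (rule induced_map_cls[OF presented presented lin_ext_fscale_hom]) (use p in \<open>auto intro: dgn_V dgn_W\<close>)
  then show ?thesis
    using M.Q_smult[OF dgn_V[OF p]] by (simp add: s_def C_def \<sigma>_def)
qed

lemma b'_cls: "p \<in> M.V (Suc n) \<Longrightarrow> b'_map C d (Suc n) (cls (Suc n) p) = cls n (b'V (Suc n) p)"
  unfolding b'_map_def b'V_def diff_Suc_1 by (rule face_sum_cls) auto

lemma tau_cls: "p \<in> M.V n \<Longrightarrow> tau_map C t n (cls n p) = cls n (\<tau> n p)"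
  using M.Q_smult[OF cyc_V] by (simp add: tau_map_def t_cls C_def \<tau>_def)

lemma tau_pow_cls: "p \<in> M.V n \<Longrightarrow> (tau_map C t n ^^ j) (cls n p) = cls n ((\<tau> n ^^ j) p)"
  by (induction j) (simp_all add: tau_cls \<tau>_pow_V)

lemma T_cls: "p \<in> M.V n \<Longrightarrow> one_minus_tau C t n (cls n p) = cls n (p - \<tau> n p)"
  using M.Q_minus[OF _ \<tau>_V] by (simp add: one_minus_tau_def tau_cls C_def)

lemma N_cls: "p \<in> M.V n \<Longrightarrow> norm_map C t n (cls n p) = cls n (NV n p)"
proof -
  assume p: "p \<in> M.V n"
  have "norm_map C t n (cls n p) = (\<Oplus>\<^bsub>C n\<^esub>i\<in>{..n}. cls n ((\<tau> n ^^ i) p))"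
    using p by (simp add: norm_map_def tau_pow_cls)
  then show ?thesis
    using M.Q_finsum[of "{..n}" "\<lambda>i. (\<tau> n ^^ i) p" n] \<tau>_pow_V[OF p] by (simp add: C_def NV_def)
qed

lemma linear_on_classes:
  assumes "module_hom fscale fscale L" "\<And>p. p \<in> M.V n \<Longrightarrow> L p \<in> M.V m"
    and "\<And>p. p \<in> M.V n \<Longrightarrow> f (cls n p) = cls m (L p)"
  shows "f \<in> linear_maps (C n) (C m)"
proof -
  interpret L: module_hom fscale fscale L by fact
  show ?thesis
  proof (rule linear_mapsI)
    fix x y assume "x \<in> carrier (C n)" "y \<in> carrier (C n)"
    then obtain p q where "p \<in> M.V n" "q \<in> M.V n" "x = cls n p" "y = cls n q"
      by (auto simp: C_carrier)
    then show "f (x \<oplus>\<^bsub>C n\<^esub> y) = f x \<oplus>\<^bsub>C m\<^esub> f y"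
      using fscale.subspace_add[OF M.subspace_V] by (simp add: C_def M.Q_add assms L.add)
  next
    fix c x assume "x \<in> carrier (C n)"
    then obtain p where "p \<in> M.V n" "x = cls n p"
      by (auto simp: C_carrier)
    then show "f (c \<odot>\<^bsub>C n\<^esub> x) = c \<odot>\<^bsub>C m\<^esub> f x"
      using fscale.subspace_scale[OF M.subspace_V] by (simp add: C_def M.Q_smult assms L.scale)
  qed (auto simp: C_carrier assms)
qed

lemma cls_eqI: "\<lbrakk>eqv n p q; p \<in> M.V n; q \<in> M.V n\<rbrakk> \<Longrightarrow> cls n p = cls n q"
  by (simp add: M.cls_eq_iff eqv_def)

lemma C_ops: "\<zero>\<^bsub>C n\<^esub> = cls n 0" "\<lbrakk>p \<in> M.V n; q \<in> M.V n\<rbrakk> \<Longrightarrow> cls n p \<oplus>\<^bsub>C n\<^esub> cls n q = cls n (p + q)"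
  by (simp_all add: C_def M.Q_zero M.Q_add)

lemmas V_closed = bV_V b'V_V NV_V \<tau>_V \<sigma>_V fscale.subspace_diff[OF M.subspace_V]
  fscale.subspace_add[OF M.subspace_V] fscale.subspace_0[OF M.subspace_V]

lemma bicomplex: "cyclic_bicomplex C d t s"
proof (rule cyclic_bicomplex.intro)
  show "kmodule (C n)" for n unfolding C_def by (rule M.kmodule_Q)
  show "b_map C d (Suc n) \<in> linear_maps (C (Suc n)) (C n)" for n
    by (rule linear_on_classes[OF bV_hom bV_V b_cls])
  show "b'_map C d (Suc n) \<in> linear_maps (C (Suc n)) (C n)" for n
    by (rule linear_on_classes[OF b'V_hom b'V_V b'_cls])
  show "one_minus_tau C t n \<in> linear_maps (C n) (C n)" for n
    by (rule linear_on_classes[where L = "\<lambda>p. p - \<tau> n p"])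
      (auto intro: fscale_pair.module_hom_sub[OF fscale.module_hom_ident \<tau>_hom] V_closed simp: T_cls)
  show "norm_map C t n \<in> linear_maps (C n) (C n)" for n
    by (rule linear_on_classes[OF NV_hom NV_V N_cls])
  show "s n \<in> linear_maps (C n) (C (Suc n))" for n
    by (rule linear_on_classes[OF \<sigma>_hom \<sigma>_V s_cls])
next
  fix n x assume "x \<in> carrier (C (Suc (Suc n)))"
  then obtain p where x: "x = cls (Suc (Suc n)) p" and p: "p \<in> M.V (Suc (Suc n))"
    by (auto simp: C_carrier)
  show "b_map C d (Suc n) (b_map C d (Suc (Suc n)) x) = \<zero>\<^bsub>C n\<^esub>"
    using bV_bV[OF p] p by (simp add: x b_cls V_closed C_ops cls_eqI)
  show "b'_map C d (Suc n) (b'_map C d (Suc (Suc n)) x) = \<zero>\<^bsub>C n\<^esub>"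
    using b'V_b'V[OF p] p by (simp add: x b'_cls V_closed C_ops cls_eqI)
next
  fix n x assume "x \<in> carrier (C (Suc n))"
  then obtain p where x: "x = cls (Suc n) p" and p: "p \<in> M.V (Suc n)"
    by (auto simp: C_carrier)
  show "b_map C d (Suc n) (one_minus_tau C t (Suc n) x) = one_minus_tau C t n (b'_map C d (Suc n) x)"
    using bV_T[OF p] p by (simp add: x b_cls b'_cls T_cls V_closed cls_eqI)
  show "b'_map C d (Suc n) (norm_map C t (Suc n) x) = norm_map C t n (b_map C d (Suc n) x)"
    using b'V_NV[OF p] p by (simp add: x b_cls b'_cls N_cls V_closed cls_eqI)
  show "b'_map C d (Suc (Suc n)) (s (Suc n) x) \<oplus>\<^bsub>C (Suc n)\<^esub> s n (b'_map C d (Suc n) x) = x"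
    using homotopyV[OF p] p by (simp add: x b'_cls s_cls V_closed C_ops cls_eqI)
next
  fix n x assume "x \<in> carrier (C n)"
  then obtain p where x: "x = cls n p" and p: "p \<in> M.V n"
    by (auto simp: C_carrier)
  have "eqv n (NV n p - \<tau> n (NV n p)) 0" "eqv n (NV n (p - \<tau> n p)) 0"
    using eqv_diff[OF eqv_refl \<tau>_NV[OF p], of "NV n p"]
    by (simp_all add: module_hom.diff[OF NV_hom] NV_\<tau>_commute)
  then show "one_minus_tau C t n (norm_map C t n x) = \<zero>\<^bsub>C n\<^esub>" "norm_map C t n (one_minus_tau C t n x) = \<zero>\<^bsub>C n\<^esub>"
    using p by (simp_all add: x T_cls N_cls V_closed C_ops cls_eqI)
next
  fix x assume "x \<in> carrier (C 0)"
  then obtain p where x: "x = cls 0 p" and p: "p \<in> M.V 0"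
    by (auto simp: C_carrier)
  show "b'_map C d (Suc 0) (s 0 x) = x"
    using homotopyV_0[OF p] p by (simp add: x b'_cls s_cls V_closed cls_eqI)
qed

end

section \<open>Tensor powers\<close>

lemma lin_ext_lin_ext:
  assumes "Modules.module s"
  shows "lin_ext s f (lin_ext fscale g p) = lin_ext s (\<lambda>x. lin_ext s f (g x)) p"
proof -
  interpret L: module_hom fscale s "lin_ext s f" by (rule lin_ext_hom[OF assms])
  show ?thesis
    by (simp add: lin_ext_def[of fscale] lin_ext_def[of s "\<lambda>x. lin_ext s f (g x)"] L.sum L.scale)
qed

lemma hom_lin_ext:
  assumes "module_hom s s' L"
  shows "L (lin_ext s g p) = lin_ext s' (\<lambda>x. L (g x)) p"
proof -
  interpret L: module_hom s s' L by fact
  show ?thesis by (simp add: lin_ext_def L.sum L.scale)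
qed

lemma presented_tensor: "presented_module {as. length as = n} (tensor_rel scale n)"
proof
  show "fscale.subspace (tensor_rel scale n)"
    by (simp add: tensor_rel_def)
  fix p assume "p \<in> tensor_rel scale n"
  moreover have "slot_relations scale {\<lambda>u. xs @ u # ys | xs ys. length xs + 1 + length ys = n} \<subseteq>
      {p. Poly_Mapping.keys p \<subseteq> {as. length as = n}}" (is "?A \<subseteq> ?B")
  proof
    fix p assume "p \<in> ?A"
    then consider
      (add) xs ys u v where "length xs + 1 + length ys = n"
        "p = Poly_Mapping.single (xs @ (u + v) # ys) 1 - Poly_Mapping.single (xs @ u # ys) 1
          - Poly_Mapping.single (xs @ v # ys) 1"
    | (scale) xs ys c u where "length xs + 1 + length ys = n"
        "p = Poly_Mapping.single (xs @ scale c u # ys) 1 - Poly_Mapping.single (xs @ u # ys) c"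
      by (auto simp: slot_relations_def)
    then show "p \<in> ?B"
    proof cases
      case add
      show ?thesis
        unfolding add(2) by (intro fscale.subspace_diff[OF subspace_keys]) (use add(1) in auto)
    next
      case scale
      show ?thesis
        unfolding scale(2) by (intro fscale.subspace_diff[OF subspace_keys]) (use scale(1) in auto)
    qed
  qed
  ultimately show "Poly_Mapping.keys p \<subseteq> {as. length as = n}"
    unfolding tensor_rel_def
    using fscale.span_minimal[OF _ subspace_keys, of _ "{as. length as = n}"] by blast
qed

definition sweedler_sum ::
  "('k::comm_ring_1 \<Rightarrow> 'v::ab_group_add \<Rightarrow> 'v) \<Rightarrow> ('h \<Rightarrow> ('h list \<Rightarrow>\<^sub>0 'k) set)
     \<Rightarrow> 'h \<Rightarrow> ('h \<Rightarrow> 'h \<Rightarrow> 'v) \<Rightarrow> 'v" where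
  "sweedler_sum sv \<Delta> a G = lin_ext sv (\<lambda>as. G (as ! 0) (as ! 1)) (sweedler \<Delta> 1 a)"

lemma hom_sweedler_sum:
  assumes "module_hom s s' L"
  shows "L (sweedler_sum s \<Delta> a G) = sweedler_sum s' \<Delta> a (\<lambda>x y. L (G x y))"
  unfolding sweedler_sum_def by (rule hom_lin_ext[OF assms])

context hopf_algebra
begin

lemma scale_module: "Modules.module scale" ..

definition \<delta> :: "'h \<Rightarrow> 'h list \<Rightarrow>\<^sub>0 'k" where "\<delta> a = representative (\<Delta> a)"

lemma \<delta>_class: "tensor_class scale 2 (\<delta> a) = \<Delta> a" "\<delta> a \<in> presented_module.V {as. length as = 2}"
proof -
  interpret P: presented_module "{as :: 'h list. length as = 2}" "tensor_rel scale 2"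
    by (rule presented_tensor)
  obtain p where p: "p \<in> P.V" "\<Delta> a = P.cls p"
    using comult_closed[of a] by (auto simp: tensor_power_def P.Q_carrier)
  have "p \<in> \<Delta> a"
    using P.a_rcos_self[of p] p by (simp add: P.cls_def P.V_def)
  then have "\<delta> a \<in> \<Delta> a"
    unfolding \<delta>_def representative_def by (rule someI)
  then have "\<delta> a \<in> carrier (free_module {as. length as = 2}) \<and>
      \<delta> a \<ominus>\<^bsub>free_module {as. length as = 2}\<^esub> p \<in> tensor_rel scale 2"
    using P.coset_carrier[of p "\<delta> a"] p by (simp add: P.cls_def P.V_def)
  then have "\<delta> a \<in> P.V \<and> \<delta> a - p \<in> tensor_rel scale 2"
    using free_module_minus[of "\<delta> a" "{as. length as = 2}" p] p by (auto simp: P.V_def)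
  then show "tensor_class scale 2 (\<delta> a) = \<Delta> a" "\<delta> a \<in> P.V"
    using P.cls_eq_iff[of "\<delta> a" p] p by (simp_all add: tensor_class_def P.cls_def)
qed

lemma \<delta>_keys: "as \<in> Poly_Mapping.keys (\<delta> a) \<Longrightarrow> length as = 2"
proof -
  interpret P: presented_module "{as :: 'h list. length as = 2}" "tensor_rel scale 2"
    by (rule presented_tensor)
  show "as \<in> Poly_Mapping.keys (\<delta> a) \<Longrightarrow> length as = 2"
    using \<delta>_class(2)[of a] by (auto simp: P.V_def)
qed

lemma lin_ext_single_1: "lin_ext fscale (\<lambda>x. Poly_Mapping.single x 1) p = p"
  using hom_eq_lin_ext[OF fscale.module_hom_ident, of p] by simp

lemma sweedler_1: "sweedler \<Delta> 1 a = \<delta> a"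
  by (simp add: module_fscale \<delta>_def[symmetric] lin_ext_single_1)

lemma tensor_rel_iff:
  assumes "tensor_class scale n p = tensor_class scale n q"
    and "Poly_Mapping.keys p \<subseteq> {as. length as = n}" "Poly_Mapping.keys q \<subseteq> {as. length as = n}"
  shows "p - q \<in> tensor_rel scale n"
proof -
  interpret P: presented_module "{as :: 'h list. length as = n}" "tensor_rel scale n"
    by (rule presented_tensor)
  show ?thesis
    using assms P.cls_eq_iff[of p q] by (simp add: tensor_class_def P.cls_def P.V_def)
qed

lemma keys_lin_ext:
  "(\<And>x. x \<in> Poly_Mapping.keys p \<Longrightarrow> Poly_Mapping.keys (f x) \<subseteq> Y) \<Longrightarrow>
    Poly_Mapping.keys (lin_ext fscale f p) \<subseteq> Y"
  using lin_ext_in_subspace[OF module_fscale subspace_keys[of Y], of p f] by simp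

lemma \<delta>_add: "\<delta> (a + b) - (\<delta> a + \<delta> b) \<in> tensor_rel scale 2"
proof -
  interpret P: presented_module "{as :: 'h list. length as = 2}" "tensor_rel scale 2"
    by (rule presented_tensor)
  have c: "P.cls = tensor_class scale 2"
    by (rule ext) (simp add: tensor_class_def P.cls_def)
  show ?thesis
    using comult_add[of a b] \<delta>_class P.Q_add[of "\<delta> a" "\<delta> b"]
      P.cls_eq_iff[of "\<delta> (a + b)" "\<delta> a + \<delta> b"] fscale.subspace_add[OF P.subspace_V, of "\<delta> a" "\<delta> b"]
    by (simp add: c tensor_power_def)
qed

lemma \<delta>_scale: "\<delta> (scale c a) - fscale c (\<delta> a) \<in> tensor_rel scale 2"
proof -
  interpret P: presented_module "{as :: 'h list. length as = 2}" "tensor_rel scale 2"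
    by (rule presented_tensor)
  have c: "P.cls = tensor_class scale 2"
    by (rule ext) (simp add: tensor_class_def P.cls_def)
  show ?thesis
    using comult_scale[of c a] \<delta>_class P.Q_smult[of "\<delta> a" c]
      P.cls_eq_iff[of "\<delta> (scale c a)" "fscale c (\<delta> a)"] fscale.subspace_scale[OF P.subspace_V, of "\<delta> a" c]
    by (simp add: c tensor_power_def)
qed

lemma \<delta>_single:
  assumes "\<Delta> a = tensor_class scale 2 (Poly_Mapping.single [x, y] 1)"
  shows "\<delta> a - Poly_Mapping.single [x, y] 1 \<in> tensor_rel scale 2"
  by (rule tensor_rel_iff) (use assms \<delta>_class(1) \<delta>_keys in \<open>auto\<close>)

lemma \<delta>_mult: "\<delta> (a * b) - lin_ext fscale (\<lambda>as. lin_ext fscale (\<lambda>bs.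
    Poly_Mapping.single [as ! 0 * bs ! 0, as ! 1 * bs ! 1] 1) (\<delta> b)) (\<delta> a) \<in> tensor_rel scale 2"
proof (rule tensor_rel_iff)
  show "tensor_class scale 2 (\<delta> (a * b)) = tensor_class scale 2 (lin_ext fscale (\<lambda>as. lin_ext fscale (\<lambda>bs.
      Poly_Mapping.single [as ! 0 * bs ! 0, as ! 1 * bs ! 1] 1) (\<delta> b)) (\<delta> a))"
    using comult_mult[of a b, unfolded sweedler_1] by (simp add: \<delta>_class(1))
  show "Poly_Mapping.keys (\<delta> (a * b)) \<subseteq> {as. length as = 2}"
    using \<delta>_keys by blast
qed (intro keys_lin_ext, simp)

lemma \<delta>_coassoc: "lin_ext fscale (\<lambda>as. lin_ext fscale (\<lambda>bs. Poly_Mapping.single [bs ! 0, bs ! 1, as ! 1] 1)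
      (\<delta> (as ! 0))) (\<delta> a) -
    lin_ext fscale (\<lambda>as. lin_ext fscale (\<lambda>bs. Poly_Mapping.single [as ! 0, bs ! 0, bs ! 1] 1)
      (\<delta> (as ! 1))) (\<delta> a) \<in> tensor_rel scale 3"
  by (rule tensor_rel_iff) (use coassoc[of a, unfolded sweedler_1] in \<open>simp_all add: keys_lin_ext\<close>)

end

section \<open>Sweedler calculus\<close>

text \<open>Values are taken in a module modulo a submodule \<open>R\<close>. Since the tensor powers of \<open>H\<close> are
  given by generators and relations, this is how identities in them can be derived without
  leaving the type of formal sums; \<open>R = {0}\<close> gives the identities in \<open>H\<close> and in the ground ring.\<close>

locale hopf_target = hopf_algebra scale \<Delta> \<epsilon> S + V: Modules.module sv
  for scale :: "'k::comm_ring_1 \<Rightarrow> 'h::ring_1 \<Rightarrow> 'h"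
    and \<Delta> :: "'h \<Rightarrow> ('h list \<Rightarrow>\<^sub>0 'k) set"
    and \<epsilon> :: "'h \<Rightarrow> 'k"
    and S :: "'h \<Rightarrow> 'h"
    and sv :: "'k \<Rightarrow> 'v::ab_group_add \<Rightarrow> 'v" +
  fixes R :: "'v set"
  assumes subspace_R: "V.subspace R"
begin

definition eqv :: "'v \<Rightarrow> 'v \<Rightarrow> bool" (infix "\<approx>" 50) where
  "x \<approx> y \<longleftrightarrow> x - y \<in> R"

lemma eqv_refl [simp, intro]: "x \<approx> x"
  using V.subspace_0[OF subspace_R] by (simp add: eqv_def)

lemma eqv_sym: "x \<approx> y \<Longrightarrow> y \<approx> x"
  unfolding eqv_def using V.subspace_neg[OF subspace_R, of "x - y"] by simp

lemma eqv_trans [trans]: "x \<approx> y \<Longrightarrow> y \<approx> z \<Longrightarrow> x \<approx> z"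
  unfolding eqv_def using V.subspace_add[OF subspace_R, of "x - y" "y - z"] by simp

lemma eq_eqv_trans [trans]: "x = y \<Longrightarrow> y \<approx> z \<Longrightarrow> x \<approx> z"
  by simp

lemma eqv_eq_trans [trans]: "x \<approx> y \<Longrightarrow> y = z \<Longrightarrow> x \<approx> z"
  by simp

lemma eqv_add: "x \<approx> y \<Longrightarrow> x' \<approx> y' \<Longrightarrow> x + x' \<approx> y + y'"
  unfolding eqv_def using V.subspace_add[OF subspace_R, of "x - y" "x' - y'"]
  by (simp add: algebra_simps)

lemma eqv_scale: "x \<approx> y \<Longrightarrow> sv c x \<approx> sv c y"
  unfolding eqv_def using V.subspace_scale[OF subspace_R, of "x - y" c]
  by (simp add: V.scale_right_diff_distrib)

lemma eqv_sum: "(\<And>i. i \<in> I \<Longrightarrow> f i \<approx> g i) \<Longrightarrow> sum f I \<approx> sum g I"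
  unfolding eqv_def using V.subspace_sum[OF subspace_R, of I "\<lambda>i. f i - g i"]
  by (simp add: sum_subtractf)

lemma sv_module: "Modules.module sv" ..

definition lin :: "('h \<Rightarrow> 'v) \<Rightarrow> bool" where
  "lin f \<longleftrightarrow> (\<forall>x y. f (x + y) \<approx> f x + f y) \<and> (\<forall>c x. f (scale c x) \<approx> sv c (f x))"

definition mlin :: "nat \<Rightarrow> ('h list \<Rightarrow> 'v) \<Rightarrow> bool" where
  "mlin n f \<longleftrightarrow> (\<forall>xs ys. length xs + 1 + length ys = n \<longrightarrow> lin (\<lambda>u. f (xs @ u # ys)))"

text \<open>The universal property of the tensor power, for maps that are multilinear modulo \<open>R\<close>. It makes
  sums in Sweedler notation independent of the chosen representatives.\<close>

lemma mlin_tensor_rel: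
  assumes f: "mlin n f" and p: "p \<in> tensor_rel scale n"
  shows "lin_ext sv f p \<in> R"
proof -
  interpret L: module_hom fscale sv "lin_ext sv f" by (rule lin_ext_hom[OF sv_module])
  have "slot_relations scale {\<lambda>u. xs @ u # ys | xs ys. length xs + 1 + length ys = n} \<subseteq>
      {p. lin_ext sv f p \<in> R}" (is "?A \<subseteq> ?B")
  proof
    fix p assume "p \<in> ?A"
    then consider
      (add) xs ys u v where "length xs + 1 + length ys = n"
        "p = Poly_Mapping.single (xs @ (u + v) # ys) 1 - Poly_Mapping.single (xs @ u # ys) 1
          - Poly_Mapping.single (xs @ v # ys) 1"
    | (scale) xs ys c u where "length xs + 1 + length ys = n"
        "p = Poly_Mapping.single (xs @ scale c u # ys) 1 - Poly_Mapping.single (xs @ u # ys) c"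
      by (auto simp: slot_relations_def)
    then show "p \<in> ?B"
    proof cases
      case add
      then have "f (xs @ (u + v) # ys) \<approx> f (xs @ u # ys) + f (xs @ v # ys)"
        using f by (simp add: mlin_def lin_def)
      moreover have "lin_ext sv f p = f (xs @ (u + v) # ys) - f (xs @ u # ys) - f (xs @ v # ys)"
        by (simp only: add(2) L.diff lin_ext_single[OF sv_module] V.scale_one)
      ultimately show ?thesis
        by (simp add: eqv_def diff_diff_eq)
    next
      case scale
      then have "f (xs @ scale c u # ys) \<approx> sv c (f (xs @ u # ys))"
        using f by (simp add: mlin_def lin_def)
      then show ?thesis
        by (simp add: scale eqv_def L.diff sv_module)
    qed
  qed
  then show ?thesis
    using p fscale.span_minimal[OF _ L.subspace_linear_preimage[OF subspace_R]] unfolding tensor_rel_def by blast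
qed

lemma mlin_eqv: "mlin n f \<Longrightarrow> p - q \<in> tensor_rel scale n \<Longrightarrow> lin_ext sv f p \<approx> lin_ext sv f q"
  by (simp only: eqv_def module_hom.diff[OF lin_ext_hom[OF sv_module], symmetric] mlin_tensor_rel)

abbreviation sw :: "'h \<Rightarrow> ('h \<Rightarrow> 'h \<Rightarrow> 'v) \<Rightarrow> 'v" where
  "sw \<equiv> sweedler_sum sv \<Delta>"

abbreviation hsw :: "'h \<Rightarrow> ('h \<Rightarrow> 'h \<Rightarrow> 'h) \<Rightarrow> 'h" where
  "hsw \<equiv> sweedler_sum scale \<Delta>"

lemma sw_def: "sw a G = lin_ext sv (\<lambda>as. G (as ! 0) (as ! 1)) (\<delta> a)"
  by (simp only: sweedler_sum_def sweedler_1)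

lemma hsw_def: "hsw a G = lin_ext scale (\<lambda>as. G (as ! 0) (as ! 1)) (\<delta> a)"
  by (simp only: sweedler_sum_def sweedler_1)

definition bilin :: "('h \<Rightarrow> 'h \<Rightarrow> 'v) \<Rightarrow> bool" where
  "bilin G \<longleftrightarrow> (\<forall>y. lin (\<lambda>x. G x y)) \<and> (\<forall>x. lin (G x))"

lemma length_split_2:
  "length xs + 1 + length ys = 2 \<longleftrightarrow> (\<exists>a. xs = [a] \<and> ys = []) \<or> (\<exists>a. xs = [] \<and> ys = [a])"
  by (cases xs; cases ys) auto

lemma mlin_2: "bilin G \<Longrightarrow> mlin 2 (\<lambda>as. G (as ! 0) (as ! 1))"
  unfolding mlin_def length_split_2 by (auto simp: bilin_def)

lemma lin_ext_eqv: "(\<And>x. x \<in> Poly_Mapping.keys p \<Longrightarrow> f x \<approx> g x) \<Longrightarrow> lin_ext sv f p \<approx> lin_ext sv g p"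
  unfolding lin_ext_def by (intro eqv_sum eqv_scale)

lemma sw_cong: "(\<And>x y. G x y \<approx> G' x y) \<Longrightarrow> sw a G \<approx> sw a G'"
  unfolding sw_def by (rule lin_ext_eqv)

lemma sw_add: "sw a (\<lambda>x y. G x y + G' x y) = sw a G + sw a G'"
  by (simp add: sw_def lin_ext_def V.scale_right_distrib sum.distrib)

lemma sw_scale: "sw a (\<lambda>x y. sv c (G x y)) = sv c (sw a G)"
  by (simp add: sw_def lin_ext_def V.scale_sum_right mult.commute)

lemma sw_swap: "sw a (\<lambda>x y. sw b (\<lambda>u v. G x y u v)) = sw b (\<lambda>u v. sw a (\<lambda>x y. G x y u v))"
  unfolding sw_def lin_ext_def V.scale_sum_right
  by (subst sum.swap) (simp add: mult.commute)

lemma linD: "lin f \<Longrightarrow> f (x + y) \<approx> f x + f y" "lin f \<Longrightarrow> f (scale c x) \<approx> sv c (f x)"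
  by (auto simp: lin_def)

lemma lin_0: "lin f \<Longrightarrow> f 0 \<approx> 0"
  using linD(2)[of f 0 0] by (simp only: V.scale_zero_left scale_zero_left)

lemma lin_sum: "finite I \<Longrightarrow> lin F \<Longrightarrow> F (sum g I) \<approx> (\<Sum>i\<in>I. F (g i))"
proof (induction I rule: finite_induct)
  case (insert i I)
  have "F (g i + sum g I) \<approx> F (g i) + F (sum g I)"
    using insert by (intro linD)
  also have "\<dots> \<approx> F (g i) + (\<Sum>i\<in>I. F (g i))"
    using insert by (intro eqv_add eqv_refl) auto
  finally show ?case using insert by simp
qed (use lin_0 in auto)

lemma lin_lin_ext: "lin F \<Longrightarrow> F (lin_ext scale g p) \<approx> lin_ext sv (\<lambda>x. F (g x)) p"
proof -
  assume F: "lin F"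
  have "F (lin_ext scale g p) \<approx> (\<Sum>x\<in>Poly_Mapping.keys p. F (scale (Poly_Mapping.lookup p x) (g x)))"
    unfolding lin_ext_def by (rule lin_sum[OF _ F]) simp
  also have "\<dots> \<approx> lin_ext sv (\<lambda>x. F (g x)) p"
    unfolding lin_ext_def by (intro eqv_sum linD F)
  finally show ?thesis .
qed

lemma lin_hsw: "lin F \<Longrightarrow> F (hsw a G) \<approx> sw a (\<lambda>x y. F (G x y))"
  unfolding sw_def hsw_def by (rule lin_lin_ext)

lemma bilinD: "bilin G \<Longrightarrow> lin (\<lambda>x. G x y)" "bilin G \<Longrightarrow> lin (G x)"
  by (auto simp: bilin_def)

lemma bilinI: "(\<And>y. lin (\<lambda>x. G x y)) \<Longrightarrow> (\<And>x. lin (\<lambda>y. G x y)) \<Longrightarrow> bilin G"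
  by (auto simp: bilin_def)

lemma lin_sw: "bilin G \<Longrightarrow> lin (\<lambda>a. sw a G)"
proof -
  assume G: "bilin G"
  interpret L: module_hom fscale sv "lin_ext sv (\<lambda>as. G (as ! 0) (as ! 1))" by (rule lin_ext_hom[OF sv_module])
  show ?thesis
    unfolding lin_def sw_def L.add[symmetric] L.scale[symmetric]
    using mlin_eqv[OF mlin_2[OF G] \<delta>_add] mlin_eqv[OF mlin_2[OF G] \<delta>_scale] by blast
qed

lemma lin_sw_body: "(\<And>x y. lin (\<lambda>a. G a x y)) \<Longrightarrow> lin (\<lambda>a. sw b (G a))"
proof -
  assume G: "\<And>x y. lin (\<lambda>a. G a x y)"
  show ?thesis
    unfolding lin_def sw_add[symmetric] sw_scale[symmetric]
    using G by (auto intro!: sw_cong linD)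
qed

lemma lin_comp: "lin F \<Longrightarrow> module_hom scale scale g \<Longrightarrow> lin (\<lambda>a. F (g a))"
  by (simp add: lin_def module_hom.add module_hom.scale)

lemma lin_scale: "lin F \<Longrightarrow> lin (\<lambda>a. sv c (F a))"
  unfolding lin_def
proof (intro conjI allI)
  fix x y assume F: "(\<forall>x y. F (x + y) \<approx> F x + F y) \<and> (\<forall>c x. F (scale c x) \<approx> sv c (F x))"
  show "sv c (F (x + y)) \<approx> sv c (F x) + sv c (F y)"
    using F by (simp add: V.scale_right_distrib[symmetric] eqv_scale)
  show "sv c (F (scale d x)) \<approx> sv d (sv c (F x))" for d
    using F eqv_scale[of "F (scale d x)" "sv d (F x)" c] by (simp add: mult.commute)
qed

lemma lin_scalar: "module_hom scale (*) \<chi> \<Longrightarrow> lin (\<lambda>a. sv (\<chi> a) v)"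
  by (simp add: lin_def module_hom.add module_hom.scale V.scale_left_distrib)

lemma sw_mult:
  "bilin G \<Longrightarrow> sw (a * b) G \<approx> sw a (\<lambda>a1 a2. sw b (\<lambda>b1 b2. G (a1 * b1) (a2 * b2)))"
  using mlin_eqv[OF mlin_2 \<delta>_mult]
  by (simp add: sw_def lin_ext_lin_ext[OF sv_module] sv_module)

lemma length_split_3:
  "length xs + 1 + length ys = 3 \<longleftrightarrow> (\<exists>a b. xs = [a, b] \<and> ys = []) \<or>
    (\<exists>a b. xs = [a] \<and> ys = [b]) \<or> (\<exists>a b. xs = [] \<and> ys = [a, b])"
proof
  assume l: "length xs + 1 + length ys = 3"
  consider "xs = []" | a where "xs = [a]" | a b zs where "xs = a # b # zs"
    by (metis list.exhaust)
  then show "(\<exists>a b. xs = [a, b] \<and> ys = []) \<or> (\<exists>a b. xs = [a] \<and> ys = [b]) \<or>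
      (\<exists>a b. xs = [] \<and> ys = [a, b])"
    using l by cases (auto simp: length_Suc_conv numeral_3_eq_3)
qed auto

lemma sw_coassoc:
  assumes "\<And>y z. lin (\<lambda>x. G x y z)" "\<And>x z. lin (\<lambda>y. G x y z)" "\<And>x y. lin (\<lambda>z. G x y z)"
  shows "sw a (\<lambda>x a3. sw x (\<lambda>a1 a2. G a1 a2 a3)) \<approx> sw a (\<lambda>a1 x. sw x (\<lambda>a2 a3. G a1 a2 a3))"
proof -
  have "mlin 3 (\<lambda>as. G (as ! 0) (as ! 1) (as ! 2))"
    unfolding mlin_def length_split_3 using assms by (auto simp: numeral_2_eq_2)
  from mlin_eqv[OF this \<delta>_coassoc[of a]] show ?thesis
    by (simp add: sw_def lin_ext_lin_ext[OF sv_module] sv_module)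
qed

lemma sw_single:
  assumes "bilin G" "\<Delta> a = tensor_class scale 2 (Poly_Mapping.single [x, y] 1)"
  shows "sw a G \<approx> G x y"
  using mlin_eqv[OF mlin_2[OF assms(1)] \<delta>_single[OF assms(2)]] by (simp add: sw_def sv_module)

lemma sw_one: "bilin G \<Longrightarrow> sw 1 G \<approx> G 1 1"
  by (rule sw_single) (auto simp: comult_one)

lemma \<epsilon>_lin: "module_hom scale (*) \<epsilon>" and \<epsilon>_one [simp]: "\<epsilon> 1 = 1"
  and \<epsilon>_mult: "\<epsilon> (a * b) = \<epsilon> a * \<epsilon> b"
  using counit_character by (auto simp: character_def)

lemma counit_left': "hsw a (\<lambda>x y. scale (\<epsilon> x) y) = a"
  and counit_right': "hsw a (\<lambda>x y. scale (\<epsilon> y) x) = a"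
  and antipode_left': "hsw a (\<lambda>x y. S x * y) = scale (\<epsilon> a) 1"
  and antipode_right': "hsw a (\<lambda>x y. x * S y) = scale (\<epsilon> a) 1"
  using counit_left[of a] counit_right[of a] antipode_left[of a] antipode_right[of a]
  by (simp_all only: sweedler_sum_def)

lemma sw_counit_left: "lin F \<Longrightarrow> sw a (\<lambda>x y. sv (\<epsilon> x) (F y)) \<approx> F a"
proof -
  assume F: "lin F"
  have "sw a (\<lambda>x y. sv (\<epsilon> x) (F y)) \<approx> sw a (\<lambda>x y. F (scale (\<epsilon> x) y))"
    by (intro sw_cong eqv_sym[OF linD(2)[OF F]])
  also have "\<dots> \<approx> F (hsw a (\<lambda>x y. scale (\<epsilon> x) y))"
    by (rule eqv_sym[OF lin_hsw[OF F]])
  finally show ?thesis by (simp only: counit_left')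
qed

lemma sw_counit_right: "lin F \<Longrightarrow> sw a (\<lambda>x y. sv (\<epsilon> y) (F x)) \<approx> F a"
proof -
  assume F: "lin F"
  have "sw a (\<lambda>x y. sv (\<epsilon> y) (F x)) \<approx> sw a (\<lambda>x y. F (scale (\<epsilon> y) x))"
    by (intro sw_cong eqv_sym[OF linD(2)[OF F]])
  also have "\<dots> \<approx> F (hsw a (\<lambda>x y. scale (\<epsilon> y) x))"
    by (rule eqv_sym[OF lin_hsw[OF F]])
  finally show ?thesis by (simp only: counit_right')
qed

lemma sw_antipode_left: "lin F \<Longrightarrow> sw a (\<lambda>x y. F (S x * y)) \<approx> sv (\<epsilon> a) (F 1)"
proof -
  assume F: "lin F"
  have "sw a (\<lambda>x y. F (S x * y)) \<approx> F (hsw a (\<lambda>x y. S x * y))"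
    by (rule eqv_sym[OF lin_hsw[OF F]])
  also have "\<dots> \<approx> sv (\<epsilon> a) (F 1)"
    unfolding antipode_left' by (rule linD(2)[OF F])
  finally show ?thesis .
qed

lemma sw_antipode_right: "lin F \<Longrightarrow> sw a (\<lambda>x y. F (x * S y)) \<approx> sv (\<epsilon> a) (F 1)"
proof -
  assume F: "lin F"
  have "sw a (\<lambda>x y. F (x * S y)) \<approx> F (hsw a (\<lambda>x y. x * S y))"
    by (rule eqv_sym[OF lin_hsw[OF F]])
  also have "\<dots> \<approx> sv (\<epsilon> a) (F 1)"
    unfolding antipode_right' by (rule linD(2)[OF F])
  finally show ?thesis .
qed

lemma hom_mult_left: "module_hom scale scale g \<Longrightarrow> module_hom scale scale (\<lambda>a. c * g a)"
  by (simp add: module_hom_iff distrib_left scale_mult_right)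

lemma hom_mult_right: "module_hom scale scale g \<Longrightarrow> module_hom scale scale (\<lambda>a. g a * c)"
  by (simp add: module_hom_iff distrib_right scale_mult_left)

lemma hom_S: "module_hom scale scale g \<Longrightarrow> module_hom scale scale (\<lambda>a. S (g a))"
  by (rule hom_comp[OF _ antipode_linear])

lemmas hom_intros = hom_mult_left hom_mult_right hom_S module_hom_ident

text \<open>\<open>\<Delta>(S a) = S a\<^sup>(\<^sup>2\<^sup>) \<otimes> S a\<^sup>(\<^sup>1\<^sup>)\<close>: the left-hand side is a left and the right-hand side a right
  convolution inverse of \<open>\<Delta>\<close>, so that both ways to evaluate the product of the three agree.\<close>

lemma sw_S:
  assumes G: "bilin G"
  shows "sw (S a) G \<approx> sw a (\<lambda>x y. G (S y) (S x))"
proof -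
  have G1: "lin (\<lambda>x. G (g x) y)" if "module_hom scale scale g" for g y
    by (rule lin_comp[OF bilinD(1)[OF G] that])
  have G2: "lin (\<lambda>x. G y (g x))" if "module_hom scale scale g" for g y
    by (rule lin_comp[OF bilinD(2)[OF G] that])
  note L = lin_sw_body bilinI hom_intros G1 G2 lin_comp[OF lin_sw]
  let ?F = "\<lambda>a1 a2 a3. sw (S a1) (\<lambda>u v. sw a2 (\<lambda>p q. sw a3 (\<lambda>r s. G (u * (p * S s)) (v * (q * S r)))))"
  have right: "sw y (\<lambda>a2 a3. sw a2 (\<lambda>p q. sw a3 (\<lambda>r s. G (u * (p * S s)) (v * (q * S r))))) \<approx> sv (\<epsilon> y) (G u v)"
    for y u v
  proof -
    have "sw y (\<lambda>a2 a3. sw a2 (\<lambda>p q. sw a3 (\<lambda>r s. G (u * (p * S s)) (v * (q * S r))))) \<approx>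
        sw y (\<lambda>p z. sw z (\<lambda>q a3. sw a3 (\<lambda>r s. G (u * (p * S s)) (v * (q * S r)))))"
      by (rule sw_coassoc) (intro L)+
    also have "\<dots> \<approx> sw y (\<lambda>p z. G (u * (p * S z)) v)"
    proof (rule sw_cong)
      fix p z
      have "sw z (\<lambda>q a3. sw a3 (\<lambda>r s. G (u * (p * S s)) (v * (q * S r)))) \<approx>
          sw z (\<lambda>w s. sw w (\<lambda>q r. G (u * (p * S s)) (v * (q * S r))))"
        by (rule eqv_sym[OF sw_coassoc]) (intro L)+
      also have "\<dots> \<approx> sw z (\<lambda>w s. sv (\<epsilon> w) (G (u * (p * S s)) (v * 1)))"
        by (rule sw_cong, rule sw_antipode_right[where F = "\<lambda>m. G _ (v * m)"]) (intro L)
      also have "\<dots> \<approx> G (u * (p * S z)) (v * 1)"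
        by (rule sw_counit_left) (intro L)
      finally show "sw z (\<lambda>q a3. sw a3 (\<lambda>r s. G (u * (p * S s)) (v * (q * S r)))) \<approx> G (u * (p * S z)) v"
        by simp
    qed
    also have "\<dots> \<approx> sv (\<epsilon> y) (G (u * 1) v)"
      by (rule sw_antipode_right[where F = "\<lambda>m. G (u * m) v"]) (intro L)
    finally show ?thesis by simp
  qed
  have "sw (S a) G \<approx> sw a (\<lambda>a1 y. sv (\<epsilon> y) (sw (S a1) G))"
    by (rule eqv_sym, rule sw_counit_right) (intro L G)
  also have "\<dots> \<approx> sw a (\<lambda>a1 y. sw y (\<lambda>a2 a3. ?F a1 a2 a3))"
  proof (rule sw_cong)
    fix a1 y
    have "sv (\<epsilon> y) (sw (S a1) G) = sw (S a1) (\<lambda>u v. sv (\<epsilon> y) (G u v))"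
      by (simp only: sw_scale)
    also have "\<dots> \<approx> sw (S a1) (\<lambda>u v. sw y (\<lambda>a2 a3. sw a2 (\<lambda>p q. sw a3 (\<lambda>r s. G (u * (p * S s)) (v * (q * S r))))))"
      by (rule sw_cong, rule eqv_sym, rule right)
    also have "\<dots> = sw y (\<lambda>a2 a3. ?F a1 a2 a3)"
      by (rule sw_swap)
    finally show "sv (\<epsilon> y) (sw (S a1) G) \<approx> sw y (\<lambda>a2 a3. ?F a1 a2 a3)" .
  qed
  also have "\<dots> \<approx> sw a (\<lambda>x a3. sw x (\<lambda>a1 a2. ?F a1 a2 a3))"
    by (rule eqv_sym, rule sw_coassoc) (intro L)+
  also have "\<dots> \<approx> sw a (\<lambda>x a3. sv (\<epsilon> x) (sw a3 (\<lambda>r s. G (S s) (S r))))"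
  proof (rule sw_cong)
    fix x a3
    have "sw x (\<lambda>a1 a2. ?F a1 a2 a3) =
        sw x (\<lambda>a1 a2. sw (S a1) (\<lambda>u v. sw a3 (\<lambda>r s. sw a2 (\<lambda>p q. G (u * (p * S s)) (v * (q * S r))))))"
      by (subst sw_swap) (rule refl)
    also have "\<dots> = sw x (\<lambda>a1 a2. sw a3 (\<lambda>r s. sw (S a1) (\<lambda>u v. sw a2 (\<lambda>p q. G (u * (p * S s)) (v * (q * S r))))))"
      by (subst sw_swap) (rule refl)
    also have "\<dots> = sw a3 (\<lambda>r s. sw x (\<lambda>a1 a2. sw (S a1) (\<lambda>u v. sw a2 (\<lambda>p q. G (u * p * S s) (v * q * S r)))))"
      by (subst sw_swap) (simp only: mult.assoc)
    also have "\<dots> \<approx> sw a3 (\<lambda>r s. sw x (\<lambda>a1 a2. sw (S a1 * a2) (\<lambda>m n. G (m * S s) (n * S r))))"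
      by (intro sw_cong, rule eqv_sym, rule sw_mult) (intro L)
    also have "\<dots> \<approx> sw a3 (\<lambda>r s. sv (\<epsilon> x) (sw 1 (\<lambda>m n. G (m * S s) (n * S r))))"
      by (intro sw_cong, rule sw_antipode_left[where F = "\<lambda>b. sw b _"]) (intro L)
    also have "\<dots> \<approx> sw a3 (\<lambda>r s. sv (\<epsilon> x) (G (1 * S s) (1 * S r)))"
      by (intro sw_cong eqv_scale, rule sw_one) (intro L)
    also have "\<dots> = sv (\<epsilon> x) (sw a3 (\<lambda>r s. G (S s) (S r)))"
      by (simp only: sw_scale mult_1_left)
    finally show "sw x (\<lambda>a1 a2. ?F a1 a2 a3) \<approx> sv (\<epsilon> x) (sw a3 (\<lambda>r s. G (S s) (S r)))" .
  qed
  also have "\<dots> \<approx> sw a (\<lambda>r s. G (S s) (S r))"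
    by (rule sw_counit_left) (intro L)
  finally show ?thesis .
qed

end

section \<open>The antipode\<close>

context hopf_target
begin

text \<open>Both sides are convolution inverses of the multiplication of \<open>H\<close>, the left-hand side from the left
  and the right-hand side from the right.\<close>

lemma lin_S_mult:
  assumes F: "lin F"
  shows "F (S (a * b)) \<approx> F (S b * S a)"
proof -
  note L = lin_sw_body bilinI hom_intros lin_comp[OF F] lin_comp[OF lin_sw] lin_scale
  let ?F = "\<lambda>a1 a2 a3 b1 b2 b3. F (S (a1 * b1) * (a2 * (b2 * S b3) * S a3))"
  have "F (S (a * b)) \<approx> sw a (\<lambda>a1 y. sv (\<epsilon> y) (F (S (a1 * b))))"
    by (rule eqv_sym, rule sw_counit_right) (intro L)
  also have "\<dots> \<approx> sw a (\<lambda>a1 y. sv (\<epsilon> y) (sw b (\<lambda>b1 z. sv (\<epsilon> z) (F (S (a1 * b1))))))"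
    by (intro sw_cong eqv_scale, rule eqv_sym, rule sw_counit_right) (intro L)
  also have "\<dots> \<approx> sw a (\<lambda>a1 y. sw b (\<lambda>b1 z. sw z (\<lambda>b2 b3. sw y (\<lambda>a2 a3. ?F a1 a2 a3 b1 b2 b3))))"
  proof (intro sw_cong)
    fix a1 y
    have "sv (\<epsilon> y) (sw b (\<lambda>b1 z. sv (\<epsilon> z) (F (S (a1 * b1))))) =
        sw b (\<lambda>b1 z. sv (\<epsilon> z) (sv (\<epsilon> y) (F (S (a1 * b1) * 1))))"
      by (simp add: sw_scale[symmetric] mult.commute)
    also have "\<dots> \<approx> sw b (\<lambda>b1 z. sv (\<epsilon> z) (sw y (\<lambda>a2 a3. F (S (a1 * b1) * (a2 * 1 * S a3)))))"
      unfolding mult_1_right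
      by (intro sw_cong eqv_scale, rule eqv_sym, rule sw_antipode_right[where F = "\<lambda>m. F (_ * m)", unfolded mult_1_right]) (intro L)
    also have "\<dots> = sw b (\<lambda>b1 z. sw y (\<lambda>a2 a3. sv (\<epsilon> z) (F (S (a1 * b1) * (a2 * 1 * S a3)))))"
      by (simp only: sw_scale)
    also have "\<dots> \<approx> sw b (\<lambda>b1 z. sw y (\<lambda>a2 a3. sw z (\<lambda>b2 b3. ?F a1 a2 a3 b1 b2 b3)))"
      by (intro sw_cong, rule eqv_sym, rule sw_antipode_right[where F = "\<lambda>m. F (_ * (_ * m * _))"]) (intro L)
    also have "\<dots> = sw b (\<lambda>b1 z. sw z (\<lambda>b2 b3. sw y (\<lambda>a2 a3. ?F a1 a2 a3 b1 b2 b3)))"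
      by (subst sw_swap) (rule refl)
    finally show "sv (\<epsilon> y) (sw b (\<lambda>b1 z. sv (\<epsilon> z) (F (S (a1 * b1))))) \<approx>
        sw b (\<lambda>b1 z. sw z (\<lambda>b2 b3. sw y (\<lambda>a2 a3. ?F a1 a2 a3 b1 b2 b3)))" .
  qed
  also have "\<dots> \<approx> sw a (\<lambda>a1 y. sw b (\<lambda>w b3. sw w (\<lambda>b1 b2. sw y (\<lambda>a2 a3. ?F a1 a2 a3 b1 b2 b3))))"
    by (rule sw_cong, rule eqv_sym, rule sw_coassoc) (intro L)+
  also have "\<dots> = sw b (\<lambda>w b3. sw w (\<lambda>b1 b2. sw a (\<lambda>a1 y. sw y (\<lambda>a2 a3. ?F a1 a2 a3 b1 b2 b3))))"
    by (subst sw_swap, subst (2) sw_swap) (rule refl)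
  also have "\<dots> \<approx> sw b (\<lambda>w b3. sw w (\<lambda>b1 b2. sw a (\<lambda>x a3. sw x (\<lambda>a1 a2. ?F a1 a2 a3 b1 b2 b3))))"
    by (rule sw_cong, rule sw_cong, rule eqv_sym, rule sw_coassoc) (intro L)+
  also have "\<dots> = sw b (\<lambda>w b3. sw a (\<lambda>x a3. sw w (\<lambda>b1 b2. sw x (\<lambda>a1 a2. ?F a1 a2 a3 b1 b2 b3))))"
    by (subst sw_swap) (rule refl)
  also have "\<dots> = sw b (\<lambda>w b3. sw a (\<lambda>x a3. sw x (\<lambda>a1 a2. sw w (\<lambda>b1 b2. F (S (a1 * b1) * (a2 * b2) * (S b3 * S a3))))))"
    by (subst (3) sw_swap) (simp only: mult.assoc)
  also have "\<dots> \<approx> sw b (\<lambda>w b3. sw a (\<lambda>x a3. sw (x * w) (\<lambda>u v. F (S u * v * (S b3 * S a3)))))"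
    by (intro sw_cong, rule eqv_sym, rule sw_mult) (intro L)
  also have "\<dots> \<approx> sw b (\<lambda>w b3. sw a (\<lambda>x a3. sv (\<epsilon> (x * w)) (F (1 * (S b3 * S a3)))))"
    by (intro sw_cong, rule sw_antipode_left[where F = "\<lambda>m. F (m * _)"]) (intro L)
  also have "\<dots> = sw b (\<lambda>w b3. sv (\<epsilon> w) (sw a (\<lambda>x a3. sv (\<epsilon> x) (F (S b3 * S a3)))))"
    by (simp add: sw_scale[symmetric] \<epsilon>_mult mult.commute)
  also have "\<dots> \<approx> sw b (\<lambda>w b3. sv (\<epsilon> w) (F (S b3 * S a)))"
    by (intro sw_cong eqv_scale, rule sw_counit_left) (intro L)
  also have "\<dots> \<approx> F (S b * S a)"
    by (rule sw_counit_left) (intro L)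
  finally show ?thesis .
qed

end

lemma scalar_module: "Modules.module ((*) :: 'k::comm_ring_1 \<Rightarrow> 'k \<Rightarrow> 'k)"
  by unfold_locales (simp_all add: algebra_simps)

context hopf_algebra
begin

lemma self_target: "hopf_target scale \<Delta> \<epsilon> S scale {0}"
  by (intro hopf_target.intro hopf_algebra_axioms scale_module hopf_target_axioms.intro) simp

lemma scalar_target: "hopf_target scale \<Delta> \<epsilon> S (*) {0}"
proof -
  interpret M: Modules.module "(*) :: 'k \<Rightarrow> 'k \<Rightarrow> 'k" by (rule scalar_module)
  show ?thesis
    by (intro hopf_target.intro hopf_algebra_axioms scalar_module hopf_target_axioms.intro) simp
qed

lemma S_mult: "S (a * b) = S b * S a"
proof -
  interpret H: hopf_target scale \<Delta> \<epsilon> S scale "{0}" by (rule self_target)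
  have "H.lin (\<lambda>x. x)" by (simp add: H.lin_def H.eqv_def)
  from H.lin_S_mult[OF this] show ?thesis by (simp add: H.eqv_def)
qed

lemma S_one: "S 1 = 1"
proof -
  interpret H: hopf_target scale \<Delta> \<epsilon> S scale "{0}" by (rule self_target)
  have *: "H.lin f" if "module_hom scale scale f" for f
    using that by (simp add: H.lin_def H.eqv_def module_hom.add module_hom.scale)
  have "H.eqv (H.hsw 1 (\<lambda>x y. S x * y)) (S 1 * 1)"
    by (rule H.sw_one) (intro H.bilinI * H.hom_intros)
  then show ?thesis
    by (simp only: H.eqv_def H.antipode_left' H.\<epsilon>_one scale_one mult_1_right singleton_iff right_minus_eq)
qed

lemma \<epsilon>_S: "\<epsilon> (S a) = \<epsilon> a"
proof -
  interpret K: hopf_target scale \<Delta> \<epsilon> S "(*)" "{0}" by (rule scalar_target)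
  have \<epsilon>: "module_hom scale (*) \<epsilon>" by (rule K.\<epsilon>_lin)
  have "\<epsilon> (S a) = \<epsilon> (S (sweedler_sum scale \<Delta> a (\<lambda>x y. scale (\<epsilon> y) x)))"
    by (simp only: K.counit_right')
  also have "\<dots> = sweedler_sum (*) \<Delta> a (\<lambda>x y. \<epsilon> (S (scale (\<epsilon> y) x)))"
    by (rule hom_sweedler_sum[OF hom_comp[OF antipode_linear \<epsilon>]])
  also have "\<dots> = sweedler_sum (*) \<Delta> a (\<lambda>x y. \<epsilon> (S x * y))"
    by (simp add: module_hom.scale[OF antipode_linear] module_hom.scale[OF \<epsilon>] K.\<epsilon>_mult mult.commute)
  also have "\<dots> = \<epsilon> (sweedler_sum scale \<Delta> a (\<lambda>x y. S x * y))"
    by (rule hom_sweedler_sum[OF \<epsilon>, symmetric])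
  also have "\<dots> = \<epsilon> a"
    by (simp add: K.antipode_left' module_hom.scale[OF \<epsilon>])
  finally show ?thesis .
qed

end

section \<open>The twisted antipode\<close>

locale modular_hopf = hopf_algebra scale \<Delta> \<epsilon> S
  for scale :: "'k::comm_ring_1 \<Rightarrow> 'h::ring_1 \<Rightarrow> 'h"
    and \<Delta> :: "'h \<Rightarrow> ('h list \<Rightarrow>\<^sub>0 'k) set"
    and \<epsilon> :: "'h \<Rightarrow> 'k"
    and S :: "'h \<Rightarrow> 'h" +
  fixes \<alpha> \<beta> :: "'h \<Rightarrow> 'k" and \<pi> :: 'h
  assumes \<alpha>: "character scale \<alpha>" and \<beta>: "character scale \<beta>"
    and \<pi>: "grouplike scale \<Delta> \<epsilon> \<pi>" and CM: "condition_CM scale \<Delta> S \<pi> \<alpha> \<beta>"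
begin

lemma \<alpha>_lin: "module_hom scale (*) \<alpha>" and \<alpha>_one [simp]: "\<alpha> 1 = 1" and \<alpha>_mult: "\<alpha> (a * b) = \<alpha> a * \<alpha> b"
  using \<alpha> by (auto simp: character_def)

lemma \<beta>_lin: "module_hom scale (*) \<beta>" and \<beta>_one [simp]: "\<beta> 1 = 1" and \<beta>_mult: "\<beta> (a * b) = \<beta> a * \<beta> b"
  using \<beta> by (auto simp: character_def)

lemma \<pi>_values [simp]: "\<alpha> \<pi> = 1" "\<beta> \<pi> = 1" "\<epsilon> \<pi> = 1"
  using CM \<pi> by (auto simp: condition_CM_def grouplike_def)

text \<open>The twisted antipode \<open>\<alpha> * S\<close>. The first entry of \<open>t\<^sub>n(a\<^sub>1 \<otimes> \<dots> \<otimes> a\<^sub>n)\<close> is \<open>\<pi>\<close> times its value at a product,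
  and like the antipode it reverses products and coproducts; thus \<open>\<alpha>\<close> disappears from the
  calculations.\<close>

definition tw :: "'h \<Rightarrow> 'h" where
  "tw a = sweedler_sum scale \<Delta> a (\<lambda>x y. scale (\<alpha> x) (S y))"

text \<open>What happens to a tensor factor that the cyclic operator moves to the front after \<open>embed\<close> below has
  added the missing factor: \<open>\<theta>(a) = \<alpha>(S(a\<^sup>(\<^sup>2\<^sup>))) \<pi> S\<^sup>2(a\<^sup>(\<^sup>1\<^sup>)) \<pi>\<^sup>-\<^sup>1 \<beta>(a\<^sup>(\<^sup>3\<^sup>))\<close>.\<close>

definition \<theta> :: "'h \<Rightarrow> 'h" where
  "\<theta> a = sweedler_sum scale \<Delta> a (\<lambda>x y. scale (\<beta> y) (\<pi> * tw (\<pi> * S x)))"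

lemma sum_linear:
  assumes "\<And>y. module_hom scale scale (\<lambda>x. G x y)" "\<And>x. module_hom scale scale (\<lambda>y. G x y)"
  shows "module_hom scale scale (\<lambda>a. sweedler_sum scale \<Delta> a G)"
proof -
  interpret H: hopf_target scale \<Delta> \<epsilon> S scale "{0}" by (rule self_target)
  have *: "H.lin f" if "module_hom scale scale f" for f
    using that by (simp add: H.lin_def H.eqv_def module_hom.add module_hom.scale)
  have "H.lin (\<lambda>a. sweedler_sum scale \<Delta> a G)"
    by (intro H.lin_sw H.bilinI * assms)
  then show ?thesis
    by (auto simp: H.lin_def H.eqv_def module_hom_iff scale_module)
qed

lemma hom_scalar_left: "module_hom scale (*) \<chi> \<Longrightarrow> module_hom scale scale (\<lambda>x. scale (\<chi> x) v)"
  by (simp add: module_hom_iff scale_module scale_left_distrib)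

lemma hom_scalar_right: "module_hom scale scale f \<Longrightarrow> module_hom scale scale (\<lambda>x. scale c (f x))"
  by (simp add: module_hom_iff scale_right_distrib mult.commute)

lemma hom_tw: "module_hom scale scale tw"
  unfolding tw_def
  by (intro sum_linear hom_scalar_left \<alpha>_lin hom_scalar_right antipode_linear)

lemma hom_\<theta>: "module_hom scale scale \<theta>"
proof -
  interpret H: hopf_target scale \<Delta> \<epsilon> S scale "{0}" by (rule self_target)
  show ?thesis
    unfolding \<theta>_def
    by (intro sum_linear hom_scalar_left \<beta>_lin hom_scalar_right H.hom_intros hom_comp[OF _ hom_tw])
qed

lemma \<alpha>_tw: "\<alpha> (tw a) = \<epsilon> a"
proof -
  interpret H: hopf_target scale \<Delta> \<epsilon> S scale "{0}" by (rule self_target)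
  have "\<alpha> (tw a) = sweedler_sum (*) \<Delta> a (\<lambda>x y. \<alpha> (x * S y))"
    unfolding tw_def hom_sweedler_sum[OF \<alpha>_lin] by (simp add: module_hom.scale[OF \<alpha>_lin] \<alpha>_mult)
  also have "\<dots> = \<alpha> (sweedler_sum scale \<Delta> a (\<lambda>x y. x * S y))"
    by (rule hom_sweedler_sum[OF \<alpha>_lin, symmetric])
  finally show ?thesis
    by (simp add: H.antipode_right' module_hom.scale[OF \<alpha>_lin])
qed

lemma \<alpha>_\<theta>: "\<alpha> (\<theta> a) = \<beta> a"
proof -
  interpret H: hopf_target scale \<Delta> \<epsilon> S scale "{0}" by (rule self_target)
  have "\<alpha> (\<theta> a) = sweedler_sum (*) \<Delta> a (\<lambda>x y. \<beta> (scale (\<epsilon> x) y))"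
    unfolding \<theta>_def hom_sweedler_sum[OF \<alpha>_lin]
    by (simp add: module_hom.scale[OF \<alpha>_lin] module_hom.scale[OF \<beta>_lin] \<alpha>_mult \<alpha>_tw H.\<epsilon>_mult \<epsilon>_S mult.commute)
  also have "\<dots> = \<beta> (sweedler_sum scale \<Delta> a (\<lambda>x y. scale (\<epsilon> x) y))"
    by (rule hom_sweedler_sum[OF \<beta>_lin, symmetric])
  finally show ?thesis
    by (simp add: H.counit_left')
qed

end

locale modular_target = hopf_target scale \<Delta> \<epsilon> S sv R + modular_hopf scale \<Delta> \<epsilon> S \<alpha> \<beta> \<pi>
  for scale :: "'k::comm_ring_1 \<Rightarrow> 'h::ring_1 \<Rightarrow> 'h"
    and \<Delta> \<epsilon> S and sv :: "'k \<Rightarrow> 'v::ab_group_add \<Rightarrow> 'v" and R \<alpha> \<beta> \<pi>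
begin

lemmas tw_intros = hom_intros hom_comp[OF _ hom_tw] hom_comp[OF _ hom_\<theta>]

lemma sw_\<pi>: "bilin G \<Longrightarrow> sw (\<pi> * a) G \<approx> sw a (\<lambda>x y. G (\<pi> * x) (\<pi> * y))"
proof -
  assume G: "bilin G"
  note L = lin_sw_body bilinI tw_intros lin_comp[OF bilinD(1)[OF G]] lin_comp[OF bilinD(2)[OF G]]
  have "sw (\<pi> * a) G \<approx> sw \<pi> (\<lambda>p q. sw a (\<lambda>x y. G (p * x) (q * y)))"
    by (rule sw_mult[OF G])
  also have "\<dots> \<approx> sw a (\<lambda>x y. G (\<pi> * x) (\<pi> * y))"
    by (rule sw_single) (intro L, use \<pi> in \<open>simp add: grouplike_def\<close>)
  finally show ?thesis .
qed

text \<open>\<open>tw\<close> is a convolution inverse from the left of the identity, up to the character \<open>\<alpha>\<close>: this is what makes a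
  face cancel the first argument of the cyclic operator.\<close>

lemma sw_tw_antipode: "lin F \<Longrightarrow> sw a (\<lambda>x y. F (tw x * y)) \<approx> sv (\<alpha> a) (F 1)"
proof -
  assume F: "lin F"
  note L = lin_sw_body bilinI tw_intros lin_comp[OF F] lin_scale lin_scalar[OF \<alpha>_lin]
  have "sw a (\<lambda>x y. F (tw x * y)) \<approx> sw a (\<lambda>x y. sw x (\<lambda>u v. sv (\<alpha> u) (F (S v * y))))"
  proof (rule sw_cong)
    fix x y
    have "F (tw x * y) = F (hsw x (\<lambda>u v. scale (\<alpha> u) (S v) * y))"
      unfolding tw_def by (subst hom_sweedler_sum[where L = "\<lambda>m. m * y" and s' = scale]) (intro L refl)+
    also have "\<dots> \<approx> sw x (\<lambda>u v. F (scale (\<alpha> u) (S v) * y))"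
      by (rule lin_hsw[OF F])
    also have "\<dots> \<approx> sw x (\<lambda>u v. sv (\<alpha> u) (F (S v * y)))"
      unfolding scale_mult_left by (intro sw_cong linD(2)[OF F])
    finally show "F (tw x * y) \<approx> sw x (\<lambda>u v. sv (\<alpha> u) (F (S v * y)))" .
  qed
  also have "\<dots> \<approx> sw a (\<lambda>u w. sw w (\<lambda>v y. sv (\<alpha> u) (F (S v * y))))"
    by (rule sw_coassoc) (intro L)+
  also have "\<dots> \<approx> sw a (\<lambda>u w. sv (\<epsilon> w) (sv (\<alpha> u) (F 1)))"
  proof (rule sw_cong)
    fix u w
    show "sw w (\<lambda>v y. sv (\<alpha> u) (F (S v * y))) \<approx> sv (\<epsilon> w) (sv (\<alpha> u) (F 1))"
      by (rule sw_antipode_left[where F = "\<lambda>m. sv (\<alpha> u) (F m)"]) (intro lin_scale F)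
  qed
  also have "\<dots> \<approx> sv (\<alpha> a) (F 1)"
    by (rule sw_counit_right) (intro L)
  finally show ?thesis .
qed

lemma lin_tw: "lin F \<Longrightarrow> F (tw x) \<approx> sw x (\<lambda>u v. sv (\<alpha> u) (F (S v)))"
proof -
  assume F: "lin F"
  have "F (tw x) \<approx> sw x (\<lambda>u v. F (scale (\<alpha> u) (S v)))"
    unfolding tw_def by (rule lin_hsw[OF F])
  also have "\<dots> \<approx> sw x (\<lambda>u v. sv (\<alpha> u) (F (S v)))"
    by (intro sw_cong linD(2)[OF F])
  finally show ?thesis .
qed

lemma sw_tw:
  assumes G: "bilin G"
  shows "sw (tw a) G \<approx> sw a (\<lambda>x y. G (S y) (tw x))"
proof -
  note L = lin_sw_body bilinI tw_intros lin_comp[OF bilinD(1)[OF G]] lin_comp[OF bilinD(2)[OF G]]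
    lin_scale lin_scalar[OF \<alpha>_lin]
  have "sw (tw a) G \<approx> sw a (\<lambda>u v. sv (\<alpha> u) (sw (S v) G))"
    by (rule lin_tw[OF lin_sw[OF G]])
  also have "\<dots> \<approx> sw a (\<lambda>u v. sw v (\<lambda>x y. sv (\<alpha> u) (G (S y) (S x))))"
    unfolding sw_scale by (intro sw_cong eqv_scale sw_S G)
  also have "\<dots> \<approx> sw a (\<lambda>w y. sw w (\<lambda>u x. sv (\<alpha> u) (G (S y) (S x))))"
    by (rule eqv_sym, rule sw_coassoc) (intro L)+
  also have "\<dots> \<approx> sw a (\<lambda>w y. G (S y) (tw w))"
    by (rule sw_cong, rule eqv_sym, rule lin_tw) (intro L bilinD[OF G])
  finally show ?thesis .
qed

lemma lin_tw_mult:
  assumes F: "lin F" shows "F (tw (a * b)) \<approx> F (tw b * tw a)"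
proof -
  note L = lin_sw_body bilinI tw_intros lin_comp[OF F] lin_scale lin_scalar[OF \<alpha>_lin]
  have \<alpha>': "module_hom scale (*) (\<lambda>a. \<alpha> (c * a))" "module_hom scale (*) (\<lambda>a. \<alpha> (a * c))" for c
    by (rule hom_comp[OF _ \<alpha>_lin]; intro L)+
  have "F (tw (a * b)) \<approx> sw (a * b) (\<lambda>u v. sv (\<alpha> u) (F (S v)))"
    by (rule lin_tw[OF F])
  also have "\<dots> \<approx> sw a (\<lambda>a1 a2. sw b (\<lambda>b1 b2. sv (\<alpha> (a1 * b1)) (F (S (a2 * b2)))))"
    by (rule sw_mult) (intro L)
  also have "\<dots> = sw a (\<lambda>a1 a2. sv (\<alpha> a1) (sw b (\<lambda>b1 b2. sv (\<alpha> b1) (F (S b2 * S a2)))))"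
    by (simp add: sw_scale[symmetric] \<alpha>_mult S_mult)
  also have "\<dots> \<approx> sw a (\<lambda>a1 a2. sv (\<alpha> a1) (F (tw b * S a2)))"
    by (intro sw_cong eqv_scale, rule eqv_sym, rule lin_tw[where F = "\<lambda>m. F (m * _)"]) (intro L)
  also have "\<dots> \<approx> F (tw b * tw a)"
    by (rule eqv_sym, rule lin_tw[where F = "\<lambda>m. F (_ * m)"]) (intro L)
  finally show ?thesis .
qed

end

context modular_hopf
begin

lemma self_modular_target: "modular_target scale \<Delta> \<epsilon> S scale {0} \<alpha> \<beta> \<pi>"
  by (intro modular_target.intro self_target modular_hopf_axioms)

lemma tw_mult: "tw (a * b) = tw b * tw a"
proof -
  interpret H: modular_target scale \<Delta> \<epsilon> S scale "{0}" by (rule self_modular_target)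
  have "H.lin (\<lambda>x. x)" by (simp add: H.lin_def H.eqv_def)
  from H.lin_tw_mult[OF this] show ?thesis by (simp add: H.eqv_def)
qed

lemma tw_one: "tw 1 = 1"
proof -
  interpret H: modular_target scale \<Delta> \<epsilon> S scale "{0}" by (rule self_modular_target)
  have *: "H.lin f" if "module_hom scale scale f" for f
    using that by (simp add: H.lin_def H.eqv_def module_hom.add module_hom.scale)
  have "H.eqv (tw 1) (scale (\<alpha> 1) (S 1))"
    unfolding tw_def
    by (rule H.sw_one) (intro H.bilinI * hom_scalar_left \<alpha>_lin hom_scalar_right antipode_linear)
  then show ?thesis by (simp add: H.eqv_def S_one)
qed

text \<open>Condition (CM): the square of \<open>\<alpha> * S\<^sub>\<pi> * \<beta>\<close> is the convolution of the character
  \<open>\<beta> \<circ> tw\<close> with \<open>\<theta>\<close>.\<close>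

lemma sum_\<theta>: "sweedler_sum scale \<Delta> a (\<lambda>x y. scale (\<beta> (tw x)) (\<theta> y)) = a"
proof -
  interpret H: modular_target scale \<Delta> \<epsilon> S scale "{0}" by (rule self_modular_target)
  have eqv: "H.eqv x y \<longleftrightarrow> x = y" for x y by (simp add: H.eqv_def)
  have lin: "H.lin f" if "module_hom scale scale f" for f
    using that by (simp add: H.lin_def H.eqv_def module_hom.add module_hom.scale)
  have scalar: "module_hom scale (*) (\<lambda>a. \<chi> (g a))"
    if "module_hom scale scale g" "module_hom scale (*) \<chi>" for \<chi> g
    using that by (rule hom_comp)
  note L = H.lin_sw_body H.bilinI lin H.tw_intros hom_scalar_left hom_scalar_right \<alpha>_lin \<beta>_lin
    scalar[OF _ \<beta>_lin]
  define \<sigma> where "\<sigma> a = H.hsw a (\<lambda>x y. scale (\<beta> y) (\<pi> * tw x))" for a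
  have "convolution scale \<Delta> (\<lambda>a. scale (\<alpha> a) 1) (\<lambda>a. \<pi> * S a) = (\<lambda>a. \<pi> * tw a)"
  proof
    fix a
    have "\<pi> * tw a = H.hsw a (\<lambda>x y. \<pi> * scale (\<alpha> x) (S y))"
      unfolding tw_def by (rule hom_sweedler_sum) (intro L)
    then show "convolution scale \<Delta> (\<lambda>a. scale (\<alpha> a) 1) (\<lambda>a. \<pi> * S a) a = \<pi> * tw a"
      by (simp add: convolution_def sweedler_sum_def scale_mult_left scale_mult_right)
  qed
  then have "convolution scale \<Delta> (convolution scale \<Delta> (\<lambda>a. scale (\<alpha> a) 1) (\<lambda>a. \<pi> * S a))
      (\<lambda>a. scale (\<beta> a) 1) = \<sigma>"
    by (simp add: fun_eq_iff \<sigma>_def convolution_def sweedler_sum_def scale_mult_right)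
  then have \<sigma>\<sigma>: "\<sigma> (\<sigma> a) = a" for a
    using CM by (simp add: condition_CM_def Let_def fun_eq_iff)
  have \<sigma>_hom: "module_hom scale scale \<sigma>"
    unfolding \<sigma>_def by (intro sum_linear L)
  have \<sigma>_tw: "\<sigma> (\<pi> * tw x) = H.hsw x (\<lambda>p q. scale (\<beta> (tw p)) (\<pi> * tw (\<pi> * S q)))" for x
  proof -
    have "H.eqv (\<sigma> (\<pi> * tw x)) (H.hsw (tw x) (\<lambda>u v. scale (\<beta> (\<pi> * v)) (\<pi> * tw (\<pi> * u))))"
      unfolding \<sigma>_def by (rule H.sw_\<pi>) (intro L)
    also have "H.eqv \<dots> (H.hsw x (\<lambda>p q. scale (\<beta> (\<pi> * tw p)) (\<pi> * tw (\<pi> * S q))))"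
      by (rule H.sw_tw) (intro L)
    finally show ?thesis by (simp add: eqv \<beta>_mult)
  qed
  have "a = \<sigma> (H.hsw a (\<lambda>x y. scale (\<beta> y) (\<pi> * tw x)))"
    using \<sigma>\<sigma>[of a] by (simp add: \<sigma>_def)
  also have "\<dots> = H.hsw a (\<lambda>x y. \<sigma> (scale (\<beta> y) (\<pi> * tw x)))"
    by (rule hom_sweedler_sum[OF \<sigma>_hom])
  also have "\<dots> = H.hsw a (\<lambda>x y. H.hsw x (\<lambda>p q. scale (\<beta> y) (scale (\<beta> (tw p)) (\<pi> * tw (\<pi> * S q)))))"
    by (simp only: module_hom.scale[OF \<sigma>_hom] \<sigma>_tw H.sw_scale)
  also have "\<dots> = H.hsw a (\<lambda>p z. H.hsw z (\<lambda>q y. scale (\<beta> y) (scale (\<beta> (tw p)) (\<pi> * tw (\<pi> * S q)))))"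
    by (subst eqv[symmetric], rule H.sw_coassoc) (intro L)+
  also have "\<dots> = H.hsw a (\<lambda>p z. scale (\<beta> (tw p)) (\<theta> z))"
    by (simp only: \<theta>_def H.sw_scale[symmetric] scale_left_commute)
  finally show ?thesis ..
qed

end

section \<open>The diagonal coaction on tensor powers\<close>

text \<open>\<open>coaction_sum\<close> is the sum over the coaction
  \<open>a\<^sub>1 \<otimes> \<dots> \<otimes> a\<^sub>n \<mapsto> a\<^sub>1\<^sup>(\<^sup>1\<^sup>)\<cdots>a\<^sub>n\<^sup>(\<^sup>1\<^sup>) \<otimes> (a\<^sub>1\<^sup>(\<^sup>2\<^sup>) \<otimes> \<dots> \<otimes> a\<^sub>n\<^sup>(\<^sup>2\<^sup>))\<close>.\<close>

primrec coaction_sum ::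
  "('k::comm_ring_1 \<Rightarrow> 'v::ab_group_add \<Rightarrow> 'v) \<Rightarrow> ('h::ring_1 \<Rightarrow> ('h list \<Rightarrow>\<^sub>0 'k) set)
     \<Rightarrow> 'h list \<Rightarrow> ('h \<Rightarrow> 'h list \<Rightarrow> 'v) \<Rightarrow> 'v" where
  "coaction_sum sv \<Delta> [] G = G 1 []"
| "coaction_sum sv \<Delta> (a # as) G =
     sweedler_sum sv \<Delta> a (\<lambda>x y. coaction_sum sv \<Delta> as (\<lambda>z w. G (x * z) (y # w)))"

lemma hom_coaction_sum:
  assumes "module_hom s s' L"
  shows "L (coaction_sum s \<Delta> as G) = coaction_sum s' \<Delta> as (\<lambda>x w. L (G x w))"
  by (induction as arbitrary: G) (simp_all add: hom_sweedler_sum[OF assms])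

context hopf_target
begin

abbreviation "rho \<equiv> coaction_sum sv \<Delta>"

lemma mlin_Suc_iff:
  "mlin (Suc n) f \<longleftrightarrow>
    (\<forall>w. length w = n \<longrightarrow> lin (\<lambda>u. f (u # w))) \<and> (\<forall>a. mlin n (\<lambda>w. f (a # w)))"
proof (intro iffI conjI allI impI)
  assume f: "mlin (Suc n) f"
  show "lin (\<lambda>u. f (u # w))" if "length w = n" for w
    using f[unfolded mlin_def, rule_format, of "[]" w] that by simp
  show "mlin n (\<lambda>w. f (a # w))" for a
    unfolding mlin_def using f[unfolded mlin_def, rule_format, of "a # _"] by simp
next
  assume f: "(\<forall>w. length w = n \<longrightarrow> lin (\<lambda>u. f (u # w))) \<and> (\<forall>a. mlin n (\<lambda>w. f (a # w)))"
  show "mlin (Suc n) f"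
    unfolding mlin_def
  proof (intro allI impI)
    fix xs ys :: "'h list" assume "length xs + 1 + length ys = Suc n"
    then show "lin (\<lambda>u. f (xs @ u # ys))"
      using f by (cases xs) (auto simp: mlin_def)
  qed
qed

lemma mlin_0 [simp]: "mlin 0 f"
  by (simp add: mlin_def)

lemma mlin_sw_body: "(\<And>x y. mlin n (G x y)) \<Longrightarrow> mlin n (\<lambda>w. sw a (\<lambda>x y. G x y w))"
  unfolding mlin_def by (auto intro: lin_sw_body)

lemma mlin_scale: "mlin n f \<Longrightarrow> mlin n (\<lambda>w. sv c (f w))"
  unfolding mlin_def by (auto intro: lin_scale)

lemma rho_cong: "(\<And>x w. length w = length as \<Longrightarrow> G x w \<approx> G' x w) \<Longrightarrow> rho as G \<approx> rho as G'"
proof (induction as arbitrary: G G')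
  case (Cons a as)
  show ?case unfolding coaction_sum.simps
    by (rule sw_cong, rule Cons.IH, rule Cons.prems) simp
qed simp

lemma rho_cong_eq: "(\<And>x w. length w = length as \<Longrightarrow> G x w = G' x w) \<Longrightarrow> rho as G = rho as G'"
proof (induction as arbitrary: G G')
  case (Cons a as)
  have "rho as (\<lambda>z w. G (x * z) (y # w)) = rho as (\<lambda>z w. G' (x * z) (y # w))" for x y
    by (rule Cons.IH, rule Cons.prems) simp
  then show ?case by simp
qed simp

lemma rho_scale: "rho as (\<lambda>x w. sv c (G x w)) = sv c (rho as G)"
  by (induction as arbitrary: G) (simp_all add: sw_scale)

lemma rho_sw_swap: "rho as (\<lambda>x w. sw b (\<lambda>u v. G x w u v)) = sw b (\<lambda>u v. rho as (\<lambda>x w. G x w u v))"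
proof (induction as arbitrary: G)
  case (Cons a as)
  then show ?case by (simp add: Cons) (rule sw_swap)
qed simp

lemma lin_rho_body:
  "(\<And>x w. length w = length as \<Longrightarrow> lin (\<lambda>u. G u x w)) \<Longrightarrow> lin (\<lambda>u. rho as (G u))"
proof (induction as arbitrary: G)
  case (Cons a as)
  show ?case unfolding coaction_sum.simps
    by (rule lin_sw_body, rule Cons.IH, rule Cons.prems) simp
qed simp

lemma mlin_rho:
  assumes "\<And>w. length w = n \<Longrightarrow> lin (\<lambda>x. G x w)" "\<And>x. mlin n (G x)"
  shows "mlin n (\<lambda>as. rho as G)"
  using assms
proof (induction n arbitrary: G)
  case (Suc n)
  have 1: "lin (\<lambda>x. G (x * z) w)" if "length w = Suc n" for z w
    by (rule lin_comp[OF Suc.prems(1)[OF that]]) (intro hom_intros)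
  have 0: "lin (\<lambda>x. G (z * x) w)" if "length w = Suc n" for z w
    by (rule lin_comp[OF Suc.prems(1)[OF that]]) (intro hom_intros)
  have 2: "lin (\<lambda>y. G x (y # w))" if "length w = n" for x w
    using Suc.prems(2)[of x] that by (simp add: mlin_Suc_iff)
  have 3: "mlin n (\<lambda>w. G x (y # w))" for x y
    using Suc.prems(2)[of x] by (simp add: mlin_Suc_iff)
  show ?case
    unfolding mlin_Suc_iff coaction_sum.simps
  proof (intro conjI allI impI)
    fix w :: "'h list" assume "length w = n"
    then show "lin (\<lambda>u. sw u (\<lambda>x y. rho w (\<lambda>z w. G (x * z) (y # w))))"
      by (intro lin_sw bilinI lin_rho_body 1 2) simp_all
  next
    fix a
    show "mlin n (\<lambda>w. sw a (\<lambda>x y. rho w (\<lambda>z w. G (x * z) (y # w))))"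
      by (intro mlin_sw_body Suc.IH 0 3) simp
  qed
qed simp

text \<open>Coassociativity and counit of the coaction.\<close>

lemma rho_rho:
  assumes "\<And>x' w. length w = length as \<Longrightarrow> lin (\<lambda>x. F x x' w)"
    and "\<And>x w. length w = length as \<Longrightarrow> lin (\<lambda>x'. F x x' w)" and "\<And>x x'. mlin (length as) (F x x')"
  shows "rho as (\<lambda>x w. rho w (\<lambda>x' w'. F x x' w')) \<approx> rho as (\<lambda>X w. sw X (\<lambda>x x'. F x x' w))"
  using assms
proof (induction as arbitrary: F)
  case Nil
  have "sw 1 (\<lambda>x x'. F x x' []) \<approx> F 1 1 []"
    by (rule sw_one) (intro bilinI Nil, simp_all)
  then show ?case by (simp add: eqv_sym)
next
  case (Cons a as)
  have 1: "lin (\<lambda>x. F (g x) x' w)" if "length w = Suc (length as)" "module_hom scale scale g" for g x' w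
    by (rule lin_comp[OF Cons.prems(1) that(2)]) (use that in simp)
  have 2: "lin (\<lambda>x. F x' (g x) w)" if "length w = Suc (length as)" "module_hom scale scale g" for g x' w
    by (rule lin_comp[OF Cons.prems(2) that(2)]) (use that in simp)
  have 3: "lin (\<lambda>y. F x x' (y # w))" if "length w = length as" for x x' w
    using Cons.prems(3)[of x x'] that by (simp add: mlin_Suc_iff)
  have 4: "mlin (length as) (\<lambda>w. F x x' (y # w))" for x x' y
    using Cons.prems(3)[of x x'] by (simp add: mlin_Suc_iff)
  have "rho (a # as) (\<lambda>x w. rho w (\<lambda>x' w'. F x x' w')) =
      sw a (\<lambda>a1 y. sw y (\<lambda>a2 a3. rho as (\<lambda>x w. rho w (\<lambda>x' w'. F (a1 * x) (a2 * x') (a3 # w')))))"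
    by (simp add: rho_sw_swap)
  also have "\<dots> \<approx> sw a (\<lambda>a1 y. sw y (\<lambda>a2 a3. rho as (\<lambda>X w. sw X (\<lambda>x x'. F (a1 * x) (a2 * x') (a3 # w)))))"
    by (rule sw_cong, rule sw_cong, (rule Cons.IH; (intro 1 2 4 hom_intros; simp)))
  also have "\<dots> \<approx> sw a (\<lambda>b a3. sw b (\<lambda>a1 a2. rho as (\<lambda>X w. sw X (\<lambda>x x'. F (a1 * x) (a2 * x') (a3 # w)))))"
    by (rule eqv_sym, (rule sw_coassoc; (intro lin_rho_body lin_sw_body 1 2 3 hom_intros; simp)))
  also have "\<dots> = sw a (\<lambda>b a3. rho as (\<lambda>X w. sw b (\<lambda>a1 a2. sw X (\<lambda>x x'. F (a1 * x) (a2 * x') (a3 # w)))))"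
    by (simp add: rho_sw_swap)
  also have "\<dots> \<approx> sw a (\<lambda>b a3. rho as (\<lambda>X w. sw (b * X) (\<lambda>x x'. F x x' (a3 # w))))"
    by (rule sw_cong, rule rho_cong, rule eqv_sym, rule sw_mult) (intro bilinI Cons.prems(1,2), simp_all)
  also have "\<dots> = rho (a # as) (\<lambda>X w. sw X (\<lambda>x x'. F x x' w))"
    by simp
  finally show ?case .
qed

lemma rho_counit: "mlin (length as) F \<Longrightarrow> rho as (\<lambda>x w. sv (\<epsilon> x) (F w)) \<approx> F as"
proof (induction as arbitrary: F)
  case (Cons a as)
  have 1: "lin (\<lambda>y. F (y # as))" and 2: "mlin (length as) (\<lambda>w. F (y # w))" for y
    using Cons.prems by (simp_all add: mlin_Suc_iff)
  have "rho (a # as) (\<lambda>x w. sv (\<epsilon> x) (F w)) =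
      sw a (\<lambda>a1 a2. sv (\<epsilon> a1) (rho as (\<lambda>x w. sv (\<epsilon> x) (F (a2 # w)))))"
    by (simp add: \<epsilon>_mult rho_scale[symmetric])
  also have "\<dots> \<approx> sw a (\<lambda>a1 a2. sv (\<epsilon> a1) (F (a2 # as)))"
    by (rule sw_cong, rule eqv_scale, rule Cons.IH, rule 2)
  also have "\<dots> \<approx> F (a # as)"
    by (rule sw_counit_left[where F = "\<lambda>y. F (y # as)"]) (rule 1)
  finally show ?case .
qed simp

lemma rho_snoc: "rho (as @ [a]) G = rho as (\<lambda>x w. sw a (\<lambda>y z. G (x * y) (w @ [z])))"
  by (induction as arbitrary: G) (simp_all add: mult.assoc)

text \<open>The coaction is multiplicative, so it does not matter whether two neighbours are multiplied before
  or after it.\<close>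

lemma rho_merge:
  assumes "\<And>w. length w = Suc (length xs + length ys) \<Longrightarrow> lin (\<lambda>x. G x w)"
    and "\<And>x. mlin (Suc (length xs + length ys)) (G x)"
  shows "rho (xs @ a * b # ys) G \<approx> rho (xs @ a # b # ys)
    (\<lambda>x w. G x (take (length xs) w @ (w ! length xs * w ! Suc (length xs)) # drop (Suc (Suc (length xs))) w))"
  using assms
proof (induction xs arbitrary: G)
  case Nil
  have 1: "lin (\<lambda>x. G (g x) w)" if "length w = Suc (length ys)" "module_hom scale scale g" for g w
    by (rule lin_comp[OF Nil.prems(1) that(2)]) (use that in simp)
  have 2: "lin (\<lambda>y. G x (y # w))" if "length w = length ys" for x w
    using Nil.prems(2)[of x] that by (simp add: mlin_Suc_iff)
  have "rho (a * b # ys) G \<approx> sw a (\<lambda>a1 a2. sw b (\<lambda>b1 b2. rho ys (\<lambda>z w. G (a1 * b1 * z) (a2 * b2 # w))))"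
    unfolding coaction_sum.simps
    by (rule sw_mult) (intro bilinI lin_rho_body 1 2 hom_intros, simp_all)
  then show ?case by (simp add: mult.assoc)
next
  case (Cons c xs)
  have 1: "lin (\<lambda>x. G (c * x) (d # w))" if "length w = Suc (length xs + length ys)" for c d w
    by (rule lin_comp[OF Cons.prems(1)]) (use that in simp, intro hom_intros)
  have 2: "mlin (Suc (length xs + length ys)) (\<lambda>w. G x (d # w))" for x d
    using Cons.prems(2)[of x] by (simp add: mlin_Suc_iff)
  show ?case
    using Cons.IH[of "\<lambda>x w. G (_ * x) (_ # w)", OF 1 2] by (simp add: sw_cong)
qed

text \<open>The sum over \<open>sweedler3_list\<close> iterates the coaction twice.\<close>

lemma sweedler_2: "lin_ext sv f (sweedler \<Delta> 2 a) = sw a (\<lambda>u v. sw u (\<lambda>p q. f [p, q, v]))"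
proof -
  have "sweedler \<Delta> 2 a = lin_ext fscale (\<lambda>as. lin_ext fscale (\<lambda>bs. Poly_Mapping.single (bs @ tl as) 1)
       (\<delta> (hd as))) (\<delta> a)"
    using sweedler_1[of a] by (simp add: numeral_2_eq_2 \<delta>_def[symmetric])
  then have "lin_ext sv f (sweedler \<Delta> 2 a) =
      lin_ext sv (\<lambda>as. lin_ext sv (\<lambda>bs. f (bs @ tl as)) (\<delta> (hd as))) (\<delta> a)"
    by (simp add: lin_ext_lin_ext[OF sv_module] sv_module)
  also have "\<dots> = sw a (\<lambda>u v. sw u (\<lambda>p q. f [p, q, v]))"
    unfolding sw_def
  proof (intro lin_ext_cong)
    fix as assume "as \<in> Poly_Mapping.keys (\<delta> a)"
    then obtain u v where as: "as = [u, v]"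
      using \<delta>_keys[of as a] by (auto simp: numeral_2_eq_2 length_Suc_conv)
    show "lin_ext sv (\<lambda>bs. f (bs @ tl as)) (\<delta> (hd as)) =
        lin_ext sv (\<lambda>bs. f [bs ! 0, bs ! 1, as ! 1]) (\<delta> (as ! 0))"
      unfolding as
    proof (simp, intro lin_ext_cong)
      fix bs assume "bs \<in> Poly_Mapping.keys (\<delta> u)"
      then obtain p q where "bs = [p, q]"
        using \<delta>_keys[of bs u] by (auto simp: numeral_2_eq_2 length_Suc_conv)
      then show "f (bs @ [v]) = f [bs ! 0, bs ! Suc 0, v]" by simp
    qed
  qed
  finally show ?thesis .
qed

lemma sweedler3_list_sum:
  assumes "\<And>y w. length w = length as \<Longrightarrow> lin (\<lambda>x. K x y w)"
    and "\<And>x w. length w = length as \<Longrightarrow> lin (\<lambda>y. K x y w)" and "\<And>x y. mlin (length as) (K x y)"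
  shows "lin_ext sv (\<lambda>xs. K (prod_list (map (\<lambda>x. x ! 0) xs)) (prod_list (map (\<lambda>x. x ! 1) xs)) (map (\<lambda>x. x ! 2) xs))
      (sweedler3_list \<Delta> as) \<approx> rho as (\<lambda>X w. sw X (\<lambda>x y. K x y w))"
  using assms
proof (induction as arbitrary: K)
  case Nil
  have "sw 1 (\<lambda>x y. K x y []) \<approx> K 1 1 []"
    by (rule sw_one) (intro bilinI Nil, simp_all)
  then show ?case by (simp add: eqv_sym sv_module)
next
  case (Cons a as)
  have 1: "lin (\<lambda>x. K (g x) x' w)" if "length w = Suc (length as)" "module_hom scale scale g" for g x' w
    by (rule lin_comp[OF Cons.prems(1) that(2)]) (use that in simp)
  have 2: "lin (\<lambda>x. K x' (g x) w)" if "length w = Suc (length as)" "module_hom scale scale g" for g x' w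
    by (rule lin_comp[OF Cons.prems(2) that(2)]) (use that in simp)
  have 4: "mlin (length as) (\<lambda>w. K x x' (y # w))" for x x' y
    using Cons.prems(3)[of x x'] by (simp add: mlin_Suc_iff)
  let ?f = "\<lambda>K xs. K (prod_list (map (\<lambda>x. x ! 0) xs)) (prod_list (map (\<lambda>x. x ! 1) xs)) (map (\<lambda>x. x ! 2) xs)"
  have "lin_ext sv (?f K) (sweedler3_list \<Delta> (a # as)) =
      sw a (\<lambda>u v. sw u (\<lambda>p q. lin_ext sv (?f (\<lambda>x y w. K (p * x) (q * y) (v # w))) (sweedler3_list \<Delta> as)))"
    by (simp add: lin_ext_lin_ext[OF sv_module] sv_module sweedler_2)
  also have "\<dots> \<approx> sw a (\<lambda>u v. sw u (\<lambda>p q. rho as (\<lambda>X w. sw X (\<lambda>x y. K (p * x) (q * y) (v # w)))))"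
    by (rule sw_cong, rule sw_cong, (rule Cons.IH; (intro 1 2 4 hom_intros; simp)))
  also have "\<dots> = sw a (\<lambda>u v. rho as (\<lambda>X w. sw u (\<lambda>p q. sw X (\<lambda>x y. K (p * x) (q * y) (v # w)))))"
    by (simp add: rho_sw_swap)
  also have "\<dots> \<approx> sw a (\<lambda>u v. rho as (\<lambda>X w. sw (u * X) (\<lambda>x y. K x y (v # w))))"
    by (rule sw_cong, rule rho_cong, rule eqv_sym, rule sw_mult) (intro bilinI Cons.prems(1,2), simp_all)
  also have "\<dots> = rho (a # as) (\<lambda>X w. sw X (\<lambda>x y. K x y w))"
    by simp
  finally show ?case .
qed

end

section \<open>The cyclic operator\<close>

context modular_hopf
begin

text \<open>The cyclic operator, with its first two Sweedler components collected by \<open>tw\<close>.\<close>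

definition t_gen :: "'h list \<Rightarrow> 'h list \<Rightarrow>\<^sub>0 'k" where
  "t_gen as = coaction_sum fscale \<Delta> as
     (\<lambda>x w. Poly_Mapping.single ((\<pi> * tw x) # butlast w) (\<beta> (last w)))"

text \<open>An additional tensor factor turns the cyclic operator into a rotation: \<open>embed\<close> is \<open>t_gen\<close> before
  \<open>\<beta>\<close> is applied to the last factor. \<open>proj\<close> is its left inverse since \<open>\<alpha> \<circ> tw = \<epsilon>\<close>.\<close>

definition embed :: "'h list \<Rightarrow> 'h list \<Rightarrow>\<^sub>0 'k" where
  "embed as = coaction_sum fscale \<Delta> as (\<lambda>x w. Poly_Mapping.single ((\<pi> * tw x) # w) 1)"

definition proj :: "'h list \<Rightarrow> 'h list \<Rightarrow>\<^sub>0 'k" where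
  "proj as = Poly_Mapping.single (tl as) (\<alpha> (hd as))"

definition rot :: "'h list \<Rightarrow> 'h list \<Rightarrow>\<^sub>0 'k" where
  "rot as = Poly_Mapping.single (\<theta> (last as) # butlast as) 1"

end

locale tensor_target = modular_target scale \<Delta> \<epsilon> S fscale "tensor_rel scale n" \<alpha> \<beta> \<pi>
  for scale :: "'k::comm_ring_1 \<Rightarrow> 'h::ring_1 \<Rightarrow> 'h" and \<Delta> \<epsilon> S \<alpha> \<beta> \<pi> and n :: nat
begin

abbreviation tensor_eqv :: "('h list \<Rightarrow>\<^sub>0 'k) \<Rightarrow> ('h list \<Rightarrow>\<^sub>0 'k) \<Rightarrow> bool" (infix "\<approx>" 50) where
  "p \<approx> q \<equiv> eqv p q"

lemma lin_slot:
  assumes "length xs + 1 + length ys = n"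
  shows "lin (\<lambda>u. Poly_Mapping.single (xs @ u # ys) c)"
proof -
  have g: "(\<lambda>u. xs @ u # ys) \<in> {\<lambda>u. xs @ u # ys | xs ys. length xs + 1 + length ys = n}"
    using assms by blast
  have add: "Poly_Mapping.single (xs @ (u + v) # ys) 1 - Poly_Mapping.single (xs @ u # ys) 1
      - Poly_Mapping.single (xs @ v # ys) 1 \<in> tensor_rel scale n" for u v
    unfolding tensor_rel_def slot_relations_def
    by (rule fscale.span_base, rule UnI1, rule CollectI, rule exI[of _ "\<lambda>u. xs @ u # ys"],
        rule exI[of _ u], rule exI[of _ v]) (use g in simp)
  have scl: "Poly_Mapping.single (xs @ scale d u # ys) 1 - Poly_Mapping.single (xs @ u # ys) d
      \<in> tensor_rel scale n" for d u
    unfolding tensor_rel_def slot_relations_def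
    by (rule fscale.span_base, rule UnI2, rule CollectI, rule exI[of _ "\<lambda>u. xs @ u # ys"],
        rule exI[of _ d], rule exI[of _ u]) (use g in simp)
  have "Poly_Mapping.single (xs @ (u + v) # ys) c \<approx>
      Poly_Mapping.single (xs @ u # ys) c + Poly_Mapping.single (xs @ v # ys) c" for u v
    using fscale.subspace_scale[OF subspace_R add[of u v], of c]
    by (simp add: eqv_def fscale.scale_right_diff_distrib fscale.scale_right_distrib diff_diff_eq)
  moreover have "Poly_Mapping.single (xs @ scale d u # ys) c \<approx> fscale d (Poly_Mapping.single (xs @ u # ys) c)" for d u
    using fscale.subspace_scale[OF subspace_R scl[of d u], of c]
    by (simp add: eqv_def fscale.scale_right_diff_distrib mult.commute)
  ultimately show ?thesis
    by (simp add: lin_def)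
qed

lemma lin_1: "length w + 1 = n \<Longrightarrow> lin (\<lambda>u. Poly_Mapping.single (u # w) c)"
  using lin_slot[of "[]" w] by simp

lemma lin_2: "length w + 2 = n \<Longrightarrow> lin (\<lambda>u. Poly_Mapping.single (a # u # w) c)"
  using lin_slot[of "[a]" w] by simp

lemma mlin_single: "mlin n (\<lambda>w. Poly_Mapping.single w c)"
  unfolding mlin_def using lin_slot by blast

lemma mlin_single_Cons: "Suc m = n \<Longrightarrow> mlin m (\<lambda>w. Poly_Mapping.single (a # w) c)"
  unfolding mlin_def using lin_slot[of "a # _"] by fastforce

lemma lin_single_scalar: "module_hom scale (*) \<chi> \<Longrightarrow> lin (\<lambda>u. Poly_Mapping.single w (\<chi> u))"
  using lin_scalar[of \<chi> "Poly_Mapping.single w 1"] by simp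

lemma lin_last_scalar:
  assumes "length xs + 1 + length ys = n"
  shows "lin (\<lambda>u. Poly_Mapping.single (a # butlast (xs @ u # ys)) (\<beta> (last (xs @ u # ys))))"
proof (cases ys rule: rev_cases)
  case Nil
  then show ?thesis
    by (simp add: lin_single_scalar \<beta>_lin)
next
  case (snoc zs z)
  then show ?thesis
    using lin_slot[of "a # xs" zs "\<beta> z"] assms by (simp add: butlast_append)
qed

lemma mlin_t_leaf: "mlin n (\<lambda>w. Poly_Mapping.single (a # butlast w) (\<beta> (last w)))"
  unfolding mlin_def by (intro allI impI lin_last_scalar)

lemma mlin_t_gen: "mlin n t_gen"
proof (cases "n = 0")
  case False
  show ?thesis
    unfolding t_gen_def
  proof (rule mlin_rho)
    fix w :: "'h list" assume w: "length w = n"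
    show "lin (\<lambda>x. Poly_Mapping.single ((\<pi> * tw x) # butlast w) (\<beta> (last w)))"
      by (rule lin_comp[OF lin_1]) (use False w in simp, intro tw_intros)
  qed (rule mlin_t_leaf)
next
  case True
  then show ?thesis unfolding mlin_def by auto
qed

lemma mlin_embed:
  assumes "Suc m = n" shows "mlin m embed"
  unfolding embed_def
proof (rule mlin_rho)
  fix w :: "'h list" assume w: "length w = m"
  show "lin (\<lambda>x. Poly_Mapping.single ((\<pi> * tw x) # w) 1)"
    by (rule lin_comp[OF lin_1]) (use assms w in simp, intro tw_intros)
qed (rule mlin_single_Cons[OF assms])

lemma mlin_proj: "mlin (Suc n) proj"
  unfolding proj_def mlin_Suc_iff list.sel
  by (intro conjI allI impI lin_single_scalar \<alpha>_lin mlin_single)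

lemma mlin_rot: "mlin n rot"
  unfolding mlin_def
proof (intro allI impI)
  fix xs ys :: "'h list" assume len: "length xs + 1 + length ys = n"
  show "lin (\<lambda>u. rot (xs @ u # ys))"
  proof (cases ys rule: rev_cases)
    case Nil
    then show ?thesis
      unfolding rot_def using len by (simp, intro lin_comp[OF lin_1] tw_intros) simp_all
  next
    case (snoc zs z)
    then show ?thesis
      unfolding rot_def using lin_slot[of "\<theta> z # xs" zs 1] len by (simp add: butlast_append)
  qed
qed

lemma proj_embed:
  assumes "length as = n"
  shows "lin_ext fscale proj (embed as) \<approx> Poly_Mapping.single as 1"
proof -
  have "lin_ext fscale proj (embed as) = rho as (\<lambda>x w. fscale (\<epsilon> x) (Poly_Mapping.single w 1))"
    unfolding embed_def hom_coaction_sum[OF lin_ext_fscale_hom]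
    by (simp add: module_fscale proj_def \<alpha>_mult \<alpha>_tw)
  also have "\<dots> \<approx> Poly_Mapping.single as 1"
    by (rule rho_counit) (use mlin_single assms in simp)
  finally show ?thesis .
qed

lemma sw_twisted:
  assumes B: "bilin B"
  shows "sw (\<pi> * tw (x * a)) B \<approx>
    sw a (\<lambda>u v. sw x (\<lambda>y z. B (\<pi> * (S v * S z)) (\<pi> * (tw u * tw y))))"
proof -
  note L = lin_sw_body bilinI tw_intros lin_comp[OF bilinD(1)[OF B]] lin_comp[OF bilinD(2)[OF B]]
  have "sw (\<pi> * tw (x * a)) B \<approx> sw (tw a * tw x) (\<lambda>p q. B (\<pi> * p) (\<pi> * q))"
    unfolding tw_mult by (rule sw_\<pi>[OF B])
  also have "\<dots> \<approx> sw (tw a) (\<lambda>p q. sw (tw x) (\<lambda>r s. B (\<pi> * (p * r)) (\<pi> * (q * s))))"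
    by (rule sw_mult) (intro L)
  also have "\<dots> \<approx> sw a (\<lambda>u v. sw (tw x) (\<lambda>r s. B (\<pi> * (S v * r)) (\<pi> * (tw u * s))))"
    by (rule sw_tw) (intro L)
  also have "\<dots> \<approx> sw a (\<lambda>u v. sw x (\<lambda>y z. B (\<pi> * (S v * S z)) (\<pi> * (tw u * tw y))))"
    by (rule sw_cong, rule sw_tw) (intro L)
  finally show ?thesis .
qed

text \<open>By coassociativity of the coaction, the part \<open>z\<close> of the first coaction is adjacent to \<open>x'\<close>, the first
  factor of the second one, and the antipode cancels the two.\<close>

lemma rho_cancel:
  assumes F1: "\<And>z w. length w = length as \<Longrightarrow> lin (\<lambda>y. F y z w)"
    and F2: "\<And>y w. length w = length as \<Longrightarrow> lin (\<lambda>z. F y z w)"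
    and F3: "\<And>y z. mlin (length as) (F y z)"
  shows "rho as (\<lambda>x w. sw x (\<lambda>y z. rho w (\<lambda>x' w'. F y (S z * x') w'))) \<approx> rho as (\<lambda>X w. F X 1 w)"
proof -
  have 1: "lin (\<lambda>y. F y z w)" if "length w = length as" for z w by (rule F1[OF that])
  have 2: "lin (\<lambda>z. F y (g z) w)" if "length w = length as" "module_hom scale scale g" for y w g
    by (rule lin_comp[OF F2[OF that(1)] that(2)])
  note L = lin_sw_body lin_sw bilinI 1 2 hom_intros mlin_sw_body F3
  have "rho as (\<lambda>x w. sw x (\<lambda>y z. rho w (\<lambda>x' w'. F y (S z * x') w'))) =
      rho as (\<lambda>x w. rho w (\<lambda>x' w'. sw x (\<lambda>y z. F y (S z * x') w')))"
    by (simp only: rho_sw_swap)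
  also have "\<dots> \<approx> rho as (\<lambda>X w. sw X (\<lambda>x x'. sw x (\<lambda>y z. F y (S z * x') w)))"
    by (rule rho_rho; (intro L; simp))
  also have "\<dots> \<approx> rho as (\<lambda>X w. sw X (\<lambda>y q. sw q (\<lambda>z x'. F y (S z * x') w)))"
    by (rule rho_cong, rule sw_coassoc; (intro L; simp))
  also have "\<dots> \<approx> rho as (\<lambda>X w. sw X (\<lambda>y q. fscale (\<epsilon> q) (F y 1 w)))"
    by (rule rho_cong, rule sw_cong, rule sw_antipode_left, rule F2)
  also have "\<dots> \<approx> rho as (\<lambda>X w. F X 1 w)"
    by (rule rho_cong, rule sw_counit_right, rule F1)
  finally show ?thesis .
qed

text \<open>Both sides are
  \<open>\<beta>(a\<^sup>(\<^sup>3\<^sup>)) \<pi> tw(\<pi> S(a\<^sup>(\<^sup>2\<^sup>))) \<otimes> \<pi> tw(x a\<^sup>(\<^sup>1\<^sup>)) \<otimes> w\<close>, summed over the coaction \<open>x \<otimes> w\<close> of the initial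
  factors \<open>ws\<close>. On the left the second coaction on \<open>w\<close> is cancelled by the antipode of a part
  of \<open>x\<close>.\<close>

lemma embed_t_gen:
  assumes n: "Suc (length (ws @ [a])) = n"
  shows "lin_ext fscale embed (t_gen (ws @ [a])) \<approx> lin_ext fscale rot (embed (ws @ [a]))"
proof -
  define G where "G y h w = Poly_Mapping.single ((\<pi> * tw y) # h # w) (1 :: 'k)" for y h w
  have G1: "lin (\<lambda>y. G (g y) h w)" if "length w = length ws" "module_hom scale scale g" for g h w
    unfolding G_def by (rule lin_comp[OF lin_1]) (use n that in simp, intro tw_intros that)
  have G2: "lin (\<lambda>h. G y (g h) w)" if "length w = length ws" "module_hom scale scale g" for g y w
    unfolding G_def by (rule lin_comp[OF lin_2]) (use n that in simp, intro that)
  have G3: "mlin (length ws) (G y h)" for y h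
    unfolding mlin_def G_def using lin_slot[of "(\<pi> * tw y) # h # _"] n by simp
  note L = lin_sw_body lin_sw bilinI lin_rho_body G1 G2 tw_intros
  define K where "K u v = rho ws (\<lambda>X w. G (\<pi> * S v) (\<pi> * (tw u * tw X)) w)" for u v
  have K1: "lin (\<lambda>u. K (g u) v)" if "module_hom scale scale g" for g v
    unfolding K_def by (intro L; simp add: that)
  have K2: "lin (\<lambda>v. K u (g v))" if "module_hom scale scale g" for g u
    unfolding K_def by (intro L; simp add: that)
  have embed_Cons: "embed (h # w) = sw h (\<lambda>h1 h2. rho w (\<lambda>x' w'. G (h1 * x') h2 w'))" for h w
    by (simp add: embed_def G_def)
  have "lin_ext fscale embed (t_gen (ws @ [a])) =
      rho ws (\<lambda>x w. sw a (\<lambda>a1 a2. fscale (\<beta> a2) (embed ((\<pi> * tw (x * a1)) # w))))"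
    unfolding t_gen_def rho_snoc hom_coaction_sum[OF lin_ext_fscale_hom] hom_sweedler_sum[OF lin_ext_fscale_hom]
    by (simp add: module_fscale)
  also have "\<dots> \<approx> rho ws (\<lambda>x w. sw a (\<lambda>a1 a2. fscale (\<beta> a2) (sw a1 (\<lambda>u v. sw x (\<lambda>y z.
      rho w (\<lambda>x' w'. G (\<pi> * (S v * S z) * x') (\<pi> * (tw u * tw y)) w'))))))"
    unfolding embed_Cons
    by (rule rho_cong, rule sw_cong, rule eqv_scale, rule sw_twisted) (intro L; simp)
  also have "\<dots> = sw a (\<lambda>a1 a2. fscale (\<beta> a2) (sw a1 (\<lambda>u v. rho ws (\<lambda>x w. sw x (\<lambda>y z.
      rho w (\<lambda>x' w'. G (\<pi> * (S v * (S z * x'))) (\<pi> * (tw u * tw y)) w'))))))"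
    by (simp only: rho_sw_swap rho_scale mult.assoc)
  also have "\<dots> \<approx> sw a (\<lambda>a1 a2. fscale (\<beta> a2) (sw a1 (\<lambda>u v.
      rho ws (\<lambda>X w. G (\<pi> * (S v * 1)) (\<pi> * (tw u * tw X)) w))))"
    by (rule sw_cong, rule eqv_scale, rule sw_cong,
        rule rho_cancel[where F = "\<lambda>y z w. G (\<pi> * (S _ * z)) (\<pi> * (tw _ * tw y)) w"])
      (intro L G3; simp)+
  also have "\<dots> = sw a (\<lambda>a1 a2. sw a1 (\<lambda>u v. fscale (\<beta> a2) (K u v)))"
    by (simp only: mult_1_right K_def sw_scale)
  also have "\<dots> \<approx> sw a (\<lambda>u y. sw y (\<lambda>v a2. fscale (\<beta> a2) (K u v)))"
    by (rule sw_coassoc; (intro lin_scale K1 K2 lin_scalar \<beta>_lin module_hom_ident))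
  also have "\<dots> = rho ws (\<lambda>X w. sw a (\<lambda>u y. sw y (\<lambda>v a2. fscale (\<beta> a2) (G (\<pi> * S v) (\<pi> * (tw u * tw X)) w))))"
    by (simp only: rho_sw_swap rho_scale K_def)
  also have "\<dots> \<approx> rho ws (\<lambda>X w. sw a (\<lambda>u y. Poly_Mapping.single (\<theta> y # (\<pi> * tw (X * u)) # w) 1))"
  proof (rule rho_cong, rule sw_cong)
    fix X u y and w :: "'h list" assume w: "length w = length ws"
    let ?F = "\<lambda>m. Poly_Mapping.single (m # (\<pi> * (tw u * tw X)) # w) (1 :: 'k)"
    have F: "lin ?F" by (rule lin_1) (use n w in simp)
    have "?F (\<theta> y) \<approx> sw y (\<lambda>v a2. ?F (scale (\<beta> a2) (\<pi> * tw (\<pi> * S v))))"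
      unfolding \<theta>_def by (rule lin_hsw[OF F])
    also have "\<dots> \<approx> sw y (\<lambda>v a2. fscale (\<beta> a2) (?F (\<pi> * tw (\<pi> * S v))))"
      by (rule sw_cong, rule linD(2)[OF F])
    finally show "sw y (\<lambda>v a2. fscale (\<beta> a2) (G (\<pi> * S v) (\<pi> * (tw u * tw X)) w)) \<approx>
        Poly_Mapping.single (\<theta> y # (\<pi> * tw (X * u)) # w) 1"
      unfolding tw_mult G_def by (rule eqv_sym)
  qed
  also have "\<dots> = lin_ext fscale rot (embed (ws @ [a]))"
    unfolding embed_def rho_snoc hom_coaction_sum[OF lin_ext_fscale_hom] hom_sweedler_sum[OF lin_ext_fscale_hom]
    by (simp add: module_fscale rot_def)
  finally show ?thesis .
qed

text \<open>The character \<open>\<beta> \<circ> tw\<close> is multiplicative, so that condition (CM) can be applied factor by factor.\<close>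

lemma rho_\<theta>: "mlin (length as) f \<Longrightarrow> rho as (\<lambda>x w. fscale (\<beta> (tw x)) (f (map \<theta> w))) \<approx> f as"
proof (induction as arbitrary: f)
  case (Cons a as)
  have 1: "lin (\<lambda>y. f (y # as))" and 2: "mlin (length as) (\<lambda>w. f (y # w))" for y
    using Cons.prems by (simp_all add: mlin_Suc_iff)
  have "rho (a # as) (\<lambda>x w. fscale (\<beta> (tw x)) (f (map \<theta> w))) =
      sw a (\<lambda>a1 a2. fscale (\<beta> (tw a1)) (rho as (\<lambda>x w. fscale (\<beta> (tw x)) (f (\<theta> a2 # map \<theta> w)))))"
    by (simp add: tw_mult \<beta>_mult rho_scale[symmetric] mult.commute)
  also have "\<dots> \<approx> sw a (\<lambda>a1 a2. fscale (\<beta> (tw a1)) (f (\<theta> a2 # as)))"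
    by (rule sw_cong, rule eqv_scale, rule Cons.IH, rule 2)
  also have "\<dots> \<approx> sw a (\<lambda>a1 a2. f (scale (\<beta> (tw a1)) (\<theta> a2) # as))"
    by (rule sw_cong, rule eqv_sym, rule linD(2)[OF 1])
  also have "\<dots> \<approx> f (hsw a (\<lambda>a1 a2. scale (\<beta> (tw a1)) (\<theta> a2)) # as)"
    by (rule eqv_sym, rule lin_hsw[OF 1])
  finally show ?case by (simp only: sum_\<theta>)
qed (simp add: tw_one)

end

context modular_hopf
begin

lemma tensor_target: "tensor_target scale \<Delta> \<epsilon> S \<alpha> \<beta> \<pi> n"
proof -
  interpret P: presented_module "{as :: 'h list. length as = n}" "tensor_rel scale n"
    by (rule presented_tensor)
  show ?thesis
    by (intro tensor_target.intro modular_target.intro modular_hopf_axioms hopf_target.intro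
        hopf_algebra_axioms module_fscale hopf_target_axioms.intro P.subspace)
qed

lemma rot_power:
  "(lin_ext fscale rot ^^ length vs) (Poly_Mapping.single (us @ vs) 1) =
    Poly_Mapping.single (map \<theta> vs @ us) 1"
proof (induction vs arbitrary: us)
  case (Cons v vs)
  have "(lin_ext fscale rot ^^ length (v # vs)) (Poly_Mapping.single (us @ v # vs) 1) =
      lin_ext fscale rot ((lin_ext fscale rot ^^ length vs) (Poly_Mapping.single ((us @ [v]) @ vs) 1))"
    by simp
  also have "\<dots> = Poly_Mapping.single (map \<theta> (v # vs) @ us) 1"
    unfolding Cons.IH by (simp add: module_fscale rot_def butlast_append)
  finally show ?case .
qed simp

text \<open>\<open>embed\<close> conjugates the cyclic operator into the twisted rotation \<open>rot\<close> of \<open>n + 1\<close> tensor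
  factors, whose power of exponent \<open>n + 1\<close> is \<open>\<theta>\<close> in every factor; \<open>proj\<close> undoes \<open>embed\<close>.\<close>

lemma t_gen_power:
  assumes as: "length as = n" and n: "n > 0"
    and cyc_V: "\<And>w. length w = n \<Longrightarrow> Poly_Mapping.keys (cyc w) \<subseteq> {w. length w = n}"
    and cyc: "\<And>w. length w = n \<Longrightarrow> cyc w - t_gen w \<in> tensor_rel scale n"
  shows "(lin_ext fscale cyc ^^ Suc n) (Poly_Mapping.single as 1) - Poly_Mapping.single as 1
    \<in> tensor_rel scale n"
proof -
  interpret T: tensor_target scale \<Delta> \<epsilon> S \<alpha> \<beta> \<pi> n by (rule tensor_target)
  interpret T1: tensor_target scale \<Delta> \<epsilon> S \<alpha> \<beta> \<pi> "Suc n" by (rule tensor_target)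
  let ?V = "{p :: 'h list \<Rightarrow>\<^sub>0 'k. Poly_Mapping.keys p \<subseteq> {w. length w = n}}"
  let ?c = "lin_ext fscale cyc" and ?e = "lin_ext fscale embed" and ?r = "lin_ext fscale rot"
  have cV: "?c p \<in> ?V" if "p \<in> ?V" for p
    by (rule lin_ext_in_subspace[OF module_fscale subspace_keys]) (use that cyc_V in blast)
  have powV: "(?c ^^ j) (Poly_Mapping.single as 1) \<in> ?V" for j
  proof (induction j)
    case 0
    show ?case using as by simp
  qed (simp only: funpow.simps comp_apply cV)
  have ec: "T1.eqv (?e (?c p)) (?r (?e p))" if p: "p \<in> ?V" for p
  proof -
    have "T1.eqv (?e (?c p)) (lin_ext fscale (\<lambda>w. ?e (t_gen w)) p)"
      unfolding lin_ext_lin_ext[OF module_fscale]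
    proof (rule T1.lin_ext_eqv)
      fix w assume "w \<in> Poly_Mapping.keys p"
      then have "cyc w - t_gen w \<in> tensor_rel scale n"
        using p cyc by blast
      then show "T1.eqv (?e (cyc w)) (?e (t_gen w))"
        by (rule T1.mlin_eqv[OF T1.mlin_embed[OF refl]])
    qed
    also have "T1.eqv \<dots> (lin_ext fscale (\<lambda>w. ?r (embed w)) p)"
    proof (rule T1.lin_ext_eqv)
      fix w assume "w \<in> Poly_Mapping.keys p"
      then have "length w = n" using p by blast
      then obtain ws a where "w = ws @ [a]" "Suc (length (ws @ [a])) = Suc n"
        using n by (cases w rule: rev_cases) auto
      then show "T1.eqv (?e (t_gen w)) (?r (embed w))"
        using T1.embed_t_gen by simp
    qed
    finally show ?thesis by (simp only: lin_ext_lin_ext[OF module_fscale])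
  qed
  have epow: "T1.eqv (?e ((?c ^^ j) (Poly_Mapping.single as 1))) ((?r ^^ j) (embed as))" for j
  proof (induction j)
    case (Suc j)
    have "T1.eqv (?e (?c ((?c ^^ j) (Poly_Mapping.single as 1)))) (?r (?e ((?c ^^ j) (Poly_Mapping.single as 1))))"
      by (rule ec[OF powV])
    also have "T1.eqv \<dots> (?r ((?r ^^ j) (embed as)))"
      using Suc unfolding T1.eqv_def by (rule T1.mlin_eqv[OF T1.mlin_rot, unfolded T1.eqv_def])
    finally show ?case by simp
  qed (simp add: module_fscale)
  have rpow: "(?r ^^ Suc n) (embed as) = coaction_sum fscale \<Delta> as
      (\<lambda>x w. Poly_Mapping.single (\<theta> (\<pi> * tw x) # map \<theta> w) 1)"
  proof -
    have hom: "module_hom fscale fscale (?r ^^ j)" for j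
    proof (induction j)
      case (Suc j)
      show ?case using hom_comp[OF Suc lin_ext_fscale_hom] by (simp add: o_def)
    qed (simp add: id_def fscale.module_hom_ident)
    show ?thesis
      unfolding embed_def hom_coaction_sum[OF hom]
    proof (rule T.rho_cong_eq)
      fix x and w :: "'h list" assume "length w = length as"
      then show "(?r ^^ Suc n) (Poly_Mapping.single ((\<pi> * tw x) # w) 1) =
          Poly_Mapping.single (\<theta> (\<pi> * tw x) # map \<theta> w) 1"
        using rot_power[of "(\<pi> * tw x) # w" "[]"] as by simp
    qed
  qed
  let ?p = "(?c ^^ Suc n) (Poly_Mapping.single as 1)"
  have "T.eqv ?p (lin_ext fscale proj (?e ?p))"
  proof -
    have "T.eqv (lin_ext fscale (\<lambda>w. Poly_Mapping.single w 1) ?p) (lin_ext fscale (\<lambda>w. lin_ext fscale proj (embed w)) ?p)"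
      by (rule T.lin_ext_eqv, rule T.eqv_sym, rule T.proj_embed) (use powV[of "Suc n"] in blast)
    then show ?thesis by (simp only: lin_ext_single_1 lin_ext_lin_ext[OF module_fscale])
  qed
  also have "T.eqv \<dots> (lin_ext fscale proj ((?r ^^ Suc n) (embed as)))"
    using epow[of "Suc n"] unfolding T1.eqv_def by (rule T.mlin_eqv[OF T.mlin_proj])
  also have "\<dots> = coaction_sum fscale \<Delta> as (\<lambda>x w. fscale (\<beta> (tw x)) (Poly_Mapping.single (map \<theta> w) 1))"
    unfolding rpow hom_coaction_sum[OF lin_ext_fscale_hom]
    by (simp add: module_fscale proj_def \<alpha>_\<theta> \<beta>_mult)
  also have "T.eqv \<dots> (Poly_Mapping.single as 1)"
    by (rule T.rho_\<theta>) (use T.mlin_single as in simp)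
  finally show ?thesis by (simp only: T.eqv_def)
qed

end

section \<open>Faces\<close>

definition merge_at :: "nat \<Rightarrow> 'h::ring_1 list \<Rightarrow> 'h list" where
  "merge_at k as = take k as @ (as ! k * as ! Suc k) # drop (Suc (Suc k)) as"

lemma merge_at_append [simp]: "length us = k \<Longrightarrow> merge_at k (us @ p # q # vs) = us @ (p * q) # vs"
  by (auto simp: merge_at_def nth_append)

lemma merge_at_Cons [simp]: "merge_at (Suc k) (a # as) = a # merge_at k as"
  "merge_at 0 (a # b # as) = a * b # as"
  by (simp_all add: merge_at_def)

lemma split_at:
  assumes "Suc k < length w"
  obtains us p q vs where "w = us @ p # q # vs" "length us = k"
proof
  show "w = take k w @ w ! k # w ! Suc k # drop (Suc (Suc k)) w"
    using assms by (simp add: Cons_nth_drop_Suc id_take_nth_drop[symmetric])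
qed (use assms in simp)

lemma hopf_face_0: "hopf_face \<alpha> \<beta> n 0 as = Poly_Mapping.single (tl as) (\<alpha> (hd as))"
  by (simp add: hopf_face_def)

lemma hopf_face_last: "hopf_face \<alpha> \<beta> (Suc n) (Suc n) as = Poly_Mapping.single (butlast as) (\<beta> (last as))"
  by (simp add: hopf_face_def)

lemma hopf_face_inner: "k < n \<Longrightarrow> hopf_face \<alpha> \<beta> (Suc n) (Suc k) as = Poly_Mapping.single (merge_at k as) 1"
  by (simp add: hopf_face_def merge_at_def)

definition prep :: "'h \<Rightarrow> ('h list \<Rightarrow>\<^sub>0 'k::comm_ring_1) \<Rightarrow> ('h list \<Rightarrow>\<^sub>0 'k)" where
  "prep a = lin_ext fscale (\<lambda>w. Poly_Mapping.single (a # w) 1)"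

lemma prep_single [simp]: "prep a (Poly_Mapping.single w c) = Poly_Mapping.single (a # w) c"
  by (simp add: prep_def module_fscale)

text \<open>Faces that do not involve the first entry are faces of the tail; the simplicial identities follow from
  this by induction on the length.\<close>

lemma hopf_face_Cons:
  assumes "length as = Suc n" "i \<le> n"
  shows "hopf_face \<alpha> \<beta> (Suc (Suc n)) (Suc (Suc i)) (a # as) = prep a (hopf_face \<alpha> \<beta> (Suc n) (Suc i) as)"
proof (cases "i = n")
  case True
  then show ?thesis using assms by (auto simp: hopf_face_last)
next
  case False
  then show ?thesis using assms by (simp add: hopf_face_inner)
qed

lemma hopf_face_keys:
  assumes "length as = Suc n" "i \<le> Suc n"
  shows "Poly_Mapping.keys (hopf_face \<alpha> \<beta> (Suc n) i as) \<subseteq> {as. length as = n}"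
proof -
  consider "i = 0" | "i = Suc n" | k where "i = Suc k" "k < n"
    using assms(2) by (cases i) (auto simp: le_less)
  then show ?thesis
    by cases (use assms in \<open>auto simp: hopf_face_0 hopf_face_last hopf_face_inner merge_at_def\<close>)
qed

lemma prep_face:
  assumes "Poly_Mapping.keys q \<subseteq> {as. length as = Suc n}" "i \<le> n"
  shows "lin_ext fscale (hopf_face \<alpha> \<beta> (Suc (Suc n)) (Suc (Suc i))) (prep a q) =
    prep a (lin_ext fscale (hopf_face \<alpha> \<beta> (Suc n) (Suc i)) q)"
proof -
  have "lin_ext fscale (hopf_face \<alpha> \<beta> (Suc (Suc n)) (Suc (Suc i))) (prep a q) =
      lin_ext fscale (\<lambda>w. prep a (hopf_face \<alpha> \<beta> (Suc n) (Suc i) w)) q"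
    unfolding prep_def lin_ext_lin_ext[OF module_fscale]
    by (rule lin_ext_cong) (use assms in \<open>auto simp: module_fscale hopf_face_Cons prep_def\<close>)
  then show ?thesis
    unfolding prep_def lin_ext_lin_ext[OF module_fscale] .
qed

lemma hopf_face_face:
  assumes \<alpha>: "\<And>a b. \<alpha> (a * b) = \<alpha> a * \<alpha> b" and \<beta>: "\<And>a b. \<beta> (a * b) = \<beta> a * \<beta> b"
    and "length as = Suc (Suc n)" "j \<le> i" "i \<le> Suc n"
  shows "lin_ext fscale (hopf_face \<alpha> \<beta> (Suc n) j) (hopf_face \<alpha> \<beta> (Suc (Suc n)) (Suc i) as) =
    lin_ext fscale (hopf_face \<alpha> \<beta> (Suc n) i) (hopf_face \<alpha> \<beta> (Suc (Suc n)) j as)"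
  using assms(3-5)
proof (induction n arbitrary: as i j)
  case (0 as i j)
  then obtain a b where as: "as = [a, b]" by (auto simp: length_Suc_conv)
  consider "j = 0" "i = 0" | "j = 0" "i = 1" | "j = 1" "i = 1"
    using 0 by (cases i; cases j) auto
  then show ?case
    by cases (simp_all add: as module_fscale hopf_face_def \<alpha> \<beta> mult.commute)
next
  case (Suc n as i j)
  then obtain a b c ds where as: "as = a # b # c # ds" by (auto simp: length_Suc_conv)
  let ?y = "b # c # ds"
  have y: "length ?y = Suc (Suc n)" using Suc.prems as by simp
  let ?F = "\<lambda>n i. lin_ext fscale (hopf_face \<alpha> \<beta> n i)" and ?f = "hopf_face \<alpha> \<beta>"
  consider "j = 0" "i = 0" | i' where "j = 0" "i = Suc i'" | "j = 1" "i = 1"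
    | i' where "j = 1" "i = Suc (Suc i')" | i' j' where "i = Suc (Suc i')" "j = Suc (Suc j')"
    using Suc.prems(2) by (cases j rule: nat.exhaust; cases i rule: nat.exhaust) (auto, metis Suc_le_D old.nat.exhaust)
  then show ?case
  proof cases
    case 1
    then show ?thesis by (simp add: as module_fscale hopf_face_0 hopf_face_inner \<alpha> mult.commute)
  next
    case 2
    have "?F (Suc (Suc n)) 0 (prep a q) = fscale (\<alpha> a) q" for q
    proof -
      have "?F (Suc (Suc n)) 0 (prep a q) = lin_ext fscale (\<lambda>w. fscale (\<alpha> a) (Poly_Mapping.single w 1)) q"
        unfolding prep_def lin_ext_lin_ext[OF module_fscale]
        by (rule lin_ext_cong) (simp add: module_fscale hopf_face_0)
      then show ?thesis
        using hom_eq_lin_ext[OF fscale.module_hom_scale_self, of "\<alpha> a" q] by simp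
    qed
    moreover have "i' \<le> Suc n" using 2 Suc.prems by simp
    ultimately have "?F (Suc (Suc n)) j (?f (Suc (Suc (Suc n))) (Suc i) as) = fscale (\<alpha> a) (?f (Suc (Suc n)) i ?y)"
      using 2 by (simp add: as hopf_face_Cons[OF y])
    moreover have "?f (Suc (Suc (Suc n))) j as = Poly_Mapping.single ?y (\<alpha> a)"
      using 2 by (simp add: as hopf_face_0)
    ultimately show ?thesis
      by (simp add: module_fscale)
  next
    case 3
    then show ?thesis
      by (simp add: as module_fscale hopf_face_inner mult.assoc)
  next
    case 4
    have i': "i' \<le> n" using 4 Suc.prems by simp
    have z: "length (c # ds) = Suc n" using y by simp
    have *: "?F (Suc (Suc n)) (Suc 0) (prep a (prep b q)) = prep (a * b) q"
      for q :: "'a list \<Rightarrow>\<^sub>0 'b"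
    proof -
      have "?F (Suc (Suc n)) (Suc 0) (prep a (prep b q)) = lin_ext fscale (\<lambda>w. Poly_Mapping.single (a * b # w) 1) q"
        unfolding prep_def lin_ext_lin_ext[OF module_fscale]
        by (rule lin_ext_cong) (simp add: module_fscale hopf_face_inner)
      then show ?thesis by (simp add: prep_def)
    qed
    have "?f (Suc (Suc (Suc n))) (Suc i) as = prep a (prep b (?f (Suc n) (Suc i') (c # ds)))"
      using 4 i' hopf_face_Cons[OF y, of "Suc i'" \<alpha> \<beta> a] hopf_face_Cons[OF z i', of \<alpha> \<beta> b] by (simp add: as)
    moreover have "?F (Suc (Suc n)) i (?f (Suc (Suc (Suc n))) j as) = prep (a * b) (?f (Suc n) (Suc i') (c # ds))"
      using 4 hopf_face_Cons[OF z i', of \<alpha> \<beta> "a * b"] by (simp add: as module_fscale hopf_face_inner)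
    ultimately show ?thesis using 4 * by simp
  next
    case 5
    have le: "i' \<le> n" "j' \<le> i'" using 5 Suc.prems by simp_all
    have "?F (Suc (Suc n)) j (?f (Suc (Suc (Suc n))) (Suc i) as) =
        prep a (?F (Suc n) (Suc j') (?f (Suc (Suc n)) (Suc (Suc i')) ?y))"
      using 5 le hopf_face_Cons[OF y, of "Suc i'" \<alpha> \<beta> a]
        prep_face[OF hopf_face_keys[OF y, of "Suc (Suc i')" \<alpha> \<beta>], of j' \<alpha> \<beta> a] by (simp add: as)
    also have "\<dots> = prep a (?F (Suc n) (Suc i') (?f (Suc (Suc n)) (Suc j') ?y))"
      using Suc.IH[OF y, of "Suc j'" "Suc i'"] le by simp
    also have "\<dots> = ?F (Suc (Suc n)) i (?f (Suc (Suc (Suc n))) j as)"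
      using 5 le hopf_face_Cons[OF y, of j' \<alpha> \<beta> a]
        prep_face[OF hopf_face_keys[OF y, of "Suc j'" \<alpha> \<beta>], of i' \<alpha> \<beta> a] by (simp add: as)
    finally show ?thesis .
  qed
qed

lemma hopf_face_dgn:
  assumes "length as = Suc n" "i \<le> n"
  shows "lin_ext fscale (hopf_face \<alpha> \<beta> (Suc (Suc n)) i) (Poly_Mapping.single (as @ [1]) 1) =
    lin_ext fscale (\<lambda>as. Poly_Mapping.single (as @ [1]) 1) (hopf_face \<alpha> \<beta> (Suc n) i as)"
proof (cases i)
  case 0
  then show ?thesis using assms by (cases as) (simp_all add: module_fscale hopf_face_0)
next
  case (Suc k)
  obtain us p q vs where "as = us @ p # q # vs" "length us = k"
    by (rule split_at[of k as]) (use assms Suc in simp)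
  then show ?thesis
    using Suc assms by (simp add: module_fscale hopf_face_inner)
qed

lemma hopf_last_face_dgn:
  assumes "length as = n" "\<alpha> 1 = 1"
  shows "lin_ext fscale (hopf_face \<alpha> \<beta> (Suc n) n) (Poly_Mapping.single (as @ [1]) 1) = Poly_Mapping.single as 1"
proof (cases as rule: rev_cases)
  case Nil
  then show ?thesis using assms by (simp add: module_fscale hopf_face_0)
next
  case (snoc us p)
  then show ?thesis
    using assms merge_at_append[of us "length us" p 1 "[]"] by (auto simp: module_fscale hopf_face_inner)
qed

context hopf_target
begin

lemma mlin_merge_at:
  "mlin n f \<Longrightarrow> k < n \<Longrightarrow> mlin (Suc n) (\<lambda>as. f (merge_at k as))"
proof (induction k arbitrary: n f)
  case 0
  then obtain m where n: "n = Suc m" by (cases n) auto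
  have 1: "lin (\<lambda>u. f (g u # w))" if "length w = m" "module_hom scale scale g" for w g
    using 0(1) that lin_comp[of "\<lambda>u. f (u # w)" g] by (simp add: n mlin_Suc_iff)
  have 2: "mlin m (\<lambda>w. f (a # w))" for a
    using 0(1) by (simp add: n mlin_Suc_iff)
  show ?case
    unfolding n mlin_Suc_iff
  proof (intro conjI allI impI)
    fix w :: "'h list" assume "length w = Suc m"
    then obtain v w' where "w = v # w'" "length w' = m" by (auto simp: length_Suc_conv)
    then show "lin (\<lambda>u. f (merge_at 0 (u # w)))"
      by (simp, intro 1 hom_intros) simp
  next
    fix a and w :: "'h list" assume "length w = m"
    then show "lin (\<lambda>u. f (merge_at 0 (a # u # w)))"
      by (simp, intro 1 hom_intros) simp
  next
    fix a b
    show "mlin m (\<lambda>w. f (merge_at 0 (a # b # w)))"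
      using 2 by simp
  qed
next
  case (Suc k)
  then obtain m where n: "n = Suc m" by (cases n) auto
  have "lin (\<lambda>u. f (u # merge_at k w))" if "length w = Suc m" for w
  proof -
    have "length (merge_at k w) = m" using that Suc.prems n by (simp add: merge_at_def)
    then show ?thesis using Suc.prems(1) by (simp add: n mlin_Suc_iff)
  qed
  moreover have "mlin (Suc m) (\<lambda>w. f (a # merge_at k w))" for a
    by (rule Suc.IH) (use Suc.prems in \<open>simp_all add: n mlin_Suc_iff\<close>)
  ultimately show ?case
    unfolding n mlin_Suc_iff[of "Suc m"] by simp
qed

end

context tensor_target
begin

lemma mlin_hopf_face:
  assumes "i \<le> Suc n"
  shows "mlin (Suc n) (hopf_face \<alpha> \<beta> (Suc n) i)"
proof -
  consider "i = 0" | "i = Suc n" | k where "i = Suc k" "k < n"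
    using assms by (cases i) (auto simp: le_less)
  then show ?thesis
  proof cases
    case 1
    show ?thesis
      unfolding 1 hopf_face_0 mlin_Suc_iff list.sel
      by (intro conjI allI impI lin_single_scalar \<alpha>_lin mlin_single)
  next
    case 2
    show ?thesis
      unfolding 2 hopf_face_last mlin_def
    proof (intro allI impI)
      fix xs ys :: "'h list" assume len: "length xs + 1 + length ys = Suc n"
      show "lin (\<lambda>u. Poly_Mapping.single (butlast (xs @ u # ys)) (\<beta> (last (xs @ u # ys))))"
      proof (cases ys rule: rev_cases)
        case Nil
        then show ?thesis by (simp add: lin_single_scalar \<beta>_lin)
      next
        case (snoc zs z)
        then show ?thesis using lin_slot[of xs zs "\<beta> z"] len by (simp add: butlast_append)
      qed
    qed
  next
    case 3
    show ?thesis
      unfolding 3(1) hopf_face_inner[OF 3(2)] by (rule mlin_merge_at[OF mlin_single 3(2)])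
  qed
qed

lemma mlin_dgn: "Suc m = n \<Longrightarrow> mlin m (\<lambda>as. Poly_Mapping.single (as @ [1]) 1)"
  unfolding mlin_def
proof (intro allI impI)
  fix xs ys :: "'h list" assume "Suc m = n" "length xs + 1 + length ys = m"
  then show "lin (\<lambda>u. Poly_Mapping.single ((xs @ u # ys) @ [1]) 1)"
    using lin_slot[of xs "ys @ [1]" 1] by simp
qed

text \<open>\<open>d\<^sub>0 t = d\<^sub>n\<close>: the character \<open>\<alpha>\<close> turns the first entry into a counit.\<close>

lemma face_0_t_gen:
  assumes "length as = Suc n"
  shows "lin_ext fscale (hopf_face \<alpha> \<beta> (Suc n) 0) (t_gen as) \<approx> hopf_face \<alpha> \<beta> (Suc n) (Suc n) as"
proof -
  obtain ws a where as: "as = ws @ [a]" "length ws = n"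
    using assms by (cases as rule: rev_cases) auto
  have "lin_ext fscale (hopf_face \<alpha> \<beta> (Suc n) 0) (t_gen as) =
      rho ws (\<lambda>x w. fscale (\<epsilon> x) (sw a (\<lambda>y z. fscale (\<epsilon> y) (Poly_Mapping.single w (\<beta> z)))))"
    unfolding t_gen_def as rho_snoc hom_coaction_sum[OF lin_ext_fscale_hom] hom_sweedler_sum[OF lin_ext_fscale_hom]
    by (simp add: module_fscale hopf_face_0 \<alpha>_mult \<alpha>_tw \<epsilon>_mult sw_scale[symmetric] mult.commute mult.left_commute)
  also have "\<dots> \<approx> rho ws (\<lambda>x w. fscale (\<epsilon> x) (Poly_Mapping.single w (\<beta> a)))"
    by (rule rho_cong, rule eqv_scale, rule sw_counit_left) (rule lin_single_scalar[OF \<beta>_lin])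
  also have "\<dots> \<approx> Poly_Mapping.single ws (\<beta> a)"
    by (rule rho_counit) (simp add: as mlin_single)
  finally show ?thesis by (simp add: as hopf_face_last)
qed

text \<open>Degree \<open>1\<close> is separate because there \<open>d\<^sub>1\<close> is the last face, and \<open>\<beta>\<close> instead of a multiplication
  brings the first entry and \<open>a\<^sup>(\<^sup>2\<^sup>)\<close> together.\<close>

lemma face_1_t_gen:
  assumes "n = 0"
  shows "lin_ext fscale (hopf_face \<alpha> \<beta> (Suc 0) (Suc 0)) (t_gen [a]) \<approx> hopf_face \<alpha> \<beta> (Suc 0) 0 [a]"
proof -
  have "lin_ext fscale (hopf_face \<alpha> \<beta> (Suc 0) (Suc 0)) (t_gen [a]) =
      sw a (\<lambda>x y. Poly_Mapping.single [] (\<beta> (tw x * y)))"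
    unfolding t_gen_def hom_coaction_sum[OF lin_ext_fscale_hom]
    by (simp add: module_fscale hopf_face_last \<beta>_mult mult.commute)
  also have "\<dots> \<approx> fscale (\<alpha> a) (Poly_Mapping.single [] (\<beta> 1))"
    by (rule sw_tw_antipode[where F = "\<lambda>m. Poly_Mapping.single [] (\<beta> m)"]) (rule lin_single_scalar[OF \<beta>_lin])
  finally show ?thesis by (simp add: hopf_face_0)
qed

text \<open>\<open>d\<^sub>i\<^sub>+\<^sub>1 t = t d\<^sub>i\<close>. For \<open>i = 0\<close> the first two entries are multiplied, which the twisted antipode reduces
  to \<open>\<alpha>\<close> of the first argument; for \<open>i > 0\<close> the coaction is multiplicative.\<close>

lemma face_Suc_t_gen:
  assumes len: "length as = Suc n" and i: "i \<le> n" and n: "n > 0"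
  shows "lin_ext fscale (hopf_face \<alpha> \<beta> (Suc n) (Suc i)) (t_gen as) \<approx>
    lin_ext fscale t_gen (hopf_face \<alpha> \<beta> (Suc n) i as)"
proof (cases i)
  case 0
  obtain b vs where as: "as = b # vs" "length vs = n"
    using len by (cases as) auto
  let ?F = "\<lambda>m. rho vs (\<lambda>x w. Poly_Mapping.single ((\<pi> * (tw x * m)) # butlast w) (\<beta> (last w)))"
  have F: "lin ?F"
    by (rule lin_rho_body, rule lin_comp[OF lin_1]) (use as n in simp, intro tw_intros)
  have "lin_ext fscale (hopf_face \<alpha> \<beta> (Suc n) (Suc i)) (t_gen as) = sw b (\<lambda>x y. ?F (tw x * y))"
    unfolding t_gen_def as coaction_sum.simps hom_sweedler_sum[OF lin_ext_fscale_hom]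
      hom_coaction_sum[OF lin_ext_fscale_hom]
  proof (rule arg_cong[where f = "sw b"], intro ext, rule rho_cong_eq)
    fix x y z and w :: "'h list" assume "length w = length vs"
    then have "w \<noteq> []" using as n by auto
    then show "lin_ext fscale (hopf_face \<alpha> \<beta> (Suc n) (Suc i))
          (Poly_Mapping.single ((\<pi> * tw (x * z)) # butlast (y # w)) (\<beta> (last (y # w)))) =
        Poly_Mapping.single ((\<pi> * (tw z * (tw x * y))) # butlast w) (\<beta> (last w))"
      using n by (simp add: 0 module_fscale hopf_face_inner tw_mult mult.assoc)
  qed
  also have "\<dots> \<approx> fscale (\<alpha> b) (?F 1)"
    by (rule sw_tw_antipode[OF F])
  finally show ?thesis
    by (simp add: 0 as module_fscale hopf_face_0 t_gen_def)
next
  case (Suc k)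
  then have k: "k < n" using i by simp
  obtain xs a b ys where as: "as = xs @ a # b # ys" "length xs = k"
    by (rule split_at[of k as]) (use len k in simp)
  let ?K = "\<lambda>x w. Poly_Mapping.single ((\<pi> * tw x) # butlast w) (\<beta> (last w))"
  have "lin_ext fscale t_gen (hopf_face \<alpha> \<beta> (Suc n) i as) = rho (xs @ a * b # ys) ?K"
    using as k by (simp add: Suc module_fscale hopf_face_inner t_gen_def)
  also have "\<dots> \<approx> rho (xs @ a # b # ys) (\<lambda>x w. ?K x (merge_at (length xs) w))"
    unfolding merge_at_def
  proof (rule rho_merge)
    have l: "Suc (length xs + length ys) = n" using as len by simp
    show "mlin (Suc (length xs + length ys)) (?K x)" for x
      unfolding l by (rule mlin_t_leaf)
    fix w :: "'h list" assume "length w = Suc (length xs + length ys)"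
    then show "lin (\<lambda>x. ?K x w)"
      by (intro lin_comp[OF lin_1] tw_intros) (use l in simp)
  qed
  also have "\<dots> = lin_ext fscale (hopf_face \<alpha> \<beta> (Suc n) (Suc i)) (t_gen as)"
    unfolding t_gen_def as(1) hom_coaction_sum[OF lin_ext_fscale_hom]
  proof (rule rho_cong_eq)
    fix x and w :: "'h list" assume "length w = length (xs @ a # b # ys)"
    then have lw: "length w = Suc n" using len as by simp
    obtain us p q vs where w: "w = us @ p # q # vs" "length us = k"
      by (rule split_at[of k w]) (use k lw in simp)
    show "?K x (merge_at (length xs) w) = lin_ext fscale (hopf_face \<alpha> \<beta> (Suc n) (Suc i)) (?K x w)"
    proof (cases vs rule: rev_cases)
      case Nil
      then have "Suc k = n" using w lw by simp
      then show ?thesis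
        using w as Nil by (simp add: Suc module_fscale hopf_face_last \<beta>_mult butlast_append mult.commute)
    next
      case (snoc zs z)
      then have "Suc k < n" using w lw by simp
      then show ?thesis
        using w as snoc by (simp add: Suc module_fscale hopf_face_inner butlast_append)
    qed
  qed
  finally show ?thesis by (rule eqv_sym)
qed

end

context modular_hopf
begin

abbreviation "cyc \<equiv> hopf_cyclic \<Delta> S \<pi> \<alpha> \<beta>"

lemma sweedler3_list_keys: "x \<in> Poly_Mapping.keys (sweedler3_list \<Delta> as) \<Longrightarrow> length x = length as"
proof (induction as arbitrary: x)
  case (Cons a as)
  have "Poly_Mapping.keys (sweedler3_list \<Delta> (a # as)) \<subseteq> {xs. length xs = Suc (length as)}"
    unfolding sweedler3_list.simps by (intro keys_lin_ext) (simp add: Cons.IH)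
  then show ?case using Cons.prems by auto
qed simp

lemma cyc_keys:
  assumes "length as = n"
  shows "Poly_Mapping.keys (cyc n as) \<subseteq> {as. length as = n}"
proof (cases "n = 0")
  case False
  then show ?thesis
    unfolding hopf_cyclic_def using assms
    by (simp del: sweedler3_list.simps) (intro keys_lin_ext, auto dest: sweedler3_list_keys)
qed (use assms in \<open>simp add: hopf_cyclic_def\<close>)

lemma cyc_t_gen:
  assumes len: "length as = n" and n: "n > 0"
  shows "cyc n as - t_gen as \<in> tensor_rel scale n"
proof -
  interpret T: tensor_target scale \<Delta> \<epsilon> S \<alpha> \<beta> \<pi> n by (rule tensor_target)
  define K where "K x y w = fscale (\<alpha> x) (Poly_Mapping.single ((\<pi> * S y) # butlast w) (\<beta> (last w)))"
    for x y and w :: "'h list"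
  have "cyc n as = lin_ext fscale (\<lambda>xs. K (prod_list (map (\<lambda>x. x ! 0) xs)) (prod_list (map (\<lambda>x. x ! 1) xs))
      (map (\<lambda>x. x ! 2) xs)) (sweedler3_list \<Delta> as)"
    unfolding hopf_cyclic_def using n
  proof (simp del: sweedler3_list.simps, intro lin_ext_cong)
    fix xs assume "xs \<in> Poly_Mapping.keys (sweedler3_list \<Delta> as)"
    then have "xs \<noteq> []" using sweedler3_list_keys[of xs as] len n by auto
    then show "Poly_Mapping.single ((\<pi> * S (prod_list (map (\<lambda>x. x ! Suc 0) xs))) # map (\<lambda>x. x ! 2) (butlast xs))
        (\<alpha> (prod_list (map (\<lambda>x. x ! 0) xs)) * \<beta> (last xs ! 2)) =
      K (prod_list (map (\<lambda>x. x ! 0) xs)) (prod_list (map (\<lambda>x. x ! Suc 0) xs)) (map (\<lambda>x. x ! 2) xs)"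
      by (simp add: K_def last_map map_butlast)
  qed
  also have "T.eqv \<dots> (coaction_sum fscale \<Delta> as (\<lambda>X w. T.sw X (\<lambda>x y. K x y w)))"
  proof (rule T.sweedler3_list_sum)
    show "T.mlin (length as) (K x y)" for x y
      unfolding K_def len by (intro T.mlin_scale T.mlin_t_leaf)
    fix w :: "'h list" assume w: "length w = length as"
    show "T.lin (\<lambda>x. K x y w)" for y
      unfolding K_def by (rule T.lin_scalar[OF \<alpha>_lin])
    show "T.lin (\<lambda>y. K x y w)" for x
      unfolding K_def
      by (rule T.lin_scale, rule T.lin_comp[OF T.lin_1]) (use w len n in simp, intro T.tw_intros)
  qed
  also have "T.eqv \<dots> (t_gen as)"
    unfolding t_gen_def
  proof (rule T.rho_cong)
    fix X and w :: "'h list" assume w: "length w = length as"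
    show "T.eqv (T.sw X (\<lambda>x y. K x y w)) (Poly_Mapping.single ((\<pi> * tw X) # butlast w) (\<beta> (last w)))"
      unfolding K_def
      by (rule T.eqv_sym, rule T.lin_tw[where F = "\<lambda>m. Poly_Mapping.single ((\<pi> * m) # butlast w) (\<beta> (last w))"],
          rule T.lin_comp[OF T.lin_1]) (use w len n in simp, intro T.tw_intros)
  qed
  finally show ?thesis by (simp only: T.eqv_def)
qed

lemma cyc_t_gen_sum:
  assumes "Poly_Mapping.keys p \<subseteq> {as. length as = n}" "n > 0"
  shows "lin_ext fscale (cyc n) p - lin_ext fscale t_gen p \<in> tensor_rel scale n"
proof -
  interpret T: tensor_target scale \<Delta> \<epsilon> S \<alpha> \<beta> \<pi> n by (rule tensor_target)
  have "T.eqv (lin_ext fscale (cyc n) p) (lin_ext fscale t_gen p)"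
    by (rule T.lin_ext_eqv) (use assms cyc_t_gen in \<open>auto simp: T.eqv_def\<close>)
  then show ?thesis by (simp only: T.eqv_def)
qed

lemma cyc_0: "cyc 0 = (\<lambda>as. Poly_Mapping.single as 1)"
  by (rule ext) (simp add: hopf_cyclic_def)

lemma cyclic_presentation_hopf:
  "cyclic_presentation (\<lambda>n. {as. length as = n}) (tensor_rel scale) (hopf_face \<alpha> \<beta>) cyc
    (\<lambda>n as. Poly_Mapping.single (as @ [1]) 1)"
proof (intro cyclic_presentation.intro presented_faces.intro cyclic_presentation_axioms.intro)
  fix n
  interpret T: tensor_target scale \<Delta> \<epsilon> S \<alpha> \<beta> \<pi> n by (rule tensor_target)
  interpret T1: tensor_target scale \<Delta> \<epsilon> S \<alpha> \<beta> \<pi> "Suc n" by (rule tensor_target)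
  interpret P: presented_module "{as :: 'h list. length as = n}" "tensor_rel scale n"
    by (rule presented_tensor)
  interpret P1: presented_module "{as :: 'h list. length as = Suc n}" "tensor_rel scale (Suc n)"
    by (rule presented_tensor)
  have zero: "0 \<in> tensor_rel scale n" "0 \<in> tensor_rel scale (Suc n)"
    using fscale.subspace_0[OF P.subspace] fscale.subspace_0[OF P1.subspace] by auto
  show "presented_module {as :: 'h list. length as = n} (tensor_rel scale n)"
    by (rule presented_tensor)
  show "Poly_Mapping.keys (Poly_Mapping.single (as @ [1]) (1 :: 'k)) \<subseteq> {as. length as = Suc n}"
    if "as \<in> {as. length as = n}" for as :: "'h list"
    using that by simp
  show "lin_ext fscale (\<lambda>as. Poly_Mapping.single (as @ [1]) 1) p \<in> tensor_rel scale (Suc n)"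
    if "p \<in> tensor_rel scale n" for p
    by (rule T1.mlin_tensor_rel[OF T1.mlin_dgn[OF refl] that])
  show "Poly_Mapping.keys (cyc n as) \<subseteq> {as. length as = n}" if "as \<in> {as. length as = n}" for as
    using that by (intro cyc_keys) simp
  show "lin_ext fscale (cyc n) p \<in> tensor_rel scale n" if p: "p \<in> tensor_rel scale n" for p
  proof (cases "n = 0")
    case True
    then show ?thesis using p by (simp add: cyc_0 lin_ext_single_1)
  next
    case False
    have "lin_ext fscale t_gen p \<in> tensor_rel scale n"
      by (rule T.mlin_tensor_rel[OF T.mlin_t_gen p])
    moreover have "lin_ext fscale (cyc n) p - lin_ext fscale t_gen p \<in> tensor_rel scale n"
      using P.keys[OF p] False by (intro cyc_t_gen_sum) auto
    ultimately show ?thesis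
      using fscale.subspace_add[OF P.subspace] by fastforce
  qed
  show "(lin_ext fscale (cyc n) ^^ Suc n) (Poly_Mapping.single as 1) - Poly_Mapping.single as 1 \<in> tensor_rel scale n"
    if as: "as \<in> {as. length as = n}" for as
  proof (cases "n = 0")
    case True
    then show ?thesis using as zero by (simp add: cyc_0 lin_ext_single_1)
  next
    case False
    then show ?thesis
      using as by (intro t_gen_power cyc_keys cyc_t_gen) auto
  qed
  show "lin_ext fscale (hopf_face \<alpha> \<beta> (Suc n) n) (Poly_Mapping.single (as @ [1]) 1) -
      Poly_Mapping.single as 1 \<in> tensor_rel scale n" if "as \<in> {as. length as = n}" for as
    using that zero by (simp add: hopf_last_face_dgn)
  show "lin_ext fscale (hopf_face \<alpha> \<beta> (Suc n) i) p \<in> tensor_rel scale n"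
    if "p \<in> tensor_rel scale (Suc n)" "i \<le> Suc n" for p i
    by (rule T.mlin_tensor_rel[OF T.mlin_hopf_face[OF that(2)] that(1)])
  have face_cyc: "T.eqv (lin_ext fscale (hopf_face \<alpha> \<beta> (Suc n) i) (cyc (Suc n) as))
      (lin_ext fscale (hopf_face \<alpha> \<beta> (Suc n) i) (t_gen as))"
    if "length as = Suc n" "i \<le> Suc n" for as i
    by (rule T.mlin_eqv[OF T.mlin_hopf_face[OF that(2)] cyc_t_gen]) (use that in simp_all)
  fix as :: "'h list" and i j
  {
    assume as: "as \<in> {as. length as = Suc n}"
    then have len: "length as = Suc n" by simp
    show "Poly_Mapping.keys (hopf_face \<alpha> \<beta> (Suc n) i as) \<subseteq> {as. length as = n}" if "i \<le> Suc n"
      using len that by (rule hopf_face_keys)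
    have "T.eqv (lin_ext fscale (hopf_face \<alpha> \<beta> (Suc n) 0) (cyc (Suc n) as)) (hopf_face \<alpha> \<beta> (Suc n) (Suc n) as)"
      using face_cyc[OF len, of 0] T.face_0_t_gen[OF len] by (blast intro: T.eqv_trans)
    then show "lin_ext fscale (hopf_face \<alpha> \<beta> (Suc n) 0) (cyc (Suc n) as) -
        hopf_face \<alpha> \<beta> (Suc n) (Suc n) as \<in> tensor_rel scale n"
      by (simp only: T.eqv_def)
    assume i: "i \<le> n"
    show "lin_ext fscale (hopf_face \<alpha> \<beta> (Suc (Suc n)) i) (Poly_Mapping.single (as @ [1]) 1) -
        lin_ext fscale (\<lambda>as. Poly_Mapping.single (as @ [1]) 1) (hopf_face \<alpha> \<beta> (Suc n) i as) \<in> tensor_rel scale (Suc n)"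
      using zero by (simp add: hopf_face_dgn[OF len i])
    have "T.eqv (lin_ext fscale (hopf_face \<alpha> \<beta> (Suc n) (Suc i)) (t_gen as))
        (lin_ext fscale (cyc n) (hopf_face \<alpha> \<beta> (Suc n) i as))"
    proof (cases "n = 0")
      case True
      then obtain a where "as = [a]" using len by (auto simp: length_Suc_conv)
      then show ?thesis
        using T.face_1_t_gen[OF True, of a] i True by (simp add: cyc_0 lin_ext_single_1)
    next
      case False
      then have "T.eqv (lin_ext fscale (cyc n) (hopf_face \<alpha> \<beta> (Suc n) i as))
          (lin_ext fscale t_gen (hopf_face \<alpha> \<beta> (Suc n) i as))"
        unfolding T.eqv_def using i by (intro cyc_t_gen_sum hopf_face_keys[OF len]) auto
      then show ?thesis
        using T.face_Suc_t_gen[OF len i] False by (blast intro: T.eqv_trans T.eqv_sym)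
    qed
    then have "T.eqv (lin_ext fscale (hopf_face \<alpha> \<beta> (Suc n) (Suc i)) (cyc (Suc n) as))
        (lin_ext fscale (cyc n) (hopf_face \<alpha> \<beta> (Suc n) i as))"
      using face_cyc[OF len, of "Suc i"] i by (blast intro: T.eqv_trans)
    then show "lin_ext fscale (hopf_face \<alpha> \<beta> (Suc n) (Suc i)) (cyc (Suc n) as) -
        lin_ext fscale (cyc n) (hopf_face \<alpha> \<beta> (Suc n) i as) \<in> tensor_rel scale n"
      by (simp only: T.eqv_def)
  }
  assume "as \<in> {as. length as = Suc (Suc n)}" "j \<le> i" "i \<le> Suc n"
  then show "lin_ext fscale (hopf_face \<alpha> \<beta> (Suc n) j) (hopf_face \<alpha> \<beta> (Suc (Suc n)) (Suc i) as) -
      lin_ext fscale (hopf_face \<alpha> \<beta> (Suc n) i) (hopf_face \<alpha> \<beta> (Suc (Suc n)) j as) \<in> tensor_rel scale n"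
    using zero hopf_face_face[OF \<alpha>_mult \<beta>_mult, of as n j i] by simp
qed

end

section \<open>Hochschild homology\<close>

lemma complex_iso_nat:
  assumes D: "chain_complex (complex_module C) (complex_diff C d)"
    and C: "\<And>n. kmodule (C n)" and E: "\<And>n. kmodule (E n)"
    and e: "\<And>n y. y \<in> carrier (E (Suc n)) \<Longrightarrow> e (Suc n) y \<in> carrier (E n)"
    and lin: "\<And>n. \<phi> n \<in> linear_maps (E n) (C n)"
    and bij: "\<And>n. bij_betw (\<phi> n) (carrier (E n)) (carrier (C n))"
    and comm: "\<And>n y. y \<in> carrier (E (Suc n)) \<Longrightarrow> \<phi> n (e (Suc n) y) = d (Suc n) (\<phi> (Suc n) y)"
  shows "complex_iso (complex_module C) (complex_diff C d) (complex_module E) (complex_diff E e)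
    (\<lambda>n. if n < 0 then (\<lambda>_. \<zero>\<^bsub>C 0\<^esub>) else \<phi> (nat n))"
proof (intro complex_iso.intro complex_iso_axioms.intro D)
  have kC: "kmodule (complex_module C n)" for n by (rule kmodule_complex_module[OF C])
  show kE: "kmodule (complex_module E n)" for n by (rule kmodule_complex_module[OF E])
  let ?\<phi> = "\<lambda>n. if n < 0 then (\<lambda>_. \<zero>\<^bsub>C 0\<^esub>) else \<phi> (nat n)"
  show linZ: "?\<phi> n \<in> linear_maps (complex_module E n) (complex_module C n)" for n
  proof (cases n rule: complex_module_cases)
    case 1
    interpret kmodule "complex_module C n" by (rule kC)
    have "(\<lambda>_. \<zero>\<^bsub>complex_module C n\<^esub>) \<in> linear_maps (complex_module E n) (complex_module C n)"
      by (rule linear_mapsI) simp_all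
    then show ?thesis using 1 by (simp add: complex_module_neg)
  qed (simp add: lin)
  show "bij_betw (?\<phi> n) (carrier (complex_module E n)) (carrier (complex_module C n))" for n
  proof (cases n rule: complex_module_cases)
    case 1
    then show ?thesis by (simp add: complex_module_neg bij_betw_def)
  qed (simp add: bij)
  fix n y assume y: "y \<in> carrier (complex_module E n)"
  interpret C0: kmodule "C 0" by (rule C)
  interpret En: kmodule "complex_module E (n - 1)" by (rule kE)
  interpret CD: chain_complex "complex_module C" "complex_diff C d" by (rule D)
  show "complex_diff E e n y \<in> carrier (complex_module E (n - 1))"
  proof (cases "n \<le> 0")
    case True
    then show ?thesis using complex_module_neg[of "n - 1" E] by simp
  next
    case False
    define k where "k = nat (n - 1)"
    have k: "n - 1 = int k" "n = int (Suc k)" using False by (simp_all add: k_def)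
    show ?thesis
      using y unfolding k(1) unfolding k(2) complex_module_nat complex_diff_simps(1) by (rule e)
  qed
  show "?\<phi> (n - 1) (complex_diff E e n y) = complex_diff C d n (?\<phi> n y)"
  proof (cases "n \<le> 0")
    case True
    then show ?thesis by simp
  next
    case False
    define k where "k = nat (n - 1)"
    have k: "n - 1 = int k" "n = int (Suc k)" using False by (simp_all add: k_def)
    show ?thesis
      using comm[of y k] y unfolding k(1) unfolding k(2) complex_module_nat complex_diff_simps(1)
      by (simp del: of_nat_Suc)
  qed
qed

lemma hom_in_subspace_span:
  assumes L: "module_hom fscale fscale L" and W: "fscale.subspace W"
    and gen: "\<And>r. r \<in> A \<Longrightarrow> L r \<in> W" and p: "p \<in> fscale.span A"
  shows "L p \<in> W"
proof -
  interpret L: module_hom fscale fscale L by fact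
  show ?thesis
    using fscale.span_minimal[OF _ L.subspace_linear_preimage[OF W], of A] gen p by blast
qed

lemma slot_relations_cases:
  assumes "r \<in> slot_relations s G"
  obtains (add) g u v where "g \<in> G"
      "r = Poly_Mapping.single (g (u + v)) 1 - Poly_Mapping.single (g u) 1 - Poly_Mapping.single (g v) 1"
  | (scale) g c u where "g \<in> G"
      "r = Poly_Mapping.single (g (s c u)) 1 - Poly_Mapping.single (g u) c"
  using assms unfolding slot_relations_def by blast

abbreviation hochschild_rel :: "('k::comm_ring_1 \<Rightarrow> 'h::ring_1 \<Rightarrow> 'h) \<Rightarrow> nat \<Rightarrow> ('k \<times> 'h list \<Rightarrow>\<^sub>0 'k) set" where
  "hochschild_rel \<equiv> coeff_tensor_rel (*)"

text \<open>The isomorphism of \<open>k \<otimes> H\<^sup>\<otimes>\<^sup>n\<close> with \<open>H\<^sup>\<otimes>\<^sup>n\<close>, which identifies the Hochschild complex of \<open>\<^sub>\<beta>k\<^sub>\<alpha>\<close>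
  with the complex for \<open>b\<close> of the cyclic module.\<close>

definition absorb :: "'k::comm_ring_1 \<times> 'h list \<Rightarrow> ('h list \<Rightarrow>\<^sub>0 'k)" where
  "absorb = (\<lambda>(m, as). Poly_Mapping.single as m)"

definition unit_coeff :: "'h list \<Rightarrow> ('k::comm_ring_1 \<times> 'h list \<Rightarrow>\<^sub>0 'k)" where
  "unit_coeff as = Poly_Mapping.single (1, as) 1"

lemma presented_hochschild: "presented_module {(m, as). length as = n} (hochschild_rel scale n)"
proof
  show "fscale.subspace (hochschild_rel scale n)"
    by (simp add: coeff_tensor_rel_def)
  fix p assume p: "p \<in> hochschild_rel scale n"
  let ?V = "{p. Poly_Mapping.keys p \<subseteq> {(m, as). length as = n}}"
  have "r \<in> ?V" if "r \<in> slot_relations (*) {\<lambda>m. (m, as) | as. length as = n} \<union>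
      slot_relations scale {\<lambda>u. (m, xs @ u # ys) | m xs ys. length xs + 1 + length ys = n}" for r
    using that
  proof
    assume "r \<in> slot_relations (*) {\<lambda>m. (m, as) | as. length as = n}"
    then show ?thesis
      by (cases rule: slot_relations_cases; elim CollectE exE conjE; hypsubst;
          intro fscale.subspace_diff[OF subspace_keys]) auto
  next
    assume "r \<in> slot_relations scale {\<lambda>u. (m, xs @ u # ys) | m xs ys. length xs + 1 + length ys = n}"
    then show ?thesis
      by (cases rule: slot_relations_cases; elim CollectE exE conjE; hypsubst;
          intro fscale.subspace_diff[OF subspace_keys]) auto
  qed
  then have "p \<in> ?V"
    using hom_in_subspace_span[OF fscale.module_hom_ident subspace_keys _ p[unfolded coeff_tensor_rel_def]] by blast
  then show "Poly_Mapping.keys p \<subseteq> {(m, as). length as = n}" by simp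
qed

context modular_hopf
begin

lemma absorb_rel: "p \<in> hochschild_rel scale n \<Longrightarrow> lin_ext fscale absorb p \<in> tensor_rel scale n"
proof -
  interpret T: tensor_target scale \<Delta> \<epsilon> S \<alpha> \<beta> \<pi> n by (rule tensor_target)
  interpret L: module_hom fscale fscale "lin_ext fscale (absorb :: 'k \<times> 'h list \<Rightarrow> _)"
    by (rule lin_ext_fscale_hom)
  have single: "lin_ext fscale absorb (Poly_Mapping.single (m, as) c) = Poly_Mapping.single as (c * m)"
    for m c and as :: "'h list"
    by (simp add: module_fscale absorb_def)
  have zero: "0 \<in> tensor_rel scale m" for m
    unfolding tensor_rel_def by (rule fscale.span_zero)
  have "lin_ext fscale absorb r \<in> tensor_rel scale n"
    if "r \<in> slot_relations (*) {\<lambda>m. (m, as) | as. length as = n} \<union>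
      slot_relations scale {\<lambda>u. (m, xs @ u # ys) | m xs ys. length xs + 1 + length ys = n}" for r
    using that
  proof
    assume "r \<in> slot_relations (*) {\<lambda>m. (m, as) | as. length as = n}"
    then show ?thesis
      by (cases rule: slot_relations_cases; elim CollectE exE conjE; hypsubst)
        (simp_all only: L.diff single, simp_all add: single_add zero)
  next
    assume "r \<in> slot_relations scale {\<lambda>u. (m, xs @ u # ys) | m xs ys. length xs + 1 + length ys = n}"
    then show ?thesis
    proof (cases rule: slot_relations_cases)
      case (add g u v)
      then obtain m xs ys where g: "g = (\<lambda>u. (m, xs @ u # ys))" "length xs + 1 + length ys = n" by blast
      show ?thesis
        using T.linD(1)[OF T.lin_slot[OF g(2), of m], of u v]
        unfolding add(2) g(1) L.diff single T.eqv_def by (simp add: diff_diff_eq)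
    next
      case (scale g c u)
      then obtain m xs ys where g: "g = (\<lambda>u. (m, xs @ u # ys))" "length xs + 1 + length ys = n" by blast
      show ?thesis
        using T.linD(2)[OF T.lin_slot[OF g(2), of m], of c u]
        unfolding scale(2) g(1) L.diff single T.eqv_def by simp
    qed
  qed
  then show "p \<in> hochschild_rel scale n \<Longrightarrow> lin_ext fscale absorb p \<in> tensor_rel scale n"
    using hom_in_subspace_span[OF lin_ext_fscale_hom T.subspace_R] unfolding coeff_tensor_rel_def by blast
qed

lemma unit_coeff_rel: "p \<in> tensor_rel scale n \<Longrightarrow> lin_ext fscale unit_coeff p \<in> hochschild_rel scale n"
proof -
  interpret P: presented_module "{(m :: 'k, as :: 'h list). length as = n}" "hochschild_rel scale n"
    by (rule presented_hochschild)
  interpret L: module_hom fscale fscale "lin_ext fscale (unit_coeff :: 'h list \<Rightarrow> 'k \<times> 'h list \<Rightarrow>\<^sub>0 'k)"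
    by (rule lin_ext_fscale_hom)
  have single: "lin_ext fscale unit_coeff (Poly_Mapping.single as c) = Poly_Mapping.single (1, as) c"
    for c :: 'k and as :: "'h list"
    by (simp add: module_fscale unit_coeff_def)
  have "lin_ext fscale unit_coeff r \<in> hochschild_rel scale n"
    if "r \<in> slot_relations scale {\<lambda>u. xs @ u # ys | xs ys. length xs + 1 + length ys = n}" for r
  proof -
    have "lin_ext fscale unit_coeff r \<in>
        slot_relations scale {\<lambda>u. (m, xs @ u # ys) | m xs ys. length xs + 1 + length ys = n}"
      using that
    proof (cases rule: slot_relations_cases)
      case (add g u v)
      then show ?thesis
        unfolding add(2) L.diff single slot_relations_def
        by (intro UnI1 CollectI exI[of _ "\<lambda>u. (1, g u)"] exI[of _ u] exI[of _ v]) auto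
    next
      case (scale g c u)
      then show ?thesis
        unfolding scale(2) L.diff single slot_relations_def
        by (intro UnI2 CollectI exI[of _ "\<lambda>u. (1, g u)"] exI[of _ c] exI[of _ u]) auto
    qed
    then show ?thesis
      unfolding coeff_tensor_rel_def by (intro fscale.span_base UnI2)
  qed
  then show "p \<in> tensor_rel scale n \<Longrightarrow> lin_ext fscale unit_coeff p \<in> hochschild_rel scale n"
    using hom_in_subspace_span[OF lin_ext_fscale_hom P.subspace] unfolding tensor_rel_def by blast
qed

lemma absorb_unit_coeff: "lin_ext fscale absorb (lin_ext fscale unit_coeff p) = p"
  by (simp add: lin_ext_lin_ext[OF module_fscale] module_fscale unit_coeff_def absorb_def lin_ext_single_1)

lemma unit_coeff_absorb:
  assumes "Poly_Mapping.keys p \<subseteq> {(m, as). length as = n}"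
  shows "lin_ext fscale unit_coeff (lin_ext fscale absorb p) - p \<in> hochschild_rel scale n"
proof -
  interpret P: presented_module "{(m :: 'k, as :: 'h list). length as = n}" "hochschild_rel scale n"
    by (rule presented_hochschild)
  let ?L = "\<lambda>p. lin_ext fscale unit_coeff (lin_ext fscale absorb p) - (p :: 'k \<times> 'h list \<Rightarrow>\<^sub>0 'k)"
  have L: "module_hom fscale fscale ?L"
    by (intro fscale_pair.module_hom_sub hom_comp[OF lin_ext_fscale_hom lin_ext_fscale_hom] fscale.module_hom_ident)
  show ?thesis
  proof (rule hom_in_subspace[OF L P.subspace])
    fix x assume "x \<in> Poly_Mapping.keys p"
    then obtain m as where x: "x = (m, as)" "length as = n" using assms by (cases x) auto
    have "Poly_Mapping.single (m * 1, as) 1 - Poly_Mapping.single (1, as) m \<in>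
        slot_relations (*) {\<lambda>m :: 'k. (m, as) | as :: 'h list. length as = n}"
      unfolding slot_relations_def
      by (intro UnI2 CollectI exI[of _ "\<lambda>m. (m, as)"] exI[of _ m] exI[of _ 1]) (use x in auto)
    then have "Poly_Mapping.single (m, as) 1 - Poly_Mapping.single (1, as) m \<in> hochschild_rel scale n"
      unfolding coeff_tensor_rel_def by (intro fscale.span_base UnI1) simp
    from fscale.subspace_neg[OF P.subspace this]
    show "?L (Poly_Mapping.single x 1) \<in> hochschild_rel scale n"
      by (simp add: x module_fscale absorb_def unit_coeff_def)
  qed
qed

abbreviation "HF \<equiv> hochschild_face (\<lambda>a x. \<beta> a * x) (\<lambda>x b. x * \<alpha> b) :: nat \<Rightarrow> nat \<Rightarrow> 'k \<times> 'h list \<Rightarrow> _"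

lemma absorb_face:
  "lin_ext fscale absorb (HF n i (m, as)) = lin_ext fscale (hopf_face \<alpha> \<beta> n i) (absorb (m, as))"
  by (simp add: hochschild_face_def hopf_face_def absorb_def module_fscale mult.commute)

lemma absorb_face_sum:
  "lin_ext fscale absorb (lin_ext fscale (HF n i) p) = lin_ext fscale (hopf_face \<alpha> \<beta> n i) (lin_ext fscale absorb p)"
  unfolding lin_ext_lin_ext[OF module_fscale] by (rule lin_ext_cong) (auto simp: absorb_face)

lemma HF_keys:
  "\<lbrakk>x \<in> {(m, as). length as = Suc n}; i \<le> Suc n\<rbrakk> \<Longrightarrow>
    Poly_Mapping.keys (HF (Suc n) i x) \<subseteq> {(m, as). length as = n}"
  by (auto simp: hochschild_face_def split: if_splits)

text \<open>Compatibility with the relations need not be checked face by face: \<open>absorb\<close> and \<open>unit_coeff\<close> are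
  inverse to each other modulo relations and transfer it from the faces of the cyclic module.\<close>

lemma hochschild_faces: "presented_faces (\<lambda>n. {(m, as). length as = n}) (hochschild_rel scale) HF"
proof (rule presented_faces.intro)
  show "presented_module {(m :: 'k, as :: 'h list). length as = n} (hochschild_rel scale n)" for n
    by (rule presented_hochschild)
  show keys: "Poly_Mapping.keys (HF (Suc n) i x) \<subseteq> {(m, as). length as = n}"
    if "x \<in> {(m, as). length as = Suc n}" "i \<le> Suc n" for n i x
    by (rule HF_keys[OF that])
  fix n i and p :: "'k \<times> 'h list \<Rightarrow>\<^sub>0 'k" assume p: "p \<in> hochschild_rel scale (Suc n)" and i: "i \<le> Suc n"
  interpret P: presented_module "{(m :: 'k, as :: 'h list). length as = n}" "hochschild_rel scale n"
    by (rule presented_hochschild)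
  interpret P1: presented_module "{(m :: 'k, as :: 'h list). length as = Suc n}" "hochschild_rel scale (Suc n)"
    by (rule presented_hochschild)
  interpret T: tensor_target scale \<Delta> \<epsilon> S \<alpha> \<beta> \<pi> n by (rule tensor_target)
  have "lin_ext fscale absorb (lin_ext fscale (HF (Suc n) i) p) \<in> tensor_rel scale n"
    unfolding absorb_face_sum by (rule T.mlin_tensor_rel[OF T.mlin_hopf_face[OF i] absorb_rel[OF p]])
  then have "lin_ext fscale unit_coeff (lin_ext fscale absorb (lin_ext fscale (HF (Suc n) i) p)) \<in> hochschild_rel scale n"
    by (rule unit_coeff_rel)
  moreover have "Poly_Mapping.keys (lin_ext fscale (HF (Suc n) i) p) \<subseteq> {(m, as). length as = n}"
    by (rule keys_lin_ext, rule HF_keys) (use P1.keys[OF p] i in auto)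
  then have "lin_ext fscale unit_coeff (lin_ext fscale absorb (lin_ext fscale (HF (Suc n) i) p)) -
      lin_ext fscale (HF (Suc n) i) p \<in> hochschild_rel scale n"
    by (rule unit_coeff_absorb)
  ultimately show "lin_ext fscale (HF (Suc n) i) p \<in> hochschild_rel scale n"
    using fscale.subspace_diff[OF P.subspace] by fastforce
qed

end
theorem proposition2p2:
  fixes scale :: "'k::comm_ring_1 \<Rightarrow> 'h::ring_1 \<Rightarrow> 'h"
    and \<Delta> :: "'h \<Rightarrow> ('h list \<Rightarrow>\<^sub>0 'k) set"
    and \<epsilon> :: "'h \<Rightarrow> 'k"
    and S :: "'h \<Rightarrow> 'h"
    and \<alpha> \<beta> :: "'h \<Rightarrow> 'k"
    and \<pi> :: 'h
  assumes "hopf_algebra scale \<Delta> \<epsilon> S"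
    and "character scale \<alpha>"
    and "character scale \<beta>"
    and "grouplike scale \<Delta> \<epsilon> \<pi>"
    and "condition_CM scale \<Delta> S \<pi> \<alpha> \<beta>"
  shows "let HH = hochschild_homology scale (*) (\<lambda>a x. \<beta> a * x) (\<lambda>x b. x * \<alpha> b);
             HC = hopf_cyclic_homology scale \<Delta> S \<pi> \<alpha> \<beta>
         in \<exists>I P B. \<forall>n::int.
           I n \<in> linear_maps (HH n) (HC n) \<and>
           P n \<in> linear_maps (HC n) (HC (n - 2)) \<and>
           B n \<in> linear_maps (HC (n - 2)) (HH (n - 1)) \<and>
           exact_at (HH n) (I n) (HC n) (P n) (HC (n - 2)) \<and>
           exact_at (HC n) (P n) (HC (n - 2)) (B n) (HH (n - 1)) \<and>
           exact_at (HC (n - 2)) (B n) (HH (n - 1)) (I (n - 1)) (HC (n - 1))"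
proof -
  interpret modular_hopf scale \<Delta> \<epsilon> S \<alpha> \<beta> \<pi>
    by (intro modular_hopf.intro modular_hopf_axioms.intro assms)
  interpret Y: cyclic_presentation "\<lambda>n. {as :: 'h list. length as = n}" "tensor_rel scale" "hopf_face \<alpha> \<beta>" cyc
    "\<lambda>n as. Poly_Mapping.single (as @ [1]) 1"
    by (rule cyclic_presentation_hopf)
  interpret Z: presented_faces "\<lambda>n. {(m :: 'k, as :: 'h list). length as = n}" "hochschild_rel scale" HF
    by (rule hochschild_faces)
  interpret B: cyclic_bicomplex Y.C Y.d Y.t Y.s by (rule Y.bicomplex)
  define \<Phi> where "\<Phi> n = induced_map {as :: 'h list. length as = n} (tensor_rel scale n) (absorb :: 'k \<times> 'h list \<Rightarrow> _)" for n
  have absorb_V: "lin_ext fscale absorb p \<in> Y.M.V n" if "p \<in> Z.M.V n" for p n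
    unfolding Y.M.V_def mem_Collect_eq
    by (rule keys_lin_ext) (use that in \<open>auto simp: Z.M.V_def absorb_def dest!: subsetD split: if_splits\<close>)
  have unit_V: "lin_ext fscale unit_coeff p \<in> Z.M.V n" if "p \<in> Y.M.V n" for p n
    unfolding Z.M.V_def mem_Collect_eq
    by (rule keys_lin_ext) (use that in \<open>auto simp: Y.M.V_def unit_coeff_def\<close>)
  have \<Phi>: "\<Phi> n (Z.cls n p) = Y.cls n (lin_ext fscale absorb p)" if "p \<in> Z.M.V n" for p n
    unfolding \<Phi>_def
    by (rule induced_map_cls[OF Z.presented Y.presented lin_ext_fscale_hom absorb_V absorb_rel that])
  interpret A: module_hom fscale fscale "lin_ext fscale (absorb :: 'k \<times> 'h list \<Rightarrow> _)" by (rule lin_ext_fscale_hom)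
  have lin: "\<Phi> n \<in> linear_maps (Z.C n) (Y.C n)" for n
  proof (rule linear_mapsI)
    fix x y assume "x \<in> carrier (Z.C n)" "y \<in> carrier (Z.C n)"
    then obtain p q where "p \<in> Z.M.V n" "q \<in> Z.M.V n" "x = Z.cls n p" "y = Z.cls n q"
      by (auto simp: Z.C_carrier)
    then show "\<Phi> n (x \<oplus>\<^bsub>Z.C n\<^esub> y) = \<Phi> n x \<oplus>\<^bsub>Y.C n\<^esub> \<Phi> n y"
      using fscale.subspace_add[OF Z.M.subspace_V]
      by (simp add: Z.C_def Y.C_def Z.M.Q_add Y.M.Q_add \<Phi> absorb_V A.add)
  next
    fix c x assume "x \<in> carrier (Z.C n)"
    then obtain p where "p \<in> Z.M.V n" "x = Z.cls n p"
      by (auto simp: Z.C_carrier)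
    then show "\<Phi> n (c \<odot>\<^bsub>Z.C n\<^esub> x) = c \<odot>\<^bsub>Y.C n\<^esub> \<Phi> n x"
      using fscale.subspace_scale[OF Z.M.subspace_V]
      by (simp add: Z.C_def Y.C_def Z.M.Q_smult Y.M.Q_smult \<Phi> absorb_V A.scale)
  qed (auto simp: Z.C_carrier Y.C_carrier \<Phi> absorb_V)
  have bij: "bij_betw (\<Phi> n) (carrier (Z.C n)) (carrier (Y.C n))" for n
  proof (rule bij_betw_imageI)
    show "inj_on (\<Phi> n) (carrier (Z.C n))"
    proof (rule inj_onI)
      fix x y assume "x \<in> carrier (Z.C n)" "y \<in> carrier (Z.C n)" and eq: "\<Phi> n x = \<Phi> n y"
      then obtain p q where pq: "p \<in> Z.M.V n" "q \<in> Z.M.V n" "x = Z.cls n p" "y = Z.cls n q"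
        by (auto simp: Z.C_carrier)
      have pq': "p - q \<in> Z.M.V n" using fscale.subspace_diff[OF Z.M.subspace_V] pq by blast
      have "lin_ext fscale absorb (p - q) \<in> tensor_rel scale n"
        using eq pq by (simp add: \<Phi> Y.M.cls_eq_iff absorb_V A.diff)
      then have "lin_ext fscale unit_coeff (lin_ext fscale absorb (p - q)) \<in> hochschild_rel scale n"
        by (rule unit_coeff_rel)
      moreover have "lin_ext fscale unit_coeff (lin_ext fscale absorb (p - q)) - (p - q) \<in> hochschild_rel scale n"
        using pq' by (intro unit_coeff_absorb) (simp add: Z.M.V_def)
      ultimately have "p - q \<in> hochschild_rel scale n"
        using fscale.subspace_diff[OF Z.M.subspace] by fastforce
      then show "x = y"
        using pq by (simp add: Z.M.cls_eq_iff)
    qed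
    show "\<Phi> n ` carrier (Z.C n) = carrier (Y.C n)"
    proof (intro subset_antisym subsetI)
      fix x assume "x \<in> carrier (Y.C n)"
      then obtain p where p: "p \<in> Y.M.V n" "x = Y.cls n p" by (auto simp: Y.C_carrier)
      then have "x = \<Phi> n (Z.cls n (lin_ext fscale unit_coeff p))"
        by (simp add: \<Phi> unit_V absorb_unit_coeff)
      then show "x \<in> \<Phi> n ` carrier (Z.C n)"
        using p unit_V by (auto simp: Z.C_carrier)
    qed (use linear_maps_closed[OF lin] in auto)
  qed
  have kZ: "kmodule (Z.C n)" for n
    unfolding Z.C_def by (rule Z.M.kmodule_Q)
  have b_closed: "b_map Z.C Z.d (Suc n) y \<in> carrier (Z.C n)" if y: "y \<in> carrier (Z.C (Suc n))" for n y
  proof -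
    obtain p where "p \<in> Z.M.V (Suc n)" "y = Z.cls (Suc n) p"
      using y by (auto simp: Z.C_carrier)
    then show ?thesis
      by (simp add: Z.C_carrier Z.b_cls Z.bV_V)
  qed
  have absorb_b: "lin_ext fscale absorb (Z.bV n p) = Y.bV n (lin_ext fscale absorb p)" for n p
    by (simp add: Z.bV_def Y.bV_def Z.E_def Y.E_def A.sum A.scale absorb_face_sum)
  have comm: "\<Phi> n (b_map Z.C Z.d (Suc n) y) = b_map Y.C Y.d (Suc n) (\<Phi> (Suc n) y)"
    if y: "y \<in> carrier (Z.C (Suc n))" for n y
  proof -
    obtain p where "p \<in> Z.M.V (Suc n)" "y = Z.cls (Suc n) p"
      using y by (auto simp: Z.C_carrier)
    then show ?thesis
      by (simp add: Z.b_cls Z.bV_V \<Phi> absorb_V Y.b_cls absorb_b)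
  qed
  have iso: "complex_iso (complex_module Y.C) (complex_diff Y.C (b_map Y.C Y.d)) (complex_module Z.C)
      (complex_diff Z.C (b_map Z.C Z.d)) (\<lambda>n. if n < 0 then (\<lambda>_. \<zero>\<^bsub>Y.C 0\<^esub>) else \<Phi> (nat n))"
    by (rule complex_iso_nat[where C = Y.C and d = "b_map Y.C Y.d" and E = Z.C and e = "b_map Z.C Z.d"
          and \<phi> = \<Phi>, OF B.P.column_complex B.kmodule kZ b_closed lin bij comm])
  have HH: "hochschild_homology scale (*) (\<lambda>a x. \<beta> a * x) (\<lambda>x b. x * \<alpha> b) =
      int_homology (complex_module Z.C) (complex_diff Z.C (b_map Z.C Z.d))"
  proof -
    have "Z.C = coeff_tensor (*) scale"
      by (rule ext) (simp add: Z.C_def coeff_tensor_def)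
    moreover have "Z.d = (\<lambda>n i. induced_map {(m, as). length as = n - 1} (hochschild_rel scale (n - 1)) (HF n i))"
      by (intro ext) (simp add: Z.d_def)
    ultimately show ?thesis
      by (simp add: hochschild_homology_def homology_eq_int_homology)
  qed
  have HC: "hopf_cyclic_homology scale \<Delta> S \<pi> \<alpha> \<beta> = cyclic_homology Y.C Y.d Y.t"
  proof -
    have "Y.C = tensor_power scale"
      by (rule ext) (simp add: Y.C_def tensor_power_def)
    moreover have "Y.d = (\<lambda>n i. induced_map {as. length as = n - 1} (tensor_rel scale (n - 1)) (hopf_face \<alpha> \<beta> n i))"
      by (intro ext) (simp add: Y.d_def)
    moreover have "Y.t = (\<lambda>n. induced_map {as. length as = n} (tensor_rel scale n) (cyc n))"
      by (intro ext) (simp add: Y.t_def)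
    ultimately show ?thesis
      by (simp add: hopf_cyclic_homology_def)
  qed
  show ?thesis
    unfolding HH HC by (rule B.connes_sequence_iso[OF iso])
qed

end
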